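(* Let $n\in\{2,3\}$, let $\Omega$, $W$, $m$ satisfy the standing assumptions listed in the context and let $r_0:=(1-m)/2$. Let $E_0\subset\Omega$ be a volume-constrained global perimeter minimizer with $\mathcal{L}^n(E_0)=r_0$, i.e. $\mathcal{L}^n(E_0)=r_0$ and $P(E_0;\Omega)=\mathcal{I}_\Omega(r_0)$. Suppose that $\mathcal{I}_\Omega$ admits a Taylor expansion of order two at $r_0$. For all sufficiently small $\varepsilon>0$ let $u_{0,\varepsilon}\in X_2\cap L^2(\Omega)$ be such that $$\|u_{0,\varepsilon}-u_{E_0}\|_{X_2}\to0\ \text{ as }\varepsilon\to0^+,\qquad \mathcal{G}_\varepsilon[u_{0,\varepsilon}]\le\mathcal{G}_0[u_{E_0}]+C\varepsilon$$ for some constant $C>0$ independent of $\varepsilon$. Let $u_\varepsilon$ be a solution of the Cahn--Hilliard problem with initial datum $u_{0,\varepsilon}$. Then for every $M>0$ $$\sup_{0\le t\le M\varepsilon^{-1}}\|u_\varepsilon(t)-u_{E_0}\|_{X_2}\to0\quad\text{as }\varepsilon\to0^+.$$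
   Context: Standing assumptions. $\Omega\subset\mathbb{R}^n$ is open, bounded, connected, $\mathcal{L}^n(\Omega)=1$, and $\partial\Omega$ is of class $C^{4,\sigma}$ for some $\sigma\in(0,1]$. The potential $W:\mathbb{R}\to[0,\infty)$ is of class $C^2$, has exactly two zeros, $-1$ and $1$; $W''(-1)=W''(1)>0$; $W'$ has exactly three zeros $-1<c<1$, and $W''(c)<0$; $\liminf_{|s|\to\infty}|W'(s)|=\infty$. The mass satisfies $m\in(-1,1)$. Notation. $P(E;\Omega)$ is the relative perimeter of $E$ in $\Omega$. For a Borel set $E_0\subset\Omega$, $u_{E_0}:=-\chi_{E_0}+\chi_{\Omega\setminus E_0}$. The isoperimetric function is $\mathcal{I}_\Omega(r):=\inf\{P(E;\Omega): E\subset\Omega\text{ Borel},\ \mathcal{L}^n(E)=r\}$, $r\in[0,1]$. A function $\mathcal{I}$ admits a Taylor expansion of order two at $r_0$ if it is differentiable at $r_0$ and there are $\varsigma\in(0,1]$ and a neighborhood $U$ of $r_0$ with $\mathcal{I}(r)=\mathcal{I}(r_0)+\mathcal{I}'(r_0)(r-r_0)+O(|r-r_0|^{1+\varsigma})$ for all $r\in U$. Energies. For $u\in L^1(\Omega)$, $\mathcal{G}_\varepsilon[u]:=\int_\Omega\big(\frac1\varepsilon W(u)+\frac\varepsilon2|\nabla u|^2\big)dx$ if $u\in H^1(\Omega)$ and $\int_\Omega u\,dx=m$, and $\mathcal{G}_\varepsilon[u]:=\infty$ otherwise. $\mathcal{G}_0[u]:=\sqrt2\,c_W\,P(\{u=-1\};\Omega)$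 if $u\in BV(\Omega;\{-1,1\})$ and $\int_\Omega u\,dx=m$, and $\mathcal{G}_0[u]:=\infty$ otherwise, where $c_W:=\int_{-1}^1W^{1/2}(s)\,ds$. The space $X_2$ is $(H^1(\Omega))'$ with the following inner product. For $f\in(H^1(\Omega))'$ with $\langle f,1\rangle=0$ let $g=-\Delta_{X_2}^{-1}f$ be the unique function $g\in H^1(\Omega)$ with zero mean over $\Omega$ such that $\langle f,\varphi\rangle=\int_\Omega\nabla g\cdot\nabla\varphi\,dx$ for all $\varphi\in H^1(\Omega)$. Then $\langle f_1,f_2\rangle_{X_2}:=\int_\Omega\nabla(\Delta_{X_2}^{-1}f_1)\cdot\nabla(\Delta_{X_2}^{-1}f_2)\,dx$ and $\|f\|_{X_2}:=\langle f,f\rangle_{X_2}^{1/2}$. (The differences whose norm is taken in the claim have zero mean.) Cahn--Hilliard problem: $\partial_tu_\varepsilon=-\Delta v_\varepsilon$, $v_\varepsilon=\varepsilon^2\Delta u_\varepsilon-W'(u_\varepsilon)$ in $\Omega\times(0,\infty)$; $\partial u_\varepsilon/\partial\nu=\partial v_\varepsilon/\partial\nu=0$ on $\partial\Omega\times(0,\infty)$; $u_\varepsilon(\cdot,0)=u_{0,\varepsilon}$. Solutions are understood in the class $u_\varepsilon\in C([0,T];L^2(\Omega))\cap L^2(0,T;H^1(\Omega))\cap L^4(0,T;L^4(\Omega))$ for all $T>0$, and as $X_2$-gradient flows of the energy, i.e. they preserve mass and satisfy $\mathcal{G}_\varepsilon[u_\varepsilon(0)]-\mathcal{G}_\varepsilon[u_\varepsilon(T)]=\varepsilon^{-1}\int_0^T\|\partial_tu_\varepsilon(s)\|_{X_2}^2\,ds$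 for every $T>0$. *)

theory Defs
  imports "HOL-Analysis.Analysis"
begin

section \<open>Functions of class \<open>C\<^sup>k\<close> and \<open>C\<^sup>k\<^sup>,\<^sup>\<sigma>\<close>; regular domains\<close>

primrec Ck :: "nat \<Rightarrow> ('a::euclidean_space \<Rightarrow> real) \<Rightarrow> bool" where
  "Ck 0 f \<longleftrightarrow> continuous_on UNIV f"
| "Ck (Suc k) f \<longleftrightarrow> (\<forall>x. f differentiable (at x)) \<and>
     (\<forall>b\<in>Basis. Ck k (\<lambda>x. frechet_derivative f (at x) b))"

text \<open>The partial derivatives of order \<open>k\<close> are required to be \<open>\<sigma>\<close>-Hoelder continuous.\<close>

primrec Ck_hoelder :: "nat \<Rightarrow> real \<Rightarrow> ('a::euclidean_space \<Rightarrow> real) \<Rightarrow> bool" where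
  "Ck_hoelder 0 \<sigma> f \<longleftrightarrow> (\<exists>L. \<forall>x y. \<bar>f x - f y\<bar> \<le> L * dist x y powr \<sigma>)"
| "Ck_hoelder (Suc k) \<sigma> f \<longleftrightarrow> (\<forall>x. f differentiable (at x)) \<and>
     (\<forall>b\<in>Basis. Ck_hoelder k \<sigma> (\<lambda>x. frechet_derivative f (at x) b))"

text \<open>Near each boundary point, \<open>\<Omega>\<close> lies strictly above the graph of a \<open>C\<^sup>k\<^sup>,\<^sup>\<sigma>\<close> function over
  the hyperplane orthogonal to a unit vector \<open>\<nu>\<close>.  A function on that hyperplane is encoded as a
  function on the whole space that is constant along \<open>\<nu>\<close>.  As only its values near the boundary
  point matter, it may be taken globally defined with a global Hoelder constant (by a cutoff).\<close>

definition Ck_hoelder_boundary :: "nat \<Rightarrow> real \<Rightarrow> 'a::euclidean_space set \<Rightarrow> bool" where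
  "Ck_hoelder_boundary k \<sigma> \<Omega> \<longleftrightarrow>
     (\<forall>p\<in>frontier \<Omega>. \<exists>r>0. \<exists>\<nu> \<gamma>. norm \<nu> = 1 \<and> Ck_hoelder k \<sigma> \<gamma> \<and>
        (\<forall>x t. \<gamma> (x + t *\<^sub>R \<nu>) = \<gamma> x) \<and>
        \<Omega> \<inter> ball p r = {x \<in> ball p r. \<gamma> x < x \<bullet> \<nu>})"


section \<open>The potential\<close>

definition double_well :: "(real \<Rightarrow> real) \<Rightarrow> bool" where
  "double_well W \<longleftrightarrow>
     Ck 2 W \<and> (\<forall>s. 0 \<le> W s) \<and> {s. W s = 0} = {-1, 1} \<and>
     deriv (deriv W) (-1) = deriv (deriv W) 1 \<and> 0 < deriv (deriv W) 1 \<and>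
     (\<exists>c. -1 < c \<and> c < 1 \<and> {s. deriv W s = 0} = {-1, c, 1} \<and> deriv (deriv W) c < 0) \<and>
     Liminf at_infinity (\<lambda>s. ereal \<bar>deriv W s\<bar>) = \<infinity>"

definition c_well :: "(real \<Rightarrow> real) \<Rightarrow> real" where
  "c_well W = integral {-1..1} (\<lambda>s. sqrt (W s))"


section \<open>Sobolev functions\<close>

text \<open>Elements of function spaces over \<open>\<Omega>\<close> are represented by functions on the whole space; only
  their values on \<open>\<Omega>\<close>, up to null sets, are relevant.\<close>

definition test_functions :: "'a::euclidean_space set \<Rightarrow> ('a \<Rightarrow> real) set" where
  "test_functions \<Omega> = {\<phi>. (\<forall>k. Ck k \<phi>) \<and>
     compact (closure {x. \<phi> x \<noteq> 0}) \<and> closure {x. \<phi> x \<noteq> 0} \<subseteq> \<Omega>}"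

definition L2 :: "'a::euclidean_space set \<Rightarrow> ('a \<Rightarrow> real) set" where
  "L2 \<Omega> = {u \<in> borel_measurable (lebesgue_on \<Omega>). integrable (lebesgue_on \<Omega>) (\<lambda>x. (u x)\<^sup>2)}"

definition L2_norm :: "'a::euclidean_space set \<Rightarrow> ('a \<Rightarrow> real) \<Rightarrow> real" where
  "L2_norm \<Omega> u = sqrt (LINT x|lebesgue_on \<Omega>. (u x)\<^sup>2)"

definition is_weak_gradient ::
    "'a::euclidean_space set \<Rightarrow> ('a \<Rightarrow> real) \<Rightarrow> ('a \<Rightarrow> 'a) \<Rightarrow> bool" where
  "is_weak_gradient \<Omega> u g \<longleftrightarrow>
     g \<in> borel_measurable (lebesgue_on \<Omega>) \<and> integrable (lebesgue_on \<Omega>) (\<lambda>x. (norm (g x))\<^sup>2) \<and>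
     (\<forall>\<phi>\<in>test_functions \<Omega>. \<forall>b\<in>Basis.
        (LINT x|lebesgue_on \<Omega>. u x * frechet_derivative \<phi> (at x) b)
          = - (LINT x|lebesgue_on \<Omega>. (g x \<bullet> b) * \<phi> x))"

definition H1 :: "'a::euclidean_space set \<Rightarrow> ('a \<Rightarrow> real) set" where
  "H1 \<Omega> = {u \<in> L2 \<Omega>. \<exists>g. is_weak_gradient \<Omega> u g}"

definition grad :: "'a::euclidean_space set \<Rightarrow> ('a \<Rightarrow> real) \<Rightarrow> ('a \<Rightarrow> 'a)" where
  "grad \<Omega> u = (SOME g. is_weak_gradient \<Omega> u g)"

definition H1_norm :: "'a::euclidean_space set \<Rightarrow> ('a \<Rightarrow> real) \<Rightarrow> real" where
  "H1_norm \<Omega> u = sqrt ((LINT x|lebesgue_on \<Omega>. (u x)\<^sup>2) +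
     (LINT x|lebesgue_on \<Omega>. (norm (grad \<Omega> u x))\<^sup>2))"


section \<open>Perimeter and the isoperimetric function\<close>

definition C1c_fields :: "'a::euclidean_space set \<Rightarrow> ('a \<Rightarrow> 'a) set" where
  "C1c_fields \<Omega> = {\<phi>. (\<forall>b\<in>Basis. Ck 1 (\<lambda>x. \<phi> x \<bullet> b)) \<and>
     compact (closure {x. \<phi> x \<noteq> 0}) \<and> closure {x. \<phi> x \<noteq> 0} \<subseteq> \<Omega>}"

definition divergence :: "('a::euclidean_space \<Rightarrow> 'a) \<Rightarrow> 'a \<Rightarrow> real" where
  "divergence \<phi> x = (\<Sum>b\<in>Basis. frechet_derivative (\<lambda>y. \<phi> y \<bullet> b) (at x) b)"

text \<open>Negative integrals are cut off to \<open>0\<close> by \<^term>\<open>ennreal\<close>; this does not change the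
  supremum, since the zero field is admissible.\<close>

definition total_variation :: "'a::euclidean_space set \<Rightarrow> ('a \<Rightarrow> real) \<Rightarrow> ennreal" where
  "total_variation \<Omega> u =
     (SUP \<phi>\<in>{\<phi> \<in> C1c_fields \<Omega>. \<forall>x. norm (\<phi> x) \<le> 1}.
        ennreal (LINT x|lebesgue_on \<Omega>. u x * divergence \<phi> x))"

definition perimeter :: "'a::euclidean_space set \<Rightarrow> 'a set \<Rightarrow> ennreal" where
  "perimeter E \<Omega> = total_variation \<Omega> (indicator E)"

definition isoperimetric :: "'a::euclidean_space set \<Rightarrow> real \<Rightarrow> ennreal" where
  "isoperimetric \<Omega> r =
     (INF E\<in>{E. E \<in> sets borel \<and> E \<subseteq> \<Omega> \<and> measure lebesgue E = r}. perimeter E \<Omega>)"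

definition taylor_order_two :: "(real \<Rightarrow> real) \<Rightarrow> real \<Rightarrow> bool" where
  "taylor_order_two f r0 \<longleftrightarrow> f differentiable (at r0) \<and>
     (\<exists>\<sigma>. 0 < \<sigma> \<and> \<sigma> \<le> 1 \<and>
        (\<exists>U K. open U \<and> r0 \<in> U \<and>
           (\<forall>r\<in>U. \<bar>f r - (f r0 + deriv f r0 * (r - r0))\<bar> \<le> K * \<bar>r - r0\<bar> powr (1 + \<sigma>))))"


section \<open>The energies\<close>

definition two_phase :: "'a set \<Rightarrow> 'a set \<Rightarrow> 'a \<Rightarrow> real" where
  "two_phase \<Omega> E x = - indicator E x + indicator (\<Omega> - E) x"

definition energy ::
    "'a::euclidean_space set \<Rightarrow> (real \<Rightarrow> real) \<Rightarrow> real \<Rightarrow> real \<Rightarrow> ('a \<Rightarrow> real) \<Rightarrow> ennreal" where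
  "energy \<Omega> W m \<epsilon> u =
     (if u \<in> H1 \<Omega> \<and> (LINT x|lebesgue_on \<Omega>. u x) = m
      then (\<integral>\<^sup>+x. ennreal (1 / \<epsilon> * W (u x) + \<epsilon> / 2 * (norm (grad \<Omega> u x))\<^sup>2) \<partial>lebesgue_on \<Omega>)
      else \<infinity>)"

definition BV_phase :: "'a::euclidean_space set \<Rightarrow> ('a \<Rightarrow> real) set" where
  "BV_phase \<Omega> = {u. integrable (lebesgue_on \<Omega>) u \<and> total_variation \<Omega> u < \<infinity> \<and>
     (AE x in lebesgue_on \<Omega>. u x \<in> {-1, 1})}"

definition limit_energy ::
    "'a::euclidean_space set \<Rightarrow> (real \<Rightarrow> real) \<Rightarrow> real \<Rightarrow> ('a \<Rightarrow> real) \<Rightarrow> ennreal" where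
  "limit_energy \<Omega> W m u =
     (if u \<in> BV_phase \<Omega> \<and> (LINT x|lebesgue_on \<Omega>. u x) = m
      then ennreal (sqrt 2 * c_well W) * perimeter {x \<in> \<Omega>. u x = -1} \<Omega>
      else \<infinity>)"


section \<open>The space \<open>X\<^sub>2\<close>\<close>

text \<open>Elements of the dual of \<open>H\<^sup>1(\<Omega>)\<close> are functionals that are only relevant on \<^term>\<open>H1 \<Omega>\<close>;
  boundedness makes them insensitive to changes of the argument on null sets.\<close>

definition X2 :: "'a::euclidean_space set \<Rightarrow> (('a \<Rightarrow> real) \<Rightarrow> real) set" where
  "X2 \<Omega> = {f. (\<forall>\<phi>\<in>H1 \<Omega>. \<forall>\<psi>\<in>H1 \<Omega>. \<forall>a b. f (\<lambda>x. a * \<phi> x + b * \<psi> x) = a * f \<phi> + b * f \<psi>) \<and>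
     (\<exists>K. \<forall>\<phi>\<in>H1 \<Omega>. \<bar>f \<phi>\<bar> \<le> K * H1_norm \<Omega> \<phi>)}"

text \<open>The functional on \<open>H\<^sup>1(\<Omega>)\<close> represented by a function in \<open>L\<^sup>2(\<Omega>)\<close>.\<close>

definition L2_functional ::
    "'a::euclidean_space set \<Rightarrow> ('a \<Rightarrow> real) \<Rightarrow> ('a \<Rightarrow> real) \<Rightarrow> real" where
  "L2_functional \<Omega> w \<phi> = (LINT x|lebesgue_on \<Omega>. w x * \<phi> x)"

definition neumann_solution ::
    "'a::euclidean_space set \<Rightarrow> (('a \<Rightarrow> real) \<Rightarrow> real) \<Rightarrow> ('a \<Rightarrow> real) \<Rightarrow> bool" where
  "neumann_solution \<Omega> f g \<longleftrightarrow> g \<in> H1 \<Omega> \<and> (LINT x|lebesgue_on \<Omega>. g x) = 0 \<and>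
     (\<forall>\<phi>\<in>H1 \<Omega>. f \<phi> = (LINT x|lebesgue_on \<Omega>. grad \<Omega> g x \<bullet> grad \<Omega> \<phi> x))"

text \<open>The inverse Laplacian, inner product and norm are meaningful for functionals \<open>f \<in> X2 \<Omega>\<close>
  vanishing on constants; then \<open>neumann_solution \<Omega> f\<close> determines its solution almost everywhere.\<close>

definition inverse_laplacian ::
    "'a::euclidean_space set \<Rightarrow> (('a \<Rightarrow> real) \<Rightarrow> real) \<Rightarrow> 'a \<Rightarrow> real" where
  "inverse_laplacian \<Omega> f = (\<lambda>x. - (SOME g. neumann_solution \<Omega> f g) x)"

definition X2_inner ::
    "'a::euclidean_space set \<Rightarrow> (('a \<Rightarrow> real) \<Rightarrow> real) \<Rightarrow> (('a \<Rightarrow> real) \<Rightarrow> real) \<Rightarrow> real" where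
  "X2_inner \<Omega> f1 f2 = (LINT x|lebesgue_on \<Omega>.
     grad \<Omega> (inverse_laplacian \<Omega> f1) x \<bullet> grad \<Omega> (inverse_laplacian \<Omega> f2) x)"

definition X2_norm :: "'a::euclidean_space set \<Rightarrow> (('a \<Rightarrow> real) \<Rightarrow> real) \<Rightarrow> real" where
  "X2_norm \<Omega> f = sqrt (X2_inner \<Omega> f f)"

definition X2_dist :: "'a::euclidean_space set \<Rightarrow> ('a \<Rightarrow> real) \<Rightarrow> ('a \<Rightarrow> real) \<Rightarrow> real" where
  "X2_dist \<Omega> u w = X2_norm \<Omega> (L2_functional \<Omega> (\<lambda>x. u x - w x))"


section \<open>The Cahn--Hilliard problem\<close>

text \<open>The class \<open>C([0,T];L\<^sup>2) \<inter> L\<^sup>2(0,T;H\<^sup>1) \<inter> L\<^sup>4(0,T;L\<^sup>4)\<close> for all \<open>T > 0\<close>.  Strong measurability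
  in time follows from the continuity in \<open>L\<^sup>2\<close>.\<close>

definition solution_class ::
    "'a::euclidean_space set \<Rightarrow> (real \<Rightarrow> 'a \<Rightarrow> real) \<Rightarrow> bool" where
  "solution_class \<Omega> u \<longleftrightarrow> (\<forall>T>0.
     (\<forall>t\<in>{0..T}. u t \<in> L2 \<Omega> \<and> ((\<lambda>s. L2_norm \<Omega> (\<lambda>x. u s x - u t x)) \<longlongrightarrow> 0) (at t within {0..T})) \<and>
     (AE t in lebesgue_on {0..T}. u t \<in> H1 \<Omega>) \<and>
     (\<integral>\<^sup>+t. ennreal ((H1_norm \<Omega> (u t))\<^sup>2) \<partial>lebesgue_on {0..T}) < \<infinity> \<and>
     (\<integral>\<^sup>+t. (\<integral>\<^sup>+x. ennreal (u t x ^ 4) \<partial>lebesgue_on \<Omega>) \<partial>lebesgue_on {0..T}) < \<infinity>)"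

text \<open>\<open>d\<close> is the weak time derivative of \<open>u\<close>, in \<open>L\<^sup>1(0,T;X\<^sub>2)\<close> for all \<open>T > 0\<close>.  Since \<open>H\<^sup>1(\<Omega>)\<close>
  is separable, measurability of \<open>d\<close> may be expressed by duality with fixed \<open>\<phi>\<close>.\<close>

definition weak_time_derivative ::
    "'a::euclidean_space set \<Rightarrow> (real \<Rightarrow> 'a \<Rightarrow> real) \<Rightarrow> (real \<Rightarrow> ('a \<Rightarrow> real) \<Rightarrow> real) \<Rightarrow> bool" where
  "weak_time_derivative \<Omega> u d \<longleftrightarrow>
     (AE t in lebesgue_on {0<..}. d t \<in> X2 \<Omega> \<and> d t (\<lambda>_. 1) = 0) \<and>
     (\<forall>\<phi>\<in>H1 \<Omega>. (\<lambda>t. d t \<phi>) \<in> borel_measurable (lebesgue_on {0<..})) \<and>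
     (\<forall>T>0. (\<integral>\<^sup>+t. ennreal (X2_norm \<Omega> (d t)) \<partial>lebesgue_on {0..T}) < \<infinity>) \<and>
     (\<forall>\<phi>\<in>H1 \<Omega>. \<forall>\<eta>\<in>test_functions {0<..}.
        (LINT t|lebesgue_on {0<..}. deriv \<eta> t * L2_functional \<Omega> (u t) \<phi>)
          = - (LINT t|lebesgue_on {0<..}. \<eta> t * d t \<phi>))"

text \<open>Weak form of \<open>\<partial>\<^sub>t u = -\<Delta>v\<close>, \<open>v = \<epsilon>\<^sup>2\<Delta>u - W'(u)\<close>; testing with functions that need not vanish
  on the boundary encodes the homogeneous Neumann conditions for \<open>u\<close> and \<open>v\<close>.  Test functions in
  the second equation are bounded because \<open>W'(u)\<close> is only known to be integrable.  The dissipation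
  identity is written additively to avoid a subtraction of extended nonnegative reals.\<close>

definition cahn_hilliard_solution ::
    "'a::euclidean_space set \<Rightarrow> (real \<Rightarrow> real) \<Rightarrow> real \<Rightarrow> real \<Rightarrow> ('a \<Rightarrow> real) \<Rightarrow>
     (real \<Rightarrow> 'a \<Rightarrow> real) \<Rightarrow> bool" where
  "cahn_hilliard_solution \<Omega> W m \<epsilon> u0 u \<longleftrightarrow>
     solution_class \<Omega> u \<and>
     (AE x in lebesgue_on \<Omega>. u 0 x = u0 x) \<and>
     (\<forall>t\<ge>0. (LINT x|lebesgue_on \<Omega>. u t x) = (LINT x|lebesgue_on \<Omega>. u 0 x)) \<and>
     (\<exists>d v. weak_time_derivative \<Omega> u d \<and>
        (AE t in lebesgue_on {0<..}.
           v t \<in> H1 \<Omega> \<and> integrable (lebesgue_on \<Omega>) (\<lambda>x. deriv W (u t x)) \<and>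
           (\<forall>\<phi>\<in>H1 \<Omega>. d t \<phi> = (LINT x|lebesgue_on \<Omega>. grad \<Omega> (v t) x \<bullet> grad \<Omega> \<phi> x)) \<and>
           (\<forall>\<psi>\<in>H1 \<Omega>. (\<exists>B. AE x in lebesgue_on \<Omega>. \<bar>\<psi> x\<bar> \<le> B) \<longrightarrow>
              (LINT x|lebesgue_on \<Omega>. v t x * \<psi> x)
                = - \<epsilon>\<^sup>2 * (LINT x|lebesgue_on \<Omega>. grad \<Omega> (u t) x \<bullet> grad \<Omega> \<psi> x)
                  - (LINT x|lebesgue_on \<Omega>. deriv W (u t x) * \<psi> x))) \<and>
        (\<forall>T>0. energy \<Omega> W m \<epsilon> (u 0) = energy \<Omega> W m \<epsilon> (u T) +
           ennreal (1 / \<epsilon>) * (\<integral>\<^sup>+s. ennreal ((X2_norm \<Omega> (d s))\<^sup>2) \<partial>lebesgue_on {0..T})))"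

end

theory Submission
  imports Defs
begin

text \<open>Along a gradient flow, the time integral of the squared speed equals the loss of energy, so a
  solution can only move as far as its energy can fall.  The energy starts at most \<open>O(\<epsilon>)\<close> above the
  limit energy of the minimizer \<open>E0\<close>.  The main point is that it can also fall only \<open>O(\<epsilon>)\<close> below that
  value (\<open>energy_lower_bound\<close>).  With the factor \<open>1 / \<epsilon>\<close> in the dissipation identity the integral
  of the squared speed over all times is then \<open>O(\<epsilon>\<^sup>2)\<close>, and the Cauchy--Schwarz inequality in time
  bounds the distance travelled up to time \<open>T\<close> by \<open>O(\<epsilon> sqrt T)\<close> (\<open>travelled_distance_le\<close>).  For
  \<open>T = M / \<epsilon>\<close> this is \<open>O(sqrt \<epsilon>)\<close>.

  The lower bound for the energy of an arbitrary \<open>u\<close> of mass \<open>m\<close> refines the argument of Modica and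
  Mortola, in which the energy density dominates \<open>sqrt 2\<close> times \<open>sqrt (W u)\<close> times the length of the
  gradient, and the coarea inequality turns this weighted variation into an integral of perimeters of
  sublevel sets over the levels between the wells.  A sublevel set of volume \<open>r\<close> has perimeter at
  least \<open>\<I>(r)\<close>, for the isoperimetric function \<open>\<I>\<close>.  Since \<open>\<I>\<close> is differentiable at
  \<open>r0 = (1 - m) / 2\<close>, \<open>\<I>(r)\<close> is at least \<open>\<I>(r0) - L \<bar>r - r0\<bar>\<close>, and \<open>\<I>(r0)\<close> is the perimeter of
  \<open>E0\<close>.  The volumes of the sublevel sets need not be \<open>r0\<close>, but their deviation from \<open>r0\<close>, integrated
  over the levels, is bounded by twice the \<open>L\<^sup>1\<close> distance of \<open>u\<close> to the wells
  (\<open>sublevel_volume_deviation\<close>).  To absorb this error, the weight \<open>sqrt W\<close> is lowered by a multiple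
  of \<open>\<epsilon>\<close>.  That costs \<open>O(\<epsilon>)\<close> in the total weight and releases enough of the potential energy to
  control any given multiple of the distance to the wells (\<open>Modica_Mortola_with_remainder\<close>).

  The distance is measured in the dual space of \<open>H\<^sup>1\<close> through solutions of the Neumann problem.  Such
  a norm is the dual norm of the Dirichlet seminorm as soon as the Neumann problem is solvable
  (\<open>X2_norm_dual\<close>); the triangle inequality and the estimate of the distance travelled follow by
  testing with a fixed function.  Solvability comes from a minimising sequence, the completeness of
  \<open>L\<^sup>2\<close> and the Poincare inequality on \<open>\<Omega>\<close> (\<open>neumann_solution_exists\<close>, \<open>poincare_domain\<close>).  The
  Poincare inequality holds on balls by an estimate for translations, extends to compact subsets by
  joining overlapping balls, and reaches the boundary because \<open>\<Omega>\<close> lies above a graph there: a small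
  translation moves a neighbourhood of a boundary point into a compact subset of \<open>\<Omega>\<close>.

  All properties of Sobolev functions used here, namely the uniqueness of weak gradients, the chain
  rule, the coarea inequality and the translation estimate, are obtained by convolution with smooth
  mollifiers.\<close>


section \<open>Differentiable functions and a smooth bump\<close>

lemma Ck_Suc_I:
  assumes "\<And>x. (f has_derivative f' x) (at x)" "\<And>b. b \<in> Basis \<Longrightarrow> Ck k (\<lambda>x. f' x b)"
  shows "Ck (Suc k) f"
proof -
  have "frechet_derivative f (at x) = f' x" for x
    using frechet_derivative_at[OF assms(1)] by simp
  then show ?thesis
    using assms by (auto simp: differentiable_def)
qed

lemma Ck_Suc_has_derivative:
  assumes "Ck (Suc k) f"
  shows "(f has_derivative frechet_derivative f (at x)) (at x)"
  using assms by (simp add: frechet_derivative_works)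

lemma Ck_Suc_D: "Ck (Suc k) f \<Longrightarrow> Ck k f"
proof (induction k arbitrary: f)
  case 0
  then have "f differentiable (at x)" for x by simp
  then show ?case
    by (auto simp: continuous_on_eq_continuous_at intro: differentiable_imp_continuous_within)
qed auto

lemma Ck_mono: "Ck k f \<Longrightarrow> j \<le> k \<Longrightarrow> Ck j f"
proof (induction k)
  case (Suc k)
  then show ?case using Ck_Suc_D[of k f] by (auto simp only: le_Suc_eq)
qed auto

lemma Ck_const: "Ck k (\<lambda>x. c)"
proof (induction k arbitrary: c)
  case (Suc k)
  then show ?case by (intro Ck_Suc_I[where f' = "\<lambda>_ _. 0"]) auto
qed auto

lemma Ck_add:
  assumes "Ck k f" "Ck k g"
  shows "Ck k (\<lambda>x. f x + g x)"
  using assms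
proof (induction k arbitrary: f g)
  case 0
  then show ?case by (auto intro: continuous_intros)
next
  case (Suc k)
  show ?case
  proof (rule Ck_Suc_I)
    show "((\<lambda>x. f x + g x) has_derivative
        (\<lambda>v. frechet_derivative f (at x) v + frechet_derivative g (at x) v)) (at x)" for x
      using Suc.prems by (intro has_derivative_add Ck_Suc_has_derivative)
  qed (use Suc in auto)
qed

lemma Ck_mult:
  assumes "Ck k f" "Ck k g"
  shows "Ck k (\<lambda>x. f x * g x)"
  using assms
proof (induction k arbitrary: f g)
  case 0
  then show ?case by (auto intro: continuous_intros)
next
  case (Suc k)
  from Suc.prems have "Ck k f" "Ck k g" by (blast dest: Ck_Suc_D)+
  show ?case
  proof (rule Ck_Suc_I)
    show "((\<lambda>x. f x * g x) has_derivative
        (\<lambda>v. f x * frechet_derivative g (at x) v + frechet_derivative f (at x) v * g x)) (at x)" for x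
      using Suc.prems by (intro has_derivative_mult Ck_Suc_has_derivative)
  qed (use Suc \<open>Ck k f\<close> \<open>Ck k g\<close> in \<open>auto intro!: Ck_add\<close>)
qed

lemma Ck_inner_left: "Ck k (\<lambda>x. (x - p) \<bullet> b)"
proof (cases k)
  case (Suc j)
  show ?thesis unfolding Suc
    by (intro Ck_Suc_I[where f' = "\<lambda>_ v. v \<bullet> b"] Ck_const) (auto intro!: derivative_eq_intros)
qed (auto intro!: continuous_intros)

text \<open>The flat functions \<open>t \<mapsto> exp (-1/t) / t ^ j\<close>, extended by zero, form a family that is closed
  under differentiation; this is what makes all of them smooth.\<close>

definition flat :: "nat \<Rightarrow> real \<Rightarrow> real" where
  "flat j t = (if 0 < t then exp (- (1 / t)) / t ^ j else 0)"

lemma flat_nonneg: "0 \<le> flat j t"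
  by (simp add: flat_def)

lemma flat_pos: "0 < t \<Longrightarrow> 0 < flat j t"
  by (simp add: flat_def)

lemma flat_tendsto_0: "(flat j \<longlongrightarrow> 0) (at 0)"
proof -
  have "((\<lambda>x::real. x ^ j / exp x) \<longlongrightarrow> 0) at_top"
    by (rule tendsto_power_div_exp_0)
  then have "((\<lambda>t::real. inverse t ^ j / exp (inverse t)) \<longlongrightarrow> 0) (at_right 0)"
    by (rule filterlim_compose) (rule filterlim_inverse_at_top_right)
  then have "(flat j \<longlongrightarrow> 0) (at_right 0)"
    by (rule Lim_transform_eventually)
      (auto simp: flat_def eventually_at_filter exp_minus field_simps)
  moreover have "(flat j \<longlongrightarrow> 0) (at_left 0)"
    by (rule tendsto_eventually) (auto simp: flat_def eventually_at_filter)
  ultimately show ?thesis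
    by (simp add: filterlim_split_at)
qed

lemma flat_deriv:
  "(flat j has_real_derivative - real j * flat (Suc j) t + flat (Suc (Suc j)) t) (at t)"
proof -
  consider "t > 0" | "t < 0" | "t = 0" by linarith
  then show ?thesis
  proof cases
    case 1
    have "((\<lambda>t. exp (- (1 / t)) / t ^ j) has_real_derivative
        - real j * flat (Suc j) t + flat (Suc (Suc j)) t) (at t)"
    proof (cases j)
      case 0
      then show ?thesis using 1
        by (auto intro!: derivative_eq_intros simp: flat_def divide_simps power2_eq_square)
    next
      case (Suc i)
      show ?thesis using 1
        by (auto intro!: derivative_eq_intros simp: flat_def Suc divide_simps power2_eq_square)
          (cases i; auto simp: algebra_simps)
    qed
    then show ?thesis
      by (rule DERIV_cong_ev[THEN iffD1, rotated -1])
        (use 1 eventually_nhds_in_open[of "{0<..}" t] in \<open>auto simp: flat_def elim!: eventually_mono\<close>)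
  next
    case 2
    have "((\<lambda>t. 0::real) has_real_derivative 0) (at t)" by simp
    then have "(flat j has_real_derivative 0) (at t)"
      by (rule DERIV_cong_ev[THEN iffD1, rotated -1])
        (use 2 eventually_nhds_in_open[of "{..<0}" t] in \<open>auto simp: flat_def elim!: eventually_mono\<close>)
    then show ?thesis using 2 by (simp add: flat_def)
  next
    case 3
    have "((\<lambda>h. (flat j (0 + h) - flat j 0) / h) \<longlongrightarrow> 0) (at 0)"
      by (rule Lim_transform_eventually[OF flat_tendsto_0[of "Suc j"]])
        (auto simp: flat_def eventually_at_filter field_simps)
    then show ?thesis
      using 3 by (simp add: DERIV_def flat_def)
  qed
qed

text \<open>The induction runs over all indices \<open>j\<close> at once, because the derivative of \<open>flat j\<close> is a
  combination of \<open>flat (Suc j)\<close> and \<open>flat (Suc (Suc j))\<close>.\<close>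

lemma Ck_flat_ball: "Ck k (\<lambda>x::'a::euclidean_space. flat j (d\<^sup>2 - (x - p) \<bullet> (x - p)))"
proof (induction k arbitrary: j)
  case 0
  have "continuous_on UNIV (flat j)"
    by (rule DERIV_continuous_on) (rule DERIV_subset[OF flat_deriv], simp)
  then show ?case
    by (auto intro!: continuous_intros continuous_on_compose2[of UNIV "flat j"])
next
  case (Suc k)
  define D where "D t = - real j * flat (Suc j) t + flat (Suc (Suc j)) t" for t
  have "((\<lambda>x::'a. flat j (d\<^sup>2 - (x - p) \<bullet> (x - p))) has_derivative
      (\<lambda>v. (-2) * (((x - p) \<bullet> v) * D (d\<^sup>2 - (x - p) \<bullet> (x - p))))) (at x)" for x
  proof -
    have "((\<lambda>x::'a. d\<^sup>2 - (x - p) \<bullet> (x - p)) has_derivative (\<lambda>v. - 2 * ((x - p) \<bullet> v))) (at x)"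
      by (auto intro!: derivative_eq_intros simp: inner_commute)
    from DERIV_compose_FDERIV[OF flat_deriv this, of j]
    show ?thesis by (simp add: D_def algebra_simps)
  qed
  then show ?case
    by (rule Ck_Suc_I) (unfold D_def, intro Ck_mult Ck_add Ck_const Ck_inner_left Suc.IH)
qed

definition gradient_of :: "('a::euclidean_space \<Rightarrow> real) \<Rightarrow> 'a \<Rightarrow> 'a" where
  "gradient_of f x = (\<Sum>b\<in>Basis. frechet_derivative f (at x) b *\<^sub>R b)"

lemma gradient_of:
  fixes f :: "'a::euclidean_space \<Rightarrow> real"
  assumes "f differentiable (at x)"
  shows "frechet_derivative f (at x) v = gradient_of f x \<bullet> v"
proof -
  interpret linear "frechet_derivative f (at x)"
    using assms by (rule linear_frechet_derivative)
  have "frechet_derivative f (at x) v = frechet_derivative f (at x) (\<Sum>b\<in>Basis. (v \<bullet> b) *\<^sub>R b)"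
    by (simp add: euclidean_representation)
  also have "\<dots> = gradient_of f x \<bullet> v"
    by (simp add: sum scale gradient_of_def inner_sum_right inner_commute[of _ v] mult.commute)
  finally show ?thesis .
qed

lemma gradient_of_eq:
  assumes "(f has_derivative (\<lambda>v. g \<bullet> v)) (at x)"
  shows "gradient_of f x = g"
  using frechet_derivative_at[OF assms, symmetric] by (simp add: gradient_of_def euclidean_representation)

lemma has_derivative_gradient_of:
  "f differentiable (at x) \<Longrightarrow> (f has_derivative (\<lambda>v. gradient_of f x \<bullet> v)) (at x)"
  using gradient_of[of f x] frechet_derivative_works[of f "at x"]
  by (simp flip: gradient_of)

lemma continuous_on_gradient_of:
  assumes "Ck (Suc k) f"
  shows "continuous_on UNIV (gradient_of f)"
  unfolding gradient_of_def
proof (intro continuous_intros)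
  fix b :: 'a assume "b \<in> Basis"
  with assms have "Ck 0 (\<lambda>x. frechet_derivative f (at x) b)"
    using Ck_mono[of k "\<lambda>x. frechet_derivative f (at x) b" 0] by simp
  then show "continuous_on UNIV (\<lambda>x. frechet_derivative f (at x) b)" by simp
qed

lemma gradient_of_outside:
  fixes f :: "'a::euclidean_space \<Rightarrow> real"
  assumes "x \<notin> closure {x. f x \<noteq> 0}"
  shows "gradient_of f x = 0"
proof (rule gradient_of_eq)
  have "((\<lambda>x. 0) has_derivative (\<lambda>v. 0 \<bullet> v)) (at x)" by simp
  moreover have "\<forall>\<^sub>F y in nhds x. f y = 0"
    using eventually_nhds_in_open[of "- closure {x. f x \<noteq> 0}" x] assms
    by (auto elim!: eventually_mono intro: closure_subset[THEN subsetD] simp: open_Compl)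
  then have "\<forall>\<^sub>F y in at x. 0 = f y"
    by (auto simp: eventually_at_filter elim: eventually_mono)
  ultimately show "(f has_derivative (\<lambda>v. 0 \<bullet> v)) (at x)"
    using has_derivative_transform_eventually[of "\<lambda>x. 0" "\<lambda>v. 0 \<bullet> v" x UNIV f]
      eventually_nhds_x_imp_x[OF \<open>\<forall>\<^sub>F y in nhds x. f y = 0\<close>]
    by simp
qed


section \<open>Lebesgue integration on Euclidean space\<close>

text \<open>Serves both the Cauchy--Schwarz inequality and the Euler equation of a minimising sequence.\<close>

lemma quadratic_nonneg_imp_discriminant:
  fixes a b c :: real
  assumes "\<And>t. 0 \<le> a + 2 * t * b + t\<^sup>2 * c" and "0 \<le> c"
  shows "b\<^sup>2 \<le> a * c"
proof (cases "c = 0")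
  case True
  have "b = 0"
  proof (rule ccontr)
    assume "b \<noteq> 0"
    \<comment> \<open>the linear function takes the value -1 somewhere\<close>
    then have "a + 2 * (- (a + 1) / (2 * b)) * b = - 1" by (simp add: field_simps)
    with assms(1)[of "- (a + 1) / (2 * b)"] True show False by simp
  qed
  with True show ?thesis by simp
next
  case False
  with assms(2) have "0 < c" by simp
  have "a + 2 * (- b / c) * b + (- b / c)\<^sup>2 * c = a - b\<^sup>2 / c"
    using False by (simp add: power2_eq_square field_simps)
  with assms(1)[of "- b / c"] have "b\<^sup>2 / c \<le> a" by linarith
  with \<open>0 < c\<close> show ?thesis by (simp add: pos_divide_le_eq)
qed

lemma integrable_inner_L2:
  fixes f g :: "'a \<Rightarrow> 'b::euclidean_space"
  assumes [measurable]: "f \<in> borel_measurable M" "g \<in> borel_measurable M"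
    and "integrable M (\<lambda>x. (norm (f x))\<^sup>2)" "integrable M (\<lambda>x. (norm (g x))\<^sup>2)"
  shows "integrable M (\<lambda>x. f x \<bullet> g x)"
proof (rule Bochner_Integration.integrable_bound)
  show "integrable M (\<lambda>x. (norm (f x))\<^sup>2 + (norm (g x))\<^sup>2)"
    using assms by simp
  show "AE x in M. norm (f x \<bullet> g x) \<le> norm ((norm (f x))\<^sup>2 + (norm (g x))\<^sup>2)"
  proof (rule AE_I2)
    fix x
    have "norm (f x \<bullet> g x) \<le> norm (f x) * norm (g x)" by (simp add: Cauchy_Schwarz_ineq2)
    also have "\<dots> \<le> (norm (f x))\<^sup>2 + (norm (g x))\<^sup>2"
      using sum_squares_bound[of "norm (f x)" "norm (g x)"]
        mult_nonneg_nonneg[OF norm_ge_zero[of "f x"] norm_ge_zero[of "g x"]] by linarith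
    finally show "norm (f x \<bullet> g x) \<le> norm ((norm (f x))\<^sup>2 + (norm (g x))\<^sup>2)" by simp
  qed
qed measurable

lemma integrable_norm2_lincomb:
  fixes f g :: "'a \<Rightarrow> 'b::euclidean_space"
  assumes [measurable]: "f \<in> borel_measurable M" "g \<in> borel_measurable M"
    and "integrable M (\<lambda>x. (norm (f x))\<^sup>2)" "integrable M (\<lambda>x. (norm (g x))\<^sup>2)"
  shows "integrable M (\<lambda>x. (norm (a *\<^sub>R f x + b *\<^sub>R g x))\<^sup>2)"
    and "(LINT x|M. (norm (a *\<^sub>R f x + b *\<^sub>R g x))\<^sup>2)
      = a\<^sup>2 * (LINT x|M. (norm (f x))\<^sup>2) + 2 * a * b * (LINT x|M. f x \<bullet> g x)
        + b\<^sup>2 * (LINT x|M. (norm (g x))\<^sup>2)"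
proof -
  have *: "(norm (a *\<^sub>R f x + b *\<^sub>R g x))\<^sup>2
      = a\<^sup>2 * (norm (f x))\<^sup>2 + 2 * a * b * (f x \<bullet> g x) + b\<^sup>2 * (norm (g x))\<^sup>2" for x
    unfolding power2_norm_eq_inner
    by (simp add: inner_simps inner_commute power2_eq_square algebra_simps)
  have "integrable M (\<lambda>x. f x \<bullet> g x)"
    by (rule integrable_inner_L2) (use assms in auto)
  with assms show "integrable M (\<lambda>x. (norm (a *\<^sub>R f x + b *\<^sub>R g x))\<^sup>2)"
    and "(LINT x|M. (norm (a *\<^sub>R f x + b *\<^sub>R g x))\<^sup>2)
      = a\<^sup>2 * (LINT x|M. (norm (f x))\<^sup>2) + 2 * a * b * (LINT x|M. f x \<bullet> g x)
        + b\<^sup>2 * (LINT x|M. (norm (g x))\<^sup>2)"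
    unfolding * by simp_all
qed

lemma Cauchy_Schwarz_L2:
  fixes f g :: "'a \<Rightarrow> 'b::euclidean_space"
  assumes [measurable]: "f \<in> borel_measurable M" "g \<in> borel_measurable M"
    and "integrable M (\<lambda>x. (norm (f x))\<^sup>2)" "integrable M (\<lambda>x. (norm (g x))\<^sup>2)"
  shows "\<bar>LINT x|M. f x \<bullet> g x\<bar> \<le> sqrt (LINT x|M. (norm (f x))\<^sup>2) * sqrt (LINT x|M. (norm (g x))\<^sup>2)"
proof -
  have "(LINT x|M. f x \<bullet> g x)\<^sup>2 \<le> (LINT x|M. (norm (f x))\<^sup>2) * (LINT x|M. (norm (g x))\<^sup>2)"
  proof (rule quadratic_nonneg_imp_discriminant)
    fix t :: real
    have "0 \<le> (LINT x|M. (norm (1 *\<^sub>R f x + t *\<^sub>R g x))\<^sup>2)" by simp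
    then show "0 \<le> (LINT x|M. (norm (f x))\<^sup>2) + 2 * t * (LINT x|M. f x \<bullet> g x)
        + t\<^sup>2 * (LINT x|M. (norm (g x))\<^sup>2)"
      by (subst (asm) integrable_norm2_lincomb(2)) (use assms in auto)
  qed simp
  from real_sqrt_le_mono[OF this] show ?thesis
    by (simp add: real_sqrt_mult)
qed

lemma lborel_distr_reflect:
  fixes t :: "'a::euclidean_space"
  shows "distr lborel borel (\<lambda>x. t - x) = lborel"
  using lborel_affine[of "-1" t] by (simp add: density_1)

lemma lborel_distr_shift:
  fixes t :: "'a::euclidean_space"
  shows "distr lborel borel (\<lambda>x. x + t) = lborel"
proof -
  have "(\<lambda>x. x + t) = (+) t" by (simp add: fun_eq_iff add.commute)
  then show ?thesis using lborel_distr_plus[of t] by simp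
qed

lemma integrable_lborel_reflect:
  fixes f :: "'a::euclidean_space \<Rightarrow> 'b::{banach, second_countable_topology}"
  shows "integrable lborel f \<Longrightarrow> integrable lborel (\<lambda>x. f (t - x))"
  using integrable_distr[of "\<lambda>x. t - x" lborel borel f] by (simp add: lborel_distr_reflect)

lemma integral_lborel_reflect:
  fixes f :: "'a::euclidean_space \<Rightarrow> 'b::{banach, second_countable_topology}"
  assumes "f \<in> borel_measurable borel"
  shows "(LINT x|lborel. f (t - x)) = (LINT x|lborel. f x)"
  using integral_distr[of "\<lambda>x. t - x" lborel borel f] assms by (simp add: lborel_distr_reflect)

lemma nn_integral_lborel_reflect:
  fixes f :: "'a::euclidean_space \<Rightarrow> ennreal"
  assumes "f \<in> borel_measurable borel"
  shows "(\<integral>\<^sup>+x. f (t - x) \<partial>lborel) = (\<integral>\<^sup>+x. f x \<partial>lborel)"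
  using nn_integral_distr[of "\<lambda>x. t - x" lborel borel f] assms by (simp add: lborel_distr_reflect)

lemma integrable_lborel_shift:
  fixes f :: "'a::euclidean_space \<Rightarrow> 'b::{banach, second_countable_topology}"
  shows "integrable lborel f \<Longrightarrow> integrable lborel (\<lambda>x. f (x + t))"
  using integrable_distr[of "\<lambda>x. x + t" lborel borel f] by (simp add: lborel_distr_shift)

lemma integral_lborel_shift:
  fixes f :: "'a::euclidean_space \<Rightarrow> 'b::{banach, second_countable_topology}"
  assumes "f \<in> borel_measurable borel"
  shows "(LINT x|lborel. f (x + t)) = (LINT x|lborel. f x)"
  using integral_distr[of "\<lambda>x. x + t" lborel borel f] assms by (simp add: lborel_distr_shift)

lemma nn_integral_lborel_shift:
  fixes f :: "'a::euclidean_space \<Rightarrow> ennreal"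
  assumes "f \<in> borel_measurable borel"
  shows "(\<integral>\<^sup>+x. f (x + t) \<partial>lborel) = (\<integral>\<^sup>+x. f x \<partial>lborel)"
  using nn_integral_distr[of "\<lambda>x. x + t" lborel borel f] assms by (simp add: lborel_distr_shift)

lemma compactly_supported_integrable:
  fixes f :: "'a::euclidean_space \<Rightarrow> 'b::{banach, second_countable_topology}"
  assumes "continuous_on UNIV f" "compact K" "\<And>x. x \<notin> K \<Longrightarrow> f x = 0"
  shows "integrable lborel f"
proof -
  have "integrable lborel (\<lambda>x. indicator K x *\<^sub>R f x)"
    using assms by (intro borel_integrable_compact continuous_on_subset[OF assms(1)]) auto
  moreover have "(\<lambda>x. indicator K x *\<^sub>R f x) = f"
    using assms(3) by (auto simp: indicator_def)
  ultimately show ?thesis by simp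
qed

lemma compactly_supported_bounded:
  fixes f :: "'a::euclidean_space \<Rightarrow> 'b::real_normed_vector"
  assumes "continuous_on UNIV f" "compact K" "\<And>x. x \<notin> K \<Longrightarrow> f x = 0"
  obtains B where "0 < B" "\<And>x. norm (f x) \<le> B"
proof -
  have "bounded (f ` K)"
    using assms by (intro compact_imp_bounded compact_continuous_image continuous_on_subset[OF assms(1)]) auto
  then obtain B where "0 < B" "\<And>x. x \<in> K \<Longrightarrow> norm (f x) \<le> B"
    unfolding bounded_pos by auto
  with assms(3) show thesis by (metis that less_imp_le norm_zero)
qed

lemma compactly_supported_uniformly_continuous:
  fixes f :: "'a::euclidean_space \<Rightarrow> 'b::real_normed_vector"
  assumes "continuous_on UNIV f" "compact K" "\<And>x. x \<notin> K \<Longrightarrow> f x = 0"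
  shows "uniformly_continuous_on UNIV f"
  unfolding uniformly_continuous_on_def
proof (intro allI impI)
  fix e :: real assume "0 < e"
  \<comment> \<open>two points at distance at most 1 both lie in the enlarged set \<open>L\<close> or both lie outside \<open>K\<close>\<close>
  define L where "L = (\<Union>x\<in>K. \<Union>y\<in>cball 0 1. {x + y})"
  have "compact L"
    unfolding L_def using assms(2) by (intro compact_sums') auto
  have L: "z \<in> L" if "x \<in> K" "dist z x \<le> 1" for x z
  proof -
    have "z = x + (z - x)" "z - x \<in> cball 0 1"
      using that by (auto simp: dist_norm norm_minus_commute)
    with that show ?thesis unfolding L_def by blast
  qed
  have "uniformly_continuous_on L f"
    using assms by (intro compact_uniformly_continuous \<open>compact L\<close> continuous_on_subset[OF assms(1)]) auto
  with \<open>0 < e\<close> obtain d where d: "0 < d" "\<And>x y. x \<in> L \<Longrightarrow> y \<in> L \<Longrightarrow> dist y x < d \<Longrightarrow> dist (f y) (f x) < e"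
    unfolding uniformly_continuous_on_def by metis
  have "dist (f y) (f x) < e" if "dist y x < min d 1" for x y
  proof (cases "x \<in> K \<or> y \<in> K")
    case True
    then have "x \<in> L \<and> y \<in> L"
      using L[of x y] L[of y x] L[of x x] L[of y y] that by (auto simp: dist_commute)
    then show ?thesis using d that by auto
  next
    case False
    then show ?thesis using assms(3) \<open>0 < e\<close> by simp
  qed
  then show "\<exists>d>0. \<forall>x\<in>UNIV. \<forall>x'\<in>UNIV. dist x' x < d \<longrightarrow> dist (f x') (f x) < e"
    using d(1) by (intro exI[of _ "min d 1"]) auto
qed

text \<open>Translation is continuous in \<open>L\<^sup>1\<close>.  The property passes to \<open>L\<^sup>1\<close> limits; for indicators of open
  sets of finite measure it is dominated convergence, since a point of an open set stays in it
  under small translations.\<close>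

lemma L1_translation_limit:
  fixes f :: "'a::euclidean_space \<Rightarrow> 'b::{banach, second_countable_topology}"
  assumes f: "integrable lborel f"
    and approx: "\<And>e. 0 < e \<Longrightarrow> \<exists>g. integrable lborel g \<and> (LINT x|lborel. norm (f x - g x)) \<le> e \<and>
        (\<lambda>n. LINT x|lborel. norm (g (x + z n) - g x)) \<longlonglongrightarrow> 0"
  shows "(\<lambda>n. LINT x|lborel. norm (f (x + z n) - f x)) \<longlonglongrightarrow> 0"
proof (rule order_tendstoI)
  fix e :: real assume "0 < e"
  then obtain g where g: "integrable lborel g" "(LINT x|lborel. norm (f x - g x)) \<le> e / 4"
    and lim: "(\<lambda>n. LINT x|lborel. norm (g (x + z n) - g x)) \<longlonglongrightarrow> 0"
    using approx[of "e / 4"] by auto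
  have "\<forall>\<^sub>F n in sequentially. (LINT x|lborel. norm (g (x + z n) - g x)) < e / 2"
    using order_tendstoD(2)[OF lim, of "e/2"] \<open>0 < e\<close> by simp
  then show "\<forall>\<^sub>F n in sequentially. (LINT x|lborel. norm (f (x + z n) - f x)) < e"
  proof eventually_elim
    case (elim n)
    note [simp] = integrable_lborel_shift[OF f, of "z n"] integrable_lborel_shift[OF g(1), of "z n"] f g(1)
    have "(LINT x|lborel. norm (f (x + z n) - f x))
        \<le> (LINT x|lborel. norm (f (x + z n) - g (x + z n)) + norm (g (x + z n) - g x) + norm (f x - g x))"
    proof (rule integral_mono)
      fix x
      have "f (x + z n) - f x = (f (x + z n) - g (x + z n)) + (g (x + z n) - g x) + (g x - f x)" by simp
      from arg_cong[OF this, of norm] show "norm (f (x + z n) - f x)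
          \<le> norm (f (x + z n) - g (x + z n)) + norm (g (x + z n) - g x) + norm (f x - g x)"
        using norm_triangle_ineq[of "(f (x + z n) - g (x + z n)) + (g (x + z n) - g x)" "g x - f x"]
          norm_triangle_ineq[of "f (x + z n) - g (x + z n)" "g (x + z n) - g x"]
          norm_minus_commute[of "f x" "g x"]
        by linarith
    qed auto
    also have "\<dots> = (LINT x|lborel. norm (f (x + z n) - g (x + z n))) + (LINT x|lborel. norm (g (x + z n) - g x))
        + (LINT x|lborel. norm (f x - g x))"
      by simp
    also have "(LINT x|lborel. norm (f (x + z n) - g (x + z n))) = (LINT x|lborel. norm (f x - g x))"
      using integral_lborel_shift[of "\<lambda>x. norm (f x - g x)" "z n"] f g(1)
      by (auto dest!: borel_measurable_integrable)
    finally show ?case using elim g(2) by simp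
  qed
qed (auto intro!: always_eventually elim: less_le_trans)

lemma L1_translation_open:
  fixes U :: "'a::euclidean_space set" and c :: "'b::{banach, second_countable_topology}"
  assumes "open U" "emeasure lborel U < \<infinity>" "z \<longlonglongrightarrow> 0"
  shows "(\<lambda>n. LINT x|lborel. norm (indicator U (x + z n) *\<^sub>R c - indicator U x *\<^sub>R c)) \<longlonglongrightarrow> 0"
proof -
  have [measurable]: "U \<in> sets borel" using assms by simp
  have int_U: "integrable lborel (indicator U :: 'a \<Rightarrow> real)"
    using assms by simp
  have lim: "(\<lambda>n. LINT x|lborel. indicator U x * (1 - indicator U (x + w n)) :: real) \<longlonglongrightarrow> 0"
    if "w \<longlonglongrightarrow> 0" for w
  proof -
    have "(\<lambda>n. LINT x|lborel. indicator U x * (1 - indicator U (x + w n)) :: real)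
        \<longlonglongrightarrow> (LINT (x::'a)|lborel. (0::real))"
    proof (rule integral_dominated_convergence[where w = "indicator U :: 'a \<Rightarrow> real"])
      show "AE x in lborel. (\<lambda>n. indicator U x * (1 - indicator U (x + w n)) :: real) \<longlonglongrightarrow> 0"
      proof (rule AE_I2)
        fix x
        show "(\<lambda>n. indicator U x * (1 - indicator U (x + w n)) :: real) \<longlonglongrightarrow> 0"
        proof (cases "x \<in> U")
          case True
          have "(\<lambda>n. x + w n) \<longlonglongrightarrow> x + 0" by (intro tendsto_intros that)
          then have "\<forall>\<^sub>F n in sequentially. x + w n \<in> U"
            using topological_tendstoD[of "\<lambda>n. x + w n" x sequentially U] assms True by simp
          then show ?thesis
            by (intro tendsto_eventually) (erule eventually_mono, use True in simp)
        qed simp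
      qed
    qed (auto simp: int_U indicator_def)
    then show ?thesis by simp
  qed
  \<comment> \<open>the two halves of the symmetric difference are exchanged by the opposite translation\<close>
  have eq: "(LINT x|lborel. norm (indicator U (x + z n) *\<^sub>R c - indicator U x *\<^sub>R c))
      = norm c * ((LINT x|lborel. indicator U x * (1 - indicator U (x + z n)))
        + (LINT x|lborel. indicator U x * (1 - indicator U (x + - z n))))" for n
  proof -
    have i: "integrable lborel (\<lambda>x. indicator U x * (1 - indicator U (x + w)) :: real)" for w
      by (rule Bochner_Integration.integrable_bound[OF int_U]) (auto simp: indicator_def)
    have "(LINT x|lborel. indicator U x * (1 - indicator U (x + - z n)) :: real)
        = (LINT x|lborel. indicator U (x + z n) * (1 - indicator U x))"
      using integral_lborel_shift[of "\<lambda>x. indicator U x * (1 - indicator U (x + - z n)) :: real" "z n"]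
      by simp
    moreover have "integrable lborel (\<lambda>x. indicator U (x + z n) * (1 - indicator U x) :: real)"
      using integrable_lborel_shift[OF i[of "- z n"], of "z n"] by simp
    moreover have "norm (indicator U (x + z n) *\<^sub>R c - indicator U x *\<^sub>R c)
        = norm c * (indicator U x * (1 - indicator U (x + z n)) + indicator U (x + z n) * (1 - indicator U x))" for x
      by (auto simp: indicator_def)
    ultimately show ?thesis using i[of "z n"] by simp
  qed
  have "(\<lambda>n. - z n) \<longlonglongrightarrow> 0" using tendsto_minus[OF assms(3)] by simp
  from tendsto_mult[OF tendsto_const tendsto_add[OF lim[OF assms(3)] lim[OF this]], of "norm c"]
  show ?thesis unfolding eq by simp
qed

lemma L1_translation:
  fixes f :: "'a::euclidean_space \<Rightarrow> 'b::{banach, second_countable_topology}"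
  assumes "integrable lborel f" "z \<longlonglongrightarrow> 0"
  shows "(\<lambda>n. LINT x|lborel. norm (f (x + z n) - f x)) \<longlonglongrightarrow> 0"
  using assms(1)
proof (induction f rule: integrable_induct)
  case (base A c)
  then have [measurable]: "A \<in> sets borel" by simp
  show ?case
  proof (rule L1_translation_limit)
    fix e :: real assume "0 < e"
    define e' where "e' = min 1 (e / (norm c + 1))"
    have "0 < e'" using \<open>0 < e\<close> by (simp add: e'_def add_nonneg_pos)
    obtain U where U: "open U" "A \<subseteq> U" "emeasure lborel (U - A) < e'"
      using outer_regular_lborel[of A e'] \<open>0 < e'\<close> by auto
    have [measurable]: "U \<in> sets borel" using U by simp
    have "emeasure lborel U = emeasure lborel A + emeasure lborel (U - A)"
      using U by (subst plus_emeasure) (auto intro: arg_cong[where f = "emeasure lborel"])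
    also have "\<dots> < \<infinity>" using base U(3) by (auto simp: less_top[symmetric])
    finally have fin: "emeasure lborel U < \<infinity>" .
    have "(LINT x|lborel. norm (indicator A x *\<^sub>R c - indicator U x *\<^sub>R c))
        = (LINT x|lborel. norm c * indicator (U - A) x)"
      using U(2) by (intro Bochner_Integration.integral_cong) (auto simp: indicator_def)
    also have "\<dots> = norm c * measure lborel (U - A)" by simp
    also have "\<dots> \<le> norm c * e'"
      using U(3) \<open>0 < e'\<close> by (intro mult_left_mono) (auto simp: measure_def enn2real_leI less_imp_le)
    also have "\<dots> \<le> e"
    proof -
      have "norm c * e' \<le> (norm c + 1) * (e / (norm c + 1))"
        using \<open>0 < e'\<close> \<open>0 < e\<close> by (intro mult_mono) (auto simp: e'_def)
      also have "\<dots> = e"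
        by (simp add: add_nonneg_pos less_imp_neq[symmetric])
      finally show ?thesis .
    qed
    finally show "\<exists>g. integrable lborel g \<and> (LINT x|lborel. norm (indicator A x *\<^sub>R c - g x)) \<le> e \<and>
        (\<lambda>n. LINT x|lborel. norm (g (x + z n) - g x)) \<longlonglongrightarrow> 0"
      using L1_translation_open[OF U(1) fin assms(2), of c] fin
      by (intro exI[of _ "\<lambda>x. indicator U x *\<^sub>R c"]) auto
  qed (use base in auto)
next
  case (add f g)
  note [simp] = add.hyps add.hyps[THEN integrable_lborel_shift]
  have "(\<lambda>n. (LINT x|lborel. norm (f (x + z n) - f x)) + (LINT x|lborel. norm (g (x + z n) - g x))) \<longlonglongrightarrow> 0"
    using tendsto_add[OF add.IH] by simp
  then show ?case
  proof (rule Lim_null_comparison[rotated], intro always_eventually allI)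
    fix n
    have "(LINT x|lborel. norm (f (x + z n) + g (x + z n) - (f x + g x)))
        \<le> (LINT x|lborel. norm (f (x + z n) - f x) + norm (g (x + z n) - g x))"
      by (intro integral_mono norm_diff_triangle_ineq) auto
    then show "norm (LINT x|lborel. norm (f (x + z n) + g (x + z n) - (f x + g x)))
        \<le> (LINT x|lborel. norm (f (x + z n) - f x)) + (LINT x|lborel. norm (g (x + z n) - g x))"
      by simp
  qed
next
  case (lim f s)
  have "(\<lambda>i. LINT x|lborel. norm (f x - s i x)) \<longlonglongrightarrow> (LINT (x::'a)|lborel. (0::real))"
  proof (rule integral_dominated_convergence[where w = "\<lambda>x. 3 * norm (f x)"])
    show "AE x in lborel. (\<lambda>i. norm (f x - s i x)) \<longlonglongrightarrow> 0"
    proof (rule AE_I2)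
      fix x
      have "(\<lambda>i. norm (f x - s i x)) \<longlonglongrightarrow> norm (f x - f x)"
        by (intro tendsto_intros lim.hyps) auto
      then show "(\<lambda>i. norm (f x - s i x)) \<longlonglongrightarrow> 0" by simp
    qed
    show "AE x in lborel. norm (norm (f x - s i x)) \<le> 3 * norm (f x)" for i
    proof (rule AE_I2)
      fix x
      show "norm (norm (f x - s i x)) \<le> 3 * norm (f x)"
        using norm_triangle_ineq4[of "f x" "s i x"] lim.hyps(3)[of x i] by simp
    qed
  qed (use lim.hyps in \<open>auto dest: borel_measurable_integrable\<close>)
  then have L: "(\<lambda>i. LINT x|lborel. norm (f x - s i x)) \<longlonglongrightarrow> 0" by simp
  show ?case
  proof (rule L1_translation_limit[OF lim.hyps(4)])
    fix e :: real assume "0 < e"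
    then obtain i where "(LINT x|lborel. norm (f x - s i x)) < e"
      using order_tendstoD(2)[OF L] by (auto simp: eventually_sequentially)
    then show "\<exists>g. integrable lborel g \<and> (LINT x|lborel. norm (f x - g x)) \<le> e \<and>
        (\<lambda>n. LINT x|lborel. norm (g (x + z n) - g x)) \<longlonglongrightarrow> 0"
      using lim.hyps(1)[of i] lim.IH[of i] by (intro exI[of _ "s i"]) auto
  qed
qed

lemma L1_translation_at_0:
  fixes f :: "'a::euclidean_space \<Rightarrow> 'b::{banach, second_countable_topology}"
  assumes "integrable lborel f"
  shows "((\<lambda>z. LINT x|lborel. norm (f (x + z) - f x)) \<longlongrightarrow> 0) (at 0)"
  unfolding tendsto_at_iff_sequentially comp_def
  using L1_translation[OF assms] by auto


section \<open>Mollification\<close>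

definition mollifier :: "real \<Rightarrow> 'a::euclidean_space \<Rightarrow> real" where
  "mollifier \<delta> x = flat 0 (\<delta>\<^sup>2 - x \<bullet> x) / (LINT y|lborel. flat 0 (\<delta>\<^sup>2 - (y::'a) \<bullet> y))"

definition conv ::
    "('a::euclidean_space \<Rightarrow> real) \<Rightarrow> ('a \<Rightarrow> 'b::{banach, second_countable_topology}) \<Rightarrow> 'a \<Rightarrow> 'b" where
  "conv \<rho> f x = (LINT y|lborel. \<rho> (x - y) *\<^sub>R f y)"

lemma flat_ball_outside:
  assumes "\<delta> \<le> norm x" "0 < \<delta>" shows "flat j (\<delta>\<^sup>2 - x \<bullet> x) = 0"
proof -
  have "\<delta>\<^sup>2 \<le> (norm x)\<^sup>2" using assms by (intro power_mono) auto
  then show ?thesis by (simp add: flat_def power2_norm_eq_inner)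
qed

lemma continuous_flat_ball: "continuous_on UNIV (\<lambda>x::'a::euclidean_space. flat j (\<delta>\<^sup>2 - x \<bullet> x))"
  using Ck_flat_ball[of 0 j \<delta> "0::'a"] by simp

lemma mollifier_mass_pos:
  assumes "0 < \<delta>"
  shows "0 < (LINT y|lborel. flat 0 (\<delta>\<^sup>2 - (y::'a::euclidean_space) \<bullet> y))"
proof -
  let ?f = "\<lambda>y::'a. flat 0 (\<delta>\<^sup>2 - y \<bullet> y)"
  have int: "integrable lborel ?f"
    by (rule compactly_supported_integrable[OF continuous_flat_ball compact_cball[of 0 \<delta>]])
      (use assms in \<open>auto intro!: flat_ball_outside\<close>)
  have "(LINT y|lborel. ?f y) \<noteq> 0"
  proof
    assume "(LINT y|lborel. ?f y) = 0"
    then have "AE y in lborel. ?f y = 0"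
      by (subst (asm) integral_nonneg_eq_0_iff_AE) (auto simp: int flat_nonneg)
    moreover have "?f y \<noteq> 0" if "y \<in> ball 0 \<delta>" for y
    proof -
      have "(norm y)\<^sup>2 < \<delta>\<^sup>2" using that by (intro power_strict_mono) auto
      then have "0 < ?f y" by (intro flat_pos) (simp add: power2_norm_eq_inner)
      then show ?thesis by simp
    qed
    ultimately have "AE y in lborel. y \<notin> ball (0::'a) \<delta>" by (auto elim!: eventually_mono)
    moreover have "{x. norm x < \<delta>} = ball (0::'a) \<delta>" by auto
    ultimately have "emeasure lborel (ball (0::'a) \<delta>) = 0"
      by (subst (asm) AE_iff_measurable[OF _ refl]) auto
    with assms show False
      using emeasure_lborel_ball_finite[of "0::'a" \<delta>] content_ball_pos[of \<delta> "0::'a"]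
      by (auto simp: measure_def)
  qed
  moreover have "0 \<le> (LINT y|lborel. ?f y)" by (simp add: flat_nonneg)
  ultimately show ?thesis by simp
qed

lemma mollifier_nonneg: "0 < \<delta> \<Longrightarrow> 0 \<le> mollifier \<delta> (x::'a::euclidean_space)"
  using mollifier_mass_pos[of \<delta>, where 'a = 'a] by (simp add: mollifier_def flat_nonneg less_imp_le)

lemma mollifier_outside: "0 < \<delta> \<Longrightarrow> \<delta> \<le> norm x \<Longrightarrow> mollifier \<delta> x = 0"
  by (simp add: mollifier_def flat_ball_outside)

lemma Ck_mollifier_shift: "Ck k (\<lambda>y::'a::euclidean_space. mollifier \<delta> (x - y))"
proof -
  have "(\<lambda>y. mollifier \<delta> (x - y)) = (\<lambda>y. flat 0 (\<delta>\<^sup>2 - (y - x) \<bullet> (y - x))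
      * inverse (LINT y|lborel. flat 0 (\<delta>\<^sup>2 - (y::'a) \<bullet> y)))"
    by (auto simp: mollifier_def divide_inverse minus_diff_eq[of _ x, symmetric] simp del: minus_diff_eq)
  then show ?thesis by (simp add: Ck_mult Ck_const Ck_flat_ball)
qed

lemma Ck_mollifier: "Ck k (mollifier \<delta> :: 'a::euclidean_space \<Rightarrow> real)"
proof -
  have "(\<lambda>y. mollifier \<delta> (0 - y)) = (mollifier \<delta> :: 'a \<Rightarrow> real)"
    by (auto simp: mollifier_def)
  from back_subst[of "Ck k", OF Ck_mollifier_shift[of k \<delta> 0] this] show ?thesis .
qed

lemma continuous_mollifier: "continuous_on UNIV (mollifier \<delta> :: 'a::euclidean_space \<Rightarrow> real)"
  using Ck_mollifier[of 0] by simp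

lemma borel_measurable_mollifier [measurable]: "mollifier \<delta> \<in> borel_measurable borel"
  by (intro borel_measurable_continuous_onI continuous_mollifier)

lemma integrable_mollifier: "0 < \<delta> \<Longrightarrow> integrable lborel (mollifier \<delta> :: 'a::euclidean_space \<Rightarrow> real)"
  by (rule compactly_supported_integrable[OF continuous_mollifier compact_cball[of 0 \<delta>]])
    (auto intro!: mollifier_outside)

lemma integral_mollifier:
  "0 < \<delta> \<Longrightarrow> (LINT x|lborel. mollifier \<delta> (x::'a::euclidean_space)) = 1"
  using mollifier_mass_pos[of \<delta>, where 'a = 'a] by (simp add: mollifier_def[abs_def])

lemma nn_integral_mollifier:
  "0 < \<delta> \<Longrightarrow> (\<integral>\<^sup>+x. mollifier \<delta> (x::'a::euclidean_space) \<partial>lborel) = 1"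
  using nn_integral_eq_integral[OF integrable_mollifier[of \<delta>, where 'a = 'a]]
  by (simp add: mollifier_nonneg integral_mollifier)

lemma gradient_mollifier:
  fixes \<delta> :: real
  assumes "0 < \<delta>"
  shows "\<And>x::'a::euclidean_space. mollifier \<delta> differentiable (at x)"
    and "continuous_on UNIV (gradient_of (mollifier \<delta> :: 'a \<Rightarrow> real))"
    and "\<And>x::'a. x \<notin> cball 0 \<delta> \<Longrightarrow> gradient_of (mollifier \<delta>) x = 0"
    and "\<exists>B>0. \<forall>x::'a. norm (gradient_of (mollifier \<delta>) x) \<le> B"
proof -
  show "mollifier \<delta> differentiable (at x)" for x :: 'a using Ck_mollifier[of "Suc 0" \<delta>, where 'a = 'a] by simp
  show cont: "continuous_on UNIV (gradient_of (mollifier \<delta> :: 'a \<Rightarrow> real))"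
    by (rule continuous_on_gradient_of[OF Ck_mollifier])
  show out: "gradient_of (mollifier \<delta>) x = 0" if "x \<notin> cball 0 \<delta>" for x :: 'a
  proof (rule gradient_of_outside)
    have "closure {x::'a. mollifier \<delta> x \<noteq> 0} \<subseteq> cball 0 \<delta>"
      by (rule closure_minimal) (use mollifier_outside[OF assms, where 'a='a] in \<open>force simp: linear\<close>)+
    with that show "x \<notin> closure {x. mollifier \<delta> x \<noteq> 0}" by auto
  qed
  show "\<exists>B>0. \<forall>x::'a. norm (gradient_of (mollifier \<delta>) x) \<le> B"
    using compactly_supported_bounded[OF cont compact_cball[of "0::'a" \<delta>] out] by metis
qed

lemma mollifier_bounded:
  assumes "0 < \<delta>"
  obtains B where "0 < B" "\<And>x::'a::euclidean_space. \<bar>mollifier \<delta> x\<bar> \<le> B"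
  using compactly_supported_bounded[OF continuous_mollifier compact_cball[of "0::'a" \<delta>]]
    mollifier_outside[OF assms] by (metis less_eq_real_def linorder_not_le mem_cball_0 real_norm_def)

lemma integrable_scaleR_bounded_kernel:
  fixes f :: "'a::euclidean_space \<Rightarrow> 'b::{banach, second_countable_topology}" and K :: "'a \<Rightarrow> real"
  assumes "integrable lborel f" "K \<in> borel_measurable borel" "\<And>x. \<bar>K x\<bar> \<le> B"
  shows "integrable lborel (\<lambda>y. K y *\<^sub>R f y)"
proof (rule Bochner_Integration.integrable_bound)
  show "integrable lborel (\<lambda>y. B * norm (f y))" using assms by simp
  show "AE y in lborel. norm (K y *\<^sub>R f y) \<le> norm (B * norm (f y))"
    using assms(3) by (auto intro!: AE_I2 mult_right_mono simp: abs_mult order_trans[OF _ abs_ge_self])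
qed (use assms in \<open>auto dest: borel_measurable_integrable\<close>)

lemma integrable_conv_kernel:
  fixes f :: "'a::euclidean_space \<Rightarrow> 'b::{banach, second_countable_topology}"
  assumes "integrable lborel f" "0 < \<delta>"
  shows "integrable lborel (\<lambda>y. mollifier \<delta> (x - y) *\<^sub>R f y)"
proof -
  obtain B where "\<And>x::'a. \<bar>mollifier \<delta> x\<bar> \<le> B" using mollifier_bounded[OF assms(2)] by metis
  then show ?thesis by (intro integrable_scaleR_bounded_kernel[where B = B] assms) auto
qed

lemma conv_reflected:
  fixes f :: "'a::euclidean_space \<Rightarrow> 'b::{banach, second_countable_topology}"
  assumes [measurable]: "f \<in> borel_measurable borel" "\<rho> \<in> borel_measurable borel"
  shows "conv \<rho> f x = (LINT z|lborel. \<rho> z *\<^sub>R f (x - z))"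
  using integral_lborel_reflect[of "\<lambda>z. \<rho> z *\<^sub>R f (x - z)" x] by (simp add: conv_def)

lemma norm_integral_le_nn_integral:
  fixes f :: "'a \<Rightarrow> 'b::{banach, second_countable_topology}"
  shows "ennreal (norm (LINT x|M. f x)) \<le> (\<integral>\<^sup>+x. norm (f x) \<partial>M)"
proof (cases "integrable M f")
  case True then show ?thesis by (rule integral_norm_bound_ennreal)
qed (simp add: not_integrable_integral_eq)

text \<open>Averaging over translations by at most \<open>\<delta>\<close> moves \<open>f\<close> in \<open>L\<^sup>1\<close> no further than the
  translations themselves do.\<close>

lemma mollify_L1_close:
  fixes f :: "'a::euclidean_space \<Rightarrow> 'b::{banach, second_countable_topology}"
  assumes f: "integrable lborel f" and "0 < e"
  obtains d where "0 < d"
    "\<And>\<delta>. 0 < \<delta> \<Longrightarrow> \<delta> < d \<Longrightarrow> (\<integral>\<^sup>+x. norm (conv (mollifier \<delta>) f x - f x) \<partial>lborel) \<le> ennreal e"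
proof -
  have [measurable]: "f \<in> borel_measurable borel"
    using f by (auto dest: borel_measurable_integrable)
  obtain d where d: "0 < d"
    "\<And>z. z \<noteq> 0 \<Longrightarrow> norm z < d \<Longrightarrow> (LINT x|lborel. norm (f (x + z) - f x)) < e"
    using order_tendstoD(2)[OF L1_translation_at_0[OF f] \<open>0 < e\<close>]
    by (auto simp: eventually_at dist_norm)
  have close: "(\<integral>\<^sup>+x. norm (f (x - z) - f x) \<partial>lborel) \<le> e" if "norm z < d" for z
  proof -
    have "(\<integral>\<^sup>+x. norm (f (x - z) - f x) \<partial>lborel) = (LINT x|lborel. norm (f (x + - z) - f x))"
      using integrable_lborel_shift[OF f, of "- z"] f by (subst nn_integral_eq_integral) auto
    also have "\<dots> \<le> ennreal e"
    proof (cases "z = 0")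
      case False
      then show ?thesis using d(2)[of "- z"] that by (intro ennreal_leI) auto
    qed simp
    finally show ?thesis .
  qed
  show thesis
  proof
    show "0 < d" by fact
    fix \<delta> :: real assume "0 < \<delta>" "\<delta> < d"
    have "ennreal (norm (conv (mollifier \<delta>) f x - f x))
        \<le> (\<integral>\<^sup>+z. ennreal (mollifier \<delta> z) * ennreal (norm (f (x - z) - f x)) \<partial>lborel)" for x
    proof -
      have i: "integrable lborel (\<lambda>z. mollifier \<delta> z *\<^sub>R f (x - z))"
        using integrable_lborel_reflect[OF integrable_conv_kernel[OF f \<open>0 < \<delta>\<close>, of x], of x] by simp
      have "(LINT (z::'a)|lborel. mollifier \<delta> z *\<^sub>R f x) = f x"
        using integrable_mollifier[OF \<open>0 < \<delta>\<close>, where 'a = 'a] integral_mollifier[OF \<open>0 < \<delta>\<close>, where 'a = 'a]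
        by (subst integral_scaleR_left) auto
      then have "conv (mollifier \<delta>) f x - f x = (LINT z|lborel. mollifier \<delta> z *\<^sub>R f (x - z) - mollifier \<delta> z *\<^sub>R f x)"
        using i integrable_mollifier[OF \<open>0 < \<delta>\<close>, where 'a = 'a]
        by (subst Bochner_Integration.integral_diff) (auto simp: conv_reflected)
      also have "ennreal (norm \<dots>) \<le> (\<integral>\<^sup>+z. norm (mollifier \<delta> z *\<^sub>R f (x - z) - mollifier \<delta> z *\<^sub>R f x) \<partial>lborel)"
        by (rule norm_integral_le_nn_integral)
      also have "\<dots> = (\<integral>\<^sup>+z. ennreal (mollifier \<delta> z) * ennreal (norm (f (x - z) - f x)) \<partial>lborel)"
        by (intro nn_integral_cong)
          (auto simp: ennreal_mult'[symmetric] mollifier_nonneg[OF \<open>0 < \<delta>\<close>] simp flip: scaleR_diff_right)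
      finally show ?thesis .
    qed
    then have "(\<integral>\<^sup>+x. norm (conv (mollifier \<delta>) f x - f x) \<partial>lborel)
        \<le> (\<integral>\<^sup>+x. \<integral>\<^sup>+z. ennreal (mollifier \<delta> z) * ennreal (norm (f (x - z) - f x)) \<partial>lborel \<partial>lborel)"
      by (intro nn_integral_mono) auto
    also have "\<dots> = (\<integral>\<^sup>+z. \<integral>\<^sup>+x. ennreal (mollifier \<delta> z) * ennreal (norm (f (x - z) - f x)) \<partial>lborel \<partial>lborel)"
      by (subst lborel_pair.Fubini') auto
    also have "\<dots> \<le> (\<integral>\<^sup>+z. ennreal (mollifier \<delta> z) * ennreal e \<partial>(lborel::'a measure))"
    proof (intro nn_integral_mono)
      fix z :: 'a
      show "(\<integral>\<^sup>+x. ennreal (mollifier \<delta> z) * ennreal (norm (f (x - z) - f x)) \<partial>lborel)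
          \<le> ennreal (mollifier \<delta> z) * ennreal e"
      proof (cases "norm z < d")
        case True
        from close[OF this] show ?thesis by (subst nn_integral_cmult) (auto intro: mult_left_mono)
      next
        case False
        then show ?thesis using \<open>\<delta> < d\<close> \<open>0 < \<delta>\<close> by (simp add: mollifier_outside)
      qed
    qed
    also have "\<dots> = ennreal e"
      using nn_integral_mollifier[OF \<open>0 < \<delta>\<close>, where 'a = 'a] by (simp add: nn_integral_multc)
    finally show "(\<integral>\<^sup>+x. norm (conv (mollifier \<delta>) f x - f x) \<partial>lborel) \<le> ennreal e" .
  qed
qed

lemma borel_measurable_conv [measurable]:
  fixes f :: "'a::euclidean_space \<Rightarrow> 'b::{banach, second_countable_topology}"
  assumes [measurable]: "f \<in> borel_measurable borel"
  shows "conv (mollifier \<delta>) f \<in> borel_measurable borel"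
  unfolding conv_def[abs_def] by measurable

lemma mollify_L1:
  fixes f :: "'a::euclidean_space \<Rightarrow> 'b::{banach, second_countable_topology}"
  assumes f: "integrable lborel f" and \<delta>: "\<And>n. 0 < \<delta> n" "\<delta> \<longlonglongrightarrow> 0"
  shows "\<forall>\<^sub>F n in sequentially. integrable lborel (conv (mollifier (\<delta> n)) f)"
    and "(\<lambda>n. \<integral>\<^sup>+x. norm (conv (mollifier (\<delta> n)) f x - f x) \<partial>lborel) \<longlonglongrightarrow> 0"
proof -
  have [measurable]: "f \<in> borel_measurable borel"
    using f by (auto dest: borel_measurable_integrable)
  have ev: "\<forall>\<^sub>F n in sequentially. (\<integral>\<^sup>+x. norm (conv (mollifier (\<delta> n)) f x - f x) \<partial>lborel) \<le> ennreal e"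
    if "0 < e" for e
  proof -
    from mollify_L1_close[OF f that] obtain d where "0 < d"
      "\<And>\<delta>. 0 < \<delta> \<Longrightarrow> \<delta> < d \<Longrightarrow> (\<integral>\<^sup>+x. norm (conv (mollifier \<delta>) f x - f x) \<partial>lborel) \<le> ennreal e" by metis
    with order_tendstoD(2)[OF \<delta>(2), of d] \<delta>(1) show ?thesis
      by (auto elim: eventually_mono)
  qed
  show "(\<lambda>n. \<integral>\<^sup>+x. norm (conv (mollifier (\<delta> n)) f x - f x) \<partial>lborel) \<longlonglongrightarrow> 0"
  proof (rule order_tendstoI)
    fix e :: ennreal assume "0 < e"
    then obtain r where r: "0 < r" "ennreal r < e"
      by (metis ennreal_0 ennreal_less_iff ennreal_less_top dense ennreal_cases leI less_imp_le not_less_zero ennreal_zero_less_top order_less_irrefl le_less_trans ennreal_eq_0_iff)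
    from ev[OF r(1)] show "\<forall>\<^sub>F n in sequentially. (\<integral>\<^sup>+x. norm (conv (mollifier (\<delta> n)) f x - f x) \<partial>lborel) < e"
      by (rule eventually_mono) (use r in auto)
  qed auto
  from ev[OF zero_less_one] show "\<forall>\<^sub>F n in sequentially. integrable lborel (conv (mollifier (\<delta> n)) f)"
  proof eventually_elim
    case (elim n)
    have "integrable lborel (\<lambda>x. conv (mollifier (\<delta> n)) f x - f x)"
    proof (rule integrableI_bounded)
      show "(\<integral>\<^sup>+x. norm (conv (mollifier (\<delta> n)) f x - f x) \<partial>lborel) < \<infinity>"
        using elim by (rule le_less_trans) simp
    qed measurable
    from Bochner_Integration.integrable_add[OF this f] show ?case by simp
  qed
qed

lemma continuous_conv_kernel:
  fixes K :: "'a::euclidean_space \<Rightarrow> 'b::{banach, second_countable_topology}" and f :: "'a \<Rightarrow> real"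
  assumes f: "integrable lborel f"
    and K: "continuous_on UNIV K" "\<And>x. norm (K x) \<le> B"
  shows "continuous_on UNIV (\<lambda>x. LINT y|lborel. f y *\<^sub>R K (x - y))"
proof -
  have [measurable]: "K \<in> borel_measurable borel" "f \<in> borel_measurable borel"
    using f K by (auto intro: borel_measurable_continuous_onI dest: borel_measurable_integrable)
  have "(\<lambda>n. LINT y|lborel. f y *\<^sub>R K (X n - y)) \<longlonglongrightarrow> (LINT y|lborel. f y *\<^sub>R K (x - y))"
    if "X \<longlonglongrightarrow> x" for X x
  proof (rule integral_dominated_convergence[where w = "\<lambda>y. \<bar>f y\<bar> * B"])
    show "AE y in lborel. (\<lambda>n. f y *\<^sub>R K (X n - y)) \<longlonglongrightarrow> f y *\<^sub>R K (x - y)"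
      using K(1) that
      by (intro AE_I2 tendsto_intros continuous_on_tendsto_compose[OF K(1)]) auto
    show "AE y in lborel. norm (f y *\<^sub>R K (X n - y)) \<le> \<bar>f y\<bar> * B" for n
      using K(2) by (auto intro!: mult_left_mono)
  qed (use f in auto)
  then show ?thesis
    by (auto simp: continuous_on_sequentially comp_def)
qed

text \<open>Convolution with the mollifier may be differentiated under the integral sign: the first order
  remainder of the mollifier is small uniformly in the base point.\<close>

lemma conv_mollifier_has_derivative:
  fixes f :: "'a::euclidean_space \<Rightarrow> real"
  assumes f: "integrable lborel f" and "0 < \<delta>"
  shows "(conv (mollifier \<delta>) f has_derivative
      (\<lambda>v. (LINT y|lborel. f y *\<^sub>R gradient_of (mollifier \<delta>) (x - y)) \<bullet> v)) (at x)"
    and "continuous_on UNIV (\<lambda>x. LINT y|lborel. f y *\<^sub>R gradient_of (mollifier \<delta>) (x - y))"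
proof -
  let ?R = "gradient_of (mollifier \<delta> :: 'a \<Rightarrow> real)"
  note diff = gradient_mollifier(1)[OF \<open>0 < \<delta>\<close>, where 'a = 'a] and contR = gradient_mollifier(2)[OF \<open>0 < \<delta>\<close>, where 'a = 'a]
    and R0 = gradient_mollifier(3)[OF \<open>0 < \<delta>\<close>, where 'a = 'a]
  obtain B where B: "0 < B" "\<And>x. norm (?R x) \<le> B" using gradient_mollifier(4)[OF \<open>0 < \<delta>\<close>, where 'a = 'a] by blast
  have [measurable]: "?R \<in> borel_measurable borel" "f \<in> borel_measurable borel"
    using f contR by (auto intro: borel_measurable_continuous_onI dest: borel_measurable_integrable)
  show "continuous_on UNIV (\<lambda>x. LINT y|lborel. f y *\<^sub>R ?R (x - y))"
    by (rule continuous_conv_kernel[OF f contR B(2)])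
  have intR: "integrable lborel (\<lambda>y. f y *\<^sub>R ?R (x - y))" for x
  proof (rule Bochner_Integration.integrable_bound)
    show "integrable lborel (\<lambda>y. \<bar>f y\<bar> * B)" using f by simp
    show "AE y in lborel. norm (f y *\<^sub>R ?R (x - y)) \<le> norm (\<bar>f y\<bar> * B)"
      using B by (auto intro!: AE_I2 mult_left_mono simp: abs_mult)
  qed measurable
  have intM: "integrable lborel (\<lambda>y. mollifier \<delta> (x - y) * f y)" for x
    using integrable_conv_kernel[OF f \<open>0 < \<delta>\<close>] by simp
  have unif: "uniformly_continuous_on UNIV ?R"
    by (rule compactly_supported_uniformly_continuous[OF contR compact_cball R0])
  show "(conv (mollifier \<delta>) f has_derivative
      (\<lambda>v. (LINT y|lborel. f y *\<^sub>R ?R (x - y)) \<bullet> v)) (at x)"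
    unfolding has_derivative_at_alt
  proof (intro conjI allI impI)
    show "bounded_linear (\<lambda>v. (LINT y|lborel. f y *\<^sub>R ?R (x - y)) \<bullet> v)"
      by (rule bounded_linear_inner_right)
    fix e :: real assume "0 < e"
    define F where "F = (LINT y|lborel. \<bar>f y\<bar>)"
    have "0 \<le> F" by (simp add: F_def)
    define e' where "e' = e / (F + 1)"
    have "0 < e'" using \<open>0 < e\<close> \<open>0 \<le> F\<close> by (simp add: e'_def)
    then obtain d where d: "0 < d" "\<And>x y. norm (y - x) < d \<Longrightarrow> norm (?R y - ?R x) < e'"
      using unif unfolding uniformly_continuous_on_def dist_norm by (metis UNIV_I)
    have rem: "\<bar>mollifier \<delta> (a + v) - mollifier \<delta> a - ?R a \<bullet> v\<bar> \<le> norm v * e'" if "norm v < d" for a v :: 'a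
    proof -
      have "norm (mollifier \<delta> (a + v) - mollifier \<delta> a - ?R a \<bullet> ((a + v) - a)) \<le> norm ((a + v) - a) * e'"
      proof (rule differentiable_bound_linearization[where S = "ball a d" and f' = "\<lambda>x v. ?R x \<bullet> v"])
        show "a + t *\<^sub>R (a + v - a) \<in> ball a d" if "t \<in> {0..1}" for t
        proof -
          have "\<bar>t\<bar> * norm v \<le> 1 * norm v" using that by (intro mult_right_mono) auto
          with \<open>norm v < d\<close> show ?thesis by (simp add: dist_norm)
        qed
        show "(mollifier \<delta> has_derivative (\<lambda>v. ?R x \<bullet> v)) (at x within ball a d)" for x
          by (rule has_derivative_at_withinI[OF has_derivative_gradient_of[OF diff]])
        show "onorm ((\<lambda>v. ?R x \<bullet> v) - (\<lambda>v. ?R a \<bullet> v)) \<le> e'" if "x \<in> ball a d" for x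
        proof (rule onorm_bound)
          fix w
          have "norm (?R x - ?R a) \<le> e'"
            using d(2)[of x a] that by (simp add: dist_norm norm_minus_commute less_imp_le)
          then show "norm (((\<lambda>v. ?R x \<bullet> v) - (\<lambda>v. ?R a \<bullet> v)) w) \<le> e' * norm w"
            using Cauchy_Schwarz_ineq2[of "?R x - ?R a" w] mult_right_mono[of "norm (?R x - ?R a)" e' "norm w"]
            by (simp add: inner_diff_left)
        qed (use \<open>0 < e'\<close> in simp)
      qed (use d in auto)
      then show ?thesis by simp
    qed
    show "\<exists>d>0. \<forall>y. norm (y - x) < d \<longrightarrow> norm (conv (mollifier \<delta>) f y - conv (mollifier \<delta>) f x -
        (LINT y|lborel. f y *\<^sub>R ?R (x - y)) \<bullet> (y - x)) \<le> e * norm (y - x)"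
    proof (intro exI[of _ d] conjI allI impI)
      fix z assume z: "norm (z - x) < d"
      have i3: "integrable lborel (\<lambda>y. (f y *\<^sub>R ?R (x - y)) \<bullet> (z - x))"
        using intR by (rule integrable_inner_left)
      have "conv (mollifier \<delta>) f z - conv (mollifier \<delta>) f x - (LINT y|lborel. f y *\<^sub>R ?R (x - y)) \<bullet> (z - x)
          = (LINT y|lborel. mollifier \<delta> (z - y) * f y - mollifier \<delta> (x - y) * f y - (f y *\<^sub>R ?R (x - y)) \<bullet> (z - x))"
        using intM[of z] intM[of x] i3 integral_inner_left[OF intR, where c = "z - x", symmetric]
        by (simp only: conv_def real_scaleR_def Bochner_Integration.integral_diff
            Bochner_Integration.integrable_diff)
      also have "norm \<dots> \<le> (LINT y|lborel. \<bar>f y\<bar> * (norm (z - x) * e'))"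
      proof (rule order_trans[OF integral_norm_bound integral_mono])
        fix y
        have "mollifier \<delta> (z - y) * f y - mollifier \<delta> (x - y) * f y - (f y *\<^sub>R ?R (x - y)) \<bullet> (z - x)
            = f y * (mollifier \<delta> ((x - y) + (z - x)) - mollifier \<delta> (x - y) - ?R (x - y) \<bullet> (z - x))"
          by (simp add: algebra_simps)
        then show "norm (mollifier \<delta> (z - y) * f y - mollifier \<delta> (x - y) * f y - (f y *\<^sub>R ?R (x - y)) \<bullet> (z - x))
            \<le> \<bar>f y\<bar> * (norm (z - x) * e')"
          using rem[OF z, of "x - y"] by (simp only: real_norm_def abs_mult) (intro mult_left_mono; simp)
      qed (use intM i3 f in auto)
      also have "\<dots> = (F * e') * norm (z - x)" by (simp add: F_def)
      also have "\<dots> \<le> e * norm (z - x)"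
        using \<open>0 \<le> F\<close> \<open>0 < e\<close> by (intro mult_right_mono) (auto simp: e'_def field_simps)
      finally show "norm (conv (mollifier \<delta>) f z - conv (mollifier \<delta>) f x -
          (LINT y|lborel. f y *\<^sub>R ?R (x - y)) \<bullet> (z - x)) \<le> e * norm (z - x)" .
    qed (rule d(1))
  qed
qed


section \<open>Weak gradients\<close>

text \<open>A Sobolev function and its gradient are represented by Borel functions on the whole space, where
  Lebesgue measure is invariant under translations; only the test functions are confined to \<open>\<Omega>\<close>.\<close>

definition weak_pair :: "'a::euclidean_space set \<Rightarrow> ('a \<Rightarrow> real) \<Rightarrow> ('a \<Rightarrow> 'a) \<Rightarrow> bool" where
  "weak_pair \<Omega> U G \<longleftrightarrow> integrable lborel U \<and> integrable lborel G \<and>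
     (\<forall>\<phi>\<in>test_functions \<Omega>. \<forall>b\<in>Basis.
        (LINT x|lborel. U x * frechet_derivative \<phi> (at x) b) = - (LINT x|lborel. (G x \<bullet> b) * \<phi> x))"

text \<open>One sequence of widths serves two functions, in the applications a Sobolev function and its
  gradient.  Almost everywhere convergence is obtained by passing to a subsequence twice.\<close>

lemma mollify_subsequence:
  fixes f :: "'a::euclidean_space \<Rightarrow> 'b::{banach, second_countable_topology}"
    and g :: "'a \<Rightarrow> 'c::{banach, second_countable_topology}"
  assumes f: "integrable lborel f" and g: "integrable lborel g"
  obtains \<delta> :: "nat \<Rightarrow> real" where "\<And>n. 0 < \<delta> n" "\<delta> \<longlonglongrightarrow> 0"
    "\<And>n. integrable lborel (conv (mollifier (\<delta> n)) f)" "\<And>n. integrable lborel (conv (mollifier (\<delta> n)) g)"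
    "(\<lambda>n. LINT x|lborel. norm (conv (mollifier (\<delta> n)) f x - f x)) \<longlonglongrightarrow> 0"
    "(\<lambda>n. LINT x|lborel. norm (conv (mollifier (\<delta> n)) g x - g x)) \<longlonglongrightarrow> 0"
    "AE x in lborel. (\<lambda>n. conv (mollifier (\<delta> n)) f x) \<longlonglongrightarrow> f x"
    "AE x in lborel. (\<lambda>n. conv (mollifier (\<delta> n)) g x) \<longlonglongrightarrow> g x"
proof -
  define \<delta>0 :: "nat \<Rightarrow> real" where "\<delta>0 n = inverse (Suc n)" for n
  have \<delta>0: "\<And>n. 0 < \<delta>0 n" "\<delta>0 \<longlonglongrightarrow> 0"
    using LIMSEQ_inverse_real_of_nat by (auto simp: \<delta>0_def[abs_def] simp del: of_nat_Suc)
  have "\<forall>\<^sub>F n in sequentially. integrable lborel (conv (mollifier (\<delta>0 n)) f) \<and>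
      integrable lborel (conv (mollifier (\<delta>0 n)) g)"
    by (intro eventually_conj mollify_L1(1) f g \<delta>0)
  then obtain N where N: "\<And>n. N \<le> n \<Longrightarrow> integrable lborel (conv (mollifier (\<delta>0 n)) f) \<and>
      integrable lborel (conv (mollifier (\<delta>0 n)) g)"
    by (auto simp: eventually_sequentially)
  define \<delta>1 where "\<delta>1 n = \<delta>0 (n + N)" for n
  have \<delta>1: "\<And>n. 0 < \<delta>1 n" "\<delta>1 \<longlonglongrightarrow> 0"
    using \<delta>0 LIMSEQ_ignore_initial_segment[OF \<delta>0(2), of N] by (auto simp: \<delta>1_def[abs_def])
  have int: "integrable lborel (conv (mollifier (\<delta>1 n)) f)" "integrable lborel (conv (mollifier (\<delta>1 n)) g)" for n
    using N[of "n + N"] by (auto simp: \<delta>1_def)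
  have L1: "(\<lambda>n. LINT x|lborel. norm (conv (mollifier (\<delta> n)) h x - h x)) \<longlonglongrightarrow> 0"
    if "integrable lborel h" "\<And>n. integrable lborel (conv (mollifier (\<delta> n)) h)" "\<And>n. 0 < \<delta> n" "\<delta> \<longlonglongrightarrow> 0"
    for h :: "'a \<Rightarrow> 'd::{banach, second_countable_topology}" and \<delta> :: "nat \<Rightarrow> real"
  proof -
    have "(\<integral>\<^sup>+x. norm (conv (mollifier (\<delta> n)) h x - h x) \<partial>lborel)
        = ennreal (LINT x|lborel. norm (conv (mollifier (\<delta> n)) h x - h x))" for n
      using that by (intro nn_integral_eq_integral) auto
    with mollify_L1(2)[OF that(1,3,4)] show ?thesis
      by (simp add: tendsto_ennreal_iff flip: ennreal_0)
  qed
  obtain r where r: "strict_mono r" "AE x in lborel. (\<lambda>n. conv (mollifier (\<delta>1 (r n))) f x - f x) \<longlonglongrightarrow> 0"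
    using tendsto_L1_AE_subseq[of lborel "\<lambda>n x. conv (mollifier (\<delta>1 n)) f x - f x"] L1[OF f int(1) \<delta>1] f int(1)
    by auto
  have \<delta>2: "\<And>n. 0 < (\<delta>1 \<circ> r) n" "(\<delta>1 \<circ> r) \<longlonglongrightarrow> 0"
    using \<delta>1 LIMSEQ_subseq_LIMSEQ[OF \<delta>1(2) r(1)] by auto
  obtain s where s: "strict_mono s"
    "AE x in lborel. (\<lambda>n. conv (mollifier ((\<delta>1 \<circ> r) (s n))) g x - g x) \<longlonglongrightarrow> 0"
    using tendsto_L1_AE_subseq[of lborel "\<lambda>n x. conv (mollifier ((\<delta>1 \<circ> r) n)) g x - g x"] L1[OF g _ \<delta>2] g int(2)
    by auto
  define \<delta> where "\<delta> n = \<delta>1 (r (s n))" for n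
  have \<delta>: "\<And>n. 0 < \<delta> n" "\<delta> \<longlonglongrightarrow> 0"
    using \<delta>2 LIMSEQ_subseq_LIMSEQ[OF \<delta>2(2) s(1)] \<delta>1(1) by (auto simp: \<delta>_def[abs_def] comp_def)
  show thesis
  proof (rule that[OF \<delta>])
    show "AE x in lborel. (\<lambda>n. conv (mollifier (\<delta> n)) f x) \<longlonglongrightarrow> f x"
      using r(2)
    proof eventually_elim
      case (elim x)
      from LIMSEQ_subseq_LIMSEQ[OF elim s(1)] show ?case
        by (auto simp: \<delta>_def comp_def intro: LIM_zero_cancel)
    qed
    show "AE x in lborel. (\<lambda>n. conv (mollifier (\<delta> n)) g x) \<longlonglongrightarrow> g x"
      using s(2) by eventually_elim (auto simp: \<delta>_def comp_def intro: LIM_zero_cancel)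
    show "integrable lborel (conv (mollifier (\<delta> n)) f)" "integrable lborel (conv (mollifier (\<delta> n)) g)" for n
      using int by (auto simp: \<delta>_def)
    then show "(\<lambda>n. LINT x|lborel. norm (conv (mollifier (\<delta> n)) f x - f x)) \<longlonglongrightarrow> 0"
      "(\<lambda>n. LINT x|lborel. norm (conv (mollifier (\<delta> n)) g x - g x)) \<longlonglongrightarrow> 0"
      by (intro L1 f g \<delta>; simp)+
  qed
qed

lemma mollifier_shift_test_function:
  assumes "0 < \<delta>" "cball x \<delta> \<subseteq> \<Omega>"
  shows "(\<lambda>y. mollifier \<delta> (x - y)) \<in> test_functions \<Omega>"
proof -
  have "closure {y. mollifier \<delta> (x - y) \<noteq> 0} \<subseteq> cball x \<delta>"
    by (rule closure_minimal)
      (use mollifier_outside[OF assms(1), of "x - _"] in \<open>force simp: dist_norm linear\<close>)+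
  moreover from this have "compact (closure {y. mollifier \<delta> (x - y) \<noteq> 0})"
    by (meson bounded_subset bounded_cball compact_closure bounded_closure closure_closure compact_eq_bounded_closed closed_closure)
  ultimately show ?thesis
    using assms(2) by (auto simp: test_functions_def Ck_mollifier_shift)
qed

text \<open>Reflected translates of the mollifier are test functions as long as their support stays in \<open>\<Omega>\<close>;
  testing with them shows that mollification commutes with differentiation.\<close>

lemma weak_pair_conv_gradient:
  fixes U :: "'a::euclidean_space \<Rightarrow> real"
  assumes UG: "weak_pair \<Omega> U G" and "0 < \<delta>" "cball x \<delta> \<subseteq> \<Omega>"
  shows "(LINT y|lborel. U y *\<^sub>R gradient_of (mollifier \<delta>) (x - y)) = conv (mollifier \<delta>) G x"
proof (rule euclidean_eqI)
  fix b :: 'a assume b: "b \<in> Basis"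
  let ?R = "gradient_of (mollifier \<delta> :: 'a \<Rightarrow> real)"
  have U: "integrable lborel U" and G: "integrable lborel G" using UG by (auto simp: weak_pair_def)
  note diff = gradient_mollifier(1)[OF \<open>0 < \<delta>\<close>, where 'a = 'a] and contR = gradient_mollifier(2)[OF \<open>0 < \<delta>\<close>, where 'a = 'a]
  obtain B where B: "0 < B" "\<And>x. norm (?R x) \<le> B" using gradient_mollifier(4)[OF \<open>0 < \<delta>\<close>, where 'a = 'a] by blast
  have deriv: "frechet_derivative (\<lambda>y. mollifier \<delta> (x - y)) (at y) b = - (?R (x - y) \<bullet> b)" for y
  proof -
    have "((\<lambda>y. mollifier \<delta> (x - y)) has_derivative (\<lambda>v. ?R (x - y) \<bullet> (- v))) (at y)"
      by (rule has_derivative_compose[of "\<lambda>y. x - y" "\<lambda>v. - v" y UNIV "mollifier \<delta>", simplified])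
        (auto intro!: derivative_eq_intros has_derivative_gradient_of diff)
    from frechet_derivative_at[OF this] show ?thesis by (metis inner_minus_right)
  qed
  have [measurable]: "?R \<in> borel_measurable borel" "U \<in> borel_measurable borel"
    using U contR by (auto intro: borel_measurable_continuous_onI dest: borel_measurable_integrable)
  have intR: "integrable lborel (\<lambda>y. U y *\<^sub>R ?R (x - y))"
  proof (rule Bochner_Integration.integrable_bound)
    show "integrable lborel (\<lambda>y. \<bar>U y\<bar> * B)" using U by simp
    show "AE y in lborel. norm (U y *\<^sub>R ?R (x - y)) \<le> norm (\<bar>U y\<bar> * B)"
      using B by (auto intro!: AE_I2 mult_left_mono simp: abs_mult)
  qed measurable
  have "(LINT y|lborel. U y * - (?R (x - y) \<bullet> b)) = - (LINT y|lborel. (G y \<bullet> b) * mollifier \<delta> (x - y))"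
    using UG mollifier_shift_test_function[OF assms(2,3)] b unfolding weak_pair_def deriv[symmetric] by blast
  then have "(LINT y|lborel. (U y *\<^sub>R ?R (x - y)) \<bullet> b) = (LINT y|lborel. (mollifier \<delta> (x - y) *\<^sub>R G y) \<bullet> b)"
    by (simp add: mult.commute)
  then show "(LINT y|lborel. U y *\<^sub>R ?R (x - y)) \<bullet> b = conv (mollifier \<delta>) G x \<bullet> b"
    using integral_inner_left[OF intR, of b] integral_inner_left[where c = b, OF integrable_conv_kernel[where x = x, OF G \<open>0 < \<delta>\<close>]]
    by (simp only: conv_def)
qed

lemma eventually_cball_subset:
  assumes "open \<Omega>" "x \<in> \<Omega>" "\<delta> \<longlonglongrightarrow> (0::real)"
  shows "\<forall>\<^sub>F n in sequentially. cball x (\<delta> n) \<subseteq> \<Omega>"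
proof -
  obtain d where "0 < d" "cball x d \<subseteq> \<Omega>"
    using assms by (meson open_contains_cball)
  with order_tendstoD(2)[OF assms(3), of d] show ?thesis
    by (auto elim!: eventually_mono)
qed

text \<open>The mollification of a weak gradient at a point of \<open>\<Omega>\<close> is determined by \<open>U\<close> once the width is
  small, and it converges to the gradient almost everywhere.\<close>

lemma weak_gradient_unique:
  assumes "open \<Omega>" and 1: "weak_pair \<Omega> U G" and 2: "weak_pair \<Omega> U H"
  shows "AE x in lborel. x \<in> \<Omega> \<longrightarrow> G x = H x"
proof -
  have G: "integrable lborel G" and H: "integrable lborel H" using 1 2 by (auto simp: weak_pair_def)
  obtain \<delta> where \<delta>: "\<And>n. 0 < \<delta> n" "\<delta> \<longlonglongrightarrow> 0"
    "AE x in lborel. (\<lambda>n. conv (mollifier (\<delta> n)) G x) \<longlonglongrightarrow> G x"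
    "AE x in lborel. (\<lambda>n. conv (mollifier (\<delta> n)) H x) \<longlonglongrightarrow> H x"
    by (rule mollify_subsequence[OF G H]) blast
  from \<delta>(3,4) show ?thesis
  proof eventually_elim
    case (elim x)
    show ?case
    proof
      assume "x \<in> \<Omega>"
      from eventually_cball_subset[OF assms(1) this \<delta>(2)]
      have "\<forall>\<^sub>F n in sequentially. conv (mollifier (\<delta> n)) G x = conv (mollifier (\<delta> n)) H x"
        by eventually_elim (metis weak_pair_conv_gradient[OF 1] weak_pair_conv_gradient[OF 2] \<delta>(1))
      from Lim_transform_eventually[OF elim(1) this] elim(2) show "G x = H x"
        by (rule LIMSEQ_unique)
    qed
  qed
qed


section \<open>Integration by parts\<close>

lemma gradient_outside_support:
  fixes \<psi> :: "'a::euclidean_space \<Rightarrow> real"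
  assumes "\<And>x. (\<psi> has_derivative (\<lambda>v. D x \<bullet> v)) (at x)" "compact K" "\<And>x. x \<notin> K \<Longrightarrow> \<psi> x = 0" "x \<notin> K"
  shows "D x = 0"
proof -
  have "closure {x. \<psi> x \<noteq> 0} \<subseteq> K"
    using assms by (intro closure_minimal) (auto simp: compact_imp_closed)
  with assms(4) have "gradient_of \<psi> x = 0" by (intro gradient_of_outside) auto
  with gradient_of_eq[OF assms(1)] show ?thesis by simp
qed

text \<open>Difference quotients integrate to zero because Lebesgue measure is invariant under translations.
  They converge to the directional derivative and are bounded with a common compact support.\<close>

lemma integral_gradient_eq_0:
  fixes \<psi> :: "'a::euclidean_space \<Rightarrow> real"
  assumes \<psi>: "\<And>x. (\<psi> has_derivative (\<lambda>v. D x \<bullet> v)) (at x)" and D: "continuous_on UNIV D"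
    and K: "compact K" "\<And>x. x \<notin> K \<Longrightarrow> \<psi> x = 0"
  shows "(LINT x|lborel. D x \<bullet> b) = 0"
proof -
  have D0: "D x = 0" if "x \<notin> K" for x
    using gradient_outside_support[OF \<psi> K that] .
  obtain B where B: "0 < B" "\<And>x. norm (D x) \<le> B"
    using compactly_supported_bounded[OF D K(1) D0] by metis
  have cont: "continuous_on UNIV \<psi>"
    using \<psi> by (meson continuous_at_imp_continuous_on has_derivative_continuous)
  then have [measurable]: "\<psi> \<in> borel_measurable borel" "D \<in> borel_measurable borel"
    using D by (auto intro: borel_measurable_continuous_onI)
  have int: "integrable lborel \<psi>"
    by (rule compactly_supported_integrable[OF cont K])
  define t :: "nat \<Rightarrow> real" where "t n = inverse (Suc n)" for n
  have t: "0 < t n" "t n \<le> 1" for n by (auto simp: t_def field_simps)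
  have "t \<longlonglongrightarrow> 0" using LIMSEQ_inverse_real_of_nat by (simp add: t_def[abs_def] del: of_nat_Suc)
  \<comment> \<open>all difference quotients with steps \<open>t n \<le> 1\<close> vanish outside \<open>L\<close>\<close>
  define L where "L = (\<Union>x\<in>K. \<Union>y\<in>cball 0 (norm b). {x + y})"
  have "compact L" unfolding L_def using K by (intro compact_sums') auto
  have L: "x \<in> L" if "x \<in> K \<or> x + t n *\<^sub>R b \<in> K" for x n
  proof -
    have "x = x + 0" "x = (x + t n *\<^sub>R b) + (- (t n *\<^sub>R b))" "norm (- (t n *\<^sub>R b)) \<le> norm b"
      using t[of n] by (auto simp: mult_left_le_one_le)
    with that show ?thesis unfolding L_def by (metis (no_types, lifting) UN_iff mem_cball_0 singletonI norm_zero norm_ge_zero)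
  qed
  have "(\<lambda>n. LINT x|lborel. (\<psi> (x + t n *\<^sub>R b) - \<psi> x) / t n) \<longlonglongrightarrow> (LINT x|lborel. D x \<bullet> b)"
  proof (rule integral_dominated_convergence[where w = "\<lambda>x. (B * norm b) * indicator L x"])
    show "integrable lborel (\<lambda>x. (B * norm b) * indicator L x)"
      using emeasure_compact_finite[OF \<open>compact L\<close>] compact_imp_closed[OF \<open>compact L\<close>]
      by (intro integrable_mult_right) (auto simp: less_top)
    show "AE x in lborel. (\<lambda>n. (\<psi> (x + t n *\<^sub>R b) - \<psi> x) / t n) \<longlonglongrightarrow> D x \<bullet> b"
    proof (rule AE_I2)
      fix x
      have "((\<lambda>s. x + s *\<^sub>R b) has_derivative (\<lambda>s. s *\<^sub>R b)) (at 0)"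
        by (auto intro!: derivative_eq_intros)
      then have "((\<lambda>s. \<psi> (x + s *\<^sub>R b)) has_derivative (\<lambda>s. D x \<bullet> (s *\<^sub>R b))) (at 0)"
        using has_derivative_compose[of "\<lambda>s. x + s *\<^sub>R b" "\<lambda>s. s *\<^sub>R b" 0 UNIV \<psi> "\<lambda>v. D x \<bullet> v"] \<psi>[of x] by simp
      moreover have "(\<lambda>s. D x \<bullet> (s *\<^sub>R b)) = (*) (D x \<bullet> b)" by (auto simp: fun_eq_iff)
      ultimately have "((\<lambda>s. \<psi> (x + s *\<^sub>R b)) has_real_derivative D x \<bullet> b) (at 0)"
        by (simp only: has_field_derivative_def)
      then have "((\<lambda>s. (\<psi> (x + s *\<^sub>R b) - \<psi> x) / s) \<longlongrightarrow> D x \<bullet> b) (at 0)"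
        by (simp add: has_field_derivative_iff)
      then show "(\<lambda>n. (\<psi> (x + t n *\<^sub>R b) - \<psi> x) / t n) \<longlonglongrightarrow> D x \<bullet> b"
        using filterlim_compose[OF \<open>((\<lambda>s. (\<psi> (x + s *\<^sub>R b) - \<psi> x) / s) \<longlongrightarrow> D x \<bullet> b) (at 0)\<close>, of t sequentially]
          \<open>t \<longlonglongrightarrow> 0\<close> t(1) by (auto simp: filterlim_at less_imp_neq[symmetric])
    qed
    show "AE x in lborel. norm ((\<psi> (x + t n *\<^sub>R b) - \<psi> x) / t n) \<le> (B * norm b) * indicator L x" for n
    proof (rule AE_I2)
      fix x
      show "norm ((\<psi> (x + t n *\<^sub>R b) - \<psi> x) / t n) \<le> (B * norm b) * indicator L x"
      proof (cases "x \<in> L")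
        case True
        have "norm (\<psi> (x + t n *\<^sub>R b) - \<psi> x) \<le> B * norm ((x + t n *\<^sub>R b) - x)"
        proof (rule differentiable_bound[where S = UNIV and f' = "\<lambda>x v. D x \<bullet> v"])
          show "onorm (\<lambda>v. D x \<bullet> v) \<le> B" for x
          proof (rule onorm_bound)
            fix v show "norm (D x \<bullet> v) \<le> B * norm v"
              using Cauchy_Schwarz_ineq2[of "D x" v] mult_right_mono[OF B(2)[of x] norm_ge_zero[of v]] by simp
          qed (use B in simp)
        qed (use \<psi> in auto)
        with True t(1)[of n] show ?thesis by (simp add: field_simps)
      next
        case False
        with L[of x n] have "x \<notin> K" "x + t n *\<^sub>R b \<notin> K" by auto
        with K B(1) show ?thesis by simp
      qed
    qed
  qed measurable
  moreover have "(LINT x|lborel. (\<psi> (x + t n *\<^sub>R b) - \<psi> x) / t n) = 0" for n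
    using int integrable_lborel_shift[OF int, of "t n *\<^sub>R b"] integral_lborel_shift[of \<psi> "t n *\<^sub>R b"] by simp
  ultimately show ?thesis
    by (metis (no_types, lifting) LIMSEQ_unique ext tendsto_const)
qed

lemma test_functionsD:
  fixes \<phi> :: "'a::euclidean_space \<Rightarrow> real"
  assumes "\<phi> \<in> test_functions \<Omega>"
  shows "compact (closure {x. \<phi> x \<noteq> 0})" "closure {x. \<phi> x \<noteq> 0} \<subseteq> \<Omega>"
    "continuous_on UNIV \<phi>" "\<And>x. x \<notin> closure {x. \<phi> x \<noteq> 0} \<Longrightarrow> \<phi> x = 0"
    "\<And>x. (\<phi> has_derivative (\<lambda>v. gradient_of \<phi> x \<bullet> v)) (at x)"
    "continuous_on UNIV (gradient_of \<phi>)" "\<And>x. x \<notin> closure {x. \<phi> x \<noteq> 0} \<Longrightarrow> gradient_of \<phi> x = 0"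
    "\<And>x b. frechet_derivative \<phi> (at x) b = gradient_of \<phi> x \<bullet> b"
    "\<And>b. continuous_on UNIV (\<lambda>x. frechet_derivative \<phi> (at x) b)"
proof -
  have C: "Ck 0 \<phi>" "Ck (Suc 0) \<phi>" and K: "compact (closure {x. \<phi> x \<noteq> 0})" "closure {x. \<phi> x \<noteq> 0} \<subseteq> \<Omega>"
    using assms unfolding test_functions_def by blast+
  show "compact (closure {x. \<phi> x \<noteq> 0})" "closure {x. \<phi> x \<noteq> 0} \<subseteq> \<Omega>" by (fact K)+
  have d: "\<phi> differentiable (at x)" for x using C(2) by simp
  show "continuous_on UNIV \<phi>" using C(1) by simp
  show "\<phi> x = 0" if "x \<notin> closure {x. \<phi> x \<noteq> 0}" for x
    using that closure_subset[of "{x. \<phi> x \<noteq> 0}"] by auto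
  show "(\<phi> has_derivative (\<lambda>v. gradient_of \<phi> x \<bullet> v)) (at x)" for x by (rule has_derivative_gradient_of[OF d])
  show cg: "continuous_on UNIV (gradient_of \<phi>)" by (rule continuous_on_gradient_of[OF C(2)])
  show "gradient_of \<phi> x = 0" if "x \<notin> closure {x. \<phi> x \<noteq> 0}" for x using that by (rule gradient_of_outside)
  show fd: "frechet_derivative \<phi> (at x) b = gradient_of \<phi> x \<bullet> b" for x b by (rule gradient_of[OF d])
  show "continuous_on UNIV (\<lambda>x. frechet_derivative \<phi> (at x) b)" for b
    unfolding fd by (intro continuous_intros cg)
qed

lemma C1c_fieldsD:
  assumes "\<phi> \<in> C1c_fields \<Omega>"
  shows "continuous_on UNIV \<phi>" "\<And>x. x \<notin> closure {x. \<phi> x \<noteq> 0} \<Longrightarrow> \<phi> x = 0"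
    "compact (closure {x. \<phi> x \<noteq> 0})" "closure {x. \<phi> x \<noteq> 0} \<subseteq> \<Omega>"
    "\<And>b x. b \<in> Basis \<Longrightarrow> ((\<lambda>y. \<phi> y \<bullet> b) has_derivative (\<lambda>v. gradient_of (\<lambda>y. \<phi> y \<bullet> b) x \<bullet> v)) (at x)"
    "\<And>b. b \<in> Basis \<Longrightarrow> continuous_on UNIV (gradient_of (\<lambda>y. \<phi> y \<bullet> b))"
    "\<And>x. divergence \<phi> x = (\<Sum>b\<in>Basis. gradient_of (\<lambda>y. \<phi> y \<bullet> b) x \<bullet> b)"
proof -
  have C: "Ck (Suc 0) (\<lambda>y. \<phi> y \<bullet> b)" if "b \<in> Basis" for b
    using assms that by (auto simp: C1c_fields_def)
  show "continuous_on UNIV \<phi>"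
    using Ck_Suc_D[OF C] by (subst continuous_on_componentwise) auto
  show "\<And>x. x \<notin> closure {x. \<phi> x \<noteq> 0} \<Longrightarrow> \<phi> x = 0"
    using closure_subset[of "{x. \<phi> x \<noteq> 0}"] by auto
  show "compact (closure {x. \<phi> x \<noteq> 0})" "closure {x. \<phi> x \<noteq> 0} \<subseteq> \<Omega>"
    using assms by (auto simp: C1c_fields_def)
  show "((\<lambda>y. \<phi> y \<bullet> b) has_derivative (\<lambda>v. gradient_of (\<lambda>y. \<phi> y \<bullet> b) x \<bullet> v)) (at x)" if "b \<in> Basis" for b x
    using C[OF that] by (intro has_derivative_gradient_of) simp
  show "continuous_on UNIV (gradient_of (\<lambda>y. \<phi> y \<bullet> b))" if "b \<in> Basis" for b
    using continuous_on_gradient_of[OF C[OF that]] .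
  show "divergence \<phi> x = (\<Sum>b\<in>Basis. gradient_of (\<lambda>y. \<phi> y \<bullet> b) x \<bullet> b)" for x
    unfolding divergence_def using C by (intro sum.cong gradient_of) auto
qed

lemma divergence_props:
  assumes "\<phi> \<in> C1c_fields \<Omega>"
  shows "continuous_on UNIV (divergence \<phi>)" "\<And>x. x \<notin> closure {x. \<phi> x \<noteq> 0} \<Longrightarrow> divergence \<phi> x = 0"
    "integrable lborel (divergence \<phi>)"
proof -
  note \<phi> = C1c_fieldsD[OF assms]
  show c: "continuous_on UNIV (divergence \<phi>)"
    unfolding \<phi>(7)[abs_def] by (intro continuous_intros \<phi>)
  show z: "divergence \<phi> x = 0" if "x \<notin> closure {x. \<phi> x \<noteq> 0}" for x
    unfolding \<phi>(7)
  proof (rule sum.neutral, rule ballI)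
    fix b :: 'a assume b: "b \<in> Basis"
    have "gradient_of (\<lambda>y. \<phi> y \<bullet> b) x = 0"
      by (rule gradient_outside_support[OF \<phi>(5)[OF b] \<phi>(3) _ that]) (metis \<phi>(2) inner_zero_left)
    then show "gradient_of (\<lambda>y. \<phi> y \<bullet> b) x \<bullet> b = 0" by simp
  qed
  show "integrable lborel (divergence \<phi>)"
    by (rule compactly_supported_integrable[OF c \<phi>(3) z])
qed

lemma integration_by_parts:
  fixes v :: "'a::euclidean_space \<Rightarrow> real"
  assumes v: "\<And>x. (v has_derivative (\<lambda>w. D x \<bullet> w)) (at x)" and D: "continuous_on UNIV D"
    and \<phi>': "\<phi> \<in> C1c_fields \<Omega>"
  shows "(LINT x|lborel. v x * divergence \<phi> x) = - (LINT x|lborel. D x \<bullet> \<phi> x)"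
proof -
  note \<phi> = C1c_fieldsD[OF \<phi>']
  let ?K = "closure {x. \<phi> x \<noteq> 0}"
  have contv: "continuous_on UNIV v"
    using v by (meson continuous_at_imp_continuous_on has_derivative_continuous)
  \<comment> \<open>the gradient of \<open>v\<close> times the \<open>b\<close>-component of \<open>\<phi>\<close>; its \<open>b\<close>-components sum to the divergence of \<open>v \<phi>\<close>\<close>
  define E where "E b x = v x *\<^sub>R gradient_of (\<lambda>y. \<phi> y \<bullet> b) x + (\<phi> x \<bullet> b) *\<^sub>R D x" for b x
  have E0: "(LINT x|lborel. E b x \<bullet> b) = 0" and Ei: "integrable lborel (\<lambda>x. E b x \<bullet> b)" if b: "b \<in> Basis" for b
  proof -
    have der: "((\<lambda>x. v x * (\<phi> x \<bullet> b)) has_derivative (\<lambda>w. E b x \<bullet> w)) (at x)" for x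
      using has_derivative_mult[OF v[of x] \<phi>(5)[OF b, of x]] by (simp add: E_def inner_simps algebra_simps)
    have cont: "continuous_on UNIV (E b)"
      unfolding E_def by (intro continuous_intros contv D \<phi>(1) \<phi>(6)[OF b])
    have out: "v x * (\<phi> x \<bullet> b) = 0" if "x \<notin> ?K" for x using \<phi>(2)[OF that] by simp
    show "(LINT x|lborel. E b x \<bullet> b) = 0"
      by (rule integral_gradient_eq_0[OF der cont \<phi>(3) out])
    show "integrable lborel (\<lambda>x. E b x \<bullet> b)"
      by (intro integrable_inner_left compactly_supported_integrable[OF cont \<phi>(3)]
          gradient_outside_support[OF der \<phi>(3) out])
  qed
  have "(\<Sum>b\<in>Basis. E b x \<bullet> b) = v x * divergence \<phi> x + D x \<bullet> \<phi> x" for x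
  proof -
    have "(\<Sum>b\<in>Basis. (\<phi> x \<bullet> b) * (D x \<bullet> b)) = D x \<bullet> \<phi> x"
      by (subst euclidean_inner[of "D x"]) (simp add: mult.commute)
    then show ?thesis
      by (simp add: E_def inner_simps sum.distrib \<phi>(7) sum_distrib_left)
  qed
  then have "(LINT x|lborel. v x * divergence \<phi> x + D x \<bullet> \<phi> x) = (LINT x|lborel. (\<Sum>b\<in>Basis. E b x \<bullet> b))"
    by simp
  also have "\<dots> = 0" using E0 Ei by (subst Bochner_Integration.integral_sum) auto
  finally have "(LINT x|lborel. v x * divergence \<phi> x + D x \<bullet> \<phi> x) = 0" .
  moreover have "integrable lborel (\<lambda>x. v x * divergence \<phi> x)"
    by (rule compactly_supported_integrable[OF _ \<phi>(3)])
      (auto intro!: continuous_intros contv divergence_props[OF \<phi>'])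
  moreover have "integrable lborel (\<lambda>x. D x \<bullet> \<phi> x)"
    by (rule compactly_supported_integrable[OF _ \<phi>(3)])
      (auto intro!: continuous_intros D \<phi>(1) dest: \<phi>(2))
  ultimately show ?thesis by simp
qed

lemma integral_divergence_eq_0:
  assumes "\<phi> \<in> C1c_fields \<Omega>" shows "(LINT x|lborel. divergence \<phi> x) = 0"
  using integration_by_parts[of "\<lambda>x. 1" "\<lambda>x. 0" \<phi> \<Omega>] assms by simp

text \<open>For mollified functions this is integration by parts.  In the limit, \<open>\<eta>\<close> and \<open>\<eta>'\<close> are bounded and
  converge almost everywhere, while the gradients converge in \<open>L\<^sup>1\<close>.\<close>

lemma weak_chain_rule:
  fixes U :: "'a::euclidean_space \<Rightarrow> real"
  assumes "open \<Omega>" and UG: "weak_pair \<Omega> U G" and \<phi>': "\<phi> \<in> C1c_fields \<Omega>"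
    and \<eta>: "\<And>s. (\<eta> has_real_derivative \<eta>' s) (at s)" and \<eta>': "continuous_on UNIV \<eta>'"
    and bound: "\<And>s. \<bar>\<eta> s\<bar> \<le> B" "\<And>s. \<bar>\<eta>' s\<bar> \<le> B"
  shows "(LINT x|lborel. \<eta> (U x) * divergence \<phi> x) = - (LINT x|lborel. \<eta>' (U x) * (G x \<bullet> \<phi> x))"
proof -
  note \<phi> = C1c_fieldsD[OF \<phi>'] and div = divergence_props[OF \<phi>']
  let ?K = "closure {x. \<phi> x \<noteq> 0}"
  have U: "integrable lborel U" and G: "integrable lborel G" using UG by (auto simp: weak_pair_def)
  obtain \<delta> where \<delta>: "\<And>n. 0 < \<delta> n" "\<delta> \<longlonglongrightarrow> 0"
    and intU: "\<And>n. integrable lborel (conv (mollifier (\<delta> n)) U)"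
    and intG: "\<And>n. integrable lborel (conv (mollifier (\<delta> n)) G)"
    and LG: "(\<lambda>n. LINT x|lborel. norm (conv (mollifier (\<delta> n)) G x - G x)) \<longlonglongrightarrow> 0"
    and AEU: "AE x in lborel. (\<lambda>n. conv (mollifier (\<delta> n)) U x) \<longlonglongrightarrow> U x"
    by (rule mollify_subsequence[OF U G]) blast
  define V where "V n = conv (mollifier (\<delta> n)) U" for n
  define H where "H n = conv (mollifier (\<delta> n)) G" for n
  have cont\<eta>: "continuous_on UNIV \<eta>"
    using \<eta> by (meson DERIV_isCont continuous_at_imp_continuous_on)
  have [measurable]: "U \<in> borel_measurable borel" "G \<in> borel_measurable borel" "\<eta> \<in> borel_measurable borel"
    "\<eta>' \<in> borel_measurable borel" "\<phi> \<in> borel_measurable borel" "divergence \<phi> \<in> borel_measurable borel"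
    using U G cont\<eta> \<eta>' \<phi>(1) div(1) by (auto intro: borel_measurable_continuous_onI dest: borel_measurable_integrable)
  have [measurable]: "V n \<in> borel_measurable borel" "H n \<in> borel_measurable borel" for n
    unfolding V_def H_def by measurable
  obtain F where F: "0 < F" "\<And>x. norm (\<phi> x) \<le> F"
    using compactly_supported_bounded[OF \<phi>(1) \<phi>(3) \<phi>(2)] by metis
  have "0 \<le> B" using bound(1)[of 0] by linarith
  \<comment> \<open>for widths below \<open>d\<close> the mollified gradient is the gradient of the mollified function on the support of \<open>\<phi>\<close>\<close>
  obtain d where d: "0 < d" "\<And>x. x \<in> ?K \<Longrightarrow> cball x d \<subseteq> \<Omega>"
    using compact_subset_open_imp_cball_epsilon_subset[OF \<phi>(3) assms(1) \<phi>(4)] by (metis UN_subset_iff)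
  have parts: "\<forall>\<^sub>F n in sequentially. (LINT x|lborel. \<eta> (V n x) * divergence \<phi> x)
      = - (LINT x|lborel. \<eta>' (V n x) * (H n x \<bullet> \<phi> x))"
    using order_tendstoD(2)[OF \<delta>(2) d(1)]
  proof eventually_elim
    case (elim n)
    let ?D = "\<lambda>x. LINT y|lborel. U y *\<^sub>R gradient_of (mollifier (\<delta> n)) (x - y)"
    note VD = conv_mollifier_has_derivative[OF U \<delta>(1)[of n], folded V_def]
    have "(LINT x|lborel. \<eta> (V n x) * divergence \<phi> x)
        = - (LINT x|lborel. (\<eta>' (V n x) *\<^sub>R ?D x) \<bullet> \<phi> x)"
    proof (rule integration_by_parts[OF _ _ \<phi>'])
      show "((\<lambda>x. \<eta> (V n x)) has_derivative (\<lambda>w. (\<eta>' (V n x) *\<^sub>R ?D x) \<bullet> w)) (at x)" for x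
        using DERIV_compose_FDERIV[OF \<eta>[of "V n x"] VD(1)[of x]] by (simp add: mult.commute)
      have "continuous_on UNIV (V n)"
        using VD(1) by (meson continuous_at_imp_continuous_on has_derivative_continuous)
      then show "continuous_on UNIV (\<lambda>x. \<eta>' (V n x) *\<^sub>R ?D x)"
        by (intro continuous_intros VD(2) continuous_on_compose2[OF \<eta>']) auto
    qed
    also have "(\<lambda>x. (\<eta>' (V n x) *\<^sub>R ?D x) \<bullet> \<phi> x) = (\<lambda>x. \<eta>' (V n x) * (H n x \<bullet> \<phi> x))"
    proof
      fix x
      show "(\<eta>' (V n x) *\<^sub>R ?D x) \<bullet> \<phi> x = \<eta>' (V n x) * (H n x \<bullet> \<phi> x)"
      proof (cases "x \<in> ?K")
        case True
        with d(2)[of x] elim have "cball x (\<delta> n) \<subseteq> \<Omega>" by auto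
        from weak_pair_conv_gradient[OF UG \<delta>(1) this] show ?thesis by (simp add: H_def)
      next
        case False
        from \<phi>(2)[OF this] show ?thesis by simp
      qed
    qed
    finally show ?case .
  qed
  have lim1: "(\<lambda>n. LINT x|lborel. \<eta> (V n x) * divergence \<phi> x) \<longlonglongrightarrow> (LINT x|lborel. \<eta> (U x) * divergence \<phi> x)"
  proof (rule integral_dominated_convergence[where w = "\<lambda>x. B * \<bar>divergence \<phi> x\<bar>"])
    show "AE x in lborel. (\<lambda>n. \<eta> (V n x) * divergence \<phi> x) \<longlonglongrightarrow> \<eta> (U x) * divergence \<phi> x"
      using AEU by eventually_elim
        (auto simp: V_def intro!: tendsto_intros continuous_on_tendsto_compose[OF cont\<eta>])
    show "AE x in lborel. norm (\<eta> (V n x) * divergence \<phi> x) \<le> B * \<bar>divergence \<phi> x\<bar>" for n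
      using bound(1) by (auto intro!: mult_right_mono simp: abs_mult)
  qed (use div(3) in auto)
  \<comment> \<open>the gradient is split into \<open>G\<close>, treated by dominated convergence, and \<open>H n - G\<close>, which is small in \<open>L\<^sup>1\<close>\<close>
  have lim2: "(\<lambda>n. LINT x|lborel. \<eta>' (V n x) * (G x \<bullet> \<phi> x)) \<longlonglongrightarrow> (LINT x|lborel. \<eta>' (U x) * (G x \<bullet> \<phi> x))"
  proof (rule integral_dominated_convergence[where w = "\<lambda>x. B * (norm (G x) * F)"])
    show "AE x in lborel. (\<lambda>n. \<eta>' (V n x) * (G x \<bullet> \<phi> x)) \<longlonglongrightarrow> \<eta>' (U x) * (G x \<bullet> \<phi> x)"
      using AEU by eventually_elim
        (auto simp: V_def intro!: tendsto_intros continuous_on_tendsto_compose[OF \<eta>'])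
    show "AE x in lborel. norm (\<eta>' (V n x) * (G x \<bullet> \<phi> x)) \<le> B * (norm (G x) * F)" for n
    proof (rule AE_I2)
      fix x
      have "\<bar>G x \<bullet> \<phi> x\<bar> \<le> norm (G x) * F"
        using Cauchy_Schwarz_ineq2[of "G x" "\<phi> x"] mult_left_mono[OF F(2)[of x] norm_ge_zero[of "G x"]] by simp
      then show "norm (\<eta>' (V n x) * (G x \<bullet> \<phi> x)) \<le> B * (norm (G x) * F)"
        unfolding real_norm_def abs_mult by (intro mult_mono bound) (use \<open>0 \<le> B\<close> in auto)
    qed
  qed (use G in auto)
  have bnd: "\<bar>\<eta>' s * (w \<bullet> \<phi> x)\<bar> \<le> (B * F) * norm w" for s w x
  proof -
    have "\<bar>w \<bullet> \<phi> x\<bar> \<le> norm w * F"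
      using Cauchy_Schwarz_ineq2[of w "\<phi> x"] mult_left_mono[OF F(2)[of x] norm_ge_zero[of w]] by simp
    then have "\<bar>\<eta>' s\<bar> * \<bar>w \<bullet> \<phi> x\<bar> \<le> B * (norm w * F)"
      by (intro mult_mono bound) (use \<open>0 \<le> B\<close> in auto)
    then show ?thesis by (simp add: abs_mult mult_ac)
  qed
  have intHG: "integrable lborel (\<lambda>x. \<eta>' (V n x) * (w x \<bullet> \<phi> x))" if "integrable lborel w" for n w
  proof (rule Bochner_Integration.integrable_bound)
    show "integrable lborel (\<lambda>x. (B * F) * norm (w x))" using that by simp
    show "AE x in lborel. norm (\<eta>' (V n x) * (w x \<bullet> \<phi> x)) \<le> norm ((B * F) * norm (w x))"
      using bnd by (auto intro!: AE_I2 order_trans[OF _ abs_ge_self])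
  qed (use that in \<open>auto dest: borel_measurable_integrable\<close>)
  have lim3: "(\<lambda>n. LINT x|lborel. \<eta>' (V n x) * ((H n x - G x) \<bullet> \<phi> x)) \<longlonglongrightarrow> 0"
  proof (rule Lim_null_comparison[OF always_eventually])
    show "\<forall>n. norm (LINT x|lborel. \<eta>' (V n x) * ((H n x - G x) \<bullet> \<phi> x))
        \<le> (B * F) * (LINT x|lborel. norm (H n x - G x))"
    proof
      fix n
      have i: "integrable lborel (\<lambda>x. H n x - G x)" using intG G by (simp add: H_def)
      show "norm (LINT x|lborel. \<eta>' (V n x) * ((H n x - G x) \<bullet> \<phi> x)) \<le> (B * F) * (LINT x|lborel. norm (H n x - G x))"
        unfolding integral_mult_right_zero[symmetric]
        by (rule order_trans[OF integral_norm_bound integral_mono]) (use i intHG[OF i] bnd in auto)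
    qed
    show "(\<lambda>n. (B * F) * (LINT x|lborel. norm (H n x - G x))) \<longlonglongrightarrow> 0"
      using tendsto_mult_right_zero[OF LG, of "B * F"] by (simp add: H_def)
  qed
  have "(\<lambda>n. - (LINT x|lborel. \<eta>' (V n x) * (H n x \<bullet> \<phi> x)))
      \<longlonglongrightarrow> - ((LINT x|lborel. \<eta>' (U x) * (G x \<bullet> \<phi> x)) + 0)"
  proof -
    have "(LINT x|lborel. \<eta>' (V n x) * (H n x \<bullet> \<phi> x)) = (LINT x|lborel. \<eta>' (V n x) * (G x \<bullet> \<phi> x))
        + (LINT x|lborel. \<eta>' (V n x) * ((H n x - G x) \<bullet> \<phi> x))" for n
    proof -
      have "integrable lborel (\<lambda>x. H n x - G x)" using intG G by (simp add: H_def)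
      from intHG[OF G, of n] intHG[OF this, of n] show ?thesis
        by (subst Bochner_Integration.integral_add[symmetric]) (auto simp: algebra_simps inner_diff_left)
    qed
    then show ?thesis using tendsto_minus[OF tendsto_add[OF lim2 lim3]] by simp
  qed
  from LIMSEQ_unique[OF Lim_transform_eventually[OF lim1 parts] this] show ?thesis by simp
qed


section \<open>Borel representatives of Sobolev functions\<close>

lemma AE_lebesgue_on_iff:
  assumes "\<Omega> \<in> sets borel"
  shows "(AE x in lebesgue_on \<Omega>. P x) \<longleftrightarrow> (AE x in lborel. x \<in> \<Omega> \<longrightarrow> P x)"
proof -
  have "\<Omega> \<inter> space lebesgue \<in> sets lebesgue" using assms by simp
  from AE_restrict_space_iff[OF this] show ?thesis by (simp add: AE_completion_iff)
qed

lemma nn_integral_lebesgue_on: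
  assumes "\<Omega> \<in> sets borel"
  shows "(\<integral>\<^sup>+x. f x \<partial>lebesgue_on \<Omega>) = (\<integral>\<^sup>+x. f x * indicator \<Omega> x \<partial>lborel)"
  using assms by (simp add: nn_integral_restrict_space nn_integral_completion)

lemma borel_measurable_lebesgue_onI: "f \<in> borel_measurable borel \<Longrightarrow> f \<in> borel_measurable (lebesgue_on \<Omega>)"
  by (intro measurable_restrict_space1 measurable_completion) simp

text \<open>Integrals of Lebesgue measurable functions over \<open>\<Omega>\<close> are traded for integrals of Borel functions
  over the whole space, to which translations and Tonelli's theorem apply.\<close>

lemma lebesgue_on_borel_representative:
  fixes f F :: "'a::euclidean_space \<Rightarrow> 'b::{banach, second_countable_topology}"
  assumes \<Omega>: "\<Omega> \<in> sets borel" and f: "f \<in> borel_measurable (lebesgue_on \<Omega>)"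
    and F: "F \<in> borel_measurable borel"
    and eq: "AE x in lborel. x \<in> \<Omega> \<longrightarrow> F x = f x" and out: "\<And>x. x \<notin> \<Omega> \<Longrightarrow> F x = 0"
  shows "integrable (lebesgue_on \<Omega>) f \<longleftrightarrow> integrable lborel F"
    and "(LINT x|lebesgue_on \<Omega>. f x) = (LINT x|lborel. F x)"
proof -
  have F': "F \<in> borel_measurable (lebesgue_on \<Omega>)" using F by (rule borel_measurable_lebesgue_onI)
  have AE: "AE x in lebesgue_on \<Omega>. f x = F x"
    using eq by (auto simp: AE_lebesgue_on_iff[OF \<Omega>] elim!: eventually_mono)
  have ind: "(\<lambda>x. indicator \<Omega> x *\<^sub>R F x) = F" using out by (auto simp: indicator_def)
  have [simp]: "\<Omega> \<in> sets lebesgue" using \<Omega> by simp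
  have F'': "F \<in> lborel \<rightarrow>\<^sub>M borel" using F by simp
  have "integrable (lebesgue_on \<Omega>) f \<longleftrightarrow> integrable (lebesgue_on \<Omega>) F"
    by (rule integrable_cong_AE[OF f F' AE])
  also have "\<dots> \<longleftrightarrow> integrable lborel F"
    by (subst integrable_restrict_space) (auto simp: ind integrable_completion[OF F''])
  finally show "integrable (lebesgue_on \<Omega>) f \<longleftrightarrow> integrable lborel F" .
  have "(LINT x|lebesgue_on \<Omega>. f x) = (LINT x|lebesgue_on \<Omega>. F x)"
    by (rule integral_cong_AE[OF f F' AE])
  also have "\<dots> = (LINT x|lborel. F x)"
    by (subst integral_restrict_space) (auto simp: ind integral_completion[OF F''])
  finally show "(LINT x|lebesgue_on \<Omega>. f x) = (LINT x|lborel. F x)" .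
qed

lemma borel_representative_real:
  fixes f :: "'a::euclidean_space \<Rightarrow> real"
  assumes \<Omega>: "\<Omega> \<in> sets borel" and f: "f \<in> borel_measurable (lebesgue_on \<Omega>)"
  obtains F where "F \<in> borel_measurable borel" "AE x in lborel. x \<in> \<Omega> \<longrightarrow> F x = f x"
    "\<And>x. x \<notin> \<Omega> \<Longrightarrow> F x = 0"
proof -
  have "(\<lambda>x. indicator \<Omega> x *\<^sub>R f x) \<in> borel_measurable lebesgue"
    using borel_measurable_restrict_space_iff[of \<Omega> lebesgue f] \<Omega> f by simp
  from completion_ex_borel_measurable_real[OF this[simplified]] obtain F where F: "F \<in> borel_measurable borel"
    "AE x in lborel. indicator \<Omega> x * f x = F x" by auto
  show thesis
  proof (rule that[of "\<lambda>x. indicator \<Omega> x * F x"])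
    show "(\<lambda>x. indicator \<Omega> x * F x) \<in> borel_measurable borel" using F \<Omega> by simp
    show "AE x in lborel. x \<in> \<Omega> \<longrightarrow> indicator \<Omega> x * F x = f x"
      using F(2) by (auto elim!: eventually_mono)
  qed auto
qed

lemma borel_representative:
  fixes f :: "'a::euclidean_space \<Rightarrow> 'b::euclidean_space"
  assumes \<Omega>: "\<Omega> \<in> sets borel" and f: "f \<in> borel_measurable (lebesgue_on \<Omega>)"
  obtains F where "F \<in> borel_measurable borel" "AE x in lborel. x \<in> \<Omega> \<longrightarrow> F x = f x"
    "\<And>x. x \<notin> \<Omega> \<Longrightarrow> F x = 0"
proof -
  have "\<exists>F. F \<in> borel_measurable borel \<and> (AE x in lborel. x \<in> \<Omega> \<longrightarrow> F x = f x \<bullet> b) \<and> (\<forall>x. x \<notin> \<Omega> \<longrightarrow> F x = 0)" for b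
  proof -
    have "(\<lambda>x. f x \<bullet> b) \<in> borel_measurable (lebesgue_on \<Omega>)" using f by simp
    from borel_representative_real[OF \<Omega> this] show ?thesis by blast
  qed
  then obtain F where F: "\<And>b. F b \<in> borel_measurable borel" "\<And>b. AE x in lborel. x \<in> \<Omega> \<longrightarrow> F b x = f x \<bullet> b"
    "\<And>b x. x \<notin> \<Omega> \<Longrightarrow> F b x = 0" by metis
  have "AE x in lborel. \<forall>b\<in>Basis. x \<in> \<Omega> \<longrightarrow> F b x = f x \<bullet> b"
    by (intro AE_finite_allI F) simp
  then have "AE x in lborel. x \<in> \<Omega> \<longrightarrow> (\<Sum>b\<in>Basis. F b x *\<^sub>R b) = f x"
    by eventually_elim (auto simp: euclidean_representation)
  with F show thesis by (intro that[of "\<lambda>x. \<Sum>b\<in>Basis. F b x *\<^sub>R b"]) auto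
qed

lemma integrable_of_square:
  fixes F :: "'a::euclidean_space \<Rightarrow> 'b::euclidean_space"
  assumes [measurable]: "F \<in> borel_measurable borel" and "integrable lborel (\<lambda>x. (norm (F x))\<^sup>2)"
    and [measurable]: "\<Omega> \<in> sets borel" and "emeasure lborel \<Omega> < \<infinity>" "\<And>x. x \<notin> \<Omega> \<Longrightarrow> F x = 0"
  shows "integrable lborel F"
proof (rule Bochner_Integration.integrable_bound)
  show "integrable lborel (\<lambda>x. indicator \<Omega> x + (norm (F x))\<^sup>2)"
    using assms by (intro Bochner_Integration.integrable_add) auto
  show "AE x in lborel. norm (F x) \<le> norm (indicator \<Omega> x + (norm (F x))\<^sup>2)"
  proof (rule AE_I2)
    fix x
    have "2 * norm (F x) \<le> 1 + (norm (F x))\<^sup>2" "0 \<le> norm (F x)"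
      using sum_squares_bound[of 1 "norm (F x)"] by simp_all
    then have "norm (F x) \<le> 1 + (norm (F x))\<^sup>2" by linarith
    with assms(5)[of x] show "norm (F x) \<le> norm (indicator \<Omega> x + (norm (F x))\<^sup>2)"
      by (cases "x \<in> \<Omega>") auto
  qed
qed measurable

lemma Sobolev_representative:
  fixes u :: "'a::euclidean_space \<Rightarrow> real"
  assumes \<Omega>: "open \<Omega>" "emeasure lborel \<Omega> < \<infinity>" and u: "u \<in> L2 \<Omega>" and g: "is_weak_gradient \<Omega> u g"
  obtains U G where "weak_pair \<Omega> U G" "U \<in> borel_measurable borel" "G \<in> borel_measurable borel"
    "AE x in lborel. x \<in> \<Omega> \<longrightarrow> U x = u x" "AE x in lborel. x \<in> \<Omega> \<longrightarrow> G x = g x"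
    "\<And>x. x \<notin> \<Omega> \<Longrightarrow> U x = 0" "\<And>x. x \<notin> \<Omega> \<Longrightarrow> G x = 0"
    "integrable lborel (\<lambda>x. (U x)\<^sup>2)" "integrable lborel (\<lambda>x. (norm (G x))\<^sup>2)"
proof -
  have b: "\<Omega> \<in> sets borel" using \<Omega> by simp
  have um: "u \<in> borel_measurable (lebesgue_on \<Omega>)" "integrable (lebesgue_on \<Omega>) (\<lambda>x. (u x)\<^sup>2)"
    using u by (auto simp: L2_def)
  have gm: "g \<in> borel_measurable (lebesgue_on \<Omega>)" "integrable (lebesgue_on \<Omega>) (\<lambda>x. (norm (g x))\<^sup>2)"
    and weak: "\<And>\<phi> b. \<phi> \<in> test_functions \<Omega> \<Longrightarrow> b \<in> Basis \<Longrightarrow>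
        (LINT x|lebesgue_on \<Omega>. u x * frechet_derivative \<phi> (at x) b) = - (LINT x|lebesgue_on \<Omega>. (g x \<bullet> b) * \<phi> x)"
    using g by (auto simp: is_weak_gradient_def)
  obtain U where U: "U \<in> borel_measurable borel" "AE x in lborel. x \<in> \<Omega> \<longrightarrow> U x = u x" "\<And>x. x \<notin> \<Omega> \<Longrightarrow> U x = 0"
    using borel_representative_real[OF b um(1)] by metis
  obtain G where G: "G \<in> borel_measurable borel" "AE x in lborel. x \<in> \<Omega> \<longrightarrow> G x = g x" "\<And>x. x \<notin> \<Omega> \<Longrightarrow> G x = 0"
    using borel_representative[OF b gm(1)] by metis
  note [measurable] = U(1) G(1) um(1) gm(1)
  have U2: "integrable lborel (\<lambda>x. (U x)\<^sup>2)"
    by (subst lebesgue_on_borel_representative(1)[OF b, symmetric, where f = "\<lambda>x. (u x)\<^sup>2"])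
      (use U(2,3) um(2) in auto)
  have G2: "integrable lborel (\<lambda>x. (norm (G x))\<^sup>2)"
    by (subst lebesgue_on_borel_representative(1)[OF b, symmetric, where f = "\<lambda>x. (norm (g x))\<^sup>2"])
      (use G(2,3) gm(2) in auto)
  have "weak_pair \<Omega> U G"
    unfolding weak_pair_def
  proof (intro conjI ballI)
    show "integrable lborel U"
      by (rule integrable_of_square[OF U(1) _ b \<Omega>(2) U(3)]) (use U2 in simp)
    show "integrable lborel G"
      by (rule integrable_of_square[OF G(1) G2 b \<Omega>(2) G(3)])
    fix \<phi> and e :: 'a assume \<phi>: "\<phi> \<in> test_functions \<Omega>" and e: "e \<in> Basis"
    have [measurable]: "\<phi> \<in> borel_measurable borel" "(\<lambda>x. frechet_derivative \<phi> (at x) e) \<in> borel_measurable borel"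
      using test_functionsD(3,9)[OF \<phi>] by (auto intro: borel_measurable_continuous_onI)
    note [measurable] = this[THEN borel_measurable_lebesgue_onI[of _ \<Omega>]]
    have "(LINT x|lborel. U x * frechet_derivative \<phi> (at x) e) = (LINT x|lebesgue_on \<Omega>. u x * frechet_derivative \<phi> (at x) e)"
      by (rule lebesgue_on_borel_representative(2)[OF b, symmetric]) (use U(2,3) in auto)
    also have "\<dots> = - (LINT x|lebesgue_on \<Omega>. (g x \<bullet> e) * \<phi> x)" by (rule weak[OF \<phi> e])
    also have "(LINT x|lebesgue_on \<Omega>. (g x \<bullet> e) * \<phi> x) = (LINT x|lborel. (G x \<bullet> e) * \<phi> x)"
      by (rule lebesgue_on_borel_representative(2)[OF b]) (use G(2,3) in auto)
    finally show "(LINT x|lborel. U x * frechet_derivative \<phi> (at x) e) = - (LINT x|lborel. (G x \<bullet> e) * \<phi> x)" .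
  qed
  with U G U2 G2 show thesis by (intro that) auto
qed

lemma weak_pair_cong_AE:
  fixes U V :: "'a::euclidean_space \<Rightarrow> real"
  assumes UG: "weak_pair \<Omega> U G" and [measurable]: "V \<in> borel_measurable borel" and eq: "AE x in lborel. U x = V x"
  shows "weak_pair \<Omega> V G"
proof -
  have [measurable]: "U \<in> borel_measurable borel" using UG by (auto simp: weak_pair_def dest: borel_measurable_integrable)
  have "(LINT x|lborel. U x * frechet_derivative \<phi> (at x) b) = (LINT x|lborel. V x * frechet_derivative \<phi> (at x) b)"
    if "\<phi> \<in> test_functions \<Omega>" "b \<in> Basis" for \<phi> b
  proof -
    have [measurable]: "(\<lambda>x. frechet_derivative \<phi> (at x) b) \<in> borel_measurable borel"
      using test_functionsD(9)[OF that(1)] by (auto intro: borel_measurable_continuous_onI)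
    show ?thesis by (rule integral_cong_AE) (use eq in auto)
  qed
  moreover have "integrable lborel V"
    using UG integrable_cong_AE[of U lborel V] eq by (auto simp: weak_pair_def)
  ultimately show ?thesis using UG by (simp add: weak_pair_def)
qed

text \<open>This gives the choice of a gradient in \<^const>\<open>grad\<close> a meaning almost everywhere.\<close>

lemma is_weak_gradient_unique:
  assumes \<Omega>: "open \<Omega>" "emeasure lborel \<Omega> < \<infinity>" and u: "u \<in> L2 \<Omega>"
    and "is_weak_gradient \<Omega> u g" "is_weak_gradient \<Omega> u h"
  shows "AE x in lebesgue_on \<Omega>. g x = h x"
proof -
  obtain U G where 1: "weak_pair \<Omega> U G" "U \<in> borel_measurable borel"
    "AE x in lborel. x \<in> \<Omega> \<longrightarrow> U x = u x" "AE x in lborel. x \<in> \<Omega> \<longrightarrow> G x = g x"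
    "\<And>x. x \<notin> \<Omega> \<Longrightarrow> U x = 0"
    by (rule Sobolev_representative[OF \<Omega> u assms(4)]) blast
  obtain V H where 2: "weak_pair \<Omega> V H"
    "AE x in lborel. x \<in> \<Omega> \<longrightarrow> V x = u x" "AE x in lborel. x \<in> \<Omega> \<longrightarrow> H x = h x"
    "\<And>x. x \<notin> \<Omega> \<Longrightarrow> V x = 0"
    by (rule Sobolev_representative[OF \<Omega> u assms(5)]) blast
  have "AE x in lborel. V x = U x"
    using 1(3) 2(2) by eventually_elim (metis 1(5) 2(4))
  from weak_pair_cong_AE[OF 2(1) 1(2) this] have "weak_pair \<Omega> U H" .
  from weak_gradient_unique[OF \<Omega>(1) 1(1) this] 1(4) 2(3) have "AE x in lborel. x \<in> \<Omega> \<longrightarrow> g x = h x"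
    by eventually_elim auto
  then show ?thesis using \<Omega>(1) by (simp add: AE_lebesgue_on_iff)
qed


section \<open>Perimeters of sublevel sets and the coarea inequality\<close>

text \<open>A smooth step of width \<open>2 \<delta>\<close>, from which both the approximate sublevel sets and the cutoffs in
  time are built.\<close>

lemma mollifier_antiderivative:
  assumes "0 < \<delta>"
  obtains F :: "real \<Rightarrow> real" where "\<And>t. (F has_real_derivative mollifier \<delta> t) (at t)"
    "\<And>t. t \<le> - \<delta> \<Longrightarrow> F t = 0" "\<And>t. \<delta> \<le> t \<Longrightarrow> F t = 1" "\<And>t. 0 \<le> F t \<and> F t \<le> 1"
proof -
  have "isCont (mollifier \<delta>) (t::real)" for t
    using continuous_mollifier[of \<delta>, where 'a = real] by (simp add: continuous_on_eq_continuous_at)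
  then obtain F where F: "\<And>t. (F has_vector_derivative mollifier \<delta> t) (at t)"
    using einterval_antiderivative[of "-\<infinity>" \<infinity> "mollifier \<delta> :: real \<Rightarrow> real"] by auto
  have FTC: "(mollifier \<delta> has_integral F b - F a) {a..b}" if "a \<le> b" for a b
    using fundamental_theorem_of_calculus[OF that, of F "mollifier \<delta>"] F
    by (auto intro: has_vector_derivative_at_within)
  have left: "F t = F (- \<delta>)" if "t \<le> - \<delta>" for t
  proof -
    have "(mollifier \<delta> has_integral 0) {t..- \<delta>}"
      by (rule has_integral_is_0) (auto intro!: mollifier_outside[OF assms])
    from has_integral_unique[OF this FTC[OF that]] show ?thesis by simp
  qed
  have right: "F t = F \<delta>" if "\<delta> \<le> t" for t
  proof -
    have "(mollifier \<delta> has_integral 0) {\<delta>..t}"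
      by (rule has_integral_is_0) (use assms in \<open>auto intro!: mollifier_outside[OF assms]\<close>)
    from has_integral_unique[OF this FTC[OF that]] show ?thesis by simp
  qed
  have "((mollifier \<delta> :: real \<Rightarrow> real) has_integral (LINT t|lborel. mollifier \<delta> (t::real))) UNIV"
    by (rule has_integral_integral_lborel[OF integrable_mollifier[OF assms]])
  then have "(mollifier \<delta> has_integral 1) {-\<delta>..\<delta>::real}"
    unfolding integral_mollifier[OF assms]
    by (rule has_integral_restrict_UNIV[THEN iffD1, OF has_integral_eq[rotated]])
      (use mollifier_outside[OF assms, where 'a = real] in force)
  from has_integral_unique[OF this FTC] assms have tot: "F \<delta> - F (- \<delta>) = 1" by simp
  have mono: "F a \<le> F b" if "a \<le> b" for a b
    using has_integral_nonneg[OF FTC[OF that]] mollifier_nonneg[OF assms, where 'a = real] by simp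
  show thesis
  proof (rule that[of "\<lambda>t. F t - F (- \<delta>)"])
    show "((\<lambda>t. F t - F (- \<delta>)) has_real_derivative mollifier \<delta> t) (at t)" for t
      using F[of t] by (auto intro!: derivative_eq_intros simp: has_real_derivative_iff_has_vector_derivative)
    show "0 \<le> F t - F (- \<delta>) \<and> F t - F (- \<delta>) \<le> 1" for t
    proof -
      consider "t \<le> - \<delta>" | "- \<delta> \<le> t" "t \<le> \<delta>" | "\<delta> \<le> t" by linarith
      then show ?thesis
      proof cases
        case 2
        then show ?thesis using mono[of "- \<delta>" t] mono[of t \<delta>] tot by simp
      qed (use left[of t] right[of t] tot in auto)
    qed
    show "F t - F (- \<delta>) = 0" if "t \<le> - \<delta>" for t using left[OF that] by simp
    show "F t - F (- \<delta>) = 1" if "\<delta> \<le> t" for t using right[OF that] tot by simp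
  qed
qed

lemma LINT_indicator_divergence:
  assumes "\<Omega> \<in> sets borel" "E \<in> sets borel" "E \<subseteq> \<Omega>" and \<phi>: "\<phi> \<in> C1c_fields \<Omega>"
  shows "(LINT x|lebesgue_on \<Omega>. indicator E x * divergence \<phi> x) = (LINT x|lborel. indicator E x * divergence \<phi> x)"
proof (rule lebesgue_on_borel_representative(2)[OF assms(1)])
  have [measurable]: "divergence \<phi> \<in> borel_measurable borel"
    using divergence_props(1)[OF \<phi>] by (rule borel_measurable_continuous_onI)
  show "(\<lambda>x. indicator E x * divergence \<phi> x :: real) \<in> borel_measurable borel" using assms by simp
  then show "(\<lambda>x. indicator E x * divergence \<phi> x :: real) \<in> borel_measurable (lebesgue_on \<Omega>)"
    by (rule borel_measurable_lebesgue_onI)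
qed (use assms in \<open>auto simp: indicator_def\<close>)

text \<open>The indicator of a sublevel set is the limit of \<open>\<eta> \<circ> U\<close> for smooth steps \<open>\<eta>\<close> of width tending
  to zero, whose variation is controlled by the chain rule.  The factor \<open>c\<close> is carried along
  because it becomes the weight of the level \<open>s\<close> in the coarea inequality.\<close>

lemma perimeter_sublevel_le:
  fixes U :: "'a::euclidean_space \<Rightarrow> real"
  assumes \<Omega>: "open \<Omega>" and UG: "weak_pair \<Omega> U G" and "0 \<le> c"
  shows "ennreal c * perimeter {x \<in> \<Omega>. U x \<le> s} \<Omega>
    \<le> liminf (\<lambda>j. ennreal c * (\<integral>\<^sup>+x. ennreal (real (Suc j) * mollifier 1 (real (Suc j) * (U x - s) - 1)) * ennreal (norm (G x)) \<partial>lborel))"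
    (is "_ \<le> liminf ?A")
proof -
  let ?E = "{x \<in> \<Omega>. U x \<le> s}"
  have U: "integrable lborel U" and G: "integrable lborel G" using UG by (auto simp: weak_pair_def)
  have [measurable]: "U \<in> borel_measurable borel" "G \<in> borel_measurable borel" "\<Omega> \<in> sets borel"
    using U G \<Omega> by (auto dest: borel_measurable_integrable)
  have E: "?E \<in> sets borel" by measurable
  obtain F :: "real \<Rightarrow> real" where F: "\<And>t. (F has_real_derivative mollifier 1 t) (at t)"
    "\<And>t. t \<le> - 1 \<Longrightarrow> F t = 0" "\<And>t. 1 \<le> t \<Longrightarrow> F t = 1" "\<And>t. 0 \<le> F t \<and> F t \<le> 1"
    by (rule mollifier_antiderivative[of 1]) auto
  obtain B where B: "0 < B" "\<And>t::real. \<bar>mollifier 1 t\<bar> \<le> B" using mollifier_bounded[of 1, where 'a = real] by auto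
  have "continuous_on UNIV F"
    using F(1) by (meson DERIV_isCont continuous_at_imp_continuous_on)
  then have [measurable]: "F \<in> borel_measurable borel" by (rule borel_measurable_continuous_onI)
  \<comment> \<open>the shift by 1 puts the step to the right of the level \<open>s\<close>, so that it converges to the indicator of the closed sublevel set\<close>
  define \<kappa> where "\<kappa> j t = real (Suc j) * mollifier 1 (real (Suc j) * (t - s) - 1)" for j t
  have \<kappa>0: "0 \<le> \<kappa> j t" for j t by (simp add: \<kappa>_def mollifier_nonneg)
  have \<kappa>_meas[measurable]: "\<kappa> j \<in> borel_measurable borel" for j unfolding \<kappa>_def by measurable
  have main: "ennreal c * ennreal (LINT x|lebesgue_on \<Omega>. indicator ?E x * divergence \<phi> x) \<le> liminf ?A"
    if \<phi>': "\<phi> \<in> C1c_fields \<Omega>" "\<And>x. norm (\<phi> x) \<le> 1" for \<phi>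
  proof -
    note \<phi> = C1c_fieldsD[OF \<phi>'(1)] and div = divergence_props[OF \<phi>'(1)]
    have [measurable]: "divergence \<phi> \<in> borel_measurable borel" "\<phi> \<in> borel_measurable borel"
      using div(1) \<phi>(1) by (auto intro: borel_measurable_continuous_onI)
    define \<eta> where "\<eta> j t = 1 - F (real (Suc j) * (t - s) - 1)" for j t
    have \<eta>: "(\<eta> j has_real_derivative - \<kappa> j t) (at t)" for j t
    proof -
      have "((\<lambda>t. real (Suc j) * (t - s) - 1) has_real_derivative real (Suc j)) (at t)"
        by (auto intro!: derivative_eq_intros)
      from DERIV_chain2[OF F(1) this] show ?thesis
        unfolding \<eta>_def \<kappa>_def by (auto intro!: derivative_eq_intros simp: mult.commute)
    qed
    have le: "ennreal c * ennreal (LINT x|lborel. \<eta> j (U x) * divergence \<phi> x) \<le> ?A j" for j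
    proof -
      have "(LINT x|lborel. \<eta> j (U x) * divergence \<phi> x) = - (LINT x|lborel. - \<kappa> j (U x) * (G x \<bullet> \<phi> x))"
      proof (rule weak_chain_rule[OF \<Omega> UG \<phi>'(1) \<eta>, where B = "real (Suc j) * B + 1"])
        have "continuous_on UNIV (\<kappa> j)"
          unfolding \<kappa>_def by (intro continuous_intros continuous_on_compose2[OF continuous_mollifier]) auto
        then show "continuous_on UNIV (\<lambda>t. - \<kappa> j t)" by (intro continuous_intros)
        show "\<bar>\<eta> j t\<bar> \<le> real (Suc j) * B + 1" for t
        proof -
          have "0 \<le> real (Suc j) * B" using B by simp
          with F(4)[of "real (Suc j) * (t - s) - 1"] show ?thesis unfolding \<eta>_def by linarith
        qed
        show "\<bar>- \<kappa> j t\<bar> \<le> real (Suc j) * B + 1" for t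
        proof -
          have "real (Suc j) * \<bar>mollifier 1 (real (Suc j) * (t - s) - 1)\<bar> \<le> real (Suc j) * B"
            by (intro mult_left_mono B) simp
          then show ?thesis unfolding \<kappa>_def abs_minus_cancel abs_mult abs_of_nat by linarith
        qed
      qed
      also have "\<dots> \<le> norm (LINT x|lborel. - \<kappa> j (U x) * (G x \<bullet> \<phi> x))" by simp
      finally have "ennreal (LINT x|lborel. \<eta> j (U x) * divergence \<phi> x)
          \<le> (\<integral>\<^sup>+x. norm (- \<kappa> j (U x) * (G x \<bullet> \<phi> x)) \<partial>lborel)"
        by (intro order_trans[OF ennreal_leI norm_integral_le_nn_integral])
      also have "\<dots> \<le> (\<integral>\<^sup>+x. ennreal (\<kappa> j (U x)) * ennreal (norm (G x)) \<partial>lborel)"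
      proof (intro nn_integral_mono)
        fix x
        have "\<bar>G x \<bullet> \<phi> x\<bar> \<le> norm (G x)"
          using Cauchy_Schwarz_ineq2[of "G x" "\<phi> x"] mult_left_mono[OF \<phi>'(2)[of x] norm_ge_zero[of "G x"]] by simp
        then have "norm (- \<kappa> j (U x) * (G x \<bullet> \<phi> x)) \<le> \<kappa> j (U x) * norm (G x)"
          using \<kappa>0[of j "U x"] by (simp add: abs_mult mult_left_mono)
        then show "ennreal (norm (- \<kappa> j (U x) * (G x \<bullet> \<phi> x))) \<le> ennreal (\<kappa> j (U x)) * ennreal (norm (G x))"
          using \<kappa>0[of j "U x"] by (simp add: ennreal_leI flip: ennreal_mult)
      qed
      finally show ?thesis unfolding \<kappa>_def by (rule mult_left_mono) simp
    qed
    have "(\<lambda>j. LINT x|lborel. \<eta> j (U x) * divergence \<phi> x) \<longlonglongrightarrow> (LINT x|lborel. indicator ?E x * divergence \<phi> x)"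
    proof (rule integral_dominated_convergence[where w = "\<lambda>x. \<bar>divergence \<phi> x\<bar>"])
      have [measurable]: "\<eta> j \<in> borel_measurable borel" for j unfolding \<eta>_def by measurable
      show "(\<lambda>x. \<eta> j (U x) * divergence \<phi> x) \<in> borel_measurable lborel" for j by measurable
      show "(\<lambda>x. indicator ?E x * divergence \<phi> x) \<in> borel_measurable lborel" using E by measurable
      show "AE x in lborel. (\<lambda>j. \<eta> j (U x) * divergence \<phi> x) \<longlonglongrightarrow> indicator ?E x * divergence \<phi> x"
      proof (rule AE_I2)
        fix x
        show "(\<lambda>j. \<eta> j (U x) * divergence \<phi> x) \<longlonglongrightarrow> indicator ?E x * divergence \<phi> x"
        proof (cases "x \<in> \<Omega>")
          case False
          with \<phi>(4) have "x \<notin> closure {x. \<phi> x \<noteq> 0}" by auto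
          from div(2)[OF this] show ?thesis by simp
        next
          case True
          have "\<forall>\<^sub>F j in sequentially. \<eta> j (U x) = indicator ?E x"
          proof (cases "U x \<le> s")
            case True
            then have "real (Suc j) * (U x - s) - 1 \<le> - 1" for j by (simp add: mult_nonneg_nonpos)
            then show ?thesis using F(2) True \<open>x \<in> \<Omega>\<close> by (simp add: \<eta>_def)
          next
            case False
            then have "0 < U x - s" by simp
            obtain N where N: "2 / (U x - s) < real N" using reals_Archimedean2 by blast
            have "\<eta> j (U x) = 0" if "N \<le> j" for j
            proof -
              have "2 / (U x - s) \<le> real (Suc j)" using N that by linarith
              then have "1 \<le> real (Suc j) * (U x - s) - 1"
                using \<open>0 < U x - s\<close> by (simp add: field_simps)
              from F(3)[OF this] show ?thesis by (simp add: \<eta>_def)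
            qed
            then show ?thesis using False by (auto simp: eventually_sequentially)
          qed
          then show ?thesis
            by (intro tendsto_eventually) (auto elim: eventually_mono)
        qed
      qed
      show "AE x in lborel. norm (\<eta> j (U x) * divergence \<phi> x) \<le> \<bar>divergence \<phi> x\<bar>" for j
      proof (rule AE_I2)
        fix x
        have "\<bar>\<eta> j (U x)\<bar> \<le> 1" using F(4)[of "real (Suc j) * (U x - s) - 1"] unfolding \<eta>_def by linarith
        then show "norm (\<eta> j (U x) * divergence \<phi> x) \<le> \<bar>divergence \<phi> x\<bar>"
          by (simp add: abs_mult mult_left_le_one_le)
      qed
    qed (use div(3) in simp)
    then have "(\<lambda>j. ennreal (c * (LINT x|lborel. \<eta> j (U x) * divergence \<phi> x)))
        \<longlonglongrightarrow> ennreal (c * (LINT x|lborel. indicator ?E x * divergence \<phi> x))"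
      by (intro tendsto_ennrealI tendsto_mult_left)
    then have "ennreal c * ennreal (LINT x|lborel. indicator ?E x * divergence \<phi> x)
        = liminf (\<lambda>j. ennreal c * ennreal (LINT x|lborel. \<eta> j (U x) * divergence \<phi> x))"
      using \<open>0 \<le> c\<close> by (simp add: ennreal_mult'[symmetric] lim_imp_Liminf)
    also have "\<dots> \<le> liminf ?A"
      by (intro Liminf_mono always_eventually allI le)
    finally show ?thesis
      using LINT_indicator_divergence[OF _ E _ \<phi>'(1)] by simp
  qed
  show ?thesis
    unfolding perimeter_def total_variation_def SUP_mult_left_ennreal
    by (rule SUP_least) (use main in auto)
qed

text \<open>Averaging the level weight \<open>q\<close> over short intervals of levels recovers \<open>q\<close>; with Tonelli and
  Fatou this turns the bound for single sublevel sets into a bound for the integral over levels.\<close>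

lemma coarea_inequality:
  fixes U :: "'a::euclidean_space \<Rightarrow> real"
  assumes \<Omega>: "open \<Omega>" and UG: "weak_pair \<Omega> U G"
    and q: "continuous_on UNIV q" "\<And>s. 0 \<le> q s" "\<And>s. q s \<le> Q"
  shows "(\<integral>\<^sup>+s. ennreal (q s) * perimeter {x \<in> \<Omega>. U x \<le> s} \<Omega> \<partial>lborel)
    \<le> (\<integral>\<^sup>+x. ennreal (q (U x)) * ennreal (norm (G x)) \<partial>lborel)"
proof -
  have U: "integrable lborel U" and G: "integrable lborel G" using UG by (auto simp: weak_pair_def)
  have [measurable]: "U \<in> borel_measurable borel" "G \<in> borel_measurable borel" "q \<in> borel_measurable borel"
    using U G q by (auto dest: borel_measurable_integrable intro: borel_measurable_continuous_onI)
  define \<kappa> where "\<kappa> j t = real (Suc j) * mollifier 1 (real (Suc j) * t - 1)" for j t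
  have \<kappa>0: "0 \<le> \<kappa> j t" for j t by (simp add: \<kappa>_def mollifier_nonneg)
  have [measurable]: "\<kappa> j \<in> borel_measurable borel" for j unfolding \<kappa>_def by measurable
  \<comment> \<open>an average of \<open>q\<close> over levels between \<open>t - 2 / Suc j\<close> and \<open>t\<close>\<close>
  define N where "N j t = (\<integral>\<^sup>+s. ennreal (q s) * ennreal (\<kappa> j (t - s)) \<partial>lborel)" for j t
  have N_subst: "N j t = (\<integral>\<^sup>+y. ennreal (mollifier 1 y) * ennreal (q (t - (y + 1) / real (Suc j))) \<partial>lborel)" for j t
  proof -
    have "N j t = ennreal \<bar>- 1 / real (Suc j)\<bar> * (\<integral>\<^sup>+y. ennreal (q ((t - 1 / real (Suc j)) + (- 1 / real (Suc j)) * y))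
        * ennreal (\<kappa> j (t - ((t - 1 / real (Suc j)) + (- 1 / real (Suc j)) * y))) \<partial>lborel)"
      unfolding N_def by (rule nn_integral_real_affine) auto
    also have "\<dots> = (\<integral>\<^sup>+y. ennreal \<bar>- 1 / real (Suc j)\<bar> * (ennreal (q ((t - 1 / real (Suc j)) + (- 1 / real (Suc j)) * y))
        * ennreal (\<kappa> j (t - ((t - 1 / real (Suc j)) + (- 1 / real (Suc j)) * y)))) \<partial>lborel)"
      by (rule nn_integral_cmult[symmetric]) auto
    also have "\<dots> = (\<integral>\<^sup>+y. ennreal (mollifier 1 y) * ennreal (q (t - (y + 1) / real (Suc j))) \<partial>lborel)"
    proof (intro nn_integral_cong)
      fix y :: real
      have 1: "(t - 1 / real (Suc j)) + (- 1 / real (Suc j)) * y = t - (y + 1) / real (Suc j)"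
        by (simp add: add_divide_distrib)
      have 2: "\<kappa> j (t - (t - (y + 1) / real (Suc j))) = real (Suc j) * mollifier 1 y"
        by (simp add: \<kappa>_def)
      have gen: "0 \<le> a \<Longrightarrow> 0 \<le> b \<Longrightarrow> 0 \<le> c \<Longrightarrow> ennreal a * (ennreal b * ennreal c) = ennreal (a * (b * c))"
        for a b c by (simp add: ennreal_mult)
      have 3: "\<bar>- 1 / real (Suc j)\<bar> * (r * (real (Suc j) * mollifier 1 y)) = mollifier 1 y * r" for r
        by (simp add: field_simps)
      show "ennreal \<bar>- 1 / real (Suc j)\<bar> * (ennreal (q ((t - 1 / real (Suc j)) + (- 1 / real (Suc j)) * y))
          * ennreal (\<kappa> j (t - ((t - 1 / real (Suc j)) + (- 1 / real (Suc j)) * y))))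
          = ennreal (mollifier 1 y) * ennreal (q (t - (y + 1) / real (Suc j)))"
        unfolding 1 2 by (subst gen) (auto simp: 3 q(2) mollifier_nonneg ennreal_mult mult.commute simp del: of_nat_Suc)
    qed
    finally show ?thesis .
  qed
  have N_le: "N j t \<le> ennreal Q" for j t
  proof -
    have "N j t \<le> (\<integral>\<^sup>+y. ennreal (mollifier 1 (y::real)) * ennreal Q \<partial>lborel)"
      unfolding N_subst by (intro nn_integral_mono mult_left_mono ennreal_leI q) auto
    then show ?thesis by (simp add: nn_integral_multc nn_integral_mollifier)
  qed
  have N_lim: "(\<lambda>j. N j t) \<longlonglongrightarrow> ennreal (q t)" for t
  proof -
    have "(\<lambda>j. N j t) \<longlonglongrightarrow> (\<integral>\<^sup>+y. ennreal (mollifier 1 (y::real)) * ennreal (q t) \<partial>lborel)"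
      unfolding N_subst
    proof (rule nn_integral_dominated_convergence[where w = "\<lambda>y. ennreal (mollifier 1 y) * ennreal Q"])
      show "AE y in lborel. ennreal (mollifier 1 y) * ennreal (q (t - (y + 1) / real (Suc j)))
          \<le> ennreal (mollifier 1 y) * ennreal Q" for j
        by (intro AE_I2 mult_left_mono ennreal_leI q) auto
      show "(\<integral>\<^sup>+y. ennreal (mollifier 1 (y::real)) * ennreal Q \<partial>lborel) < \<infinity>"
        by (simp add: nn_integral_multc nn_integral_mollifier)
      show "AE y in lborel. (\<lambda>j. ennreal (mollifier 1 y) * ennreal (q (t - (y + 1) / real (Suc j))))
          \<longlonglongrightarrow> ennreal (mollifier 1 y) * ennreal (q t)"
      proof (rule AE_I2)
        fix y :: real
        have "(\<lambda>j. (y + 1) * inverse (real (Suc j))) \<longlonglongrightarrow> (y + 1) * 0"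
          by (intro tendsto_mult_left LIMSEQ_inverse_real_of_nat)
        from tendsto_diff[OF tendsto_const this, of t]
        have "(\<lambda>j. t - (y + 1) / real (Suc j)) \<longlonglongrightarrow> t" by (simp add: divide_inverse)
        then have "(\<lambda>j. q (t - (y + 1) / real (Suc j))) \<longlonglongrightarrow> q t"
          by (intro continuous_on_tendsto_compose[OF q(1)]) auto
        then have "(\<lambda>j. ennreal (mollifier 1 y * q (t - (y + 1) / real (Suc j)))) \<longlonglongrightarrow> ennreal (mollifier 1 y * q t)"
          by (intro tendsto_ennrealI tendsto_mult_left)
        then show "(\<lambda>j. ennreal (mollifier 1 y) * ennreal (q (t - (y + 1) / real (Suc j))))
            \<longlonglongrightarrow> ennreal (mollifier 1 y) * ennreal (q t)"
          by (simp add: ennreal_mult q(2) mollifier_nonneg)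
      qed
    qed measurable
    then show ?thesis by (simp add: nn_integral_multc nn_integral_mollifier)
  qed
  have [measurable]: "(\<lambda>x. N j (U x)) \<in> borel_measurable borel" for j
    unfolding N_def by measurable
  let ?A = "\<lambda>j s. \<integral>\<^sup>+x. ennreal (\<kappa> j (U x - s)) * ennreal (norm (G x)) \<partial>lborel"
  have swap: "(\<integral>\<^sup>+s. ennreal (q s) * ?A j s \<partial>lborel) = (\<integral>\<^sup>+x. N j (U x) * ennreal (norm (G x)) \<partial>lborel)" for j
  proof -
    have "(\<integral>\<^sup>+s. ennreal (q s) * ?A j s \<partial>lborel)
        = (\<integral>\<^sup>+s. \<integral>\<^sup>+x. ennreal (q s) * ennreal (\<kappa> j (U x - s)) * ennreal (norm (G x)) \<partial>lborel \<partial>lborel)"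
      by (simp add: nn_integral_cmult mult.assoc)
    also have "\<dots> = (\<integral>\<^sup>+x. \<integral>\<^sup>+s. ennreal (q s) * ennreal (\<kappa> j (U x - s)) * ennreal (norm (G x)) \<partial>lborel \<partial>lborel)"
      by (rule lborel_pair.Fubini') measurable
    also have "\<dots> = (\<integral>\<^sup>+x. N j (U x) * ennreal (norm (G x)) \<partial>lborel)"
      unfolding N_def by (simp add: nn_integral_multc)
    finally show ?thesis .
  qed
  have "(\<integral>\<^sup>+s. ennreal (q s) * perimeter {x \<in> \<Omega>. U x \<le> s} \<Omega> \<partial>lborel)
      \<le> (\<integral>\<^sup>+s. liminf (\<lambda>j. ennreal (q s) * ?A j s) \<partial>lborel)"
    unfolding \<kappa>_def by (intro nn_integral_mono perimeter_sublevel_le[OF \<Omega> UG q(2)])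
  also have "\<dots> \<le> liminf (\<lambda>j. \<integral>\<^sup>+s. ennreal (q s) * ?A j s \<partial>lborel)"
    by (rule nn_integral_liminf) measurable
  also have "\<dots> = liminf (\<lambda>j. \<integral>\<^sup>+x. N j (U x) * ennreal (norm (G x)) \<partial>lborel)"
    by (simp only: swap)
  also have "\<dots>
      = (\<integral>\<^sup>+x. ennreal (q (U x)) * ennreal (norm (G x)) \<partial>lborel)"
  proof (intro lim_imp_Liminf nn_integral_dominated_convergence[where w = "\<lambda>x. ennreal Q * ennreal (norm (G x))"])
    show "AE x in lborel. N j (U x) * ennreal (norm (G x)) \<le> ennreal Q * ennreal (norm (G x))" for j
      by (intro AE_I2 mult_right_mono N_le) auto
    show "(\<integral>\<^sup>+x. ennreal Q * ennreal (norm (G x)) \<partial>lborel) < \<infinity>"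
      using G by (simp add: nn_integral_cmult ennreal_mult_less_top integrable_iff_bounded)
    show "AE x in lborel. (\<lambda>j. N j (U x) * ennreal (norm (G x))) \<longlonglongrightarrow> ennreal (q (U x)) * ennreal (norm (G x))"
      by (intro AE_I2 tendsto_mult_ennreal N_lim tendsto_const) auto
  qed auto
  finally show ?thesis .
qed


section \<open>The double-well potential\<close>

lemma Ck_real_has_derivative:
  fixes f :: "real \<Rightarrow> real"
  assumes "Ck (Suc k) f"
  shows "(f has_real_derivative deriv f x) (at x)" and "Ck k (deriv f)"
proof -
  have "f differentiable (at x)" for x using assms by simp
  then have d: "(f has_real_derivative deriv f x) (at x)" for x
    by (simp add: DERIV_deriv_iff_real_differentiable)
  then show "(f has_real_derivative deriv f x) (at x)" .
  have "frechet_derivative f (at x) = (*) (deriv f x)" for x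
    using frechet_derivative_at[OF d[of x, unfolded has_field_derivative_def]] by simp
  with assms show "Ck k (deriv f)" by simp
qed

text \<open>Near its zero \<open>a\<close> the derivative grows at least like \<open>w / 2 * (s - a)\<close>, and this is integrated.\<close>

lemma quadratic_lower_bound_at_minimum:
  fixes f f' :: "real \<Rightarrow> real"
  assumes f: "\<And>s. (f has_real_derivative f' s) (at s)" and f': "(f' has_real_derivative w) (at a)"
    and "f a = 0" "f' a = 0" "0 < w"
  obtains d where "0 < d" "d \<le> 1" "\<And>s. \<bar>s - a\<bar> < d \<Longrightarrow> w / 4 * (s - a)\<^sup>2 \<le> f s"
proof -
  have "((\<lambda>s. f' s / (s - a)) \<longlongrightarrow> w) (at a)"
    using f' \<open>f' a = 0\<close> by (simp add: has_field_derivative_iff LIM_offset_zero_iff[of a] DERIV_def)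
  from order_tendstoD(1)[OF this, of "w/2"] \<open>0 < w\<close>
  obtain d where d: "0 < d" "\<And>s. s \<noteq> a \<Longrightarrow> \<bar>s - a\<bar> < d \<Longrightarrow> w / 2 < f' s / (s - a)"
    by (auto simp: eventually_at dist_real_def)
  define g where "g s = f s - w / 4 * (s - a)\<^sup>2" for s
  have g: "(g has_real_derivative f' s - w / 2 * (s - a)) (at s)" for s
    unfolding g_def by (auto intro!: derivative_eq_intros f)
  have "0 \<le> g s" if s: "\<bar>s - a\<bar> < d" for s
  proof (cases "a \<le> s")
    case True
    have "g a \<le> g s"
    proof (rule DERIV_nonneg_imp_nondecreasing[OF True])
      fix x assume x: "a \<le> x" "x \<le> s"
      have "w / 2 * (x - a) \<le> f' x"
      proof (cases "x = a")
        case False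
        with d(2)[of x] x s show ?thesis by (simp add: field_simps)
      qed (use assms in simp)
      with g[of x] show "\<exists>y. (g has_real_derivative y) (at x) \<and> 0 \<le> y" by force
    qed
    then show ?thesis using assms by (simp add: g_def)
  next
    case False
    then have "s \<le> a" by simp
    have "g a \<le> g s"
    proof (rule DERIV_nonpos_imp_nonincreasing[OF \<open>s \<le> a\<close>])
      fix x assume x: "s \<le> x" "x \<le> a"
      have "f' x \<le> w / 2 * (x - a)"
      proof (cases "x = a")
        case False
        with d(2)[of x] x s show ?thesis by (simp add: field_simps)
      qed (use assms in simp)
      with g[of x] show "\<exists>y. (g has_real_derivative y) (at x) \<and> y \<le> 0" by force
    qed
    then show ?thesis using assms by (simp add: g_def)
  qed
  then show thesis
    using d(1) by (intro that[of "min d 1"]) (auto simp: g_def)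
qed

text \<open>The derivative is positive somewhere beyond \<open>1\<close> by the mean value theorem, hence everywhere beyond
  \<open>1\<close>, where it has no zeros; by compactness and its size at infinity it is bounded below from \<open>2\<close> on.\<close>

lemma linear_lower_bound_at_infinity:
  fixes f f' :: "real \<Rightarrow> real"
  assumes f: "\<And>s. (f has_real_derivative f' s) (at s)" and cont: "continuous_on UNIV f'"
    and "f 1 = 0" and pos: "\<And>s. 1 < s \<Longrightarrow> 0 < f s" and nz: "\<And>s. 1 < s \<Longrightarrow> f' s \<noteq> 0"
    and large: "\<And>s. S \<le> s \<Longrightarrow> 1 \<le> \<bar>f' s\<bar>"
  obtains a where "0 < a" "\<And>s. 2 \<le> s \<Longrightarrow> a * (s - 1) \<le> f s"
proof -
  obtain z where z: "1 < z" "z < 2" "f 2 - f 1 = (2 - 1) * f' z"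
    using MVT2[of 1 2 f f'] f by auto
  with pos[of 2] \<open>f 1 = 0\<close> have "0 < f' z" by simp
  have fpos: "0 < f' s" if "1 < s" for s
  proof (rule ccontr)
    assume "\<not> 0 < f' s"
    then have neg: "f' s \<le> 0" by simp
    have c: "continuous_on {a..b} f'" for a b by (rule continuous_on_subset[OF cont]) simp
    have "\<exists>y. min s z \<le> y \<and> f' y = 0"
    proof (cases "z \<le> s")
      case True
      from IVT2'[of f' s 0 z, OF neg _ True c] \<open>0 < f' z\<close> True show ?thesis by auto
    next
      case False
      from IVT'[of f' s 0 z, OF neg _ _ c] \<open>0 < f' z\<close> False show ?thesis by auto
    qed
    with nz that z(1) show False by (metis less_le_trans min_less_iff_conj)
  qed
  define T where "T = max 2 S"
  have "continuous_on {2..T} f'" by (rule continuous_on_subset[OF cont]) simp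
  then obtain x where x: "x \<in> {2..T}" "\<And>y. y \<in> {2..T} \<Longrightarrow> f' x \<le> f' y"
    using continuous_attains_inf[of "{2..T}" f'] by (auto simp: T_def)
  define a where "a = min (min (f' x) 1) (f 2)"
  have "0 < a" using fpos[of x] x(1) pos[of 2] by (simp add: a_def)
  have low: "a \<le> f' s" if "2 \<le> s" for s
  proof (cases "s \<le> T")
    case True
    then show ?thesis using x(2)[of s] that by (simp add: a_def)
  next
    case False
    then have "1 \<le> f' s" using large[of s] fpos[of s] that by (simp add: T_def)
    then show ?thesis by (simp add: a_def min.coboundedI1)
  qed
  have "a * (s - 1) \<le> f s" if "2 \<le> s" for s
  proof -
    have "f 2 - a * 2 \<le> f s - a * s"
      by (rule DERIV_nonneg_imp_nondecreasing[OF that])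
        (use low in \<open>force intro!: derivative_eq_intros f\<close>)
    moreover have "a \<le> f 2" by (simp add: a_def)
    ultimately show ?thesis by (simp add: algebra_simps)
  qed
  with \<open>0 < a\<close> that show thesis by blast
qed

definition well_distance :: "real \<Rightarrow> real" where
  "well_distance s = \<bar>\<bar>s\<bar> - 1\<bar>"

text \<open>\<open>W\<close> dominates the squared distance to the wells on a bounded set, and the distance itself far
  out, where only linear growth is guaranteed.\<close>

lemma double_well_coercive:
  assumes "double_well W"
  obtains c where "0 < c" "\<And>s. \<bar>s\<bar> \<le> 2 \<Longrightarrow> (c * well_distance s)\<^sup>2 \<le> W s"
    "\<And>s. 2 \<le> \<bar>s\<bar> \<Longrightarrow> c\<^sup>2 * well_distance s \<le> W s"
proof -
  obtain c0 where W: "Ck 2 W" "\<And>s. 0 \<le> W s" "{s. W s = 0} = {-1, 1}"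
    "deriv (deriv W) (-1) = deriv (deriv W) 1" "0 < deriv (deriv W) 1" "-1 < c0" "c0 < 1"
    "{s. deriv W s = 0} = {-1, c0, 1}" "Liminf at_infinity (\<lambda>s. ereal \<bar>deriv W s\<bar>) = \<infinity>"
    using assms by (auto simp: double_well_def)
  define w where "w = deriv (deriv W) 1"
  have C2: "Ck (Suc (Suc 0)) W" using W(1) by (simp add: numeral_2_eq_2)
  note D = Ck_real_has_derivative(1)[OF C2] and C1 = Ck_real_has_derivative(2)[OF C2]
  note D2 = Ck_real_has_derivative(1)[OF C1]
  have contW: "continuous_on UNIV W" using D by (meson DERIV_isCont continuous_at_imp_continuous_on)
  have contD: "continuous_on UNIV (deriv W)" using D2 by (meson DERIV_isCont continuous_at_imp_continuous_on)
  have W0: "W s = 0 \<longleftrightarrow> s = -1 \<or> s = 1" and D0: "deriv W s = 0 \<longleftrightarrow> s = -1 \<or> s = c0 \<or> s = 1" for s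
    using W(3,8) by auto
  obtain d1 where d1: "0 < d1" "d1 \<le> 1" "\<And>s. \<bar>s - 1\<bar> < d1 \<Longrightarrow> w / 4 * (s - 1)\<^sup>2 \<le> W s"
    using quadratic_lower_bound_at_minimum[OF D D2[of 1]] W0[of 1] D0[of 1] W(5) unfolding w_def by auto
  obtain d2 where d2: "0 < d2" "d2 \<le> 1" "\<And>s. \<bar>s - (-1)\<bar> < d2 \<Longrightarrow> w / 4 * (s - (-1))\<^sup>2 \<le> W s"
    using quadratic_lower_bound_at_minimum[OF D D2[of "-1"]] W0[of "-1"] D0[of "-1"] W(4,5) unfolding w_def by metis
  define Z where "Z = {-2..2::real} - ball 1 d1 - ball (-1) d2"
  have "compact Z" unfolding Z_def by (intro compact_diff open_ball) auto
  have "0 < W x" if "x \<in> Z" for x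
  proof -
    have "x \<noteq> 1" "x \<noteq> -1" using that d1(1) d2(1) by (auto simp: Z_def)
    then show ?thesis using W0[of x] W(2)[of x] by linarith
  qed
  then obtain m0 where m0: "0 < m0" "\<And>x. x \<in> Z \<Longrightarrow> m0 \<le> W x"
  proof (cases "Z = {}")
    case False
    with \<open>compact Z\<close> continuous_attains_inf[of Z W] continuous_on_subset[OF contW, of Z]
    obtain x where "x \<in> Z" "\<And>y. y \<in> Z \<Longrightarrow> W x \<le> W y" by auto
    with \<open>\<And>x. x \<in> Z \<Longrightarrow> 0 < W x\<close> that show thesis by blast
  next
    case True
    with that[of 1] show thesis by simp
  qed
  define b where "b = min (w / 4) m0"
  have "0 < b" using m0 W(5) by (simp add: b_def w_def)
  have inner: "b * (well_distance s)\<^sup>2 \<le> W s" if s: "\<bar>s\<bar> \<le> 2" for s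
  proof -
    consider "\<bar>s - 1\<bar> < d1" | "\<bar>s - (-1)\<bar> < d2" | "s \<in> Z"
    proof -
      have "s \<in> Z" if "\<not> \<bar>s - 1\<bar> < d1" "\<not> \<bar>s - (-1)\<bar> < d2"
        using s that unfolding Z_def by (auto simp: dist_real_def abs_minus_commute[of _ s])
      then show thesis using that by blast
    qed
    then show ?thesis
    proof cases
      case 1
      then have "well_distance s = \<bar>s - 1\<bar>" using d1 by (simp add: well_distance_def)
      then have "b * (well_distance s)\<^sup>2 \<le> w / 4 * (s - 1)\<^sup>2"
        by (simp only: power2_abs) (intro mult_right_mono; simp add: b_def)
      with d1(3)[OF 1] show ?thesis by simp
    next
      case 2
      then have "well_distance s = \<bar>s - (-1)\<bar>" using d2 by (auto simp: well_distance_def)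
      then have "b * (well_distance s)\<^sup>2 \<le> w / 4 * (s - (-1))\<^sup>2"
        by (simp only: power2_abs) (intro mult_right_mono; simp add: b_def)
      with d2(3)[OF 2] show ?thesis by simp
    next
      case 3
      have "\<bar>well_distance s\<bar> \<le> 1" using s by (auto simp: well_distance_def)
      then have "(well_distance s)\<^sup>2 \<le> 1" by (simp add: abs_square_le_1)
      then have "b * (well_distance s)\<^sup>2 \<le> b * 1" using \<open>0 < b\<close> by (intro mult_left_mono) auto
      with m0(2)[OF 3] show ?thesis by (simp add: b_def)
    qed
  qed
  have "1 < Liminf at_infinity (\<lambda>s. ereal \<bar>deriv W s\<bar>)" using W(9) by simp
  from less_LiminfD[OF this] obtain S where S: "\<And>s. S \<le> \<bar>s\<bar> \<Longrightarrow> 1 < \<bar>deriv W s\<bar>"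
    by (auto simp: eventually_at_infinity one_ereal_def)
  have Wpos: "0 < W s" if "1 < \<bar>s\<bar>" for s
    using W0[of s] W(2)[of s] that by (cases "W s = 0") auto
  have Dnz: "deriv W s \<noteq> 0" if "1 < \<bar>s\<bar>" for s
    using D0[of s] W(6,7) that by auto
  obtain a1 where a1: "0 < a1" "\<And>s. 2 \<le> s \<Longrightarrow> a1 * (s - 1) \<le> W s"
  proof (rule linear_lower_bound_at_infinity[OF D contD, of S])
    show "1 \<le> \<bar>deriv W s\<bar>" if "S \<le> s" for s
      using S[of s] that by (simp add: less_imp_le)
  qed (use W0[of 1] Wpos Dnz in auto)
  obtain a2 where a2: "0 < a2" "\<And>s. 2 \<le> s \<Longrightarrow> a2 * (s - 1) \<le> W (- s)"
  proof (rule linear_lower_bound_at_infinity[of "\<lambda>s. W (- s)" "\<lambda>s. - deriv W (- s)" S])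
    show "((\<lambda>s. W (- s)) has_real_derivative - deriv W (- s)) (at s)" for s
      by (rule DERIV_mirror[THEN iffD1, OF D])
    show "continuous_on UNIV (\<lambda>s. - deriv W (- s))"
      by (intro continuous_intros continuous_on_compose2[OF contD]) auto
    show "1 \<le> \<bar>- deriv W (- s)\<bar>" if "S \<le> s" for s
      using S[of "- s"] that by (simp add: less_imp_le)
  qed (use W0[of "-1"] Wpos Dnz in auto)
  have outer: "min a1 a2 * well_distance s \<le> W s" if "2 \<le> \<bar>s\<bar>" for s
  proof (cases "2 \<le> s")
    case True
    then have "min a1 a2 * well_distance s \<le> a1 * (s - 1)"
      by (intro mult_mono) (use a1 in \<open>auto simp: well_distance_def\<close>)
    with a1(2)[OF True] show ?thesis by simp
  next
    case False
    with that have "2 \<le> - s" by simp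
    then have "min a1 a2 * well_distance s \<le> a2 * (- s - 1)"
      by (intro mult_mono) (use a2 in \<open>auto simp: well_distance_def\<close>)
    with a2(2)[OF \<open>2 \<le> - s\<close>] show ?thesis by simp
  qed
  define c where "c = sqrt (min b (min a1 a2))"
  have c2: "c\<^sup>2 = min b (min a1 a2)" using \<open>0 < b\<close> a1 a2 by (simp add: c_def)
  show thesis
  proof (rule that[of c])
    show "0 < c" using \<open>0 < b\<close> a1 a2 by (simp add: c_def)
    show "(c * well_distance s)\<^sup>2 \<le> W s" if "\<bar>s\<bar> \<le> 2" for s
    proof -
      have "(c * well_distance s)\<^sup>2 \<le> b * (well_distance s)\<^sup>2"
        unfolding power_mult_distrib c2 by (intro mult_right_mono) auto
      with inner[OF that] show ?thesis by simp
    qed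
    show "c\<^sup>2 * well_distance s \<le> W s" if "2 \<le> \<bar>s\<bar>" for s
    proof -
      have "c\<^sup>2 * well_distance s \<le> min a1 a2 * well_distance s"
        unfolding c2 by (intro mult_right_mono) (auto simp: well_distance_def)
      with outer[OF that] show ?thesis by simp
    qed
  qed
qed

definition clamp1 :: "real \<Rightarrow> real" where
  "clamp1 s = max (- 1) (min 1 s)"

text \<open>The weight that is kept for the gradient term: \<open>sqrt W\<close> lowered by \<open>\<tau>\<close> between the wells and
  cut off to zero outside.\<close>

definition lowered_weight :: "(real \<Rightarrow> real) \<Rightarrow> real \<Rightarrow> real \<Rightarrow> real" where
  "lowered_weight W \<tau> s = max (sqrt (W (clamp1 s)) - \<tau>) 0"

text \<open>Lowering the weight by \<open>\<tau> = \<Lambda> \<epsilon>\<close> costs only \<open>O(\<epsilon>)\<close> in the total weight, but releases enough of the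
  potential energy to control any given multiple of the distance to the wells.  This controls
  the first order effects of the deviation of \<open>u\<close> from a two-phase function.\<close>

lemma Modica_Mortola_with_remainder:
  assumes "double_well W" "0 < K"
  obtains \<Lambda> K' \<epsilon>0 where "0 \<le> \<Lambda>" "0 \<le> K'" "0 < \<epsilon>0"
    "\<And>\<epsilon> s p. 0 < \<epsilon> \<Longrightarrow> \<epsilon> \<le> \<epsilon>0 \<Longrightarrow>
      sqrt 2 * (lowered_weight W (\<Lambda> * \<epsilon>) s * p) + K * well_distance s
        \<le> 1 / \<epsilon> * W s + \<epsilon> / 2 * p\<^sup>2 + K' * \<epsilon>"
proof -
  obtain c where c: "0 < c" "\<And>s. \<bar>s\<bar> \<le> 2 \<Longrightarrow> (c * well_distance s)\<^sup>2 \<le> W s"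
    "\<And>s. 2 \<le> \<bar>s\<bar> \<Longrightarrow> c\<^sup>2 * well_distance s \<le> W s"
    using double_well_coercive[OF assms(1)] by metis
  have W0: "W (-1) = 0" "W 1 = 0" and Wn: "\<And>s. 0 \<le> W s"
    using assms(1) by (auto simp: double_well_def)
  \<comment> \<open>between the wells \<open>sqrt W\<close> is at least \<open>c\<close> times the distance to the wells, so that lowering it
    by \<open>K / c * \<epsilon>\<close> releases at least \<open>K * \<epsilon>\<close> times that distance\<close>
  define \<Lambda> where "\<Lambda> = K / c"
  define K' where "K' = K\<^sup>2 / c\<^sup>2"
  have \<Lambda>: "0 < \<Lambda>" using assms c by (simp add: \<Lambda>_def)
  show thesis
  \<comment> \<open>for \<open>\<epsilon>\<close> up to \<open>c\<^sup>2 / K\<close> the factor \<open>c\<^sup>2 / \<epsilon>\<close> is at least \<open>K\<close>, as required far out, where \<open>W\<close> is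
    only known to grow linearly\<close>
  proof (rule that[of \<Lambda> K' "c\<^sup>2 / K"])
    show "0 \<le> \<Lambda>" "0 \<le> K'" "0 < c\<^sup>2 / K" using \<Lambda> assms c by (auto simp: K'_def)
    fix \<epsilon> s p :: real assume \<epsilon>: "0 < \<epsilon>" "\<epsilon> \<le> c\<^sup>2 / K"
    define q where "q = lowered_weight W (\<Lambda> * \<epsilon>) s"
    define x where "x = well_distance s"
    have "0 \<le> x" by (simp add: x_def well_distance_def)
    have young: "sqrt 2 * (q * p) \<le> 1 / \<epsilon> * q\<^sup>2 + \<epsilon> / 2 * p\<^sup>2"
    proof -
      have "0 \<le> (q * sqrt (1 / \<epsilon>) - p * sqrt (\<epsilon> / 2))\<^sup>2" by simp
      also have "\<dots> = q\<^sup>2 * (1 / \<epsilon>) + p\<^sup>2 * (\<epsilon> / 2) - 2 * (q * p) * (sqrt (1 / \<epsilon>) * sqrt (\<epsilon> / 2))"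
        using \<epsilon> by (simp add: power2_diff power_mult_distrib algebra_simps)
      also have "sqrt (1 / \<epsilon>) * sqrt (\<epsilon> / 2) = sqrt 2 / 2"
        using \<epsilon> by (simp add: real_sqrt_mult[symmetric] real_sqrt_divide real_div_sqrt field_simps)
      finally show ?thesis by (simp add: algebra_simps)
    qed
    have "K * x \<le> 1 / \<epsilon> * (W s - q\<^sup>2) + K' * \<epsilon>"
    proof (cases "\<bar>s\<bar> \<le> 1")
      case True
      then have "clamp1 s = s" by (simp add: clamp1_def)
      define \<omega> where "\<omega> = sqrt (W s)"
      have W: "W s = \<omega>\<^sup>2" "0 \<le> \<omega>" using Wn by (simp_all add: \<omega>_def)
      have "c * x \<le> \<omega>"
        using c(2)[of s] True \<open>0 \<le> x\<close> c(1) W by (auto simp: x_def intro: power2_le_imp_le)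
      show ?thesis
      proof (cases "\<Lambda> * \<epsilon> \<le> \<omega>")
        case True
        then have q: "q = \<omega> - \<Lambda> * \<epsilon>" using \<open>clamp1 s = s\<close> by (simp add: q_def lowered_weight_def \<omega>_def)
        have "W s - q\<^sup>2 = 2 * (\<omega> * (\<Lambda> * \<epsilon>)) - (\<Lambda> * \<epsilon>)\<^sup>2"
          unfolding q W by (simp add: power2_eq_square algebra_simps)
        moreover have "(\<Lambda> * \<epsilon>)\<^sup>2 \<le> \<omega> * (\<Lambda> * \<epsilon>)"
          unfolding power2_eq_square using True \<Lambda> \<epsilon> by (intro mult_right_mono) auto
        ultimately have "\<omega> * (\<Lambda> * \<epsilon>) \<le> W s - q\<^sup>2" by linarith
        then have "1 / \<epsilon> * (\<omega> * (\<Lambda> * \<epsilon>)) \<le> 1 / \<epsilon> * (W s - q\<^sup>2)"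
          using \<epsilon> by (intro mult_left_mono) auto
        moreover have "K * x \<le> \<omega> * \<Lambda>"
          using \<open>c * x \<le> \<omega>\<close> c(1) assms(2) by (simp add: \<Lambda>_def field_simps)
        moreover have "0 \<le> K' * \<epsilon>" using \<epsilon> by (simp add: K'_def)
        ultimately show ?thesis using \<epsilon> by simp
      next
        case False
        then have q: "q = 0" using \<open>clamp1 s = s\<close> by (simp add: q_def lowered_weight_def \<omega>_def)
        have "c * x \<le> \<Lambda> * \<epsilon>" using False \<open>c * x \<le> \<omega>\<close> by simp
        then have "x \<le> K * \<epsilon> / c\<^sup>2" using c(1) by (simp add: \<Lambda>_def field_simps power2_eq_square)
        then have "K * x \<le> K * (K * \<epsilon> / c\<^sup>2)" using assms(2) by (intro mult_left_mono) auto
        also have "\<dots> = K' * \<epsilon>" by (simp add: K'_def power2_eq_square)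
        finally have "K * x \<le> K' * \<epsilon>" .
        moreover have "0 \<le> 1 / \<epsilon> * W s" using \<epsilon> Wn[of s] by simp
        ultimately show ?thesis by (simp add: q)
      qed
    next
      case False
      then have "clamp1 s = 1 \<or> clamp1 s = -1" by (auto simp: clamp1_def min_def max_def)
      then have q: "q = 0" using W0 \<Lambda> \<epsilon> by (auto simp: q_def lowered_weight_def max_def)
      show ?thesis
      proof (cases "\<bar>s\<bar> \<le> 2")
        case True
        have "0 \<le> (c * x / sqrt \<epsilon> - K * sqrt \<epsilon> / (2 * c))\<^sup>2" by simp
        also have "\<dots> = 1 / \<epsilon> * (c * x)\<^sup>2 + K\<^sup>2 * \<epsilon> / (4 * c\<^sup>2) - K * x"
          using \<epsilon> c(1) by (simp add: power2_diff power_divide power_mult_distrib)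
        also have "K\<^sup>2 * \<epsilon> / (4 * c\<^sup>2) \<le> K' * \<epsilon>"
          using \<epsilon> c(1) by (simp add: K'_def field_simps)
        also have "1 / \<epsilon> * (c * x)\<^sup>2 \<le> 1 / \<epsilon> * W s"
          using c(2)[OF True] \<epsilon> by (intro mult_left_mono) (auto simp: x_def)
        finally show ?thesis by (simp add: q)
      next
        case False
        then have "c\<^sup>2 * x \<le> W s" using c(3)[of s] by (simp add: x_def)
        then have "1 / \<epsilon> * (c\<^sup>2 * x) \<le> 1 / \<epsilon> * W s" using \<epsilon> by (intro mult_left_mono) auto
        moreover have "K \<le> 1 / \<epsilon> * c\<^sup>2" using \<epsilon> assms(2) by (simp add: field_simps)
        then have "K * x \<le> 1 / \<epsilon> * c\<^sup>2 * x" using \<open>0 \<le> x\<close> by (intro mult_right_mono) auto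
        moreover have "0 \<le> K' * \<epsilon>" using \<epsilon> by (simp add: K'_def)
        ultimately show ?thesis by (simp add: q)
      qed
    qed
    then have "sqrt 2 * (q * p) + K * x \<le> 1 / \<epsilon> * q\<^sup>2 + \<epsilon> / 2 * p\<^sup>2 + 1 / \<epsilon> * (W s - q\<^sup>2) + K' * \<epsilon>"
      using young by linarith
    also have "\<dots> = 1 / \<epsilon> * W s + \<epsilon> / 2 * p\<^sup>2 + K' * \<epsilon>" by (simp add: algebra_simps)
    finally show "sqrt 2 * (lowered_weight W (\<Lambda> * \<epsilon>) s * p) + K * well_distance s
        \<le> 1 / \<epsilon> * W s + \<epsilon> / 2 * p\<^sup>2 + K' * \<epsilon>"
      by (simp add: q_def x_def)
  qed
qed


section \<open>The isoperimetric function\<close>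

lemma slab_emeasure_le:
  fixes b :: "'a::euclidean_space"
  assumes b: "b \<in> Basis" and "0 \<le> c" "0 \<le> t" and \<Omega>: "\<Omega> \<subseteq> cbox (- (c *\<^sub>R One)) (c *\<^sub>R One)"
  shows "emeasure lborel {x \<in> \<Omega>. \<alpha> \<le> x \<bullet> b \<and> x \<bullet> b \<le> \<alpha> + t} \<le> ennreal (t * (2 * c) ^ (DIM('a) - 1))"
proof -
  define l where "l = (\<Sum>i\<in>Basis. (if i = b then \<alpha> else - c) *\<^sub>R i)"
  define u where "u = (\<Sum>i\<in>Basis. (if i = b then \<alpha> + t else c) *\<^sub>R i)"
  have l: "l \<bullet> i = (if i = b then \<alpha> else - c)" and u: "u \<bullet> i = (if i = b then \<alpha> + t else c)"
    if "i \<in> Basis" for i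
    using that by (simp_all add: l_def u_def inner_sum_left_Basis)
  have "{x \<in> \<Omega>. \<alpha> \<le> x \<bullet> b \<and> x \<bullet> b \<le> \<alpha> + t} \<subseteq> cbox l u"
  proof
    fix x assume x: "x \<in> {x \<in> \<Omega>. \<alpha> \<le> x \<bullet> b \<and> x \<bullet> b \<le> \<alpha> + t}"
    with \<Omega> have "x \<in> cbox (- (c *\<^sub>R One)) (c *\<^sub>R One)" by auto
    then have "- c \<le> x \<bullet> i \<and> x \<bullet> i \<le> c" if "i \<in> Basis" for i
      using that by (auto simp: mem_box)
    with x show "x \<in> cbox l u" by (auto simp: mem_box l u)
  qed
  then have "emeasure lborel {x \<in> \<Omega>. \<alpha> \<le> x \<bullet> b \<and> x \<bullet> b \<le> \<alpha> + t} \<le> emeasure lborel (cbox l u)"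
    by (rule emeasure_mono) simp
  also have "\<dots> = ennreal (\<Prod>i\<in>Basis. (u - l) \<bullet> i)"
    by (rule emeasure_lborel_cbox) (use assms in \<open>simp add: l u\<close>)
  also have "(\<Prod>i\<in>Basis. (u - l) \<bullet> i) = (\<Prod>i\<in>Basis. if i = b then t else 2 * c)"
    by (intro prod.cong) (auto simp: inner_diff_left l u)
  also have "\<dots> = t * (\<Prod>i\<in>Basis - {b}. 2 * c)"
    using b by (subst prod.remove[of Basis b]) (auto intro!: arg_cong2[where f = "(*)"] prod.cong)
  also have "\<dots> = t * (2 * c) ^ (DIM('a) - 1)"
    using b by (simp add: card_Diff_singleton)
  finally show ?thesis .
qed

text \<open>Half-space cuts of \<open>\<Omega>\<close> are sublevel sets of a coordinate, so that their perimeters are estimated like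
  those of sublevel sets of any Sobolev function.\<close>

lemma coordinate_weak_pair:
  fixes b :: "'a::euclidean_space"
  assumes \<Omega>: "open \<Omega>" "bounded \<Omega>" and b: "b \<in> Basis"
  shows "weak_pair \<Omega> (\<lambda>x. indicator \<Omega> x * (x \<bullet> b)) (\<lambda>x. indicator \<Omega> x *\<^sub>R b)"
proof -
  have [measurable]: "\<Omega> \<in> sets borel" using \<Omega> by simp
  obtain R where R: "\<And>x. x \<in> \<Omega> \<Longrightarrow> norm x \<le> R" using \<Omega>(2) by (auto simp: bounded_iff)
  have int1: "integrable lborel (indicator \<Omega> :: 'a \<Rightarrow> real)"
    using emeasure_bounded_finite[OF \<Omega>(2)] by simp
  show ?thesis
    unfolding weak_pair_def
  proof (intro conjI ballI)
    show "integrable lborel (\<lambda>x. indicator \<Omega> x * (x \<bullet> b))"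
    proof (rule Bochner_Integration.integrable_bound)
      show "integrable lborel (\<lambda>x. R * indicator \<Omega> x :: real)" using int1 by simp
      show "AE x in lborel. norm (indicator \<Omega> x * (x \<bullet> b)) \<le> norm (R * indicator \<Omega> x)"
      proof (rule AE_I2)
        fix x
        have "\<bar>x \<bullet> b\<bar> \<le> norm x" using Basis_le_norm[OF b] .
        then show "norm (indicator \<Omega> x * (x \<bullet> b)) \<le> norm (R * indicator \<Omega> x)"
          using R[of x] by (auto simp: indicator_def)
      qed
    qed measurable
    show "integrable lborel (\<lambda>x. indicator \<Omega> x *\<^sub>R b)" using int1 by simp
    fix \<phi> and e :: 'a assume \<phi>: "\<phi> \<in> test_functions \<Omega>" and e: "e \<in> Basis"
    note t = test_functionsD[OF \<phi>]
    note K = t(1,2) and cont = t(3) and out = t(4) and dg = t(5) and contg = t(6) and outg = t(7)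
    define D where "D x = (x \<bullet> b) *\<^sub>R gradient_of \<phi> x + \<phi> x *\<^sub>R b" for x
    have der: "((\<lambda>x. (x \<bullet> b) * \<phi> x) has_derivative (\<lambda>v. D x \<bullet> v)) (at x)" for x
    proof -
      have "((\<lambda>x. (x \<bullet> b) * \<phi> x) has_derivative (\<lambda>v. (x \<bullet> b) * (gradient_of \<phi> x \<bullet> v) + (v \<bullet> b) * \<phi> x)) (at x)"
        by (intro has_derivative_mult dg has_derivative_inner_left has_derivative_ident)
      then show ?thesis by (simp add: D_def inner_simps inner_commute mult.commute)
    qed
    have contD: "continuous_on UNIV D" unfolding D_def by (intro continuous_intros contg cont)
    have "(x \<bullet> b) * \<phi> x = 0" if "x \<notin> closure {x. \<phi> x \<noteq> 0}" for x using out[OF that] by simp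
    from integral_gradient_eq_0[OF der contD K(1) this]
    have "(LINT x|lborel. (x \<bullet> b) * (gradient_of \<phi> x \<bullet> e) + \<phi> x * (b \<bullet> e)) = 0"
      by (simp add: D_def inner_simps)
    moreover have "integrable lborel (\<lambda>x. (x \<bullet> b) * (gradient_of \<phi> x \<bullet> e))"
    proof (rule compactly_supported_integrable[OF _ K(1)])
      show "continuous_on UNIV (\<lambda>x. (x \<bullet> b) * (gradient_of \<phi> x \<bullet> e))" by (intro continuous_intros contg)
      show "(x \<bullet> b) * (gradient_of \<phi> x \<bullet> e) = 0" if "x \<notin> closure {x. \<phi> x \<noteq> 0}" for x using outg[OF that] by simp
    qed
    moreover have "integrable lborel (\<lambda>x. \<phi> x * (b \<bullet> e))"
    proof (rule compactly_supported_integrable[OF _ K(1)])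
      show "continuous_on UNIV (\<lambda>x. \<phi> x * (b \<bullet> e))" by (intro continuous_intros cont)
      show "\<phi> x * (b \<bullet> e) = 0" if "x \<notin> closure {x. \<phi> x \<noteq> 0}" for x using out[OF that] by simp
    qed
    ultimately have "(LINT x|lborel. (x \<bullet> b) * (gradient_of \<phi> x \<bullet> e)) = - (LINT x|lborel. \<phi> x * (b \<bullet> e))"
      by simp
    moreover have "(\<lambda>x. indicator \<Omega> x * (x \<bullet> b) * frechet_derivative \<phi> (at x) e) = (\<lambda>x. (x \<bullet> b) * (gradient_of \<phi> x \<bullet> e))"
    proof
      fix x show "indicator \<Omega> x * (x \<bullet> b) * frechet_derivative \<phi> (at x) e = (x \<bullet> b) * (gradient_of \<phi> x \<bullet> e)"
      proof (cases "x \<in> \<Omega>")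
        case False
        then have "x \<notin> closure {x. \<phi> x \<noteq> 0}" using K(2) by blast
        from outg[OF this] False show ?thesis by simp
      qed (simp add: t(8))
    qed
    moreover have "(\<lambda>x. (indicator \<Omega> x *\<^sub>R b) \<bullet> e * \<phi> x) = (\<lambda>x. \<phi> x * (b \<bullet> e))"
    proof
      fix x show "(indicator \<Omega> x *\<^sub>R b) \<bullet> e * \<phi> x = \<phi> x * (b \<bullet> e)"
      proof (cases "x \<in> \<Omega>")
        case False
        then have "x \<notin> closure {x. \<phi> x \<noteq> 0}" using K(2) by blast
        from out[OF this] False show ?thesis by simp
      qed simp
    qed
    ultimately show "(LINT x|lborel. indicator \<Omega> x * (x \<bullet> b) * frechet_derivative \<phi> (at x) e)
        = - (LINT x|lborel. (indicator \<Omega> x *\<^sub>R b) \<bullet> e * \<phi> x)"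
      by simp
  qed
qed

text \<open>Half-space cuts of \<open>\<Omega>\<close> have finite perimeter and realise every volume.\<close>

lemma isoperimetric_finite:
  fixes \<Omega> :: "'a::euclidean_space set"
  assumes \<Omega>: "open \<Omega>" "bounded \<Omega>" and r: "0 \<le> r" "r \<le> measure lebesgue \<Omega>"
  shows "isoperimetric \<Omega> r < \<infinity>"
proof -
  obtain b :: 'a where b: "b \<in> Basis" using nonempty_Basis by blast
  have [measurable]: "\<Omega> \<in> sets borel" using \<Omega> by simp
  obtain c where c: "\<Omega> \<subseteq> cbox (- (c *\<^sub>R One)) (c *\<^sub>R One)" "0 < c"
  proof -
    obtain R where R: "\<And>x. x \<in> \<Omega> \<Longrightarrow> norm x \<le> R" using \<Omega>(2) by (auto simp: bounded_iff)
    have "\<bar>x \<bullet> i\<bar> \<le> max R 1" if "x \<in> \<Omega>" "i \<in> Basis" for x i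
      using R[OF that(1)] Basis_le_norm[OF that(2), of x] by simp
    then have "\<Omega> \<subseteq> cbox (- (max R 1 *\<^sub>R One)) (max R 1 *\<^sub>R One)"
      by (fastforce simp: mem_box abs_le_iff)
    then show thesis by (rule that) simp
  qed
  define M where "M = (2 * c) ^ (DIM('a) - 1)"
  have "0 \<le> M" using c by (simp add: M_def)
  define E where "E a = {x \<in> \<Omega>. x \<bullet> b \<le> a}" for a
  have E[measurable]: "E a \<in> sets borel" for a unfolding E_def by measurable
  have fin: "emeasure lborel A < \<infinity>" if "A \<subseteq> \<Omega>" for A
    using emeasure_bounded_finite[OF bounded_subset[OF \<Omega>(2) that]] .
  \<comment> \<open>the volume that is cut off depends continuously on the position of the hyperplane and thus takes all values\<close>
  define f where "f a = measure lborel (E a)" for a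
  have step: "f a \<le> f a' \<and> f a' \<le> f a + (a' - a) * M" if "a \<le> a'" for a a'
  proof
    show "f a \<le> f a'" unfolding f_def
    proof (rule measure_mono_fmeasurable)
      have sub: "E a' \<subseteq> \<Omega>" by (auto simp: E_def)
      show "E a' \<in> fmeasurable lborel" using fin[OF sub] E[of a'] by (simp add: fmeasurable_def)
      show "E a \<subseteq> E a'" using that by (auto simp: E_def)
    qed simp
    have "emeasure lborel (E a') \<le> emeasure lborel (E a \<union> {x \<in> \<Omega>. a \<le> x \<bullet> b \<and> x \<bullet> b \<le> a + (a' - a)})"
      by (rule emeasure_mono) (auto simp: E_def)
    also have "\<dots> \<le> emeasure lborel (E a) + emeasure lborel {x \<in> \<Omega>. a \<le> x \<bullet> b \<and> x \<bullet> b \<le> a + (a' - a)}"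
    proof (rule emeasure_subadditive)
      have "{x \<in> \<Omega>. a \<le> x \<bullet> b \<and> x \<bullet> b \<le> a + (a' - a)} \<in> sets borel" by measurable
      then show "{x \<in> \<Omega>. a \<le> x \<bullet> b \<and> x \<bullet> b \<le> a + (a' - a)} \<in> sets lborel" by simp
    qed (use E in simp)
    also have "\<dots> \<le> emeasure lborel (E a) + ennreal ((a' - a) * M)"
      unfolding M_def by (intro add_left_mono slab_emeasure_le[OF b _ _ c(1)]) (use c that in auto)
    finally have "emeasure lborel (E a') \<le> emeasure lborel (E a) + ennreal ((a' - a) * M)" .
    moreover have "emeasure lborel (E d) = ennreal (f d)" for d
      unfolding f_def using fin[of "E d"] by (intro emeasure_eq_ennreal_measure) (auto simp: E_def)
    ultimately have "ennreal (f a') \<le> ennreal (f a + (a' - a) * M)"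
      using that \<open>0 \<le> M\<close> by (simp add: f_def)
    then show "f a' \<le> f a + (a' - a) * M"
      using that \<open>0 \<le> M\<close> by (subst (asm) ennreal_le_iff) (auto simp: f_def)
  qed
  have lip: "\<bar>f x - f y\<bar> \<le> M * \<bar>x - y\<bar>" for x y
    using step[of x y] step[of y x] by (cases "x \<le> y") (auto simp: mult.commute abs_if)
  have "continuous_on UNIV f"
  proof (rule lipschitz_on_continuous_on[of M])
    show "M-lipschitz_on UNIV f"
      using lip \<open>0 \<le> M\<close> by (intro lipschitz_onI) (auto simp: dist_real_def)
  qed
  then have "continuous_on {- c - 1..c} f" by (rule continuous_on_subset) simp
  moreover have "f (- c - 1) \<le> r"
  proof -
    have "E (- c - 1) = {}"
      using c b by (force simp: E_def mem_box)
    then show ?thesis using r by (simp add: f_def)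
  qed
  moreover have "r \<le> f c"
  proof -
    have "E c = \<Omega>"
      using c b by (force simp: E_def mem_box)
    then show ?thesis using r by (simp add: f_def measure_completion)
  qed
  ultimately obtain a where a: "f a = r" using IVT'[of f "- c - 1" r c] c(2) by auto
  obtain B where B: "0 < B" "\<And>t::real. \<bar>mollifier 1 t\<bar> \<le> B" using mollifier_bounded[of 1, where 'a = real] by auto
  have "ennreal 1 * perimeter {x \<in> \<Omega>. indicator \<Omega> x * (x \<bullet> b) \<le> a} \<Omega>
      \<le> liminf (\<lambda>j. ennreal 1 * (\<integral>\<^sup>+x. ennreal (real (Suc j) * mollifier 1 (real (Suc j) * (indicator \<Omega> x * (x \<bullet> b) - a) - 1))
        * ennreal (norm (indicator \<Omega> x *\<^sub>R b)) \<partial>lborel))"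
    by (rule perimeter_sublevel_le[OF \<Omega>(1) coordinate_weak_pair[OF \<Omega> b]]) simp
  also have "\<dots> \<le> ennreal (2 * B * M)"
  proof (rule order_trans[OF Liminf_mono[OF always_eventually, rule_format] eq_refl[OF Liminf_const]])
    fix j
    let ?S = "{x \<in> \<Omega>. a \<le> x \<bullet> b \<and> x \<bullet> b \<le> a + 2 / real (Suc j)}"
    have pt: "ennreal (real (Suc j) * mollifier 1 (real (Suc j) * (indicator \<Omega> x * (x \<bullet> b) - a) - 1))
        * ennreal (norm (indicator \<Omega> x *\<^sub>R b)) \<le> ennreal (real (Suc j) * B) * indicator ?S x" for x
    proof (cases "x \<in> \<Omega>")
      case True
      show ?thesis
      proof (cases "x \<in> ?S")
        case True
        have "real (Suc j) * mollifier 1 (real (Suc j) * (x \<bullet> b - a) - 1) \<le> real (Suc j) * B"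
          using B(2) by (intro mult_left_mono) (auto simp: abs_le_iff)
        then show ?thesis using True b by (auto intro!: ennreal_leI)
      next
        case False
        have "1 \<le> norm (real (Suc j) * (x \<bullet> b - a) - 1)"
        proof (cases "a \<le> x \<bullet> b")
          case True
          with False \<open>x \<in> \<Omega>\<close> have "2 / real (Suc j) < x \<bullet> b - a" by auto
          then have "2 < real (Suc j) * (x \<bullet> b - a)" by (simp add: field_simps)
          then show ?thesis by simp
        next
          case False
          then have "real (Suc j) * (x \<bullet> b - a) \<le> 0" by (intro mult_nonneg_nonpos) auto
          then show ?thesis by simp
        qed
        from mollifier_outside[OF _ this] True show ?thesis by simp
      qed
    qed simp
    have "ennreal 1 * (\<integral>\<^sup>+x. ennreal (real (Suc j) * mollifier 1 (real (Suc j) * (indicator \<Omega> x * (x \<bullet> b) - a) - 1))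
        * ennreal (norm (indicator \<Omega> x *\<^sub>R b)) \<partial>lborel)
        \<le> (\<integral>\<^sup>+x. ennreal (real (Suc j) * B) * indicator ?S x \<partial>lborel)"
      unfolding ennreal_1 mult_1_left by (intro nn_integral_mono pt)
    also have "\<dots> = ennreal (real (Suc j) * B) * emeasure lborel ?S"
      by (rule nn_integral_cmult_indicator) measurable
    also have "\<dots> \<le> ennreal (real (Suc j) * B) * ennreal (2 / real (Suc j) * M)"
      unfolding M_def by (intro mult_left_mono slab_emeasure_le[OF b _ _ c(1)]) (use c in auto)
    also have "\<dots> = ennreal (real (Suc j) * B * (2 / real (Suc j) * M))"
      using B \<open>0 \<le> M\<close> by (subst ennreal_mult) auto
    also have "real (Suc j) * B * (2 / real (Suc j) * M) = 2 * B * M" by (simp del: of_nat_Suc)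
    finally show "ennreal 1 * (\<integral>\<^sup>+x. ennreal (real (Suc j) * mollifier 1 (real (Suc j) * (indicator \<Omega> x * (x \<bullet> b) - a) - 1))
        * ennreal (norm (indicator \<Omega> x *\<^sub>R b)) \<partial>lborel) \<le> ennreal (2 * B * M)" .
  qed simp
  also have "{x \<in> \<Omega>. indicator \<Omega> x * (x \<bullet> b) \<le> a} = E a" by (auto simp: E_def)
  finally have "perimeter (E a) \<Omega> < \<infinity>" by (simp add: le_less_trans[OF _ ennreal_less_top])
  moreover have "isoperimetric \<Omega> r \<le> perimeter (E a) \<Omega>"
    unfolding isoperimetric_def
    by (rule INF_lower) (use a in \<open>auto simp: E_def f_def measure_completion\<close>)
  ultimately show ?thesis by (rule le_less_trans[rotated])
qed

text \<open>Differentiability at \<open>r0\<close> gives a linear lower bound near \<open>r0\<close>; away from \<open>r0\<close> nonnegativity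
  suffices.\<close>

lemma isoperimetric_linear_lower_bound:
  assumes diff: "(\<lambda>r. enn2real (isoperimetric \<Omega> r)) differentiable (at r0)"
  obtains L where "0 \<le> L" "\<And>r. ennreal (enn2real (isoperimetric \<Omega> r0) - L * \<bar>r - r0\<bar>) \<le> isoperimetric \<Omega> r"
proof -
  define f where "f r = enn2real (isoperimetric \<Omega> r)" for r
  obtain D where D: "(f has_derivative D) (at r0)" using diff by (auto simp: differentiable_def f_def[abs_def])
  then obtain d where d: "0 < d" "\<And>y. norm (y - r0) < d \<Longrightarrow> norm (f y - f r0 - D (y - r0)) \<le> 1 * norm (y - r0)"
    unfolding has_derivative_at_alt by (meson zero_less_one)
  interpret D: bounded_linear D by (rule has_derivative_bounded_linear[OF D])
  \<comment> \<open>the increment \<open>1\<close> absorbs the first order remainder; the last summand makes the lower bound nonpositive at distance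
    at least \<open>d\<close> from \<open>r0\<close>\<close>
  define L where "L = \<bar>D 1\<bar> + 1 + f r0 / d"
  have f0: "0 \<le> f r" for r by (simp add: f_def)
  have "0 \<le> L" using d f0 by (simp add: L_def)
  moreover have "ennreal (f r0 - L * \<bar>r - r0\<bar>) \<le> isoperimetric \<Omega> r" for r
  proof -
    have "f r0 - L * \<bar>r - r0\<bar> \<le> f r"
    proof (cases "\<bar>r - r0\<bar> < d")
      case True
      have "D (r - r0) = (r - r0) * D 1" using D.scaleR[of "r - r0" 1] by simp
      then have "\<bar>D (r - r0)\<bar> = \<bar>D 1\<bar> * \<bar>r - r0\<bar>" by (simp add: abs_mult)
      with d(2)[of r] True have "f r0 - f r \<le> \<bar>r - r0\<bar> + \<bar>D 1\<bar> * \<bar>r - r0\<bar>" by simp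
      also have "\<dots> \<le> L * \<bar>r - r0\<bar>" using d f0[of r0] by (simp add: L_def algebra_simps)
      finally show ?thesis by simp
    next
      case False
      have "f r0 / d * d \<le> L * \<bar>r - r0\<bar>"
        using False d f0[of r0] \<open>0 \<le> L\<close> by (intro mult_mono) (auto simp: L_def)
      then show ?thesis using d f0[of r] by simp
    qed
    then have "ennreal (f r0 - L * \<bar>r - r0\<bar>) \<le> ennreal (f r)" by (rule ennreal_leI)
    also have "\<dots> \<le> isoperimetric \<Omega> r"
      unfolding f_def by (cases "isoperimetric \<Omega> r") auto
    finally show ?thesis .
  qed
  ultimately show thesis using that by (simp add: f_def[abs_def])
qed


section \<open>The energy lower bound\<close>

text \<open>If \<open>t\<close> is one of the wells, the integrand vanishes at almost every level; in general the integral is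
  therefore of the order of the distance of \<open>t\<close> to the wells.\<close>

lemma deviation_on_levels:
  "(\<integral>\<^sup>+s. ennreal \<bar>(if t \<le> s then 1 else 0) - (1 - t) / 2\<bar> * indicator {-1..1} s \<partial>lborel)
    \<le> ennreal (2 * well_distance t)" (is "?I \<le> _")
proof -
  consider "t \<le> -1 \<or> 1 < t" | "-1 \<le> t" "t \<le> 1" by linarith
  then show ?thesis
  proof cases
    case 1
    have "?I = (\<integral>\<^sup>+s. ennreal (well_distance t / 2) * indicator {-1..1} s \<partial>(lborel::real measure))"
      using 1 by (intro nn_integral_cong) (auto simp: indicator_def well_distance_def abs_if field_simps)
    also have "\<dots> = ennreal (well_distance t / 2) * ennreal 2"
      by (subst nn_integral_cmult_indicator) auto
    also have "\<dots> = ennreal (well_distance t)"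
      by (subst ennreal_mult[symmetric]) (auto simp: well_distance_def)
    also have "\<dots> \<le> ennreal (2 * well_distance t)" by (intro ennreal_leI) (simp add: well_distance_def)
    finally show ?thesis .
  next
    case 2
    have "?I \<le> (\<integral>\<^sup>+s. ennreal ((1 + t) / 2) * indicator {t..1} s + ennreal ((1 - t) / 2) * indicator {-1..t} s \<partial>(lborel::real measure))"
    proof (intro nn_integral_mono)
      fix s :: real
      have "1 - (1 - t) / 2 = (1 + t) / 2" by (simp add: field_simps)
      then show "ennreal \<bar>(if t \<le> s then 1 else 0) - (1 - t) / 2\<bar> * indicator {-1..1} s
          \<le> ennreal ((1 + t) / 2) * indicator {t..1} s + ennreal ((1 - t) / 2) * indicator {-1..t} s"
        using 2 by (auto simp: indicator_def simp flip: ennreal_plus) (simp add: field_simps)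
    qed
    also have "\<dots> = ennreal ((1 + t) / 2) * ennreal (1 - t) + ennreal ((1 - t) / 2) * ennreal (t - (-1))"
      using 2 by (subst nn_integral_add) (auto simp: nn_integral_cmult_indicator)
    also have "\<dots> = ennreal ((1 + t) / 2 * (1 - t) + (1 - t) / 2 * (t - (-1)))"
      using 2 by (subst (1 2) ennreal_mult[symmetric]) (auto simp: ennreal_plus)
    also have "\<dots> \<le> ennreal (2 * well_distance t)"
    proof (rule ennreal_leI)
      have "\<bar>t\<bar> \<le> 1" using 2 by auto
      have "(1 + t) / 2 * (1 - t) + (1 - t) / 2 * (t - (-1)) = (1 - \<bar>t\<bar>) * (1 + \<bar>t\<bar>)"
        by (auto simp: field_simps abs_if)
      also have "\<dots> \<le> (1 - \<bar>t\<bar>) * 2" using \<open>\<bar>t\<bar> \<le> 1\<close> by (intro mult_left_mono) auto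
      finally show "(1 + t) / 2 * (1 - t) + (1 - t) / 2 * (t - (-1)) \<le> 2 * well_distance t"
        using \<open>\<bar>t\<bar> \<le> 1\<close> by (simp add: well_distance_def)
    qed
    finally show ?thesis .
  qed
qed

text \<open>For a two-phase function all sublevels between the wells have the volume prescribed by the
  mass.  In general \<open>m\<close> expresses that volume as the integral of \<open>(1 - U) / 2\<close>, so that the
  deviation is an integral over \<open>x\<close> of a quantity that vanishes at the wells.\<close>

lemma sublevel_volume_deviation:
  fixes U :: "'a::euclidean_space \<Rightarrow> real"
  assumes U: "integrable lborel U" and \<Omega>: "\<Omega> \<in> sets borel" "emeasure lborel \<Omega> = 1"
    and out: "\<And>x. x \<notin> \<Omega> \<Longrightarrow> U x = 0" and m: "(LINT x|lborel. U x) = m"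
  shows "(\<integral>\<^sup>+s. ennreal \<bar>measure lborel {x \<in> \<Omega>. U x \<le> s} - (1 - m) / 2\<bar> * indicator {-1..1} s \<partial>lborel)
    \<le> (\<integral>\<^sup>+x. ennreal (2 * well_distance (U x)) * indicator \<Omega> x \<partial>lborel)"
proof -
  have [measurable]: "U \<in> borel_measurable borel" "\<Omega> \<in> sets borel"
    using U \<Omega> by (auto dest: borel_measurable_integrable)
  let ?h = "\<lambda>s x. (if U x \<le> s then 1 else 0) - (1 - U x) / 2 :: real"
  have level: "ennreal \<bar>measure lborel {x \<in> \<Omega>. U x \<le> s} - (1 - m) / 2\<bar>
      \<le> (\<integral>\<^sup>+x. ennreal \<bar>?h s x\<bar> * indicator \<Omega> x \<partial>lborel)" for s
  proof -
    let ?E = "{x \<in> \<Omega>. U x \<le> s}"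
    have "?E \<in> sets borel" by measurable
    have "emeasure lborel ?E \<le> emeasure lborel \<Omega>" by (rule emeasure_mono) auto
    then have "emeasure lborel ?E < \<infinity>" using \<Omega>(2) by (simp add: le_less_trans)
    then have i: "integrable lborel (indicator ?E :: 'a \<Rightarrow> real)" "integrable lborel (indicator \<Omega> :: 'a \<Rightarrow> real)"
      using \<Omega> \<open>?E \<in> sets borel\<close> by auto
    have "(LINT x|lborel. indicator ?E x - (indicator \<Omega> x - U x) / 2)
        = (LINT x|lborel. indicator ?E x) - ((LINT x|lborel. indicator \<Omega> x) - (LINT x|lborel. U x)) / 2"
      using i U by simp
    also have "\<dots> = measure lborel ?E - (1 - m) / 2"
      using \<Omega>(2) by (simp add: m measure_def)
    finally have "ennreal \<bar>measure lborel ?E - (1 - m) / 2\<bar>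
        = ennreal (norm (LINT x|lborel. indicator ?E x - (indicator \<Omega> x - U x) / 2))" by simp
    also have "\<dots> \<le> (\<integral>\<^sup>+x. norm (indicator ?E x - (indicator \<Omega> x - U x) / 2) \<partial>lborel)"
      by (rule norm_integral_le_nn_integral)
    also have "\<dots> = (\<integral>\<^sup>+x. ennreal \<bar>?h s x\<bar> * indicator \<Omega> x \<partial>lborel)"
      by (intro nn_integral_cong) (auto simp: indicator_def out)
    finally show ?thesis .
  qed
  have "(\<integral>\<^sup>+s. ennreal \<bar>measure lborel {x \<in> \<Omega>. U x \<le> s} - (1 - m) / 2\<bar> * indicator {-1..1} s \<partial>lborel)
      \<le> (\<integral>\<^sup>+s. (\<integral>\<^sup>+x. ennreal \<bar>?h s x\<bar> * indicator \<Omega> x \<partial>lborel) * indicator {-1..1} s \<partial>lborel)"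
    by (intro nn_integral_mono mult_right_mono level) auto
  also have "\<dots> = (\<integral>\<^sup>+s. \<integral>\<^sup>+x. ennreal \<bar>?h s x\<bar> * indicator \<Omega> x * indicator {-1..1} s \<partial>lborel \<partial>lborel)"
    by (intro nn_integral_cong nn_integral_multc[symmetric]) measurable
  also have "\<dots> = (\<integral>\<^sup>+x. \<integral>\<^sup>+s. ennreal \<bar>?h s x\<bar> * indicator \<Omega> x * indicator {-1..1} s \<partial>lborel \<partial>lborel)"
    by (rule lborel_pair.Fubini') measurable
  also have "\<dots> = (\<integral>\<^sup>+x. (\<integral>\<^sup>+s. ennreal \<bar>?h s x\<bar> * indicator {-1..1} s \<partial>lborel) * indicator \<Omega> x \<partial>lborel)"
  proof (intro nn_integral_cong)
    fix x
    have "(\<integral>\<^sup>+s. ennreal \<bar>?h s x\<bar> * indicator \<Omega> x * indicator {-1..1} s \<partial>lborel)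
        = (\<integral>\<^sup>+s. ennreal \<bar>?h s x\<bar> * indicator {-1..1} s * indicator \<Omega> x \<partial>lborel)"
      by (intro nn_integral_cong) (simp add: mult_ac)
    also have "\<dots> = (\<integral>\<^sup>+s. ennreal \<bar>?h s x\<bar> * indicator {-1..1} s \<partial>lborel) * indicator \<Omega> x"
      by (rule nn_integral_multc) measurable
    finally show "(\<integral>\<^sup>+s. ennreal \<bar>?h s x\<bar> * indicator \<Omega> x * indicator {-1..1} s \<partial>lborel)
        = (\<integral>\<^sup>+s. ennreal \<bar>?h s x\<bar> * indicator {-1..1} s \<partial>lborel) * indicator \<Omega> x" .
  qed
  also have "\<dots> \<le> (\<integral>\<^sup>+x. ennreal (2 * well_distance (U x)) * indicator \<Omega> x \<partial>lborel)"
    by (intro nn_integral_mono mult_right_mono deviation_on_levels) auto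
  finally show ?thesis .
qed

lemma continuous_double_well:
  assumes "double_well W" shows "continuous_on UNIV W"
proof -
  have "Ck 0 W" using assms Ck_mono[of 2 W 0] by (simp add: double_well_def)
  then show ?thesis by simp
qed

lemma c_well_nonneg: "double_well W \<Longrightarrow> 0 \<le> c_well W"
  unfolding c_well_def
  by (intro integral_nonneg integrable_continuous_real continuous_on_subset[OF continuous_double_well] continuous_intros)
    (auto simp: double_well_def)

lemma c_well_le_lowered_weight:
  assumes W: "double_well W" and "0 \<le> \<tau>"
  shows "ennreal (c_well W) \<le> (\<integral>\<^sup>+s. ennreal (lowered_weight W \<tau> s) * indicator {-1..1} s \<partial>lborel) + ennreal (2 * \<tau>)"
proof -
  note cont = continuous_double_well[OF W]
  have Wn: "0 \<le> W s" for s using W by (simp add: double_well_def)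
  have [measurable]: "W \<in> borel_measurable borel" using cont by (rule borel_measurable_continuous_onI)
  have "((\<lambda>s. sqrt (W s)) has_integral c_well W) {-1..1}"
    unfolding c_well_def
    by (intro integrable_integral integrable_continuous_real continuous_intros continuous_on_subset[OF cont]) auto
  then have "ennreal (c_well W) = (\<integral>\<^sup>+s. ennreal (indicator {-1..1} s * sqrt (W s)) \<partial>lborel)"
    using Wn by (intro nn_integral_has_integral_lebesgue[symmetric]) auto
  also have "\<dots> \<le> (\<integral>\<^sup>+s. ennreal (lowered_weight W \<tau> s) * indicator {-1..1} s + ennreal \<tau> * indicator {-1..1} s \<partial>(lborel::real measure))"
  proof (intro nn_integral_mono)
    fix s :: real
    have "sqrt (W s) \<le> lowered_weight W \<tau> s + \<tau>" if "s \<in> {-1..1}"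
      using that by (simp add: lowered_weight_def clamp1_def)
    then show "ennreal (indicator {-1..1} s * sqrt (W s))
        \<le> ennreal (lowered_weight W \<tau> s) * indicator {-1..1} s + ennreal \<tau> * indicator {-1..1} s"
      using \<open>0 \<le> \<tau>\<close> by (auto simp: indicator_def lowered_weight_def intro!: ennreal_leI simp flip: ennreal_plus)
  qed
  also have "\<dots> = (\<integral>\<^sup>+s. ennreal (lowered_weight W \<tau> s) * indicator {-1..1} s \<partial>lborel) + ennreal \<tau> * 2"
  proof -
    have [measurable]: "lowered_weight W \<tau> \<in> borel_measurable borel"
      unfolding lowered_weight_def clamp1_def by measurable
    show ?thesis by (subst nn_integral_add) (auto simp: nn_integral_cmult_indicator)
  qed
  also have "ennreal \<tau> * 2 = ennreal (2 * \<tau>)"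
    using \<open>0 \<le> \<tau>\<close> by (simp add: ennreal_mult mult.commute)
  finally show ?thesis .
qed

lemma energy_cong_AE:
  assumes "open \<Omega>" "u \<in> L2 \<Omega>" "w \<in> L2 \<Omega>" and eq: "AE x in lebesgue_on \<Omega>. u x = w x"
  shows "energy \<Omega> W m \<epsilon> u = energy \<Omega> W m \<epsilon> w"
proof -
  have [measurable]: "u \<in> borel_measurable (lebesgue_on \<Omega>)" "w \<in> borel_measurable (lebesgue_on \<Omega>)"
    using assms by (auto simp: L2_def)
  have i: "(LINT x|lebesgue_on \<Omega>. u x) = (LINT x|lebesgue_on \<Omega>. w x)"
    by (rule integral_cong_AE) (use eq in auto)
  have "(LINT x|lebesgue_on \<Omega>. u x * frechet_derivative \<phi> (at x) b) = (LINT x|lebesgue_on \<Omega>. w x * frechet_derivative \<phi> (at x) b)"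
    if "\<phi> \<in> test_functions \<Omega>" "b \<in> Basis" for \<phi> b
  proof -
    have [measurable]: "(\<lambda>x. frechet_derivative \<phi> (at x) b) \<in> borel_measurable (lebesgue_on \<Omega>)"
      using test_functionsD(9)[OF that(1)] by (intro borel_measurable_lebesgue_onI borel_measurable_continuous_onI)
    show ?thesis by (rule integral_cong_AE) (use eq in auto)
  qed
  then have g: "is_weak_gradient \<Omega> u = is_weak_gradient \<Omega> w"
    unfolding is_weak_gradient_def by (intro ext) auto
  then have "grad \<Omega> u = grad \<Omega> w" "u \<in> H1 \<Omega> \<longleftrightarrow> w \<in> H1 \<Omega>"
    using assms by (simp_all add: grad_def H1_def)
  moreover have "(\<integral>\<^sup>+x. ennreal (1 / \<epsilon> * W (u x) + \<epsilon> / 2 * (norm (grad \<Omega> w x))\<^sup>2) \<partial>lebesgue_on \<Omega>)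
      = (\<integral>\<^sup>+x. ennreal (1 / \<epsilon> * W (w x) + \<epsilon> / 2 * (norm (grad \<Omega> w x))\<^sup>2) \<partial>lebesgue_on \<Omega>)"
    by (intro nn_integral_cong_AE) (use eq in auto)
  ultimately show ?thesis using i by (simp add: energy_def)
qed

lemma grad_is_weak_gradient: "u \<in> H1 \<Omega> \<Longrightarrow> is_weak_gradient \<Omega> u (grad \<Omega> u)"
  unfolding grad_def H1_def by (auto intro: someI[where P = "is_weak_gradient \<Omega> u"])

text \<open>The lowered weight turns the gradient term into perimeters of sublevel sets by the coarea inequality.
  Their volumes deviate from \<open>(1 - m) / 2\<close>, which lowers the perimeters at most linearly in the
  deviation, and the released potential energy pays for this loss.\<close>

theorem energy_lower_bound:
  fixes \<Omega> :: "'a::euclidean_space set"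
  assumes \<Omega>: "open \<Omega>" "measure lebesgue \<Omega> = 1" and W: "double_well W"
    and diff: "(\<lambda>r. enn2real (isoperimetric \<Omega> r)) differentiable (at ((1 - m) / 2))"
  obtains K \<epsilon>0 where "0 \<le> K" "0 < \<epsilon>0" "\<And>\<epsilon> u. 0 < \<epsilon> \<Longrightarrow> \<epsilon> \<le> \<epsilon>0 \<Longrightarrow>
      ennreal (sqrt 2 * c_well W * enn2real (isoperimetric \<Omega> ((1 - m) / 2))) \<le> energy \<Omega> W m \<epsilon> u + ennreal (K * \<epsilon>)"
proof -
  define P where "P = enn2real (isoperimetric \<Omega> ((1 - m) / 2))"
  have "0 \<le> P" by (simp add: P_def)
  have [measurable]: "\<Omega> \<in> sets borel" using \<Omega> by simp
  have "measure lborel \<Omega> = 1" using \<Omega>(2) by (simp add: measure_completion)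
  then have vol: "emeasure lborel \<Omega> = 1"
    by (metis emeasure_eq_ennreal_measure enn2real_top ennreal_1 measure_def zero_neq_one)
  have Wn: "0 \<le> W s" for s using W by (simp add: double_well_def)
  note contW = continuous_double_well[OF W]
  have [measurable]: "W \<in> borel_measurable borel" using contW by (rule borel_measurable_continuous_onI)
  obtain L where L: "0 \<le> L" "\<And>r. ennreal (P - L * \<bar>r - (1 - m) / 2\<bar>) \<le> isoperimetric \<Omega> r"
    using isoperimetric_linear_lower_bound[OF diff] unfolding P_def by metis
  obtain Q where Q: "0 \<le> Q" "\<And>s. s \<in> {-1..1} \<Longrightarrow> sqrt (W s) \<le> Q"
  proof -
    have "continuous_on {-1..1} (\<lambda>s. sqrt (W s))" by (intro continuous_intros continuous_on_subset[OF contW]) auto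
    from continuous_attains_sup[OF _ _ this] obtain x where "\<forall>s\<in>{-1..1}. sqrt (W s) \<le> sqrt (W x)" by force
    with that[of "sqrt (W x)"] Wn show thesis by simp
  qed
  \<comment> \<open>the multiple of the distance to the wells that is lost: \<open>Q\<close> bounds the weight of a level, \<open>L\<close> is the
    loss of perimeter per deviation of volume, and the last factor \<open>2\<close> relates that deviation to the
    distance to the wells; \<open>1\<close> is added to make the constant positive\<close>
  define K1 where "K1 = sqrt 2 * (Q * L) * 2 + 1"
  have "0 < K1" using Q L by (simp add: K1_def add_nonneg_pos)
  obtain \<Lambda> K' \<epsilon>0 where R: "0 \<le> \<Lambda>" "0 \<le> K'" "0 < \<epsilon>0"
    "\<And>\<epsilon> s p. 0 < \<epsilon> \<Longrightarrow> \<epsilon> \<le> \<epsilon>0 \<Longrightarrow>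
      sqrt 2 * (lowered_weight W (\<Lambda> * \<epsilon>) s * p) + K1 * well_distance s \<le> 1 / \<epsilon> * W s + \<epsilon> / 2 * p\<^sup>2 + K' * \<epsilon>"
    using Modica_Mortola_with_remainder[OF W \<open>0 < K1\<close>] by metis
  define K where "K = K' + sqrt 2 * P * (2 * \<Lambda>)"
  have "0 \<le> K" using R \<open>0 \<le> P\<close> by (simp add: K_def)
  have main: "ennreal (sqrt 2 * c_well W * P) \<le> energy \<Omega> W m \<epsilon> u + ennreal (K * \<epsilon>)"
    if \<epsilon>: "0 < \<epsilon>" "\<epsilon> \<le> \<epsilon>0" for \<epsilon> u
  proof (cases "u \<in> H1 \<Omega> \<and> (LINT x|lebesgue_on \<Omega>. u x) = m")
    case False
    then show ?thesis by (auto simp: energy_def)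
  next
    case True
    then have u: "u \<in> L2 \<Omega>" and m: "(LINT x|lebesgue_on \<Omega>. u x) = m" by (auto simp: H1_def)
    have fin: "emeasure lborel \<Omega> < \<infinity>" using vol by simp
    obtain U G where UG: "weak_pair \<Omega> U G" and [measurable]: "U \<in> borel_measurable borel" "G \<in> borel_measurable borel"
      and eqU: "AE x in lborel. x \<in> \<Omega> \<longrightarrow> U x = u x" and eqG: "AE x in lborel. x \<in> \<Omega> \<longrightarrow> G x = grad \<Omega> u x"
      and outU: "\<And>x. x \<notin> \<Omega> \<Longrightarrow> U x = 0" and outG: "\<And>x. x \<notin> \<Omega> \<Longrightarrow> G x = 0"
      by (rule Sobolev_representative[OF \<Omega>(1) fin u grad_is_weak_gradient[OF conjunct1[OF True]]]) blast
    have mU: "(LINT x|lborel. U x) = m"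
      using lebesgue_on_borel_representative(2)[of \<Omega> u U] u m eqU outU by (auto simp: L2_def)
    have intU: "integrable lborel U" using UG by (simp add: weak_pair_def)
    define q where "q = lowered_weight W (\<Lambda> * \<epsilon>)"
    have q: "continuous_on UNIV q" "\<And>s. 0 \<le> q s" "\<And>s. q s \<le> Q"
    proof -
      show "continuous_on UNIV q"
        unfolding q_def lowered_weight_def[abs_def] clamp1_def
        by (intro continuous_intros continuous_on_compose2[OF contW]) auto
      show "0 \<le> q s" for s by (simp add: q_def lowered_weight_def)
      have "0 \<le> \<Lambda> * \<epsilon>" using R(1) \<epsilon> by simp
      moreover have "sqrt (W (clamp1 s)) \<le> Q" for s
        by (rule Q(2)) (simp add: clamp1_def)
      ultimately have "sqrt (W (clamp1 s)) - \<Lambda> * \<epsilon> \<le> Q" for s by (smt (verit))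
      then show "q s \<le> Q" for s using Q(1) by (simp add: q_def lowered_weight_def)
    qed
    have [measurable]: "q \<in> borel_measurable borel" using q(1) by (rule borel_measurable_continuous_onI)
    have [measurable]: "well_distance \<in> borel_measurable borel" unfolding well_distance_def by measurable
    define A where "A = (\<integral>\<^sup>+x. ennreal (q (U x)) * ennreal (norm (G x)) \<partial>lborel)"
    define D where "D = (\<integral>\<^sup>+x. ennreal (well_distance (U x)) * indicator \<Omega> x \<partial>lborel)"
    define Iq where "Iq = (\<integral>\<^sup>+s. ennreal (q s) * indicator {-1..1} s \<partial>lborel)"
    have energy: "energy \<Omega> W m \<epsilon> u = (\<integral>\<^sup>+x. ennreal (1 / \<epsilon> * W (U x) + \<epsilon> / 2 * (norm (G x))\<^sup>2) * indicator \<Omega> x \<partial>lborel)"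
    proof -
      have "energy \<Omega> W m \<epsilon> u = (\<integral>\<^sup>+x. ennreal (1 / \<epsilon> * W (u x) + \<epsilon> / 2 * (norm (grad \<Omega> u x))\<^sup>2) * indicator \<Omega> x \<partial>lborel)"
        using True by (simp add: energy_def nn_integral_lebesgue_on)
      also have "\<dots> = (\<integral>\<^sup>+x. ennreal (1 / \<epsilon> * W (U x) + \<epsilon> / 2 * (norm (G x))\<^sup>2) * indicator \<Omega> x \<partial>lborel)"
      proof (rule nn_integral_cong_AE)
        show "AE x in lborel. ennreal (1 / \<epsilon> * W (u x) + \<epsilon> / 2 * (norm (grad \<Omega> u x))\<^sup>2) * indicator \<Omega> x
            = ennreal (1 / \<epsilon> * W (U x) + \<epsilon> / 2 * (norm (G x))\<^sup>2) * indicator \<Omega> x"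
          using eqU eqG by eventually_elim (auto simp: indicator_def)
      qed
      finally show ?thesis .
    qed
    have bulk: "ennreal (sqrt 2) * A + ennreal K1 * D \<le> energy \<Omega> W m \<epsilon> u + ennreal (K' * \<epsilon>)"
    proof -
      have "ennreal (sqrt 2) * A + ennreal K1 * D
          = (\<integral>\<^sup>+x. ennreal (sqrt 2) * (ennreal (q (U x)) * ennreal (norm (G x)))
              + ennreal K1 * (ennreal (well_distance (U x)) * indicator \<Omega> x) \<partial>lborel)"
        unfolding A_def D_def by (simp add: nn_integral_add nn_integral_cmult)
      also have "\<dots> \<le> (\<integral>\<^sup>+x. ennreal (1 / \<epsilon> * W (U x) + \<epsilon> / 2 * (norm (G x))\<^sup>2) * indicator \<Omega> x
          + ennreal (K' * \<epsilon>) * indicator \<Omega> x \<partial>lborel)"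
      proof (intro nn_integral_mono)
        fix x
        have wd: "0 \<le> well_distance (U x)" by (simp add: well_distance_def)
        have e0: "0 \<le> 1 / \<epsilon> * W (U x) + \<epsilon> / 2 * (norm (G x))\<^sup>2" using \<epsilon> Wn[of "U x"] by simp
        have "ennreal (sqrt 2) * (ennreal (q (U x)) * ennreal (norm (G x))) + ennreal K1 * ennreal (well_distance (U x))
            = ennreal (sqrt 2 * (q (U x) * norm (G x)) + K1 * well_distance (U x))"
          using q(2)[of "U x"] wd \<open>0 < K1\<close> by (simp add: ennreal_mult ennreal_plus)
        also have "\<dots> \<le> ennreal ((1 / \<epsilon> * W (U x) + \<epsilon> / 2 * (norm (G x))\<^sup>2) + K' * \<epsilon>)"
          using R(4)[OF \<epsilon>, of "U x" "norm (G x)"] by (intro ennreal_leI) (simp add: q_def)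
        also have "\<dots> = ennreal (1 / \<epsilon> * W (U x) + \<epsilon> / 2 * (norm (G x))\<^sup>2) + ennreal (K' * \<epsilon>)"
          using e0 R(2) \<epsilon> by (intro ennreal_plus) auto
        finally show "ennreal (sqrt 2) * (ennreal (q (U x)) * ennreal (norm (G x)))
            + ennreal K1 * (ennreal (well_distance (U x)) * indicator \<Omega> x)
            \<le> ennreal (1 / \<epsilon> * W (U x) + \<epsilon> / 2 * (norm (G x))\<^sup>2) * indicator \<Omega> x + ennreal (K' * \<epsilon>) * indicator \<Omega> x"
          by (cases "x \<in> \<Omega>") (simp_all add: outG)
      qed
      also have "\<dots> = energy \<Omega> W m \<epsilon> u + ennreal (K' * \<epsilon>)"
        unfolding energy by (subst nn_integral_add) (auto simp: nn_integral_cmult_indicator vol)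
      finally show ?thesis .
    qed
    define \<mu> where "\<mu> s = measure lborel {x \<in> \<Omega>. U x \<le> s}" for s
    have "mono \<mu>"
    proof (rule monoI)
      fix s t :: real assume "s \<le> t"
      show "\<mu> s \<le> \<mu> t" unfolding \<mu>_def
      proof (rule measure_mono_fmeasurable)
        have "{x \<in> \<Omega>. U x \<le> t} \<in> sets borel" by measurable
        moreover have "emeasure lborel {x \<in> \<Omega>. U x \<le> t} \<le> emeasure lborel \<Omega>" by (rule emeasure_mono) auto
        ultimately show "{x \<in> \<Omega>. U x \<le> t} \<in> fmeasurable lborel" using fin by (auto simp: fmeasurable_def)
        have "{x \<in> \<Omega>. U x \<le> s} \<in> sets borel" by measurable
        then show "{x \<in> \<Omega>. U x \<le> s} \<in> sets lborel" by simp
      qed (use \<open>s \<le> t\<close> in auto)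
    qed
    then have [measurable]: "\<mu> \<in> borel_measurable borel" by (rule borel_measurable_mono)
    have dev: "(\<integral>\<^sup>+s. ennreal \<bar>\<mu> s - (1 - m) / 2\<bar> * indicator {-1..1} s \<partial>lborel) \<le> 2 * D"
    proof -
      have "(\<integral>\<^sup>+s. ennreal \<bar>\<mu> s - (1 - m) / 2\<bar> * indicator {-1..1} s \<partial>lborel)
          \<le> (\<integral>\<^sup>+x. ennreal (2 * well_distance (U x)) * indicator \<Omega> x \<partial>lborel)"
        unfolding \<mu>_def by (rule sublevel_volume_deviation[OF intU _ vol outU mU]) simp
      also have "\<dots> = (\<integral>\<^sup>+x. 2 * (ennreal (well_distance (U x)) * indicator \<Omega> x) \<partial>lborel)"
        by (intro nn_integral_cong) (simp add: ennreal_mult well_distance_def mult.assoc)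
      also have "\<dots> = 2 * D" unfolding D_def by (rule nn_integral_cmult) measurable
      finally show ?thesis .
    qed
    have low: "(\<integral>\<^sup>+s. ennreal (q s) * ennreal (P - L * \<bar>\<mu> s - (1 - m) / 2\<bar>) * indicator {-1..1} s \<partial>lborel) \<le> A"
    proof -
      have "(\<integral>\<^sup>+s. ennreal (q s) * ennreal (P - L * \<bar>\<mu> s - (1 - m) / 2\<bar>) * indicator {-1..1} s \<partial>lborel)
          \<le> (\<integral>\<^sup>+s. ennreal (q s) * perimeter {x \<in> \<Omega>. U x \<le> s} \<Omega> \<partial>lborel)"
      proof (intro nn_integral_mono)
        fix s :: real
        have E: "{x \<in> \<Omega>. U x \<le> s} \<in> sets borel" by measurable
        have "ennreal (P - L * \<bar>\<mu> s - (1 - m) / 2\<bar>) \<le> isoperimetric \<Omega> (\<mu> s)" by (rule L(2))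
        also have "\<dots> \<le> perimeter {x \<in> \<Omega>. U x \<le> s} \<Omega>"
          unfolding isoperimetric_def by (rule INF_lower) (use E in \<open>auto simp: \<mu>_def measure_completion\<close>)
        finally have "ennreal (q s) * ennreal (P - L * \<bar>\<mu> s - (1 - m) / 2\<bar>) \<le> ennreal (q s) * perimeter {x \<in> \<Omega>. U x \<le> s} \<Omega>"
          by (rule mult_left_mono) simp
        then show "ennreal (q s) * ennreal (P - L * \<bar>\<mu> s - (1 - m) / 2\<bar>) * indicator {-1..1} s
            \<le> ennreal (q s) * perimeter {x \<in> \<Omega>. U x \<le> s} \<Omega>"
          by (simp add: indicator_def)
      qed
      also have "\<dots> \<le> A" unfolding A_def by (rule coarea_inequality[OF \<Omega>(1) UG q])
      finally show ?thesis .
    qed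
    have levels: "ennreal P * Iq \<le> A + ennreal (Q * L) * (2 * D)"
    proof -
      have "ennreal P * Iq = (\<integral>\<^sup>+s. ennreal P * (ennreal (q s) * indicator {-1..1} s) \<partial>lborel)"
        unfolding Iq_def by (rule nn_integral_cmult[symmetric]) measurable
      also have "\<dots> \<le> (\<integral>\<^sup>+s. ennreal (q s) * ennreal (P - L * \<bar>\<mu> s - (1 - m) / 2\<bar>) * indicator {-1..1} s
          + ennreal (Q * L) * (ennreal \<bar>\<mu> s - (1 - m) / 2\<bar> * indicator {-1..1} s) \<partial>lborel)"
      proof (intro nn_integral_mono)
        fix s :: real
        define y where "y = \<bar>\<mu> s - (1 - m) / 2\<bar>"
        have "0 \<le> y" by (simp add: y_def)
        have "ennreal P \<le> ennreal (P - L * y) + ennreal (L * y)"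
        proof (cases "0 \<le> P - L * y")
          case True
          then show ?thesis using L(1) \<open>0 \<le> y\<close> by (simp flip: ennreal_plus)
        next
          case False
          then show ?thesis by (intro order_trans[OF ennreal_leI[of P "L * y"]]) auto
        qed
        then have "ennreal P * ennreal (q s) \<le> (ennreal (P - L * y) + ennreal (L * y)) * ennreal (q s)"
          by (rule mult_right_mono) simp
        also have "\<dots> = ennreal (q s) * ennreal (P - L * y) + ennreal (q s) * ennreal (L * y)"
          by (simp add: algebra_simps)
        also have "ennreal (q s) * ennreal (L * y) \<le> ennreal (Q * L) * ennreal y"
        proof -
          have "ennreal (q s) * ennreal (L * y) \<le> ennreal Q * ennreal (L * y)"
            by (intro mult_right_mono ennreal_leI q) auto
          also have "\<dots> = ennreal (Q * L) * ennreal y"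
            using Q(1) L(1) \<open>0 \<le> y\<close> by (simp add: ennreal_mult mult.assoc)
          finally show ?thesis .
        qed
        finally have "ennreal P * ennreal (q s) \<le> ennreal (q s) * ennreal (P - L * y) + ennreal (Q * L) * ennreal y"
          by (simp add: add_left_mono)
        then show "ennreal P * (ennreal (q s) * indicator {-1..1} s)
            \<le> ennreal (q s) * ennreal (P - L * \<bar>\<mu> s - (1 - m) / 2\<bar>) * indicator {-1..1} s
            + ennreal (Q * L) * (ennreal \<bar>\<mu> s - (1 - m) / 2\<bar> * indicator {-1..1} s)"
          unfolding y_def[symmetric] by (auto simp: indicator_def)
      qed
      also have "\<dots> = (\<integral>\<^sup>+s. ennreal (q s) * ennreal (P - L * \<bar>\<mu> s - (1 - m) / 2\<bar>) * indicator {-1..1} s \<partial>lborel)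
          + ennreal (Q * L) * (\<integral>\<^sup>+s. ennreal \<bar>\<mu> s - (1 - m) / 2\<bar> * indicator {-1..1} s \<partial>lborel)"
        by (subst nn_integral_add) (auto simp: nn_integral_cmult)
      also have "\<dots> \<le> A + ennreal (Q * L) * (2 * D)"
        by (intro add_mono low mult_left_mono dev) auto
      finally show ?thesis .
    qed
    have "ennreal (sqrt 2 * c_well W * P) = ennreal (sqrt 2) * ennreal P * ennreal (c_well W)"
      using \<open>0 \<le> P\<close> c_well_nonneg[OF W] by (simp add: ennreal_mult mult_ac)
    also have "\<dots> \<le> ennreal (sqrt 2) * ennreal P * (Iq + ennreal (2 * (\<Lambda> * \<epsilon>)))"
      unfolding Iq_def q_def using R(1) \<epsilon> by (intro mult_left_mono c_well_le_lowered_weight[OF W]) auto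
    also have "\<dots> = ennreal (sqrt 2) * (ennreal P * Iq) + ennreal (sqrt 2 * P * (2 * \<Lambda>) * \<epsilon>)"
      using \<open>0 \<le> P\<close> R(1) \<epsilon> by (simp add: ennreal_mult distrib_left mult_ac)
    also have "\<dots> \<le> ennreal (sqrt 2) * (A + ennreal (Q * L) * (2 * D)) + ennreal (sqrt 2 * P * (2 * \<Lambda>) * \<epsilon>)"
      by (intro add_mono mult_left_mono levels) auto
    also have "ennreal (sqrt 2) * (A + ennreal (Q * L) * (2 * D)) = ennreal (sqrt 2) * A + ennreal (sqrt 2 * (Q * L) * 2) * D"
      using Q(1) L(1) by (simp add: ennreal_mult distrib_left mult_ac)
    also have "\<dots> \<le> ennreal (sqrt 2) * A + ennreal K1 * D"
      by (intro add_left_mono mult_right_mono ennreal_leI) (auto simp: K1_def)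
    also have "\<dots> \<le> energy \<Omega> W m \<epsilon> u + ennreal (K' * \<epsilon>)" by (rule bulk)
    finally have "ennreal (sqrt 2 * c_well W * P)
        \<le> energy \<Omega> W m \<epsilon> u + ennreal (K' * \<epsilon>) + ennreal (sqrt 2 * P * (2 * \<Lambda>) * \<epsilon>)"
      by (simp add: add_right_mono)
    also have "\<dots> = energy \<Omega> W m \<epsilon> u + ennreal (K * \<epsilon>)"
      using R \<epsilon> \<open>0 \<le> P\<close> by (simp add: K_def add.assoc distrib_right flip: ennreal_plus)
    finally show ?thesis .
  qed
  show thesis using that[OF \<open>0 \<le> K\<close> R(3)] main unfolding P_def by blast
qed


section \<open>The translation estimate\<close>

abbreviation sq_mass :: "('a::euclidean_space \<Rightarrow> 'b::real_normed_vector) \<Rightarrow> ennreal" where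
  "sq_mass G \<equiv> \<integral>\<^sup>+x. ennreal ((norm (G x))\<^sup>2) \<partial>lborel"

abbreviation sq_dev :: "('a::euclidean_space \<Rightarrow> real) \<Rightarrow> real \<Rightarrow> 'a set \<Rightarrow> ennreal" where
  "sq_dev U c A \<equiv> \<integral>\<^sup>+x. ennreal ((U x - c)\<^sup>2) * indicator A x \<partial>lborel"

text \<open>Jensen's inequality for the square.  If \<open>f\<close> is not integrable, its integral is \<open>0\<close>; if the square is
  not integrable, the right-hand side is \<open>\<infinity>\<close>.\<close>

lemma norm_integral_square_le:
  fixes f :: "'a \<Rightarrow> 'b::euclidean_space"
  assumes M: "emeasure M (space M) = 1"
  shows "ennreal ((norm (LINT x|M. f x))\<^sup>2) \<le> (\<integral>\<^sup>+x. ennreal ((norm (f x))\<^sup>2) \<partial>M)"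
proof (cases "integrable M f \<and> integrable M (\<lambda>x. (norm (f x))\<^sup>2)")
  case True
  then have f: "integrable M f" and f2: "integrable M (\<lambda>x. (norm (f x))\<^sup>2)" by auto
  then have [measurable]: "f \<in> borel_measurable M" by auto
  interpret finite_measure M by (rule finite_measureI) (simp add: M)
  have one: "integrable M (\<lambda>x. (1::real))" "(LINT x|M. (1::real)) = 1"
    using M by (auto simp: measure_def)
  have "\<bar>LINT x|M. norm (f x) \<bullet> 1\<bar> \<le> sqrt (LINT x|M. (norm (norm (f x)))\<^sup>2) * sqrt (LINT x|M. (norm (1::real))\<^sup>2)"
    by (rule Cauchy_Schwarz_L2) (use f2 one in auto)
  then have "(LINT x|M. norm (f x)) \<le> sqrt (LINT x|M. (norm (f x))\<^sup>2)" using one(2) by simp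
  with integral_norm_bound[of M f] have "norm (LINT x|M. f x) \<le> sqrt (LINT x|M. (norm (f x))\<^sup>2)" by linarith
  then have "(norm (LINT x|M. f x))\<^sup>2 \<le> (sqrt (LINT x|M. (norm (f x))\<^sup>2))\<^sup>2" by (rule power_mono) simp
  also have "\<dots> = (LINT x|M. (norm (f x))\<^sup>2)" by simp
  finally have "ennreal ((norm (LINT x|M. f x))\<^sup>2) \<le> ennreal (LINT x|M. (norm (f x))\<^sup>2)" by (rule ennreal_leI)
  also have "\<dots> = (\<integral>\<^sup>+x. ennreal ((norm (f x))\<^sup>2) \<partial>M)"
    by (rule nn_integral_eq_integral[symmetric]) (use f2 in auto)
  finally show ?thesis .
next
  case False
  show ?thesis
  proof (cases "integrable M f")
    case True
    then have [measurable]: "f \<in> borel_measurable M" by auto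
    from False True have "\<not> integrable M (\<lambda>x. (norm (f x))\<^sup>2)" by simp
    then have "(\<integral>\<^sup>+x. ennreal ((norm (f x))\<^sup>2) \<partial>M) = \<infinity>"
      by (subst (asm) integrable_iff_bounded) (auto simp: less_top[symmetric])
    then show ?thesis by simp
  qed (simp add: not_integrable_integral_eq)
qed

text \<open>Mollification averages with respect to a probability density, so that Jensen's inequality and
  Tonelli's theorem apply.\<close>

lemma conv_square_le:
  fixes G :: "'a::euclidean_space \<Rightarrow> 'b::euclidean_space"
  assumes [measurable]: "G \<in> borel_measurable borel" and "0 < \<delta>"
  shows "(\<integral>\<^sup>+y. ennreal ((norm (conv (mollifier \<delta>) G y))\<^sup>2) \<partial>lborel) \<le> sq_mass G"
proof -
  have pt: "ennreal ((norm (conv (mollifier \<delta>) G y))\<^sup>2)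
      \<le> (\<integral>\<^sup>+w. ennreal (mollifier \<delta> (y - w)) * ennreal ((norm (G w))\<^sup>2) \<partial>lborel)" for y
  proof -
    let ?M = "density lborel (\<lambda>w. ennreal (mollifier \<delta> (y - w)))"
    have "emeasure ?M (space ?M) = (\<integral>\<^sup>+w. ennreal (mollifier \<delta> (y - w)) \<partial>lborel)"
      by (simp add: emeasure_density)
    also have "\<dots> = 1"
      using nn_integral_lborel_reflect[of "\<lambda>w. ennreal (mollifier \<delta> w)" y] nn_integral_mollifier[OF \<open>0 < \<delta>\<close>, where 'a = 'a] by simp
    finally have "ennreal ((norm (LINT w|?M. G w))\<^sup>2) \<le> (\<integral>\<^sup>+w. ennreal ((norm (G w))\<^sup>2) \<partial>?M)"
      by (rule norm_integral_square_le)
    moreover have "(LINT w|?M. G w) = conv (mollifier \<delta>) G y"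
      unfolding conv_def by (rule integral_density) (auto simp: mollifier_nonneg \<open>0 < \<delta>\<close>)
    ultimately show ?thesis by (simp add: nn_integral_density)
  qed
  have "(\<integral>\<^sup>+y. ennreal ((norm (conv (mollifier \<delta>) G y))\<^sup>2) \<partial>lborel)
      \<le> (\<integral>\<^sup>+y. \<integral>\<^sup>+w. ennreal (mollifier \<delta> (y - w)) * ennreal ((norm (G w))\<^sup>2) \<partial>lborel \<partial>lborel)"
    by (intro nn_integral_mono pt)
  also have "\<dots> = (\<integral>\<^sup>+w. \<integral>\<^sup>+y. ennreal (mollifier \<delta> (y - w)) * ennreal ((norm (G w))\<^sup>2) \<partial>lborel \<partial>lborel)"
    by (rule lborel_pair.Fubini') measurable
  also have "\<dots> = sq_mass G"
  proof (intro nn_integral_cong)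
    fix w :: 'a
    have "(\<integral>\<^sup>+y. ennreal (mollifier \<delta> (y - w)) \<partial>lborel) = 1"
      using nn_integral_lborel_shift[of "\<lambda>y. ennreal (mollifier \<delta> y)" "- w"] nn_integral_mollifier[OF \<open>0 < \<delta>\<close>, where 'a = 'a] by simp
    then show "(\<integral>\<^sup>+y. ennreal (mollifier \<delta> (y - w)) * ennreal ((norm (G w))\<^sup>2) \<partial>lborel) = ennreal ((norm (G w))\<^sup>2)"
      by (subst nn_integral_multc) auto
  qed
  finally show ?thesis .
qed

text \<open>The fundamental theorem of calculus along the segment, followed by Jensen's inequality.\<close>

lemma increment_square_le:
  fixes V :: "'a::euclidean_space \<Rightarrow> real"
  assumes V: "\<And>x. (V has_derivative (\<lambda>v. D x \<bullet> v)) (at x)" and D: "continuous_on UNIV D"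
  shows "ennreal ((V (x + z) - V x)\<^sup>2)
    \<le> (\<integral>\<^sup>+t. indicator {0..1} t * ennreal ((norm z)\<^sup>2 * (norm (D (x + t *\<^sub>R z)))\<^sup>2) \<partial>lborel)"
proof -
  define g where "g t = D (x + t *\<^sub>R z) \<bullet> z" for t
  have contg: "continuous_on UNIV g"
    unfolding g_def by (intro continuous_intros continuous_on_compose2[OF D]) auto
  then have [measurable]: "g \<in> borel_measurable borel" by (rule borel_measurable_continuous_onI)
  have [measurable]: "D \<in> borel_measurable borel" using D by (rule borel_measurable_continuous_onI)
  have "(g has_integral V (x + 1 *\<^sub>R z) - V (x + 0 *\<^sub>R z)) {0..1}"
  proof (rule fundamental_theorem_of_calculus)
    fix t :: real
    have "((\<lambda>t. x + t *\<^sub>R z) has_derivative (\<lambda>s. s *\<^sub>R z)) (at t)"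
      by (auto intro!: derivative_eq_intros)
    from has_derivative_compose[OF this V[of "x + t *\<^sub>R z"]]
    have "((\<lambda>t. V (x + t *\<^sub>R z)) has_vector_derivative g t) (at t)"
      by (simp add: has_vector_derivative_def g_def)
    then show "((\<lambda>t. V (x + t *\<^sub>R z)) has_vector_derivative g t) (at t within {0..1})"
      by (rule has_vector_derivative_at_within)
  qed simp
  then have I: "(g has_integral V (x + z) - V x) {0..1}" by simp
  have si: "set_integrable lborel {0..1} g"
    unfolding set_integrable_def by (rule borel_integrable_compact) (auto intro: continuous_on_subset[OF contg])
  have "(LINT t:{0..1}|lborel. g t) = V (x + z) - V x"
    using set_borel_integral_eq_integral(2)[OF si] integral_unique[OF I] by simp
  let ?M = "density lborel (\<lambda>t::real. ennreal (indicator {0..1} t))"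
  have "(LINT t|?M. g t) = (LINT t:{0..1}|lborel. g t)"
    unfolding set_lebesgue_integral_def by (rule integral_density) auto
  also have "\<dots> = V (x + z) - V x" by fact
  finally have eq: "V (x + z) - V x = (LINT t|?M. g t)" by simp
  have "emeasure ?M (space ?M) = 1"
    by (simp add: emeasure_density ennreal_indicator)
  from norm_integral_square_le[OF this, of g]
  have "ennreal ((V (x + z) - V x)\<^sup>2) \<le> (\<integral>\<^sup>+t. ennreal ((norm (g t))\<^sup>2) \<partial>?M)" by (simp add: eq)
  also have "\<dots> = (\<integral>\<^sup>+t. indicator {0..1} t * ennreal ((norm (g t))\<^sup>2) \<partial>lborel)"
    by (subst nn_integral_density) (auto simp: ennreal_indicator)
  also have "\<dots> \<le> (\<integral>\<^sup>+t. indicator {0..1} t * ennreal ((norm z)\<^sup>2 * (norm (D (x + t *\<^sub>R z)))\<^sup>2) \<partial>lborel)"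
  proof (intro nn_integral_mono mult_left_mono ennreal_leI)
    fix t :: real
    have "norm (g t) \<le> norm z * norm (D (x + t *\<^sub>R z))"
      using Cauchy_Schwarz_ineq2[of "D (x + t *\<^sub>R z)" z] by (simp add: g_def mult.commute)
    then have "(norm (g t))\<^sup>2 \<le> (norm z * norm (D (x + t *\<^sub>R z)))\<^sup>2" by (rule power_mono) simp
    then show "(norm (g t))\<^sup>2 \<le> (norm z)\<^sup>2 * (norm (D (x + t *\<^sub>R z)))\<^sup>2" by (simp add: power_mult_distrib)
  qed auto
  finally show ?thesis .
qed

definition translatable :: "'a::euclidean_space set \<Rightarrow> 'a \<Rightarrow> 'a set" where
  "translatable \<Omega> z = {x. \<forall>t\<in>{0..1}. x + t *\<^sub>R z \<in> \<Omega>}"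

lemma segment_compact: "compact ((\<lambda>t. x + t *\<^sub>R (z::'a::euclidean_space)) ` {0..1::real})"
  by (intro compact_continuous_image continuous_intros) auto

text \<open>The mollified function satisfies the estimate at the points whose segment keeps its distance from the
  complement of \<open>\<Omega>\<close>, because mollification does not increase the \<open>L\<^sup>2\<close> norm of the gradient.  Fatou's lemma
  passes to the limit.\<close>

theorem translation_estimate:
  fixes U :: "'a::euclidean_space \<Rightarrow> real"
  assumes \<Omega>: "open \<Omega>" and UG: "weak_pair \<Omega> U G" and A: "A \<in> sets borel" "A \<subseteq> translatable \<Omega> z"
  shows "(\<integral>\<^sup>+x. ennreal ((U (x + z) - U x)\<^sup>2) * indicator A x \<partial>lborel)
    \<le> ennreal ((norm z)\<^sup>2) * sq_mass G"
proof -
  have U: "integrable lborel U" and G: "integrable lborel G" using UG by (auto simp: weak_pair_def)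
  have [measurable]: "U \<in> borel_measurable borel" "G \<in> borel_measurable borel" "A \<in> sets borel"
    using U G A by (auto dest: borel_measurable_integrable)
  obtain \<delta> where \<delta>: "\<And>n. 0 < \<delta> n" "\<delta> \<longlonglongrightarrow> 0"
    and AEU: "AE x in lborel. (\<lambda>n. conv (mollifier (\<delta> n)) U x) \<longlonglongrightarrow> U x"
    by (rule mollify_subsequence[OF U G]) blast
  define V where "V n = conv (mollifier (\<delta> n)) U" for n
  define H where "H n = conv (mollifier (\<delta> n)) G" for n
  have [measurable]: "V n \<in> borel_measurable borel" "H n \<in> borel_measurable borel" for n
    unfolding V_def H_def by measurable
  define T where "T n = {x. \<forall>t\<in>{0..1}. cball (x + t *\<^sub>R z) (\<delta> n) \<subseteq> \<Omega>}" for n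
  \<comment> \<open>the complement of \<open>T n\<close> is the sum of a closed and a compact set\<close>
  have "open (T n)" for n
  proof -
    let ?K = "(\<lambda>p. - (fst p *\<^sub>R z + snd p)) ` ({0..1} \<times> cball 0 (\<delta> n))"
    have "compact ?K"
      by (intro compact_continuous_image continuous_intros compact_Times) auto
    with \<Omega> have "closed (\<Union>x\<in>- \<Omega>. \<Union>k\<in>?K. {x + k})" by (intro closed_compact_sums) auto
    moreover have "T n = - (\<Union>x\<in>- \<Omega>. \<Union>k\<in>?K. {x + k})"
    proof (intro equalityI subsetI)
      fix x assume x: "x \<in> T n"
      show "x \<in> - (\<Union>x\<in>- \<Omega>. \<Union>k\<in>?K. {x + k})"
      proof
        assume "x \<in> (\<Union>x\<in>- \<Omega>. \<Union>k\<in>?K. {x + k})"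
        then obtain w t y where w: "w \<notin> \<Omega>" "t \<in> {0..1}" "y \<in> cball 0 (\<delta> n)" "x = w - (t *\<^sub>R z + y)" by auto
        then have "w \<in> cball (x + t *\<^sub>R z) (\<delta> n)" by (simp add: dist_norm)
        moreover have "cball (x + t *\<^sub>R z) (\<delta> n) \<subseteq> \<Omega>" using x w(2) unfolding T_def by blast
        ultimately show False using w(1) by blast
      qed
    next
      fix x assume x: "x \<in> - (\<Union>x\<in>- \<Omega>. \<Union>k\<in>?K. {x + k})"
      show "x \<in> T n"
        unfolding T_def
      proof (intro CollectI ballI subsetI, rule ccontr)
        fix t :: real and w assume t: "t \<in> {0..1}" and w: "w \<in> cball (x + t *\<^sub>R z) (\<delta> n)" "w \<notin> \<Omega>"
        have "(t, w - (x + t *\<^sub>R z)) \<in> {0..1} \<times> cball 0 (\<delta> n)"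
          using t w by (simp add: dist_norm norm_minus_commute)
        then have "- (t *\<^sub>R z + (w - (x + t *\<^sub>R z))) \<in> ?K" by force
        moreover have "x = w + - (t *\<^sub>R z + (w - (x + t *\<^sub>R z)))" by simp
        ultimately show False using x w(2) by blast
      qed
    qed
    ultimately show ?thesis by (simp only: open_Compl)
  qed
  then have [measurable]: "T n \<in> sets borel" for n by simp
  let ?N = "sq_mass G"
  have each: "(\<integral>\<^sup>+x. ennreal ((V n (x + z) - V n x)\<^sup>2) * indicator (T n) x \<partial>lborel) \<le> ennreal ((norm z)\<^sup>2) * ?N" for n
  proof -
    let ?D = "\<lambda>x. LINT y|lborel. U y *\<^sub>R gradient_of (mollifier (\<delta> n)) (x - y)"
    note VD = conv_mollifier_has_derivative[OF U \<delta>(1)[of n], folded V_def]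
    have "ennreal ((V n (x + z) - V n x)\<^sup>2) * indicator (T n) x
        \<le> (\<integral>\<^sup>+t. indicator {0..1} t * ennreal ((norm z)\<^sup>2 * (norm (H n (x + t *\<^sub>R z)))\<^sup>2) \<partial>lborel)" for x
    proof (cases "x \<in> T n")
      case True
      have "?D (x + t *\<^sub>R z) = H n (x + t *\<^sub>R z)" if "t \<in> {0..1}" for t
        unfolding H_def by (rule weak_pair_conv_gradient[OF UG \<delta>(1)]) (use True that in \<open>auto simp: T_def\<close>)
      then have "(\<integral>\<^sup>+t. indicator {0..1} t * ennreal ((norm z)\<^sup>2 * (norm (?D (x + t *\<^sub>R z)))\<^sup>2) \<partial>lborel)
          = (\<integral>\<^sup>+t. indicator {0..1} t * ennreal ((norm z)\<^sup>2 * (norm (H n (x + t *\<^sub>R z)))\<^sup>2) \<partial>lborel)"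
        by (intro nn_integral_cong) (auto simp: indicator_def)
      with increment_square_le[OF VD, of x z] True show ?thesis by simp
    qed simp
    then have "(\<integral>\<^sup>+x. ennreal ((V n (x + z) - V n x)\<^sup>2) * indicator (T n) x \<partial>lborel)
        \<le> (\<integral>\<^sup>+x. \<integral>\<^sup>+t. indicator {0..1} t * ennreal ((norm z)\<^sup>2 * (norm (H n (x + t *\<^sub>R z)))\<^sup>2) \<partial>lborel \<partial>lborel)"
      by (intro nn_integral_mono)
    also have "\<dots> = (\<integral>\<^sup>+t. \<integral>\<^sup>+x. indicator {0..1} t * ennreal ((norm z)\<^sup>2 * (norm (H n (x + t *\<^sub>R z)))\<^sup>2) \<partial>lborel \<partial>lborel)"
      by (rule lborel_pair.Fubini') measurable
    also have "\<dots> \<le> (\<integral>\<^sup>+t. indicator {0..1} t * (ennreal ((norm z)\<^sup>2) * ?N) \<partial>(lborel::real measure))"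
    proof (intro nn_integral_mono)
      fix t :: real
      have "(\<integral>\<^sup>+x. indicator {0..1} t * ennreal ((norm z)\<^sup>2 * (norm (H n (x + t *\<^sub>R z)))\<^sup>2) \<partial>lborel)
          = indicator {0..1} t * (ennreal ((norm z)\<^sup>2) * (\<integral>\<^sup>+x. ennreal ((norm (H n (x + t *\<^sub>R z)))\<^sup>2) \<partial>lborel))"
        by (simp add: ennreal_mult nn_integral_cmult)
      also have "(\<integral>\<^sup>+x. ennreal ((norm (H n (x + t *\<^sub>R z)))\<^sup>2) \<partial>lborel) = (\<integral>\<^sup>+x. ennreal ((norm (H n x))\<^sup>2) \<partial>lborel)"
        by (rule nn_integral_lborel_shift) measurable
      also have "\<dots> \<le> ?N" unfolding H_def by (rule conv_square_le) (auto simp: \<delta>)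
      finally show "(\<integral>\<^sup>+x. indicator {0..1} t * ennreal ((norm z)\<^sup>2 * (norm (H n (x + t *\<^sub>R z)))\<^sup>2) \<partial>lborel)
          \<le> indicator {0..1} t * (ennreal ((norm z)\<^sup>2) * ?N)"
        by (simp add: mult_left_mono)
    qed
    also have "\<dots> = ennreal ((norm z)\<^sup>2) * ?N"
      by (subst nn_integral_multc) auto
    finally show ?thesis .
  qed
  have AEz: "AE x in lborel. (\<lambda>n. V n (x + z)) \<longlonglongrightarrow> U (x + z)"
  proof -
    have "AE x in distr lborel borel (\<lambda>x. x + z). (\<lambda>n. V n x) \<longlonglongrightarrow> U x"
      unfolding lborel_distr_shift V_def by (rule AEU)
    then show ?thesis by (subst (asm) AE_distr_iff) auto
  qed
  have "(\<integral>\<^sup>+x. ennreal ((U (x + z) - U x)\<^sup>2) * indicator A x \<partial>lborel)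
      \<le> (\<integral>\<^sup>+x. liminf (\<lambda>n. ennreal ((V n (x + z) - V n x)\<^sup>2) * indicator (T n) x) \<partial>lborel)"
  proof (rule nn_integral_mono_AE)
    show "AE x in lborel. ennreal ((U (x + z) - U x)\<^sup>2) * indicator A x
        \<le> liminf (\<lambda>n. ennreal ((V n (x + z) - V n x)\<^sup>2) * indicator (T n) x)"
      using AEU AEz
    proof eventually_elim
      case (elim x)
      show ?case
      proof (cases "x \<in> A")
        case True
        then have "(\<lambda>t. x + t *\<^sub>R z) ` {0..1} \<subseteq> \<Omega>" using A by (auto simp: translatable_def)
        from compact_subset_open_imp_cball_epsilon_subset[OF segment_compact \<Omega> this]
        obtain e where e: "0 < e" "(\<Union>y\<in>(\<lambda>t. x + t *\<^sub>R z) ` {0..1}. cball y e) \<subseteq> \<Omega>" by metis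
        have "\<forall>\<^sub>F n in sequentially. x \<in> T n"
          using order_tendstoD(2)[OF \<delta>(2) e(1)]
        proof eventually_elim
          case (elim n)
          then have "cball y (\<delta> n) \<subseteq> cball y e" for y :: 'a by auto
          with e(2) show ?case unfolding T_def by blast
        qed
        then have ev: "\<forall>\<^sub>F n in sequentially. ennreal ((V n (x + z) - V n x)\<^sup>2)
            = ennreal ((V n (x + z) - V n x)\<^sup>2) * indicator (T n) x"
          by eventually_elim simp
        have "(\<lambda>n. ennreal ((V n (x + z) - V n x)\<^sup>2)) \<longlonglongrightarrow> ennreal ((U (x + z) - U x)\<^sup>2)"
          using elim unfolding V_def by (intro tendsto_ennrealI tendsto_intros)
        from Lim_transform_eventually[OF this ev]
        have "(\<lambda>n. ennreal ((V n (x + z) - V n x)\<^sup>2) * indicator (T n) x) \<longlonglongrightarrow> ennreal ((U (x + z) - U x)\<^sup>2)" .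
        from lim_imp_Liminf[OF _ this] True show ?thesis by simp
      qed simp
    qed
  qed
  also have "\<dots> \<le> liminf (\<lambda>n. \<integral>\<^sup>+x. ennreal ((V n (x + z) - V n x)\<^sup>2) * indicator (T n) x \<partial>lborel)"
    by (rule nn_integral_liminf) measurable
  also have "\<dots> \<le> ennreal ((norm z)\<^sup>2) * ?N"
    by (rule order_trans[OF Liminf_mono[OF always_eventually, rule_format] eq_refl[OF Liminf_const]]) (auto intro: each)
  finally show ?thesis .
qed


section \<open>The Poincare inequality\<close>

text \<open>The bound is by the gradient on all of \<open>\<Omega>\<close>, which makes the property easy to transport:
  two overlapping sets can be joined, and a set can be translated inside \<open>\<Omega>\<close>.\<close>

definition poincare_on :: "'a::euclidean_space set \<Rightarrow> 'a set \<Rightarrow> bool" where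
  "poincare_on \<Omega> A \<longleftrightarrow> (\<exists>C\<ge>0. \<forall>U G. weak_pair \<Omega> U G \<longrightarrow>
     (\<exists>c. sq_dev U c A \<le> ennreal C * sq_mass G))"

lemma poincare_on_subset:
  assumes "poincare_on \<Omega> B" "A \<subseteq> B"
  shows "poincare_on \<Omega> A"
proof -
  have "sq_dev U c A \<le> sq_dev U c B"
    for U :: "'a \<Rightarrow> real" and c
    using assms(2) by (intro nn_integral_mono mult_left_mono) (auto simp: indicator_def)
  then show ?thesis using assms(1) unfolding poincare_on_def by (meson order_trans)
qed

text \<open>With the mean value over the ball as the constant, the deviation is bounded by the average of the
  squared differences over all pairs of points.  For pairs with a given difference \<open>z\<close> the translation
  estimate applies, since the ball is convex.\<close>

lemma poincare_on_ball:
  assumes \<Omega>: "open \<Omega>" and B: "ball p r \<subseteq> \<Omega>" and "0 < r"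
  shows "poincare_on \<Omega> (ball p r)"
proof -
  define v where "v = measure lborel (ball p r)"
  have v: "emeasure lborel (ball p r) = ennreal v" "0 < v"
    using emeasure_lborel_ball_finite[of p r] content_ball_pos[OF \<open>0 < r\<close>, of p]
    by (auto simp: v_def emeasure_eq_ennreal_measure less_top[symmetric])
  have [measurable]: "ball p r \<in> sets borel" by simp
  define w where "w = measure lborel (cball (0::'a) (2 * r))"
  have w: "emeasure lborel (cball (0::'a) (2 * r)) = ennreal w"
    using emeasure_lborel_cball_finite[of "0::'a" "2 * r"] by (auto simp: w_def emeasure_eq_ennreal_measure less_top[symmetric])
  have "0 \<le> w" by (simp add: w_def)
  define C where "C = 1 / v * (w * (2 * r)\<^sup>2)"
  show ?thesis
    unfolding poincare_on_def
  proof (rule exI[of _ C], intro conjI allI impI)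
    show "0 \<le> C" using v \<open>0 \<le> w\<close> by (simp add: C_def)
    fix U :: "'a \<Rightarrow> real" and G assume UG: "weak_pair \<Omega> U G"
    have U: "integrable lborel U" using UG by (auto simp: weak_pair_def)
    then have [measurable]: "U \<in> borel_measurable borel" by (auto dest: borel_measurable_integrable)
    let ?N = "sq_mass G"
    define M where "M = density lborel (\<lambda>y. ennreal (1 / v * indicator (ball p r) y))"
    have M1: "emeasure M (space M) = 1"
    proof -
      have "emeasure M (space M) = (\<integral>\<^sup>+y. ennreal (1 / v * indicator (ball p r) y) \<partial>lborel)"
        unfolding M_def by (subst emeasure_density) auto
      also have "\<dots> = (\<integral>\<^sup>+y. ennreal (1 / v) * indicator (ball p r) y \<partial>lborel)"
        by (intro nn_integral_cong) (auto simp: indicator_def)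
      also have "\<dots> = 1" using v by (subst nn_integral_cmult_indicator) (auto simp flip: ennreal_mult)
      finally show ?thesis .
    qed
    have intM: "integrable M U"
      unfolding M_def
    proof (subst integrable_density)
      show "integrable lborel (\<lambda>y. (1 / v * indicator (ball p r) y) *\<^sub>R U y)"
        by (rule integrable_scaleR_bounded_kernel[OF U, where B = "1 / v"]) (use v in \<open>auto simp: indicator_def\<close>)
    qed (use v in auto)
    interpret M: finite_measure M by (rule finite_measureI) (simp add: M1)
    define c where "c = (LINT y|M. U y)"
    have mean: "ennreal ((U x - c)\<^sup>2) \<le> (\<integral>\<^sup>+y. ennreal (1 / v) * indicator (ball p r) y * ennreal ((U x - U y)\<^sup>2) \<partial>lborel)" for x
    proof -
      have "(LINT y|M. U x - U y) = U x - c"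
        using intM M1 by (simp add: c_def measure_def)
      with norm_integral_square_le[OF M1, of "\<lambda>y. U x - U y"]
      have "ennreal ((U x - c)\<^sup>2) \<le> (\<integral>\<^sup>+y. ennreal ((U x - U y)\<^sup>2) \<partial>M)" by simp
      also have "\<dots> = (\<integral>\<^sup>+y. ennreal (1 / v * indicator (ball p r) y) * ennreal ((U x - U y)\<^sup>2) \<partial>lborel)"
        unfolding M_def by (subst nn_integral_density) auto
      also have "\<dots> = (\<integral>\<^sup>+y. ennreal (1 / v) * indicator (ball p r) y * ennreal ((U x - U y)\<^sup>2) \<partial>lborel)"
        by (intro nn_integral_cong) (auto simp: indicator_def)
      finally show ?thesis .
    qed
    have "sq_dev U c (ball p r)
        \<le> (\<integral>\<^sup>+x. (\<integral>\<^sup>+y. ennreal (1 / v) * indicator (ball p r) y * ennreal ((U x - U y)\<^sup>2) \<partial>lborel) * indicator (ball p r) x \<partial>lborel)"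
      by (intro nn_integral_mono mult_right_mono mean) auto
    also have "\<dots> = (\<integral>\<^sup>+x. (\<integral>\<^sup>+z. ennreal (1 / v) * indicator (ball p r) (z + x) * ennreal ((U x - U (z + x))\<^sup>2) \<partial>lborel) * indicator (ball p r) x \<partial>lborel)"
      by (subst nn_integral_lborel_shift) auto
    also have "\<dots> = (\<integral>\<^sup>+x. \<integral>\<^sup>+z. ennreal (1 / v) * indicator (ball p r) (z + x) * ennreal ((U x - U (z + x))\<^sup>2) * indicator (ball p r) x \<partial>lborel \<partial>lborel)"
      by (subst nn_integral_multc) auto
    also have "\<dots> = (\<integral>\<^sup>+z. \<integral>\<^sup>+x. ennreal (1 / v) * indicator (ball p r) (z + x) * ennreal ((U x - U (z + x))\<^sup>2) * indicator (ball p r) x \<partial>lborel \<partial>lborel)"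
      by (rule lborel_pair.Fubini') measurable
    also have "\<dots> \<le> (\<integral>\<^sup>+z. ennreal (1 / v) * (ennreal ((2 * r)\<^sup>2) * ?N) * indicator (cball 0 (2 * r)) (z::'a) \<partial>lborel)"
    proof (intro nn_integral_mono)
      fix z :: 'a
      define A where "A = {x. x \<in> ball p r \<and> z + x \<in> ball p r}"
      have A[measurable]: "A \<in> sets borel" unfolding A_def by measurable
      have "A \<subseteq> translatable \<Omega> z"
      proof
        fix x assume x: "x \<in> A"
        have "x + t *\<^sub>R z \<in> ball p r" if "t \<in> {0..1}" for t
        proof -
          have "(1 - t) *\<^sub>R x + t *\<^sub>R (z + x) \<in> ball p r"
            using convexD_alt[OF convex_ball, of x p r "z + x" t] x that by (auto simp: A_def)
          then show ?thesis by (simp add: algebra_simps)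
        qed
        with B show "x \<in> translatable \<Omega> z" by (auto simp: translatable_def)
      qed
      have "(\<integral>\<^sup>+x. ennreal (1 / v) * indicator (ball p r) (z + x) * ennreal ((U x - U (z + x))\<^sup>2) * indicator (ball p r) x \<partial>lborel)
          = (\<integral>\<^sup>+x. ennreal (1 / v) * (ennreal ((U (x + z) - U x)\<^sup>2) * indicator A x) \<partial>lborel)"
        by (intro nn_integral_cong) (auto simp: A_def indicator_def add.commute power2_commute)
      also have "\<dots> = ennreal (1 / v) * (\<integral>\<^sup>+x. ennreal ((U (x + z) - U x)\<^sup>2) * indicator A x \<partial>lborel)"
        by (intro nn_integral_cmult) measurable
      also have "\<dots> \<le> ennreal (1 / v) * (ennreal ((2 * r)\<^sup>2) * ?N) * indicator (cball 0 (2 * r)) z"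
      proof (cases "norm z \<le> 2 * r")
        case True
        have "(\<integral>\<^sup>+x. ennreal ((U (x + z) - U x)\<^sup>2) * indicator A x \<partial>lborel) \<le> ennreal ((norm z)\<^sup>2) * ?N"
          by (rule translation_estimate[OF \<Omega> UG \<open>A \<in> sets borel\<close> \<open>A \<subseteq> translatable \<Omega> z\<close>])
        also have "\<dots> \<le> ennreal ((2 * r)\<^sup>2) * ?N"
          using True by (intro mult_right_mono ennreal_leI power_mono) auto
        finally show ?thesis using True by (simp add: mult_left_mono)
      next
        case False
        have "A = {}"
        proof (rule ccontr)
          assume "A \<noteq> {}"
          then obtain x where "dist p x < r" "dist p (z + x) < r" by (auto simp: A_def)
          then have "dist x (z + x) < 2 * r" using dist_triangle3[of x "z + x" p] by (simp add: dist_commute)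
          with False show False by (simp add: dist_norm)
        qed
        then show ?thesis by simp
      qed
      finally show "(\<integral>\<^sup>+x. ennreal (1 / v) * indicator (ball p r) (z + x) * ennreal ((U x - U (z + x))\<^sup>2) * indicator (ball p r) x \<partial>lborel)
          \<le> ennreal (1 / v) * (ennreal ((2 * r)\<^sup>2) * ?N) * indicator (cball 0 (2 * r)) z" .
    qed
    also have "\<dots> = ennreal (1 / v) * (ennreal ((2 * r)\<^sup>2) * ?N) * ennreal w"
      by (subst nn_integral_cmult_indicator) (auto simp: w)
    also have "\<dots> = ennreal C * ?N"
    proof -
      have "ennreal (1 / v * (w * (2 * r)\<^sup>2)) = ennreal (1 / v) * ennreal (w * (2 * r)\<^sup>2)"
        using v \<open>0 \<le> w\<close> by (intro ennreal_mult) auto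
      also have "ennreal (w * (2 * r)\<^sup>2) = ennreal w * ennreal ((2 * r)\<^sup>2)"
        using \<open>0 \<le> w\<close> by (intro ennreal_mult) auto
      finally show ?thesis by (simp only: C_def mult_ac)
    qed
    finally show "\<exists>c. sq_dev U c (ball p r) \<le> ennreal C * ?N" by blast
  qed
qed

lemma square_diff_le: "((a::real) - c)\<^sup>2 \<le> 2 * (a - b)\<^sup>2 + 2 * (b - c)\<^sup>2"
proof -
  have "0 \<le> ((a - b) - (b - c))\<^sup>2" by simp
  then show ?thesis by (simp add: power2_eq_square algebra_simps)
qed

lemma nn_integral_square_diff_le:
  fixes U :: "'a::euclidean_space \<Rightarrow> real"
  assumes [measurable]: "U \<in> borel_measurable borel" "V \<in> borel_measurable borel" "A \<in> sets borel"
  shows "sq_dev U c A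
    \<le> 2 * (\<integral>\<^sup>+x. ennreal ((U x - V x)\<^sup>2) * indicator A x \<partial>lborel) + 2 * sq_dev V c A"
proof -
  have "sq_dev U c A
      \<le> (\<integral>\<^sup>+x. 2 * (ennreal ((U x - V x)\<^sup>2) * indicator A x) + 2 * (ennreal ((V x - c)\<^sup>2) * indicator A x) \<partial>lborel)"
  proof (intro nn_integral_mono)
    fix x
    have "ennreal ((U x - c)\<^sup>2) \<le> ennreal (2 * (U x - V x)\<^sup>2 + 2 * (V x - c)\<^sup>2)"
      by (intro ennreal_leI square_diff_le)
    also have "\<dots> = 2 * ennreal ((U x - V x)\<^sup>2) + 2 * ennreal ((V x - c)\<^sup>2)"
      by (simp add: ennreal_plus ennreal_mult)
    finally show "ennreal ((U x - c)\<^sup>2) * indicator A x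
        \<le> 2 * (ennreal ((U x - V x)\<^sup>2) * indicator A x) + 2 * (ennreal ((V x - c)\<^sup>2) * indicator A x)"
      by (simp add: indicator_def)
  qed
  also have "\<dots> = 2 * (\<integral>\<^sup>+x. ennreal ((U x - V x)\<^sup>2) * indicator A x \<partial>lborel) + 2 * sq_dev V c A"
    by (simp add: nn_integral_add nn_integral_cmult)
  finally show ?thesis .
qed

text \<open>The constants that fit \<open>U\<close> on the two sets are close to each other, because both fit \<open>U\<close> on the
  overlap, which has positive measure.\<close>

lemma poincare_on_Un:
  assumes A: "poincare_on \<Omega> A" "A \<in> sets borel" and B: "poincare_on \<Omega> B" "B \<in> sets borel"
    and finB: "emeasure lborel B < \<infinity>" and S: "open S" "S \<noteq> {}" "S \<subseteq> A \<inter> B"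
  shows "poincare_on \<Omega> (A \<union> B)"
proof -
  note [measurable] = A(2) B(2)
  have [measurable]: "S \<in> sets borel" using S by simp
  obtain CA where CA: "0 \<le> CA" "\<And>U G. weak_pair \<Omega> U G \<Longrightarrow> \<exists>c. sq_dev U c A
        \<le> ennreal CA * sq_mass G"
    using A(1) unfolding poincare_on_def by blast
  obtain CB where CB: "0 \<le> CB" "\<And>U G. weak_pair \<Omega> U G \<Longrightarrow> \<exists>c. sq_dev U c B
        \<le> ennreal CB * sq_mass G"
    using B(1) unfolding poincare_on_def by blast
  define b where "b = measure lborel B"
  have b: "emeasure lborel B = ennreal b" "0 \<le> b" using finB by (auto simp: b_def emeasure_eq_ennreal_measure)
  define s where "s = measure lborel S"
  have sfin: "emeasure lborel S < \<infinity>"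
    using emeasure_mono[of S B lborel] S finB by (auto intro: le_less_trans)
  then have s: "emeasure lborel S = ennreal s" by (auto simp: s_def emeasure_eq_ennreal_measure)
  have "0 < s"
  proof -
    have "s \<noteq> 0"
    proof
      assume "s = 0"
      then have "S \<in> null_sets lborel" using s by (auto simp: null_sets_def)
      then have "S \<in> null_sets lebesgue" by (rule null_sets_completionI)
      with S open_not_negligible[of S] show False by (simp add: negligible_iff_null_sets)
    qed
    then show ?thesis by (simp add: s_def less_le)
  qed
  \<comment> \<open>\<open>e\<close> controls the squared difference of the two constants\<close>
  define e where "e = (2 * CA + 2 * CB) / s"
  define C where "C = CA + 2 * (CB + e * b)"
  have "0 \<le> e" using CA CB \<open>0 < s\<close> by (simp add: e_def)
  show ?thesis
    unfolding poincare_on_def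
  proof (rule exI[of _ C], intro conjI allI impI)
    show "0 \<le> C" unfolding C_def using CA(1) CB(1) \<open>0 \<le> e\<close> b(2)
      by (intro add_nonneg_nonneg mult_nonneg_nonneg) auto
    fix U :: "'a \<Rightarrow> real" and G assume UG: "weak_pair \<Omega> U G"
    then have [measurable]: "U \<in> borel_measurable borel" by (auto simp: weak_pair_def dest: borel_measurable_integrable)
    let ?N = "sq_mass G"
    obtain p where p: "sq_dev U p A \<le> ennreal CA * ?N" using CA(2)[OF UG] by blast
    obtain q where q: "sq_dev U q B \<le> ennreal CB * ?N" using CB(2)[OF UG] by blast
    define k where "k = ennreal ((p - q)\<^sup>2)"
    have ks: "k * ennreal s \<le> ennreal (2 * CA + 2 * CB) * ?N"
    proof -
      have "k * ennreal s = (\<integral>\<^sup>+x. ennreal ((p - q)\<^sup>2) * indicator S x \<partial>lborel)"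
        unfolding k_def s[symmetric] by (rule nn_integral_cmult_indicator[symmetric]) simp
      also have "\<dots> \<le> 2 * (\<integral>\<^sup>+x. ennreal ((p - U x)\<^sup>2) * indicator S x \<partial>lborel) + 2 * sq_dev U q S"
        by (rule nn_integral_square_diff_le[of "\<lambda>_. p"]) auto
      also have "\<dots> \<le> 2 * (ennreal CA * ?N) + 2 * (ennreal CB * ?N)"
      proof (intro add_mono mult_left_mono)
        show "(\<integral>\<^sup>+x. ennreal ((p - U x)\<^sup>2) * indicator S x \<partial>lborel) \<le> ennreal CA * ?N"
          using S by (intro order_trans[OF nn_integral_mono p]) (auto simp: indicator_def power2_commute)
        show "sq_dev U q S \<le> ennreal CB * ?N"
          using S by (intro order_trans[OF nn_integral_mono q]) (auto simp: indicator_def)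
      qed auto
      also have "\<dots> = ennreal (2 * CA + 2 * CB) * ?N"
        using CA(1) CB(1) by (simp add: ennreal_plus ennreal_mult distrib_right mult.assoc)
      finally show ?thesis .
    qed
    have k: "k \<le> ennreal e * ?N"
    proof -
      have "k = (k * ennreal s) * ennreal (1 / s)"
        using \<open>0 < s\<close> by (simp add: mult.assoc flip: ennreal_mult)
      also have "\<dots> \<le> (ennreal (2 * CA + 2 * CB) * ?N) * ennreal (1 / s)"
        by (intro mult_right_mono ks) simp
      also have "\<dots> = ennreal e * ?N"
      proof -
        have "ennreal e = ennreal (2 * CA + 2 * CB) * ennreal (1 / s)"
          using CA(1) CB(1) \<open>0 < s\<close> by (subst ennreal_mult[symmetric]) (auto simp: e_def)
        then show ?thesis by (simp add: mult_ac)
      qed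
      finally show ?thesis .
    qed
    have "sq_dev U p (A \<union> B)
        \<le> (\<integral>\<^sup>+x. ennreal ((U x - p)\<^sup>2) * indicator A x + ennreal ((U x - p)\<^sup>2) * indicator B x \<partial>lborel)"
      by (intro nn_integral_mono) (auto simp: indicator_def)
    also have "\<dots> = sq_dev U p A + sq_dev U p B"
      by (rule nn_integral_add) measurable
    also have "\<dots> \<le> ennreal CA * ?N + (2 * (ennreal CB * ?N) + 2 * (ennreal e * ?N * ennreal b))"
    proof (rule add_mono[OF p])
      have "sq_dev U p B
          \<le> 2 * sq_dev U q B + 2 * (\<integral>\<^sup>+x. ennreal ((q - p)\<^sup>2) * indicator B x \<partial>lborel)"
        by (rule nn_integral_square_diff_le) auto
      also have "(\<integral>\<^sup>+x. ennreal ((q - p)\<^sup>2) * indicator B x \<partial>lborel) = k * ennreal b"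
        unfolding k_def b(1)[symmetric] by (subst nn_integral_cmult_indicator) (auto simp: power2_commute)
      also have "2 * sq_dev U q B + 2 * (k * ennreal b)
          \<le> 2 * (ennreal CB * ?N) + 2 * (ennreal e * ?N * ennreal b)"
        by (intro add_mono mult_left_mono mult_right_mono q k) auto
      finally show "sq_dev U p B
          \<le> 2 * (ennreal CB * ?N) + 2 * (ennreal e * ?N * ennreal b)" .
    qed
    also have "\<dots> = ennreal C * ?N"
      unfolding C_def using CA(1) CB(1) b(2) \<open>0 \<le> e\<close>
      by (simp add: ennreal_plus ennreal_mult distrib_left distrib_right mult_ac)
    finally show "\<exists>c. sq_dev U c (A \<union> B) \<le> ennreal C * ?N" by blast
  qed
qed

text \<open>The points that share with \<open>p\<close> an open set for which the Poincare inequality holds form an open and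
  closed part of \<open>\<Omega>\<close>.\<close>

lemma poincare_on_point_pair:
  assumes \<Omega>: "open \<Omega>" "connected \<Omega>" and p: "p \<in> \<Omega>" and x: "x \<in> \<Omega>"
  obtains D where "open D" "D \<subseteq> \<Omega>" "p \<in> D" "x \<in> D" "poincare_on \<Omega> D"
proof -
  define V where "V = {x. \<exists>D. open D \<and> D \<subseteq> \<Omega> \<and> p \<in> D \<and> x \<in> D \<and> poincare_on \<Omega> D}"
  have ball: "\<exists>r>0. ball y r \<subseteq> \<Omega> \<and> poincare_on \<Omega> (ball y r)" if "y \<in> \<Omega>" for y
    using \<Omega>(1) that poincare_on_ball[OF \<Omega>(1), of y] by (meson open_contains_ball)
  have "V = \<Union>{D. open D \<and> D \<subseteq> \<Omega> \<and> p \<in> D \<and> poincare_on \<Omega> D}" by (auto simp: V_def)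
  then have "open V" by (simp add: open_Union)
  have "open (\<Omega> - V)"
    unfolding open_contains_ball
  proof
    fix y assume y: "y \<in> \<Omega> - V"
    then obtain r where r: "0 < r" "ball y r \<subseteq> \<Omega>" "poincare_on \<Omega> (ball y r)" using ball by blast
    have "w \<notin> V" if w: "w \<in> ball y r" for w
    proof
      assume "w \<in> V"
      then obtain D where D: "open D" "D \<subseteq> \<Omega>" "p \<in> D" "w \<in> D" "poincare_on \<Omega> D" by (auto simp: V_def)
      have "poincare_on \<Omega> (D \<union> ball y r)"
      proof (rule poincare_on_Un[OF D(5) _ r(3)])
        show "open (D \<inter> ball y r)" "D \<inter> ball y r \<noteq> {}" using D w by auto
      qed (use D(1) emeasure_lborel_ball_finite[of y r] in auto)
      then have "y \<in> V" unfolding V_def using D r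
        by (intro CollectI exI[of _ "D \<union> ball y r"]) auto
      with y show False by simp
    qed
    with r show "\<exists>e>0. ball y e \<subseteq> \<Omega> - V" by blast
  qed
  have "p \<in> V"
  proof -
    obtain r where "0 < r" "ball p r \<subseteq> \<Omega>" "poincare_on \<Omega> (ball p r)" using ball[OF p] by blast
    then show ?thesis unfolding V_def by (intro CollectI exI[of _ "ball p r"]) auto
  qed
  have "\<Omega> \<subseteq> V"
  proof (rule ccontr)
    assume "\<not> \<Omega> \<subseteq> V"
    then have "(\<Omega> - V) \<inter> \<Omega> \<noteq> {}" by auto
    moreover have "V \<inter> \<Omega> \<noteq> {}" using \<open>p \<in> V\<close> p by auto
    ultimately show False
      using connectedD[OF \<Omega>(2) \<open>open V\<close> \<open>open (\<Omega> - V)\<close>] by auto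
  qed
  with x that show thesis by (auto simp: V_def)
qed

text \<open>Finitely many sets that join points of \<open>K\<close> to \<open>p\<close> cover \<open>K\<close>; they overlap near \<open>p\<close>.\<close>

lemma poincare_on_compact:
  assumes \<Omega>: "open \<Omega>" "connected \<Omega>" and fin: "emeasure lborel \<Omega> < \<infinity>" and p: "p \<in> \<Omega>"
    and K: "compact K" "K \<subseteq> \<Omega>"
  shows "poincare_on \<Omega> K"
proof -
  have "\<forall>x\<in>K. \<exists>D. open D \<and> D \<subseteq> \<Omega> \<and> p \<in> D \<and> x \<in> D \<and> poincare_on \<Omega> D"
    using poincare_on_point_pair[OF \<Omega> p] K(2) by (metis subsetD)
  then obtain D where D: "\<And>x. x \<in> K \<Longrightarrow> open (D x) \<and> D x \<subseteq> \<Omega> \<and> p \<in> D x \<and> x \<in> D x \<and> poincare_on \<Omega> (D x)" by metis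
  obtain F where F: "F \<subseteq> K" "finite F" "K \<subseteq> (\<Union>x\<in>F. D x)"
    using compactE_image[OF K(1), of K D] D by (metis UN_I subsetI)
  obtain D0 where D0: "open D0" "D0 \<subseteq> \<Omega>" "p \<in> D0" "poincare_on \<Omega> D0"
    using poincare_on_point_pair[OF \<Omega> p p] by metis
  have "poincare_on \<Omega> (D0 \<union> (\<Union>x\<in>F. D x)) \<and> open (D0 \<union> (\<Union>x\<in>F. D x))"
    using F(2,1)
  proof (induction F rule: finite_induct)
    case empty
    then show ?case using D0 by simp
  next
    case (insert x F)
    then have IH: "poincare_on \<Omega> (D0 \<union> (\<Union>x\<in>F. D x))" "open (D0 \<union> (\<Union>x\<in>F. D x))" and Dx: "open (D x)" "D x \<subseteq> \<Omega>" "p \<in> D x" "poincare_on \<Omega> (D x)"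
      using D[of x] by auto
    have "emeasure lborel (D x) \<le> emeasure lborel \<Omega>" using Dx \<Omega>(1) by (intro emeasure_mono) auto
    then have "poincare_on \<Omega> ((D0 \<union> (\<Union>x\<in>F. D x)) \<union> D x)"
    proof (intro poincare_on_Un[OF IH(1) _ Dx(4)])
      show "open ((D0 \<union> (\<Union>x\<in>F. D x)) \<inter> D x)" using IH Dx by (intro open_Int)
      show "(D0 \<union> (\<Union>x\<in>F. D x)) \<inter> D x \<noteq> {}" using D0(3) Dx(3) by blast
      show "emeasure lborel (D x) < \<infinity>" using \<open>emeasure lborel (D x) \<le> emeasure lborel \<Omega>\<close> fin by (rule le_less_trans)
    qed (use IH Dx in auto)
    moreover have "D0 \<union> (\<Union>x\<in>insert x F. D x) = (D0 \<union> (\<Union>x\<in>F. D x)) \<union> D x" by auto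
    ultimately show ?case using IH Dx by (simp add: open_Un)
  qed
  with F(3) show ?thesis using poincare_on_subset[of \<Omega> "D0 \<union> (\<Union>x\<in>F. D x)" K] by blast
qed

text \<open>Near a boundary point, translation in the direction of the graph pushes \<open>\<Omega>\<close> into a compact part
  of itself.\<close>

lemma boundary_translation:
  assumes \<Omega>: "Ck_hoelder_boundary (Suc k) \<sigma> \<Omega>" and p: "p \<in> frontier \<Omega>"
  obtains \<rho> z K where "0 < \<rho>" "compact K" "K \<subseteq> \<Omega>" "\<And>x. x \<in> \<Omega> \<inter> ball p \<rho> \<Longrightarrow> x + z \<in> K"
    "\<Omega> \<inter> ball p \<rho> \<subseteq> translatable \<Omega> z"
proof -
  obtain r \<nu> \<gamma> where r: "0 < r" and \<nu>: "norm \<nu> = 1" and \<gamma>: "Ck_hoelder (Suc k) \<sigma> \<gamma>"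
    "\<And>x t. \<gamma> (x + t *\<^sub>R \<nu>) = \<gamma> x" and eq: "\<Omega> \<inter> ball p r = {x \<in> ball p r. \<gamma> x < x \<bullet> \<nu>}"
    using \<Omega> p unfolding Ck_hoelder_boundary_def by blast
  have "\<gamma> differentiable (at x)" for x using \<gamma>(1) by simp
  then have cont: "continuous_on UNIV \<gamma>"
    by (auto simp: continuous_on_eq_continuous_at intro: differentiable_imp_continuous_within)
  \<comment> \<open>points at distance less than \<open>r / 4\<close> from \<open>p\<close> stay within distance \<open>r / 2\<close> when moved by at most \<open>\<tau>\<close>\<close>
  define \<tau> where "\<tau> = r / 4"
  define K where "K = cball p (r / 2) \<inter> {y. \<gamma> y + \<tau> \<le> y \<bullet> \<nu>}"
  have nn: "\<nu> \<bullet> \<nu> = 1" using \<nu> by (simp add: norm_eq_1)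
  have stay: "x + t *\<^sub>R (\<tau> *\<^sub>R \<nu>) \<in> ball p (r / 2) \<and> \<gamma> (x + t *\<^sub>R (\<tau> *\<^sub>R \<nu>)) + t * \<tau> < (x + t *\<^sub>R (\<tau> *\<^sub>R \<nu>)) \<bullet> \<nu>"
    if x: "x \<in> \<Omega> \<inter> ball p (r / 4)" and t: "t \<in> {0..1}" for x t
  proof
    have "norm (t *\<^sub>R (\<tau> *\<^sub>R \<nu>)) \<le> r / 4" using t r \<nu> by (simp add: \<tau>_def mult_left_le_one_le)
    moreover have "dist p x < r / 4" using x by simp
    ultimately show "x + t *\<^sub>R (\<tau> *\<^sub>R \<nu>) \<in> ball p (r / 2)"
      using norm_triangle_ineq[of "x - p" "t *\<^sub>R (\<tau> *\<^sub>R \<nu>)"] by (simp add: dist_norm norm_minus_commute algebra_simps)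
    have "x \<in> \<Omega> \<inter> ball p r" using x r by auto
    then have "\<gamma> x < x \<bullet> \<nu>" unfolding eq by simp
    moreover have "\<gamma> (x + t *\<^sub>R (\<tau> *\<^sub>R \<nu>)) = \<gamma> x" using \<gamma>(2)[of x "t * \<tau>"] by simp
    ultimately show "\<gamma> (x + t *\<^sub>R (\<tau> *\<^sub>R \<nu>)) + t * \<tau> < (x + t *\<^sub>R (\<tau> *\<^sub>R \<nu>)) \<bullet> \<nu>"
      by (simp add: inner_add_left nn)
  qed
  show thesis
  proof (rule that[of "r / 4" K "\<tau> *\<^sub>R \<nu>"])
    show "0 < r / 4" using r by simp
    have "closed {y. \<gamma> y + \<tau> \<le> y \<bullet> \<nu>}"
      by (intro closed_Collect_le continuous_intros cont)
    then show "compact K" unfolding K_def by (intro compact_Int_closed) auto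
    show "K \<subseteq> \<Omega>"
    proof
      fix y assume "y \<in> K"
      then have "y \<in> {x \<in> ball p r. \<gamma> x < x \<bullet> \<nu>}" using r by (auto simp: K_def \<tau>_def)
      then show "y \<in> \<Omega>" unfolding eq[symmetric] by simp
    qed
    show "x + \<tau> *\<^sub>R \<nu> \<in> K" if "x \<in> \<Omega> \<inter> ball p (r / 4)" for x
      using stay[OF that, of 1] by (auto simp: K_def)
    show "\<Omega> \<inter> ball p (r / 4) \<subseteq> translatable \<Omega> (\<tau> *\<^sub>R \<nu>)"
      unfolding translatable_def
    proof (intro subsetI CollectI ballI)
      fix x t assume x: "x \<in> \<Omega> \<inter> ball p (r / 4)" and t: "t \<in> {0..1::real}"
      have "0 \<le> t * \<tau>" using t r by (simp add: \<tau>_def)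
      with stay[OF x t] r have "x + t *\<^sub>R (\<tau> *\<^sub>R \<nu>) \<in> {x \<in> ball p r. \<gamma> x < x \<bullet> \<nu>}" by auto
      then show "x + t *\<^sub>R (\<tau> *\<^sub>R \<nu>) \<in> \<Omega>" unfolding eq[symmetric] by simp
    qed
  qed
qed

text \<open>A constant that fits \<open>U\<close> on a compact part \<open>L\<close> of \<open>\<Omega>\<close> also fits near the boundary: \<open>U\<close> is close there to
  its translate, which only takes values of \<open>U\<close> on \<open>L\<close>.\<close>

theorem poincare_domain:
  assumes \<Omega>: "open \<Omega>" "bounded \<Omega>" "connected \<Omega>" and bd: "Ck_hoelder_boundary (Suc k) \<sigma> \<Omega>" and ne: "\<Omega> \<noteq> {}"
  shows "poincare_on \<Omega> \<Omega>"
proof -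
  have fin: "emeasure lborel \<Omega> < \<infinity>" using emeasure_bounded_finite[OF \<Omega>(2)] .
  obtain p where p: "p \<in> \<Omega>" using ne by blast
  have [measurable]: "\<Omega> \<in> sets borel" using \<Omega> by simp
  obtain \<rho> z K where loc: "\<And>q. q \<in> frontier \<Omega> \<Longrightarrow> 0 < \<rho> q \<and> compact (K q) \<and> K q \<subseteq> \<Omega>
      \<and> (\<forall>x\<in>\<Omega> \<inter> ball q (\<rho> q). x + z q \<in> K q) \<and> \<Omega> \<inter> ball q (\<rho> q) \<subseteq> translatable \<Omega> (z q)"
  proof -
    have "\<exists>\<rho> z K. 0 < \<rho> \<and> compact K \<and> K \<subseteq> \<Omega>
        \<and> (\<forall>x\<in>\<Omega> \<inter> ball q \<rho>. x + z \<in> K) \<and> \<Omega> \<inter> ball q \<rho> \<subseteq> translatable \<Omega> z" if "q \<in> frontier \<Omega>" for q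
      by (rule boundary_translation[OF bd that]) blast
    then have "\<forall>q\<in>frontier \<Omega>. \<exists>t. case t of (\<rho>, z, K) \<Rightarrow> 0 < \<rho> \<and> compact K \<and> K \<subseteq> \<Omega>
        \<and> (\<forall>x\<in>\<Omega> \<inter> ball q \<rho>. x + z \<in> K) \<and> \<Omega> \<inter> ball q \<rho> \<subseteq> translatable \<Omega> z" by simp
    from bchoice[OF this] obtain f where f: "\<forall>q\<in>frontier \<Omega>. case f q of (\<rho>, z, K) \<Rightarrow> 0 < \<rho> \<and> compact K \<and> K \<subseteq> \<Omega>
        \<and> (\<forall>x\<in>\<Omega> \<inter> ball q \<rho>. x + z \<in> K) \<and> \<Omega> \<inter> ball q \<rho> \<subseteq> translatable \<Omega> z" ..
    show thesis
      by (rule that[of "\<lambda>q. fst (f q)" "\<lambda>q. snd (snd (f q))" "\<lambda>q. fst (snd (f q))"])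
        (use f in \<open>auto simp: case_prod_unfold\<close>)
  qed
  have "compact (frontier \<Omega>)" using \<Omega>(2) by (rule compact_frontier_bounded)
  then obtain F where F: "F \<subseteq> frontier \<Omega>" "finite F" "frontier \<Omega> \<subseteq> (\<Union>q\<in>F. ball q (\<rho> q))"
    using compactE_image[of "frontier \<Omega>" "frontier \<Omega>" "\<lambda>q. ball q (\<rho> q)"] loc
    by (metis (no_types, lifting) UN_I centre_in_ball open_ball subsetI)
  define K0 where "K0 = closure \<Omega> - (\<Union>q\<in>F. ball q (\<rho> q))"
  have "compact K0" unfolding K0_def using \<Omega>(2) by (intro compact_diff compact_closure[THEN iffD2]) auto
  have "K0 \<subseteq> \<Omega>" using F(3) \<Omega>(1) unfolding K0_def frontier_def by (auto simp: interior_open)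
  define L where "L = K0 \<union> (\<Union>q\<in>F. K q)"
  have "compact L" unfolding L_def using F loc \<open>compact K0\<close> by (intro compact_Un compact_UN) auto
  have "L \<subseteq> \<Omega>" unfolding L_def using F loc \<open>K0 \<subseteq> \<Omega>\<close> by blast
  have [measurable]: "L \<in> sets borel" using \<open>compact L\<close> by (intro borel_closed compact_imp_closed)
  from poincare_on_compact[OF \<Omega>(1,3) fin p \<open>compact L\<close> \<open>L \<subseteq> \<Omega>\<close>]
  obtain C where C: "0 \<le> C" "\<And>U G. weak_pair \<Omega> U G \<Longrightarrow> \<exists>c. sq_dev U c L
        \<le> ennreal C * sq_mass G"
    unfolding poincare_on_def by blast
  define C' where "C' = C + (\<Sum>q\<in>F. 2 * (norm (z q))\<^sup>2 + 2 * C)"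
  show ?thesis
    unfolding poincare_on_def
  proof (rule exI[of _ C'], intro conjI allI impI)
    show "0 \<le> C'" using C(1) by (auto simp: C'_def intro!: add_nonneg_nonneg sum_nonneg)
    fix U :: "'a \<Rightarrow> real" and G assume UG: "weak_pair \<Omega> U G"
    then have [measurable]: "U \<in> borel_measurable borel" by (auto simp: weak_pair_def dest: borel_measurable_integrable)
    let ?N = "sq_mass G"
    obtain c where c: "sq_dev U c L \<le> ennreal C * ?N" using C(2)[OF UG] by blast
    have piece: "sq_dev U c (\<Omega> \<inter> ball q (\<rho> q)) \<le> ennreal (2 * (norm (z q))\<^sup>2 + 2 * C) * ?N"
      if q: "q \<in> F" for q
    proof -
      have q': "q \<in> frontier \<Omega>" using q F(1) by auto
      let ?A = "\<Omega> \<inter> ball q (\<rho> q)"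
      have "sq_dev U c ?A
          \<le> 2 * (\<integral>\<^sup>+x. ennreal ((U x - U (x + z q))\<^sup>2) * indicator ?A x \<partial>lborel) + 2 * (\<integral>\<^sup>+x. ennreal ((U (x + z q) - c)\<^sup>2) * indicator ?A x \<partial>lborel)"
        by (rule nn_integral_square_diff_le) measurable
      also have "\<dots> \<le> 2 * (ennreal ((norm (z q))\<^sup>2) * ?N) + 2 * (ennreal C * ?N)"
      proof (intro add_mono mult_left_mono)
        show "(\<integral>\<^sup>+x. ennreal ((U x - U (x + z q))\<^sup>2) * indicator ?A x \<partial>lborel) \<le> ennreal ((norm (z q))\<^sup>2) * ?N"
          using translation_estimate[OF \<Omega>(1) UG, of ?A "z q"] loc[OF q'] by (simp add: power2_commute)
        have "(\<integral>\<^sup>+x. ennreal ((U (x + z q) - c)\<^sup>2) * indicator ?A x \<partial>lborel)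
            \<le> (\<integral>\<^sup>+x. ennreal ((U (x + z q) - c)\<^sup>2) * indicator L (x + z q) \<partial>lborel)"
        proof (intro nn_integral_mono mult_left_mono)
          fix x
          have "x + z q \<in> L" if "x \<in> ?A" using loc[OF q'] that q by (auto simp: L_def)
          then show "indicator ?A x \<le> (indicator L (x + z q) :: ennreal)" by (auto simp: indicator_def)
        qed simp
        also have "\<dots> = sq_dev U c L"
          using nn_integral_lborel_shift[of "\<lambda>x. ennreal ((U x - c)\<^sup>2) * indicator L x" "z q"] by simp
        finally show "(\<integral>\<^sup>+x. ennreal ((U (x + z q) - c)\<^sup>2) * indicator ?A x \<partial>lborel) \<le> ennreal C * ?N"
          using c by (rule order_trans)
      qed auto
      also have "\<dots> = ennreal (2 * (norm (z q))\<^sup>2 + 2 * C) * ?N"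
        using C(1) by (simp add: ennreal_plus ennreal_mult distrib_right mult.assoc)
      finally show ?thesis .
    qed
    have [measurable]: "ball q (\<rho> q) \<in> sets borel" for q by simp
    have cover: "x \<in> L \<or> (\<exists>q\<in>F. x \<in> \<Omega> \<inter> ball q (\<rho> q))" if "x \<in> \<Omega>" for x
      using that closure_subset[of \<Omega>] by (auto simp: L_def K0_def)
    have "sq_dev U c \<Omega>
        \<le> (\<integral>\<^sup>+x. ennreal ((U x - c)\<^sup>2) * indicator L x + (\<Sum>q\<in>F. ennreal ((U x - c)\<^sup>2) * indicator (\<Omega> \<inter> ball q (\<rho> q)) x) \<partial>lborel)"
    proof (intro nn_integral_mono)
      fix x
      show "ennreal ((U x - c)\<^sup>2) * indicator \<Omega> x
          \<le> ennreal ((U x - c)\<^sup>2) * indicator L x + (\<Sum>q\<in>F. ennreal ((U x - c)\<^sup>2) * indicator (\<Omega> \<inter> ball q (\<rho> q)) x)"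
      proof (cases "x \<in> \<Omega>")
        case True
        from cover[OF True] show ?thesis
        proof
          assume "\<exists>q\<in>F. x \<in> \<Omega> \<inter> ball q (\<rho> q)"
          then obtain q where q: "q \<in> F" "x \<in> \<Omega> \<inter> ball q (\<rho> q)" by blast
          have "ennreal ((U x - c)\<^sup>2) * indicator (\<Omega> \<inter> ball q (\<rho> q)) x
              \<le> (\<Sum>q\<in>F. ennreal ((U x - c)\<^sup>2) * indicator (\<Omega> \<inter> ball q (\<rho> q)) x)"
            using F(2) q(1) by (intro member_le_sum) auto
          with q True show ?thesis by (simp add: add_increasing)
        qed (use True in \<open>simp add: add_increasing2\<close>)
      qed simp
    qed
    also have "\<dots> = sq_dev U c L
        + (\<integral>\<^sup>+x. (\<Sum>q\<in>F. ennreal ((U x - c)\<^sup>2) * indicator (\<Omega> \<inter> ball q (\<rho> q)) x) \<partial>lborel)"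
      by (rule nn_integral_add) measurable
    also have "(\<integral>\<^sup>+x. (\<Sum>q\<in>F. ennreal ((U x - c)\<^sup>2) * indicator (\<Omega> \<inter> ball q (\<rho> q)) x) \<partial>lborel)
        = (\<Sum>q\<in>F. \<integral>\<^sup>+x. ennreal ((U x - c)\<^sup>2) * indicator (\<Omega> \<inter> ball q (\<rho> q)) x \<partial>lborel)"
      by (rule nn_integral_sum) measurable
    also have "sq_dev U c L + \<dots> \<le> ennreal C * ?N + (\<Sum>q\<in>F. ennreal (2 * (norm (z q))\<^sup>2 + 2 * C) * ?N)"
      by (intro add_mono c sum_mono piece)
    also have "\<dots> = ennreal C' * ?N"
    proof -
      have n: "0 \<le> 2 * (norm (z q))\<^sup>2 + 2 * C" for q using C(1) by simp
      have "ennreal C' = ennreal C + ennreal (\<Sum>q\<in>F. 2 * (norm (z q))\<^sup>2 + 2 * C)"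
        unfolding C'_def using C(1) n by (intro ennreal_plus sum_nonneg) auto
      also have "ennreal (\<Sum>q\<in>F. 2 * (norm (z q))\<^sup>2 + 2 * C) = (\<Sum>q\<in>F. ennreal (2 * (norm (z q))\<^sup>2 + 2 * C))"
        using n by (intro sum_ennreal[symmetric])
      finally show ?thesis by (simp only: distrib_right sum_distrib_right)
    qed
    finally show "\<exists>c. sq_dev U c \<Omega> \<le> ennreal C' * ?N" by blast
  qed
qed


section \<open>Completeness and the Neumann problem\<close>

lemma finite_measure_L2_imp_L1:
  fixes f :: "'a \<Rightarrow> 'b::euclidean_space"
  assumes M: "emeasure M (space M) = 1" and [measurable]: "f \<in> borel_measurable M"
    and f2: "integrable M (\<lambda>x. (norm (f x))\<^sup>2)"
  shows "integrable M f" "(LINT x|M. norm (f x)) \<le> sqrt (LINT x|M. (norm (f x))\<^sup>2)"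
proof -
  interpret finite_measure M by (rule finite_measureI) (simp add: M)
  have one: "integrable M (\<lambda>x. (1::real))" "(LINT x|M. (1::real)) = 1"
    using M by (auto simp: measure_def)
  have "\<bar>LINT x|M. norm (f x) \<bullet> 1\<bar> \<le> sqrt (LINT x|M. (norm (norm (f x)))\<^sup>2) * sqrt (LINT x|M. (norm (1::real))\<^sup>2)"
    by (rule Cauchy_Schwarz_L2) (use f2 one in auto)
  then show "(LINT x|M. norm (f x)) \<le> sqrt (LINT x|M. (norm (f x))\<^sup>2)" using one(2) by simp
  have "integrable M (\<lambda>x. norm (f x) \<bullet> (1::real))"
    by (rule integrable_inner_L2) (use f2 one in auto)
  then show "integrable M f" by (simp add: integrable_norm_iff)
qed

text \<open>A Cauchy sequence in \<open>L\<^sup>2\<close> is one in \<open>L\<^sup>1\<close>, so that a subsequence converges almost everywhere; by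
  Fatou's lemma its limit is also the \<open>L\<^sup>2\<close> limit.\<close>

lemma L2_complete:
  fixes f :: "nat \<Rightarrow> 'a \<Rightarrow> 'b::euclidean_space"
  assumes M: "emeasure M (space M) = 1" and f[measurable]: "\<And>n. f n \<in> borel_measurable M"
    and f2: "\<And>n. integrable M (\<lambda>x. (norm (f n x))\<^sup>2)"
    and cauchy: "\<And>e. 0 < e \<Longrightarrow> \<exists>N. \<forall>i\<ge>N. \<forall>j\<ge>N. (LINT x|M. (norm (f i x - f j x))\<^sup>2) < e"
  obtains F where "F \<in> borel_measurable M" "integrable M (\<lambda>x. (norm (F x))\<^sup>2)"
    "(\<lambda>n. LINT x|M. (norm (f n x - F x))\<^sup>2) \<longlonglongrightarrow> 0"
proof -
  have d2: "integrable M (\<lambda>x. (norm (f i x - f j x))\<^sup>2)" for i j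
    using integrable_norm2_lincomb(1)[OF f f f2 f2, of 1 i "-1" j] by simp
  have "\<exists>N. \<forall>i\<ge>N. \<forall>j\<ge>N. (LINT x|M. norm (f i x - f j x)) < e" if "0 < e" for e
  proof -
    from cauchy[of "e\<^sup>2"] that obtain N where N: "\<And>i j. N \<le> i \<Longrightarrow> N \<le> j \<Longrightarrow> (LINT x|M. (norm (f i x - f j x))\<^sup>2) < e\<^sup>2" by auto
    have "(LINT x|M. norm (f i x - f j x)) < e" if "N \<le> i" "N \<le> j" for i j
    proof -
      have "(LINT x|M. norm (f i x - f j x)) \<le> sqrt (LINT x|M. (norm (f i x - f j x))\<^sup>2)"
        by (rule finite_measure_L2_imp_L1(2)[OF M _ d2]) measurable
      also have "\<dots> < sqrt (e\<^sup>2)" using N[OF that] by (rule real_sqrt_less_mono)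
      finally show ?thesis using \<open>0 < e\<close> by simp
    qed
    then show ?thesis by blast
  qed
  from cauchy_L1_AE_cauchy_subseq[OF finite_measure_L2_imp_L1(1)[OF M f f2] this]
  obtain r where r: "strict_mono r" "AE x in M. Cauchy (\<lambda>i. f (r i) x)" by blast
  define F where "F x = lim (\<lambda>i. f (r i) x)" for x
  have F[measurable]: "F \<in> borel_measurable M" unfolding F_def by measurable
  have lim: "AE x in M. (\<lambda>i. f (r i) x) \<longlonglongrightarrow> F x"
    using r(2) by eventually_elim (auto simp: F_def Cauchy_convergent_iff convergent_LIMSEQ_iff)
  have bound: "(\<integral>\<^sup>+x. ennreal ((norm (f n x - F x))\<^sup>2) \<partial>M) \<le> ennreal e"
    if N: "\<And>i j. N \<le> i \<Longrightarrow> N \<le> j \<Longrightarrow> (LINT x|M. (norm (f i x - f j x))\<^sup>2) < e" and n: "N \<le> n" for n N e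
  proof -
    have "(\<integral>\<^sup>+x. ennreal ((norm (f n x - F x))\<^sup>2) \<partial>M) \<le> (\<integral>\<^sup>+x. liminf (\<lambda>i. ennreal ((norm (f n x - f (r i) x))\<^sup>2)) \<partial>M)"
    proof (rule nn_integral_mono_AE)
      show "AE x in M. ennreal ((norm (f n x - F x))\<^sup>2) \<le> liminf (\<lambda>i. ennreal ((norm (f n x - f (r i) x))\<^sup>2))"
        using lim
      proof eventually_elim
        case (elim x)
        have "(\<lambda>i. ennreal ((norm (f n x - f (r i) x))\<^sup>2)) \<longlonglongrightarrow> ennreal ((norm (f n x - F x))\<^sup>2)"
          by (intro tendsto_ennrealI tendsto_intros elim)
        from lim_imp_Liminf[OF _ this] show ?case by simp
      qed
    qed
    also have "\<dots> \<le> liminf (\<lambda>i. \<integral>\<^sup>+x. ennreal ((norm (f n x - f (r i) x))\<^sup>2) \<partial>M)"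
      by (rule nn_integral_liminf) measurable
    also have "\<dots> \<le> liminf (\<lambda>i::nat. ennreal e)"
    proof (rule Liminf_mono)
      show "\<forall>\<^sub>F i in sequentially. (\<integral>\<^sup>+x. ennreal ((norm (f n x - f (r i) x))\<^sup>2) \<partial>M) \<le> ennreal e"
        using eventually_ge_at_top[of N]
      proof eventually_elim
        case (elim i)
        then have "N \<le> r i" using seq_suble[OF r(1), of i] by simp
        from N[OF n this] show ?case
          using nn_integral_eq_integral[OF d2[of n "r i"]] by (simp add: ennreal_leI less_imp_le)
      qed
    qed
    also have "\<dots> = ennreal e" by (simp add: Liminf_const)
    finally show ?thesis .
  qed
  have fF: "integrable M (\<lambda>x. (norm (f n x - F x))\<^sup>2)" if "\<And>i j. N \<le> i \<Longrightarrow> N \<le> j \<Longrightarrow> (LINT x|M. (norm (f i x - f j x))\<^sup>2) < 1" "N \<le> n" for n N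
  proof (rule integrableI_bounded)
    show "(\<integral>\<^sup>+x. ennreal (norm ((norm (f n x - F x))\<^sup>2)) \<partial>M) < \<infinity>"
      using bound[OF that] by (simp add: le_less_trans)
  qed measurable
  obtain N1 where N1: "\<And>i j. N1 \<le> i \<Longrightarrow> N1 \<le> j \<Longrightarrow> (LINT x|M. (norm (f i x - f j x))\<^sup>2) < 1"
    using cauchy[of 1] by auto
  have F2: "integrable M (\<lambda>x. (norm (F x))\<^sup>2)"
    using integrable_norm2_lincomb(1)[of "f N1" M "\<lambda>x. f N1 x - F x" 1 "-1"] f2[of N1] fF[OF N1 order_refl] by simp
  show thesis
  proof (rule that[OF F F2])
    show "(\<lambda>n. LINT x|M. (norm (f n x - F x))\<^sup>2) \<longlonglongrightarrow> 0"
    proof (rule LIMSEQ_I)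
      fix e :: real assume "0 < e"
      obtain N where N: "\<And>i j. N \<le> i \<Longrightarrow> N \<le> j \<Longrightarrow> (LINT x|M. (norm (f i x - f j x))\<^sup>2) < e / 2"
        using cauchy[of "e / 2"] \<open>0 < e\<close> by auto
      have "norm ((LINT x|M. (norm (f n x - F x))\<^sup>2) - 0) < e" if "max N N1 \<le> n" for n
      proof -
        have "ennreal (LINT x|M. (norm (f n x - F x))\<^sup>2) \<le> ennreal (e / 2)"
          using bound[OF N, of n] nn_integral_eq_integral[OF fF[OF N1, of n]] that by simp
        then show ?thesis using \<open>0 < e\<close> by simp
      qed
      then show "\<exists>no. \<forall>n\<ge>no. norm ((LINT x|M. (norm (f n x - F x))\<^sup>2) - 0) < e" by blast
    qed
  qed
qed

lemma L2_tendsto_inner: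
  fixes f :: "nat \<Rightarrow> 'a \<Rightarrow> 'b::euclidean_space"
  assumes [measurable]: "\<And>n. f n \<in> borel_measurable M" "F \<in> borel_measurable M" "g \<in> borel_measurable M"
    and "\<And>n. integrable M (\<lambda>x. (norm (f n x))\<^sup>2)" "integrable M (\<lambda>x. (norm (F x))\<^sup>2)" "integrable M (\<lambda>x. (norm (g x))\<^sup>2)"
    and lim: "(\<lambda>n. LINT x|M. (norm (f n x - F x))\<^sup>2) \<longlonglongrightarrow> 0"
  shows "(\<lambda>n. LINT x|M. f n x \<bullet> g x) \<longlonglongrightarrow> (LINT x|M. F x \<bullet> g x)"
proof -
  have d2: "integrable M (\<lambda>x. (norm (f n x - F x))\<^sup>2)" for n
    using integrable_norm2_lincomb(1)[of "f n" M F 1 "-1"] assms by simp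
  have "(\<lambda>n. (LINT x|M. f n x \<bullet> g x) - (LINT x|M. F x \<bullet> g x)) \<longlonglongrightarrow> 0"
  proof (rule Lim_null_comparison[OF always_eventually])
    show "\<forall>n. norm ((LINT x|M. f n x \<bullet> g x) - (LINT x|M. F x \<bullet> g x))
        \<le> sqrt (LINT x|M. (norm (f n x - F x))\<^sup>2) * sqrt (LINT x|M. (norm (g x))\<^sup>2)"
    proof
      fix n
      have "(LINT x|M. f n x \<bullet> g x) - (LINT x|M. F x \<bullet> g x) = (LINT x|M. (f n x - F x) \<bullet> g x)"
        using integrable_inner_L2[of "f n" M g] integrable_inner_L2[of F M g] assms
        by (simp add: inner_diff_left)
      then show "norm ((LINT x|M. f n x \<bullet> g x) - (LINT x|M. F x \<bullet> g x))
          \<le> sqrt (LINT x|M. (norm (f n x - F x))\<^sup>2) * sqrt (LINT x|M. (norm (g x))\<^sup>2)"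
        using Cauchy_Schwarz_L2[of "\<lambda>x. f n x - F x" M g] d2[of n] assms by simp
    qed
    show "(\<lambda>n. sqrt (LINT x|M. (norm (f n x - F x))\<^sup>2) * sqrt (LINT x|M. (norm (g x))\<^sup>2)) \<longlonglongrightarrow> 0"
      using tendsto_mult_left_zero[OF tendsto_real_sqrt[OF lim, unfolded real_sqrt_zero]] by simp
  qed
  then show ?thesis by (rule LIM_zero_cancel)
qed

text \<open>Minimising sequences for \<open>a(v,v) - 2 l(v)\<close> are Cauchy sequences for the form \<open>a\<close> by the
  parallelogram identity, and they satisfy the Euler equation \<open>a(v,w) = l(w)\<close> in the limit.  Since \<open>V\<close>
  is going to be a set of functions, linear combinations enter as an operation \<open>comb\<close>.\<close>

lemma Riesz_minimizing_sequence:
  fixes a :: "'v \<Rightarrow> 'v \<Rightarrow> real" and l :: "'v \<Rightarrow> real" and comb :: "real \<Rightarrow> 'v \<Rightarrow> real \<Rightarrow> 'v \<Rightarrow> 'v"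
  assumes ne: "V \<noteq> {}" and comb: "\<And>s v t w. v \<in> V \<Longrightarrow> w \<in> V \<Longrightarrow> comb s v t w \<in> V"
    and alin: "\<And>s v t w z. v \<in> V \<Longrightarrow> w \<in> V \<Longrightarrow> z \<in> V \<Longrightarrow> a (comb s v t w) z = s * a v z + t * a w z"
    and asym: "\<And>v w. v \<in> V \<Longrightarrow> w \<in> V \<Longrightarrow> a v w = a w v" and apos: "\<And>v. v \<in> V \<Longrightarrow> 0 \<le> a v v"
    and llin: "\<And>s v t w. v \<in> V \<Longrightarrow> w \<in> V \<Longrightarrow> l (comb s v t w) = s * l v + t * l w"
    and bound: "\<And>v. v \<in> V \<Longrightarrow> \<bar>l v\<bar> \<le> B * sqrt (a v v)"
  obtains v where "\<And>n. v n \<in> V"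
    "\<And>m n. a (comb 1 (v m) (-1) (v n)) (comb 1 (v m) (-1) (v n)) \<le> 2 / real (Suc m) + 2 / real (Suc n)"
    "\<And>w. w \<in> V \<Longrightarrow> (\<lambda>n. a (v n) w) \<longlonglongrightarrow> l w"
proof -
  define J where "J v = a v v - 2 * l v" for v
  have J_comb: "J (comb s v t w) = s\<^sup>2 * a v v + 2 * s * t * a v w + t\<^sup>2 * a w w - 2 * s * l v - 2 * t * l w"
    if "v \<in> V" "w \<in> V" for s v t w
  proof -
    note c = comb[OF that, of s t]
    have "a (comb s v t w) (comb s v t w) = s * a v (comb s v t w) + t * a w (comb s v t w)"
      using alin[OF that c] by simp
    also have "a v (comb s v t w) = s * a v v + t * a w v" using asym[OF that(1) c] alin[OF that that(1)] by simp
    also have "a w (comb s v t w) = s * a v w + t * a w w" using asym[OF that(2) c] alin[OF that that(2)] by simp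
    finally show ?thesis using asym[OF that] llin[OF that, of s t]
      by (simp add: J_def power2_eq_square algebra_simps)
  qed
  have low: "- B\<^sup>2 \<le> J v" if "v \<in> V" for v
  proof -
    have "0 \<le> (sqrt (a v v) - B)\<^sup>2" by simp
    also have "\<dots> = a v v - 2 * (B * sqrt (a v v)) + B\<^sup>2" using apos[OF that] by (simp add: power2_diff)
    also have "\<dots> \<le> J v + B\<^sup>2" using bound[OF that] by (simp add: J_def)
    finally show ?thesis by simp
  qed
  have bdd: "bdd_below (J ` V)" using low by (intro bdd_belowI2)
  define I where "I = Inf (J ` V)"
  have I: "I \<le> J v" if "v \<in> V" for v unfolding I_def using that bdd by (intro cInf_lower) auto
  have "\<exists>v\<in>V. J v < I + 1 / real (Suc n)" for n
  proof -
    have "Inf (J ` V) < I + 1 / real (Suc n)" by (simp add: I_def)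
    from cInf_lessD[OF _ this] ne show ?thesis by auto
  qed
  then obtain v where v: "\<And>n. v n \<in> V" "\<And>n. J (v n) < I + 1 / real (Suc n)" by metis
  show thesis
  proof (rule that[OF v(1)])
    fix m n
    have "a (comb 1 (v m) (-1) (v n)) (comb 1 (v m) (-1) (v n)) = J (comb 1 (v m) (-1) (v n)) + 2 * l (comb 1 (v m) (-1) (v n))"
      by (simp add: J_def)
    also have "\<dots> = a (v m) (v m) - 2 * a (v m) (v n) + a (v n) (v n)"
      using J_comb[OF v(1)[of m] v(1)[of n], of 1 "-1"] llin[OF v(1)[of m] v(1)[of n], of 1 "-1"] by simp
    also have "\<dots> = 2 * J (v m) + 2 * J (v n) - 4 * J (comb (1/2) (v m) (1/2) (v n))"
      using J_comb[OF v(1)[of m] v(1)[of n], of "1/2" "1/2"] by (simp add: J_def power2_eq_square field_simps)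
    also have "\<dots> \<le> 2 * (I + 1 / real (Suc m)) + 2 * (I + 1 / real (Suc n)) - 4 * I"
      using v(2)[of m] v(2)[of n] I[OF comb[OF v(1)[of m] v(1)[of n], of "1/2" "1/2"]] by (intro diff_mono add_mono) auto
    finally show "a (comb 1 (v m) (-1) (v n)) (comb 1 (v m) (-1) (v n)) \<le> 2 / real (Suc m) + 2 / real (Suc n)" by simp
  next
    fix w assume w: "w \<in> V"
    have "(a (v n) w - l w)\<^sup>2 \<le> (J (v n) - I) * a w w" for n
    proof (rule quadratic_nonneg_imp_discriminant)
      fix t :: real
      have "0 \<le> J (comb 1 (v n) t w) - I" using I[OF comb[OF v(1) w]] by simp
      also have "\<dots> = (J (v n) - I) + 2 * t * (a (v n) w - l w) + t\<^sup>2 * a w w"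
        unfolding J_comb[OF v(1) w] by (simp add: J_def algebra_simps)
      finally show "0 \<le> (J (v n) - I) + 2 * t * (a (v n) w - l w) + t\<^sup>2 * a w w" .
    qed (rule apos[OF w])
    also have "(J (v n) - I) * a w w \<le> inverse (real (Suc n)) * a w w" for n
      using v(2)[of n] apos[OF w] by (intro mult_right_mono) (auto simp: inverse_eq_divide)
    finally have le: "(a (v n) w - l w)\<^sup>2 \<le> inverse (real (Suc n)) * a w w" for n by simp
    have "(\<lambda>n. (a (v n) w - l w)\<^sup>2) \<longlonglongrightarrow> 0"
    proof (rule Lim_null_comparison[OF always_eventually])
      show "\<forall>n. norm ((a (v n) w - l w)\<^sup>2) \<le> inverse (real (Suc n)) * a w w" using le by simp
      show "(\<lambda>n. inverse (real (Suc n)) * a w w) \<longlonglongrightarrow> 0"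
        by (rule tendsto_mult_left_zero[OF LIMSEQ_inverse_real_of_nat])
    qed
    then have "(\<lambda>n. a (v n) w - l w) \<longlonglongrightarrow> 0" by (simp add: power_tendsto_0_iff)
    then show "(\<lambda>n. a (v n) w) \<longlonglongrightarrow> l w" by (rule LIM_zero_cancel)
  qed
qed

lemma test_function_bounded:
  assumes "\<phi> \<in> test_functions \<Omega>"
  obtains B where "\<And>x. \<bar>\<phi> x\<bar> \<le> B" "\<And>x b. b \<in> Basis \<Longrightarrow> \<bar>frechet_derivative \<phi> (at x) b\<bar> \<le> B"
    "\<And>x. x \<notin> \<Omega> \<Longrightarrow> \<phi> x = 0" "\<And>x b. x \<notin> \<Omega> \<Longrightarrow> b \<in> Basis \<Longrightarrow> frechet_derivative \<phi> (at x) b = 0"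
proof -
  note t = test_functionsD[OF assms]
  note K = t(1,2) and cont = t(3) and out = t(4) and contg = t(6) and outg = t(7)
  obtain B1 where B1: "0 < B1" "\<And>x. norm (\<phi> x) \<le> B1" using compactly_supported_bounded[OF cont K(1) out] by metis
  obtain B2 where B2: "0 < B2" "\<And>x. norm (gradient_of \<phi> x) \<le> B2" using compactly_supported_bounded[OF contg K(1) outg] by metis
  show thesis
  proof (rule that[of "max B1 B2"])
    show "\<bar>\<phi> x\<bar> \<le> max B1 B2" for x using B1(2)[of x] by simp
    show "\<bar>frechet_derivative \<phi> (at x) b\<bar> \<le> max B1 B2" if "b \<in> Basis" for x b
      using Basis_le_norm[OF that, of "gradient_of \<phi> x"] B2(2)[of x] by (simp add: t(8))
    show "\<phi> x = 0" if "x \<notin> \<Omega>" for x using K(2) that out[of x] by blast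
    show "frechet_derivative \<phi> (at x) b = 0" if "x \<notin> \<Omega>" "b \<in> Basis" for x b
    proof -
      have "x \<notin> closure {x. \<phi> x \<noteq> 0}" using K(2) that by blast
      from outg[OF this] show ?thesis by (simp add: t(8))
    qed
  qed
qed

text \<open>Volume one makes \<^term>\<open>lebesgue_on \<Omega>\<close> a probability measure, so that mean values are integrals.\<close>

locale regular_domain =
  fixes \<Omega> :: "'a::euclidean_space set" and k :: nat and \<sigma> :: real
  assumes open_\<Omega>: "open \<Omega>" and bounded_\<Omega>: "bounded \<Omega>" and connected_\<Omega>: "connected \<Omega>"
    and volume_\<Omega>: "measure lebesgue \<Omega> = 1" and boundary_\<Omega>: "Ck_hoelder_boundary (Suc k) \<sigma> \<Omega>"
begin

abbreviation (input) M where "M \<equiv> lebesgue_on \<Omega>"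

lemma \<Omega>_borel [measurable]: "\<Omega> \<in> sets borel"
  using open_\<Omega> by simp

lemma emeasure_\<Omega>: "emeasure lborel \<Omega> = 1"
proof -
  have "measure lborel \<Omega> = 1" using volume_\<Omega> by (simp add: measure_completion)
  then show ?thesis
    by (metis emeasure_eq_ennreal_measure enn2real_top ennreal_1 measure_def zero_neq_one)
qed

lemma emeasure_\<Omega>_fin: "emeasure lborel \<Omega> < \<infinity>"
  by (simp add: emeasure_\<Omega>)

lemma emeasure_M: "emeasure M (space M) = 1"
proof -
  have "emeasure M (space M) = emeasure lebesgue \<Omega>"
    using open_\<Omega> by (subst emeasure_restrict_space) (auto simp: space_restrict_space)
  then show ?thesis by (simp add: emeasure_\<Omega>)
qed

sublocale M: finite_measure M
  by (rule finite_measureI) (use emeasure_M in simp)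

lemma measure_M: "measure M \<Omega> = 1"
  using emeasure_M by (simp add: measure_def)

lemma L2D:
  assumes "u \<in> L2 \<Omega>"
  shows "u \<in> borel_measurable M" "integrable M (\<lambda>x. (u x)\<^sup>2)" "integrable M u"
proof -
  show 1: "u \<in> borel_measurable M" and 2: "integrable M (\<lambda>x. (u x)\<^sup>2)" using assms by (auto simp: L2_def)
  show "integrable M u" using finite_measure_L2_imp_L1(1)[OF emeasure_M 1] 2 by simp
qed

lemma L2_lincomb:
  assumes "u \<in> L2 \<Omega>" "w \<in> L2 \<Omega>" shows "(\<lambda>x. a * u x + b * w x) \<in> L2 \<Omega>"
proof -
  note [measurable] = L2D(1)[OF assms(1)] L2D(1)[OF assms(2)]
  have "integrable M (\<lambda>x. (norm (a *\<^sub>R u x + b *\<^sub>R w x))\<^sup>2)"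
    by (rule integrable_norm2_lincomb(1)) (use L2D(2)[OF assms(1)] L2D(2)[OF assms(2)] in auto)
  then show ?thesis by (simp add: L2_def)
qed

lemma L2_diff: "u \<in> L2 \<Omega> \<Longrightarrow> w \<in> L2 \<Omega> \<Longrightarrow> (\<lambda>x. u x - w x) \<in> L2 \<Omega>"
  using L2_lincomb[of u w 1 "-1"] by simp

lemma L2_const: "(\<lambda>x. c) \<in> L2 \<Omega>"
  by (simp add: L2_def)

lemma integrable_L2_mult: "u \<in> L2 \<Omega> \<Longrightarrow> w \<in> L2 \<Omega> \<Longrightarrow> integrable M (\<lambda>x. u x * w x)"
  using integrable_inner_L2[of u M w] by (simp add: L2_def)

lemma H1_L2: "u \<in> H1 \<Omega> \<Longrightarrow> u \<in> L2 \<Omega>"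
  by (simp add: H1_def)

lemma weak_gradientD:
  assumes "is_weak_gradient \<Omega> u g"
  shows "g \<in> borel_measurable M" "integrable M (\<lambda>x. (norm (g x))\<^sup>2)"
  using assms by (auto simp: is_weak_gradient_def)

lemma gradD:
  assumes "u \<in> H1 \<Omega>"
  shows "grad \<Omega> u \<in> borel_measurable M" "integrable M (\<lambda>x. (norm (grad \<Omega> u x))\<^sup>2)"
  using weak_gradientD[OF grad_is_weak_gradient[OF assms]] by auto

lemma test_function_measurable:
  assumes "\<phi> \<in> test_functions \<Omega>" "b \<in> Basis"
  shows "\<phi> \<in> borel_measurable M" "(\<lambda>x. frechet_derivative \<phi> (at x) b) \<in> borel_measurable M"
  using test_functionsD(3,9)[OF assms(1)]
  by (auto intro: borel_measurable_lebesgue_onI borel_measurable_continuous_onI)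

lemma test_function_L2:
  assumes "\<phi> \<in> test_functions \<Omega>" "b \<in> Basis"
  shows "\<phi> \<in> L2 \<Omega>" "(\<lambda>x. frechet_derivative \<phi> (at x) b) \<in> L2 \<Omega>"
proof -
  note [measurable] = test_function_measurable[OF assms]
  obtain B where B: "\<And>x. \<bar>\<phi> x\<bar> \<le> B" "\<And>x b. b \<in> Basis \<Longrightarrow> \<bar>frechet_derivative \<phi> (at x) b\<bar> \<le> B"
    using test_function_bounded[OF assms(1)] by metis
  have sq: "y\<^sup>2 \<le> B\<^sup>2" if "\<bar>y\<bar> \<le> B" for y :: real using power_mono[OF that, of 2] by simp
  have "integrable M (\<lambda>x. (\<phi> x)\<^sup>2)"
    by (rule M.integrable_const_bound[where B = "B\<^sup>2"]) (use B sq in auto)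
  moreover have "integrable M (\<lambda>x. (frechet_derivative \<phi> (at x) b)\<^sup>2)"
    by (rule M.integrable_const_bound[where B = "B\<^sup>2"]) (use B(2)[OF assms(2)] sq in auto)
  ultimately show "\<phi> \<in> L2 \<Omega>" "(\<lambda>x. frechet_derivative \<phi> (at x) b) \<in> L2 \<Omega>" by (auto simp: L2_def)
qed

lemma weak_gradient_lincomb:
  assumes u: "u \<in> L2 \<Omega>" "is_weak_gradient \<Omega> u g" and w: "w \<in> L2 \<Omega>" "is_weak_gradient \<Omega> w h"
  shows "is_weak_gradient \<Omega> (\<lambda>x. a * u x + b * w x) (\<lambda>x. a *\<^sub>R g x + b *\<^sub>R h x)"
proof -
  note g = weak_gradientD[OF u(2)] and h = weak_gradientD[OF w(2)]
  note [measurable] = g(1) h(1)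
  show ?thesis
    unfolding is_weak_gradient_def
  proof (intro conjI ballI)
    show "(\<lambda>x. a *\<^sub>R g x + b *\<^sub>R h x) \<in> borel_measurable M" by measurable
    show "integrable M (\<lambda>x. (norm (a *\<^sub>R g x + b *\<^sub>R h x))\<^sup>2)"
      by (rule integrable_norm2_lincomb(1)[OF g(1) h(1) g(2) h(2)])
    fix \<phi> and e :: 'a assume \<phi>: "\<phi> \<in> test_functions \<Omega>" and e: "e \<in> Basis"
    note t = test_function_L2[OF \<phi> e]
    have comp: "integrable M (\<lambda>x. (f x \<bullet> e) * \<phi> x)" if "f \<in> borel_measurable M" "integrable M (\<lambda>x. (norm (f x))\<^sup>2)" for f :: "'a \<Rightarrow> 'a"
    proof (rule integrable_L2_mult[OF _ t(1)])
      have "integrable M (\<lambda>x. (f x \<bullet> e)\<^sup>2)"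
      proof (rule Bochner_Integration.integrable_bound[OF that(2)])
        show "(\<lambda>x. (f x \<bullet> e)\<^sup>2) \<in> borel_measurable M" using that(1) by measurable
        show "AE x in M. norm ((f x \<bullet> e)\<^sup>2) \<le> norm ((norm (f x))\<^sup>2)"
        proof (rule AE_I2)
          fix x
          have "\<bar>f x \<bullet> e\<bar>\<^sup>2 \<le> (norm (f x))\<^sup>2" by (intro power_mono Basis_le_norm e) simp
          then show "norm ((f x \<bullet> e)\<^sup>2) \<le> norm ((norm (f x))\<^sup>2)" by simp
        qed
      qed
      then show "(\<lambda>x. f x \<bullet> e) \<in> L2 \<Omega>" using that(1) by (simp add: L2_def)
    qed
    have "(LINT x|M. (a * u x + b * w x) * frechet_derivative \<phi> (at x) e)
        = a * (LINT x|M. u x * frechet_derivative \<phi> (at x) e) + b * (LINT x|M. w x * frechet_derivative \<phi> (at x) e)"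
      using integrable_L2_mult[OF u(1) t(2)] integrable_L2_mult[OF w(1) t(2)]
      by (simp add: distrib_right mult.assoc)
    also have "\<dots> = - (a * (LINT x|M. (g x \<bullet> e) * \<phi> x) + b * (LINT x|M. (h x \<bullet> e) * \<phi> x))"
      using u(2) w(2) \<phi> e by (simp add: is_weak_gradient_def)
    also have "a * (LINT x|M. (g x \<bullet> e) * \<phi> x) + b * (LINT x|M. (h x \<bullet> e) * \<phi> x)
        = (LINT x|M. ((a *\<^sub>R g x + b *\<^sub>R h x) \<bullet> e) * \<phi> x)"
      using comp[OF g] comp[OF h] by (simp add: inner_simps distrib_right mult.assoc)
    finally show "(LINT x|M. (a * u x + b * w x) * frechet_derivative \<phi> (at x) e)
        = - (LINT x|M. ((a *\<^sub>R g x + b *\<^sub>R h x) \<bullet> e) * \<phi> x)" .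
  qed
qed

lemma weak_gradient_const: "is_weak_gradient \<Omega> (\<lambda>x. c) (\<lambda>x. 0)"
  unfolding is_weak_gradient_def
proof (intro conjI ballI)
  fix \<phi> and e :: 'a assume \<phi>: "\<phi> \<in> test_functions \<Omega>" and e: "e \<in> Basis"
  note t = test_functionsD[OF \<phi>]
  have "(LINT x|M. c * frechet_derivative \<phi> (at x) e) = (LINT x|lborel. c * frechet_derivative \<phi> (at x) e)"
  proof (rule lebesgue_on_borel_representative(2)[OF \<Omega>_borel])
    show "(\<lambda>x. c * frechet_derivative \<phi> (at x) e) \<in> borel_measurable M"
      using test_function_measurable(2)[OF \<phi> e] by simp
    show "(\<lambda>x. c * frechet_derivative \<phi> (at x) e) \<in> borel_measurable borel"
      using t(9) by (intro borel_measurable_times borel_measurable_continuous_onI) auto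
    show "c * frechet_derivative \<phi> (at x) e = 0" if "x \<notin> \<Omega>" for x
      using test_function_bounded[OF \<phi>] that e by (metis mult_zero_right)
  qed simp
  also have "\<dots> = 0"
    using integral_gradient_eq_0[OF t(5,6,1,4), of e] by (simp add: t(8))
  finally show "(LINT x|M. c * frechet_derivative \<phi> (at x) e) = - (LINT x|M. (0 \<bullet> e) * \<phi> x)" by simp
qed auto

lemma H1_const: "(\<lambda>x. c) \<in> H1 \<Omega>"
  using weak_gradient_const L2_const by (auto simp: H1_def)

lemma H1_lincomb:
  assumes "u \<in> H1 \<Omega>" "w \<in> H1 \<Omega>"
  shows "(\<lambda>x. a * u x + b * w x) \<in> H1 \<Omega>"
    and "AE x in M. grad \<Omega> (\<lambda>x. a * u x + b * w x) x = a *\<^sub>R grad \<Omega> u x + b *\<^sub>R grad \<Omega> w x"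
proof -
  note wg = weak_gradient_lincomb[OF H1_L2[OF assms(1)] grad_is_weak_gradient[OF assms(1)]
      H1_L2[OF assms(2)] grad_is_weak_gradient[OF assms(2)], of a b]
  note l2 = L2_lincomb[OF H1_L2[OF assms(1)] H1_L2[OF assms(2)], of a b]
  show H: "(\<lambda>x. a * u x + b * w x) \<in> H1 \<Omega>" using wg l2 unfolding H1_def by blast
  show "AE x in M. grad \<Omega> (\<lambda>x. a * u x + b * w x) x = a *\<^sub>R grad \<Omega> u x + b *\<^sub>R grad \<Omega> w x"
    by (rule is_weak_gradient_unique[OF open_\<Omega> emeasure_\<Omega>_fin l2 grad_is_weak_gradient[OF H] wg])
qed

lemma grad_shift_const:
  assumes "u \<in> H1 \<Omega>"
  shows "(\<lambda>x. u x - c) \<in> H1 \<Omega>" "AE x in M. grad \<Omega> (\<lambda>x. u x - c) x = grad \<Omega> u x"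
proof -
  have g0: "AE x in M. grad \<Omega> (\<lambda>x. 1) x = 0"
    by (rule is_weak_gradient_unique[OF open_\<Omega> emeasure_\<Omega>_fin L2_const grad_is_weak_gradient[OF H1_const] weak_gradient_const])
  note L = H1_lincomb[OF assms H1_const[of 1], of 1 "- c"]
  then show "(\<lambda>x. u x - c) \<in> H1 \<Omega>" by simp
  from L(2) g0 show "AE x in M. grad \<Omega> (\<lambda>x. u x - c) x = grad \<Omega> u x"
    by eventually_elim simp
qed

definition dirichlet :: "('a \<Rightarrow> real) \<Rightarrow> ('a \<Rightarrow> real) \<Rightarrow> real" where
  "dirichlet u w = (LINT x|M. grad \<Omega> u x \<bullet> grad \<Omega> w x)"

lemma dirichlet_sym: "dirichlet u w = dirichlet w u"
  by (simp add: dirichlet_def inner_commute)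

lemma dirichlet_self: "dirichlet u u = (LINT x|M. (norm (grad \<Omega> u x))\<^sup>2)"
  by (simp add: dirichlet_def power2_norm_eq_inner)

lemma dirichlet_nonneg: "0 \<le> dirichlet u u"
  by (simp add: dirichlet_self)

lemma dirichlet_Cauchy_Schwarz:
  "u \<in> H1 \<Omega> \<Longrightarrow> w \<in> H1 \<Omega> \<Longrightarrow> \<bar>dirichlet u w\<bar> \<le> sqrt (dirichlet u u) * sqrt (dirichlet w w)"
  unfolding dirichlet_self unfolding dirichlet_def by (rule Cauchy_Schwarz_L2) (auto intro: gradD)

lemma dirichlet_cong_AE:
  assumes "u \<in> H1 \<Omega>" "v \<in> H1 \<Omega>" "w \<in> H1 \<Omega>" "AE x in M. grad \<Omega> u x = grad \<Omega> v x"
  shows "dirichlet u w = dirichlet v w"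
proof -
  note [measurable] = gradD(1)[OF assms(1)] gradD(1)[OF assms(2)] gradD(1)[OF assms(3)]
  show ?thesis unfolding dirichlet_def by (rule integral_cong_AE) (use assms(4) in auto)
qed

lemma dirichlet_lincomb:
  assumes "u \<in> H1 \<Omega>" "w \<in> H1 \<Omega>" "z \<in> H1 \<Omega>"
  shows "dirichlet (\<lambda>x. a * u x + b * w x) z = a * dirichlet u z + b * dirichlet w z"
proof -
  note g = gradD[OF assms(1)] and h = gradD[OF assms(2)] and f = gradD[OF assms(3)]
  note [measurable] = g(1) h(1) f(1) gradD(1)[OF H1_lincomb(1)[OF assms(1,2), of a b]]
  have "dirichlet (\<lambda>x. a * u x + b * w x) z = (LINT x|M. (a *\<^sub>R grad \<Omega> u x + b *\<^sub>R grad \<Omega> w x) \<bullet> grad \<Omega> z x)"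
    unfolding dirichlet_def by (rule integral_cong_AE) (use H1_lincomb(2)[OF assms(1,2), of a b] in auto)
  then show ?thesis
    using integrable_inner_L2[OF g(1) f(1) g(2) f(2)] integrable_inner_L2[OF h(1) f(1) h(2) f(2)]
    by (simp add: dirichlet_def inner_simps)
qed

lemma integral_sub_mean:
  fixes u :: "'a \<Rightarrow> real"
  shows "integrable M u \<Longrightarrow> (LINT x|M. u x - (LINT y|M. u y)) = 0"
  by (simp add: measure_M)

text \<open>For a function of mean zero, no constant fits better in \<open>L\<^sup>2\<close> than \<open>0\<close>.\<close>

lemma Poincare_H1:
  obtains C where "0 \<le> C"
    "\<And>u. u \<in> H1 \<Omega> \<Longrightarrow> (LINT x|M. u x) = 0 \<Longrightarrow> (LINT x|M. (u x)\<^sup>2) \<le> C * dirichlet u u"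
proof -
  have "\<Omega> \<noteq> {}" using volume_\<Omega> by auto
  from poincare_domain[OF open_\<Omega> bounded_\<Omega> connected_\<Omega> boundary_\<Omega> this]
  obtain C where C: "0 \<le> C" "\<And>U G. weak_pair \<Omega> U G \<Longrightarrow> \<exists>c. sq_dev U c \<Omega>
        \<le> ennreal C * sq_mass G"
    unfolding poincare_on_def by blast
  show thesis
  proof (rule that[OF C(1)])
    fix u assume u: "u \<in> H1 \<Omega>" and mean: "(LINT x|M. u x) = 0"
    note uL = L2D[OF H1_L2[OF u]]
    note [measurable] = uL(1) gradD(1)[OF u]
    obtain U G where UG: "weak_pair \<Omega> U G" and [measurable]: "U \<in> borel_measurable borel" "G \<in> borel_measurable borel"
      and eqU: "AE x in lborel. x \<in> \<Omega> \<longrightarrow> U x = u x" and eqG: "AE x in lborel. x \<in> \<Omega> \<longrightarrow> G x = grad \<Omega> u x"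
      and out: "\<And>x. x \<notin> \<Omega> \<Longrightarrow> G x = 0" and G2: "integrable lborel (\<lambda>x. (norm (G x))\<^sup>2)"
      by (rule Sobolev_representative[OF open_\<Omega> emeasure_\<Omega>_fin H1_L2[OF u] grad_is_weak_gradient[OF u]]) blast
    obtain c where c: "sq_dev U c \<Omega> \<le> ennreal C * sq_mass G"
      using C(2)[OF UG] by blast
    have "sq_mass G = ennreal (LINT x|lborel. (norm (G x))\<^sup>2)"
      by (rule nn_integral_eq_integral[OF G2]) simp
    also have "(LINT x|lborel. (norm (G x))\<^sup>2) = dirichlet u u"
      unfolding dirichlet_self by (rule lebesgue_on_borel_representative(2)[OF \<Omega>_borel, symmetric]) (use eqG out in auto)
    finally have N: "sq_mass G = ennreal (dirichlet u u)" .
    have uc: "(\<lambda>x. u x - c) \<in> L2 \<Omega>" using L2_diff[OF H1_L2[OF u] L2_const] .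
    have "sq_dev U c \<Omega> = sq_dev u c \<Omega>"
    proof (rule nn_integral_cong_AE)
      show "AE x in lborel. ennreal ((U x - c)\<^sup>2) * indicator \<Omega> x = ennreal ((u x - c)\<^sup>2) * indicator \<Omega> x"
        using eqU by eventually_elim (auto simp: indicator_def)
    qed
    also have "\<dots> = (\<integral>\<^sup>+x. ennreal ((u x - c)\<^sup>2) \<partial>M)" by (simp add: nn_integral_lebesgue_on)
    also have "\<dots> = ennreal (LINT x|M. (u x - c)\<^sup>2)"
      by (rule nn_integral_eq_integral[OF L2D(2)[OF uc]]) simp
    finally have "ennreal (LINT x|M. (u x - c)\<^sup>2) \<le> ennreal (C * dirichlet u u)"
      using c N C(1) dirichlet_nonneg[of u] by (simp add: ennreal_mult)
    then have le: "(LINT x|M. (u x - c)\<^sup>2) \<le> C * dirichlet u u"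
      using C(1) dirichlet_nonneg[of u] by simp
    have "(LINT x|M. (u x - c)\<^sup>2) = (LINT x|M. (u x)\<^sup>2 - 2 * c * u x + c\<^sup>2)"
      by (intro Bochner_Integration.integral_cong) (auto simp: power2_eq_square algebra_simps)
    also have "\<dots> = (LINT x|M. (u x)\<^sup>2) + c\<^sup>2"
      using uL(2,3) mean by (simp add: measure_M)
    finally show "(LINT x|M. (u x)\<^sup>2) \<le> C * dirichlet u u" using le zero_le_power2[of c] by linarith
  qed
qed

text \<open>The Dirichlet form and functionals that vanish on constants do not distinguish a function from its
  deviation from the mean; equations and bounds therefore carry over from mean zero test functions.\<close>

lemma sub_mean:
  assumes \<phi>: "\<phi> \<in> H1 \<Omega>" and w: "w \<in> L2 \<Omega>" "(LINT x|M. w x) = 0"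
  obtains \<psi> where "\<psi> \<in> H1 \<Omega>" "(LINT x|M. \<psi> x) = 0" "\<And>z. z \<in> H1 \<Omega> \<Longrightarrow> dirichlet z \<psi> = dirichlet z \<phi>"
    "L2_functional \<Omega> w \<psi> = L2_functional \<Omega> w \<phi>"
proof
  define c where "c = (LINT x|M. \<phi> x)"
  define \<psi> where "\<psi> x = \<phi> x - c" for x
  note g = grad_shift_const[OF \<phi>, of c, folded \<psi>_def]
  then show "\<psi> \<in> H1 \<Omega>" by (simp add: \<psi>_def[abs_def])
  then show "dirichlet z \<psi> = dirichlet z \<phi>" if "z \<in> H1 \<Omega>" for z
    using dirichlet_cong_AE[of \<psi> \<phi> z] g(2) \<phi> that by (simp add: dirichlet_sym \<psi>_def[abs_def])
  show "(LINT x|M. \<psi> x) = 0"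
    using integral_sub_mean[OF L2D(3)[OF H1_L2[OF \<phi>]]] by (simp add: \<psi>_def c_def)
  have "L2_functional \<Omega> w \<psi> = (LINT x|M. w x * \<phi> x - c * w x)"
    unfolding L2_functional_def \<psi>_def by (intro Bochner_Integration.integral_cong) (auto simp: algebra_simps)
  also have "\<dots> = L2_functional \<Omega> w \<phi>"
    using integrable_L2_mult[OF w(1) H1_L2[OF \<phi>]] L2D(3)[OF w(1)] w(2) by (simp add: L2_functional_def)
  finally show "L2_functional \<Omega> w \<psi> = L2_functional \<Omega> w \<phi>" .
qed

lemma mean_zero_functional_bounded:
  assumes w: "w \<in> L2 \<Omega>" and w0: "(LINT x|M. w x) = 0"
  obtains B where "0 \<le> B" "\<And>\<phi>. \<phi> \<in> H1 \<Omega> \<Longrightarrow> \<bar>L2_functional \<Omega> w \<phi>\<bar> \<le> B * sqrt (dirichlet \<phi> \<phi>)"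
proof -
  obtain C where C: "0 \<le> C" "\<And>u. u \<in> H1 \<Omega> \<Longrightarrow> (LINT x|M. u x) = 0 \<Longrightarrow> (LINT x|M. (u x)\<^sup>2) \<le> C * dirichlet u u"
    using Poincare_H1 by metis
  show thesis
  proof (rule that[of "sqrt (LINT x|M. (w x)\<^sup>2) * sqrt C"])
    show "0 \<le> sqrt (LINT x|M. (w x)\<^sup>2) * sqrt C" using C(1) by simp
    fix \<phi> assume \<phi>: "\<phi> \<in> H1 \<Omega>"
    obtain \<psi> where \<psi>: "\<psi> \<in> H1 \<Omega>" "(LINT x|M. \<psi> x) = 0" "\<And>z. z \<in> H1 \<Omega> \<Longrightarrow> dirichlet z \<psi> = dirichlet z \<phi>"
      "L2_functional \<Omega> w \<psi> = L2_functional \<Omega> w \<phi>"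
      using sub_mean[OF \<phi> w w0] by blast
    note P = C(2)[OF \<psi>(1,2)]
    have d: "dirichlet \<psi> \<psi> = dirichlet \<phi> \<phi>"
      using \<psi>(3)[OF \<psi>(1)] \<psi>(3)[OF \<phi>] by (simp add: dirichlet_sym)
    have "\<bar>L2_functional \<Omega> w \<phi>\<bar> = \<bar>LINT x|M. w x \<bullet> \<psi> x\<bar>" using \<psi>(4) by (simp add: L2_functional_def)
    also have "\<dots> \<le> sqrt (LINT x|M. (norm (w x))\<^sup>2) * sqrt (LINT x|M. (norm (\<psi> x))\<^sup>2)"
      by (rule Cauchy_Schwarz_L2) (use L2D[OF w] L2D[OF H1_L2[OF \<psi>(1)]] in auto)
    also have "\<dots> \<le> sqrt (LINT x|M. (w x)\<^sup>2) * sqrt (C * dirichlet \<phi> \<phi>)"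
      using P d by (intro mult_mono) auto
    finally show "\<bar>L2_functional \<Omega> w \<phi>\<bar> \<le> sqrt (LINT x|M. (w x)\<^sup>2) * sqrt C * sqrt (dirichlet \<phi> \<phi>)"
      by (simp add: real_sqrt_mult mult.assoc)
  qed
qed

text \<open>By the Poincare inequality a minimising sequence in the space of mean zero functions is Cauchy in
  \<open>L\<^sup>2\<close> together with its gradients.  The limit of the gradients is a weak gradient of the limit, since both
  sides of the defining identity are continuous in \<open>L\<^sup>2\<close>.\<close>

lemma neumann_solution_exists:
  assumes w: "w \<in> L2 \<Omega>" and w0: "(LINT x|M. w x) = 0"
  shows "\<exists>g. neumann_solution \<Omega> (L2_functional \<Omega> w) g"
proof -
  define V where "V = {u \<in> H1 \<Omega>. (LINT x|M. u x) = 0}"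
  obtain C where C: "0 \<le> C" "\<And>u. u \<in> V \<Longrightarrow> (LINT x|M. (u x)\<^sup>2) \<le> C * dirichlet u u"
    by (rule Poincare_H1) (auto simp: V_def)
  obtain B where B: "\<And>\<phi>. \<phi> \<in> H1 \<Omega> \<Longrightarrow> \<bar>L2_functional \<Omega> w \<phi>\<bar> \<le> B * sqrt (dirichlet \<phi> \<phi>)"
    using mean_zero_functional_bounded[OF w w0] by metis
  let ?comb = "\<lambda>s u t v. \<lambda>x. s * u x + t * (v x :: real)"
  obtain v where v: "\<And>n. v n \<in> V"
    and cauchy: "\<And>m n. dirichlet (?comb 1 (v m) (-1) (v n)) (?comb 1 (v m) (-1) (v n)) \<le> 2 / real (Suc m) + 2 / real (Suc n)"
    and lim: "\<And>\<psi>. \<psi> \<in> V \<Longrightarrow> (\<lambda>n. dirichlet (v n) \<psi>) \<longlonglongrightarrow> L2_functional \<Omega> w \<psi>"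
  proof (rule Riesz_minimizing_sequence[of V ?comb dirichlet "L2_functional \<Omega> w" B])
    show "V \<noteq> {}" using H1_const[of 0] by (auto simp: V_def)
    show "?comb s u t v \<in> V" if "u \<in> V" "v \<in> V" for s u t v
      using that H1_lincomb(1)[of u v s t] L2D(3)[OF H1_L2, of u] L2D(3)[OF H1_L2, of v] by (auto simp: V_def)
    show "dirichlet (?comb s u t v) z = s * dirichlet u z + t * dirichlet v z" if "u \<in> V" "v \<in> V" "z \<in> V" for s u t v z
      using that by (intro dirichlet_lincomb) (auto simp: V_def)
    show "L2_functional \<Omega> w (?comb s u t v) = s * L2_functional \<Omega> w u + t * L2_functional \<Omega> w v" if "u \<in> V" "v \<in> V" for s u t v
    proof -
      have "(LINT x|M. w x * (s * u x + t * v x)) = (LINT x|M. s * (w x * u x) + t * (w x * v x))"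
        by (intro Bochner_Integration.integral_cong) (auto simp: algebra_simps)
      then show ?thesis
        using integrable_L2_mult[OF w H1_L2, of u] integrable_L2_mult[OF w H1_L2, of v] that
        by (simp add: L2_functional_def V_def)
    qed
    show "\<bar>L2_functional \<Omega> w u\<bar> \<le> B * sqrt (dirichlet u u)" if "u \<in> V" for u
      using that by (intro B) (simp add: V_def)
  qed (auto simp: dirichlet_sym dirichlet_nonneg)
  have vH: "v n \<in> H1 \<Omega>" and v0: "(LINT x|M. v n x) = 0" for n using v[of n] by (auto simp: V_def)
  note vm[measurable] = L2D(1)[OF H1_L2[OF vH]] and v2 = L2D(2)[OF H1_L2[OF vH]]
  note gm[measurable] = gradD(1)[OF vH] and g2 = gradD(2)[OF vH]
  have dd: "(LINT x|M. (norm (grad \<Omega> (v m) x - grad \<Omega> (v n) x))\<^sup>2) \<le> 2 / real (Suc m) + 2 / real (Suc n)" for m n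
  proof -
    note [measurable] = gradD(1)[OF H1_lincomb(1)[OF vH vH, of 1 m "-1" n]]
    have "(LINT x|M. (norm (grad \<Omega> (v m) x - grad \<Omega> (v n) x))\<^sup>2) = dirichlet (?comb 1 (v m) (-1) (v n)) (?comb 1 (v m) (-1) (v n))"
      unfolding dirichlet_self
    proof (rule integral_cong_AE)
      show "AE x in M. (norm (grad \<Omega> (v m) x - grad \<Omega> (v n) x))\<^sup>2 = (norm (grad \<Omega> (?comb 1 (v m) (-1) (v n)) x))\<^sup>2"
        using H1_lincomb(2)[OF vH vH, of 1 m "-1" n] by eventually_elim simp
    qed measurable
    then show ?thesis using cauchy[of m n] by simp
  qed
  have vv: "(LINT x|M. (norm (v m x - v n x))\<^sup>2) \<le> C * (2 / real (Suc m) + 2 / real (Suc n))" for m n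
  proof -
    have "?comb 1 (v m) (-1) (v n) \<in> V"
      using H1_lincomb(1)[OF vH vH, of 1 m "-1" n] L2D(3)[OF H1_L2[OF vH]] v0 by (auto simp: V_def)
    from C(2)[OF this] have "(LINT x|M. (norm (v m x - v n x))\<^sup>2) \<le> C * dirichlet (?comb 1 (v m) (-1) (v n)) (?comb 1 (v m) (-1) (v n))"
      by simp
    also have "\<dots> \<le> C * (2 / real (Suc m) + 2 / real (Suc n))" using cauchy C(1) by (intro mult_left_mono)
    finally show ?thesis .
  qed
  have small: "\<exists>N. \<forall>i\<ge>N. \<forall>j\<ge>N. D * (2 / real (Suc i) + 2 / real (Suc j)) < e" if "0 < e" "0 \<le> D" for e D :: real
  proof -
    obtain N :: nat where N: "4 * D / e < real N" using reals_Archimedean2 by blast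
    have "D * (2 / real (Suc i) + 2 / real (Suc j)) < e" if "N \<le> i" "N \<le> j" for i j
    proof -
      have "2 / real (Suc i) \<le> 2 / real (Suc N)" "2 / real (Suc j) \<le> 2 / real (Suc N)"
        using that by (auto intro!: divide_left_mono)
      then have "D * (2 / real (Suc i) + 2 / real (Suc j)) \<le> D * (2 / real (Suc N) + 2 / real (Suc N))"
        using \<open>0 \<le> D\<close> by (intro mult_left_mono) auto
      also have "\<dots> = 4 * D / real (Suc N)" by (simp add: field_simps del: of_nat_Suc)
      also have "\<dots> < e"
      proof -
        have "4 * D < e * real N" using N \<open>0 < e\<close> by (simp add: field_simps)
        also have "\<dots> \<le> e * real (Suc N)" using \<open>0 < e\<close> by (intro mult_left_mono) auto
        finally show ?thesis by (simp add: field_simps)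
      qed
      finally show ?thesis .
    qed
    then show ?thesis by blast
  qed
  obtain g where g[measurable]: "g \<in> borel_measurable M" and gg2: "integrable M (\<lambda>x. (norm (g x))\<^sup>2)"
    and gl: "(\<lambda>n. LINT x|M. (norm (v n x - g x))\<^sup>2) \<longlonglongrightarrow> 0"
  proof (rule L2_complete[OF emeasure_M vm])
    show "integrable M (\<lambda>x. (norm (v n x))\<^sup>2)" for n using v2[of n] by simp
    show "\<exists>N. \<forall>i\<ge>N. \<forall>j\<ge>N. (LINT x|M. (norm (v i x - v j x))\<^sup>2) < e" if "0 < e" for e
    proof -
      from small[OF that C(1)] obtain N where N: "\<And>i j. N \<le> i \<Longrightarrow> N \<le> j \<Longrightarrow> C * (2 / real (Suc i) + 2 / real (Suc j)) < e" by blast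
      show ?thesis
        by (intro exI[of _ N] allI impI le_less_trans[OF vv] N)
    qed
  qed blast
  obtain h where h[measurable]: "h \<in> borel_measurable M" and h2: "integrable M (\<lambda>x. (norm (h x))\<^sup>2)"
    and hl: "(\<lambda>n. LINT x|M. (norm (grad \<Omega> (v n) x - h x))\<^sup>2) \<longlonglongrightarrow> 0"
  proof (rule L2_complete[OF emeasure_M gm g2])
    show "\<exists>N. \<forall>i\<ge>N. \<forall>j\<ge>N. (LINT x|M. (norm (grad \<Omega> (v i) x - grad \<Omega> (v j) x))\<^sup>2) < e" if "0 < e" for e
    proof -
      from small[OF that zero_le_one] obtain N where N: "\<And>i j. N \<le> i \<Longrightarrow> N \<le> j \<Longrightarrow> 1 * (2 / real (Suc i) + 2 / real (Suc j)) < e" by blast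
      show ?thesis
        by (intro exI[of _ N] allI impI le_less_trans[OF dd] N[unfolded mult_1_left])
    qed
  qed blast
  have gL2: "g \<in> L2 \<Omega>" using gg2 by (simp add: L2_def)
  have v2': "integrable M (\<lambda>x. (norm (v n x))\<^sup>2)" for n using v2[of n] by simp
  have weak: "is_weak_gradient \<Omega> g h"
    unfolding is_weak_gradient_def
  proof (intro conjI ballI h h2)
    fix \<phi> and e :: 'a assume \<phi>: "\<phi> \<in> test_functions \<Omega>" and e: "e \<in> Basis"
    note t = test_function_L2[OF \<phi> e]
    note [measurable] = L2D(1)[OF t(1)] L2D(1)[OF t(2)]
    have 1: "(\<lambda>n. LINT x|M. v n x \<bullet> frechet_derivative \<phi> (at x) e) \<longlonglongrightarrow> (LINT x|M. g x \<bullet> frechet_derivative \<phi> (at x) e)"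
      by (rule L2_tendsto_inner[OF _ _ _ v2' gg2 _ gl]) (use L2D(2)[OF t(2)] in auto)
    have ne: "norm e = 1" using e by simp
    have 2: "(\<lambda>n. LINT x|M. grad \<Omega> (v n) x \<bullet> (\<phi> x *\<^sub>R e)) \<longlonglongrightarrow> (LINT x|M. h x \<bullet> (\<phi> x *\<^sub>R e))"
      by (rule L2_tendsto_inner[OF _ _ _ g2 h2 _ hl]) (use L2D(2)[OF t(1)] ne in auto)
    have "(LINT x|M. v n x \<bullet> frechet_derivative \<phi> (at x) e) = - (LINT x|M. grad \<Omega> (v n) x \<bullet> (\<phi> x *\<^sub>R e))" for n
      using grad_is_weak_gradient[OF vH[of n]] \<phi> e by (simp add: is_weak_gradient_def mult.commute)
    with 1 tendsto_minus[OF 2] have "(LINT x|M. g x \<bullet> frechet_derivative \<phi> (at x) e) = - (LINT x|M. h x \<bullet> (\<phi> x *\<^sub>R e))"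
      by (simp add: LIMSEQ_unique)
    then show "(LINT x|M. g x * frechet_derivative \<phi> (at x) e) = - (LINT x|M. (h x \<bullet> e) * \<phi> x)"
      by (simp add: mult.commute)
  qed
  have gH: "g \<in> H1 \<Omega>" using gL2 weak by (auto simp: H1_def)
  have gradg: "AE x in M. grad \<Omega> g x = h x"
    by (rule is_weak_gradient_unique[OF open_\<Omega> emeasure_\<Omega>_fin gL2 grad_is_weak_gradient[OF gH] weak])
  have "(\<lambda>n. LINT x|M. v n x \<bullet> 1) \<longlonglongrightarrow> (LINT x|M. g x \<bullet> 1)"
    by (rule L2_tendsto_inner[OF _ _ _ v2' gg2 _ gl]) auto
  then have g0: "(LINT x|M. g x) = 0" using v0 by (simp add: LIMSEQ_const_iff)
  have eq: "L2_functional \<Omega> w \<psi> = dirichlet g \<psi>" if \<psi>: "\<psi> \<in> V" for \<psi>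
  proof -
    have \<psi>H: "\<psi> \<in> H1 \<Omega>" using \<psi> by (simp add: V_def)
    note [measurable] = gradD(1)[OF \<psi>H] gradD(1)[OF gH]
    have "(\<lambda>n. LINT x|M. grad \<Omega> (v n) x \<bullet> grad \<Omega> \<psi> x) \<longlonglongrightarrow> (LINT x|M. h x \<bullet> grad \<Omega> \<psi> x)"
      by (rule L2_tendsto_inner[OF _ _ _ g2 h2 _ hl]) (use gradD[OF \<psi>H] in auto)
    with lim[OF \<psi>] have "L2_functional \<Omega> w \<psi> = (LINT x|M. h x \<bullet> grad \<Omega> \<psi> x)"
      unfolding dirichlet_def by (rule LIMSEQ_unique)
    also have "\<dots> = dirichlet g \<psi>"
      unfolding dirichlet_def by (rule integral_cong_AE) (use gradg in auto)
    finally show ?thesis .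
  qed
  have "L2_functional \<Omega> w \<phi> = (LINT x|M. grad \<Omega> g x \<bullet> grad \<Omega> \<phi> x)" if \<phi>: "\<phi> \<in> H1 \<Omega>" for \<phi>
  proof -
    obtain \<psi> where \<psi>: "\<psi> \<in> H1 \<Omega>" "(LINT x|M. \<psi> x) = 0" "\<And>z. z \<in> H1 \<Omega> \<Longrightarrow> dirichlet z \<psi> = dirichlet z \<phi>"
      "L2_functional \<Omega> w \<psi> = L2_functional \<Omega> w \<phi>"
      using sub_mean[OF \<phi> w w0] by blast
    then have "L2_functional \<Omega> w \<phi> = dirichlet g \<phi>" using eq[of \<psi>] \<psi>(3)[OF gH] by (simp add: V_def)
    then show ?thesis by (simp add: dirichlet_def)
  qed
  with gH g0 show ?thesis unfolding neumann_solution_def by blast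
qed


subsection \<open>The norm of \<open>X\<^sub>2\<close> as a dual norm\<close>

text \<open>The Neumann solution of \<open>f\<close> is itself an extremal test function.  As a dual norm, the norm can be
  estimated after a test function has been fixed; the triangle inequality and the integration in time
  are obtained in this way.\<close>

lemma X2_norm_dual:
  assumes ex: "\<exists>g. neumann_solution \<Omega> f g"
  shows "0 \<le> X2_norm \<Omega> f"
    and "\<And>\<phi>. \<phi> \<in> H1 \<Omega> \<Longrightarrow> \<bar>f \<phi>\<bar> \<le> X2_norm \<Omega> f * sqrt (dirichlet \<phi> \<phi>)"
    and "\<And>B. 0 \<le> B \<Longrightarrow> (\<And>\<phi>. \<phi> \<in> H1 \<Omega> \<Longrightarrow> \<bar>f \<phi>\<bar> \<le> B * sqrt (dirichlet \<phi> \<phi>)) \<Longrightarrow> X2_norm \<Omega> f \<le> B"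
proof -
  define g where "g = (SOME g. neumann_solution \<Omega> f g)"
  have "neumann_solution \<Omega> f g" using ex unfolding g_def by (rule someI_ex)
  then have gH: "g \<in> H1 \<Omega>" and f: "\<And>\<phi>. \<phi> \<in> H1 \<Omega> \<Longrightarrow> f \<phi> = dirichlet g \<phi>"
    by (auto simp: neumann_solution_def dirichlet_def)
  define n where "n = inverse_laplacian \<Omega> f"
  have n: "n = (\<lambda>x. - 1 * g x + 0 * g x)" by (simp add: n_def inverse_laplacian_def g_def)
  have nH: "n \<in> H1 \<Omega>" unfolding n by (rule H1_lincomb(1)[OF gH gH])
  have "dirichlet n n = - 1 * dirichlet g n + 0 * dirichlet g n"
    unfolding n by (rule dirichlet_lincomb[OF gH gH nH[unfolded n]])
  also have "dirichlet g n = - 1 * dirichlet g g + 0 * dirichlet g g"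
    unfolding dirichlet_sym[of g n] unfolding n by (rule dirichlet_lincomb[OF gH gH gH])
  finally have nn: "dirichlet n n = dirichlet g g" by simp
  have "X2_norm \<Omega> f = sqrt (dirichlet n n)"
    by (simp add: X2_norm_def X2_inner_def dirichlet_def n_def)
  with nn have N: "X2_norm \<Omega> f = sqrt (dirichlet g g)" by simp
  show "0 \<le> X2_norm \<Omega> f" by (simp add: N dirichlet_nonneg)
  show "\<bar>f \<phi>\<bar> \<le> X2_norm \<Omega> f * sqrt (dirichlet \<phi> \<phi>)" if "\<phi> \<in> H1 \<Omega>" for \<phi>
    unfolding f[OF that] N by (rule dirichlet_Cauchy_Schwarz[OF gH that])
  show "X2_norm \<Omega> f \<le> B" if "0 \<le> B" "\<And>\<phi>. \<phi> \<in> H1 \<Omega> \<Longrightarrow> \<bar>f \<phi>\<bar> \<le> B * sqrt (dirichlet \<phi> \<phi>)" for B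
  proof -
    have "sqrt (dirichlet g g) * sqrt (dirichlet g g) \<le> B * sqrt (dirichlet g g)"
      using that(2)[OF gH] f[OF gH] dirichlet_nonneg[of g] by simp
    then have "sqrt (dirichlet g g) \<le> B \<or> sqrt (dirichlet g g) = 0"
      using dirichlet_nonneg[of g] by (metis less_eq_real_def mult_le_cancel_right not_less real_sqrt_ge_zero)
    with that(1) show ?thesis by (auto simp: N)
  qed
qed

lemma X2_dist_triangle:
  assumes L: "u \<in> L2 \<Omega>" "v \<in> L2 \<Omega>" "w \<in> L2 \<Omega>"
    and mean: "(LINT x|M. u x) = (LINT x|M. v x)" "(LINT x|M. v x) = (LINT x|M. w x)"
  shows "X2_dist \<Omega> u w \<le> X2_dist \<Omega> u v + X2_dist \<Omega> v w"
proof -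
  have ex: "\<exists>g. neumann_solution \<Omega> (L2_functional \<Omega> (\<lambda>x. p x - q x)) g"
    if "p \<in> L2 \<Omega>" "q \<in> L2 \<Omega>" "(LINT x|M. p x) = (LINT x|M. q x)" for p q
    using that L2D(3)[OF that(1)] L2D(3)[OF that(2)] by (intro neumann_solution_exists L2_diff) auto
  note uv = ex[OF L(1,2) mean(1)] and vw = ex[OF L(2,3) mean(2)] and uw = ex[OF L(1,3) mean(1)[unfolded mean(2)]]
  show ?thesis
    unfolding X2_dist_def
  proof (rule X2_norm_dual(3)[OF uw])
    show "0 \<le> X2_norm \<Omega> (L2_functional \<Omega> (\<lambda>x. u x - v x)) + X2_norm \<Omega> (L2_functional \<Omega> (\<lambda>x. v x - w x))"
      using X2_norm_dual(1)[OF uv] X2_norm_dual(1)[OF vw] by simp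
    fix \<phi> assume \<phi>: "\<phi> \<in> H1 \<Omega>"
    have "L2_functional \<Omega> (\<lambda>x. u x - w x) \<phi> = (LINT x|M. (u x - v x) * \<phi> x + (v x - w x) * \<phi> x)"
      unfolding L2_functional_def by (intro Bochner_Integration.integral_cong) (auto simp: algebra_simps)
    also have "\<dots> = L2_functional \<Omega> (\<lambda>x. u x - v x) \<phi> + L2_functional \<Omega> (\<lambda>x. v x - w x) \<phi>"
      unfolding L2_functional_def
      by (intro Bochner_Integration.integral_add integrable_L2_mult L2_diff L H1_L2[OF \<phi>])
    finally show "\<bar>L2_functional \<Omega> (\<lambda>x. u x - w x) \<phi>\<bar>
        \<le> (X2_norm \<Omega> (L2_functional \<Omega> (\<lambda>x. u x - v x)) + X2_norm \<Omega> (L2_functional \<Omega> (\<lambda>x. v x - w x))) * sqrt (dirichlet \<phi> \<phi>)"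
      using X2_norm_dual(2)[OF uv \<phi>] X2_norm_dual(2)[OF vw \<phi>] by (simp add: distrib_right)
  qed
qed

end


section \<open>The speed of the flow\<close>

lemma mollifier_times_continuous_integrable:
  fixes f :: "real \<Rightarrow> real"
  assumes "continuous_on UNIV f" "0 < \<delta>"
  shows "integrable lborel (\<lambda>y. mollifier \<delta> (c - y) * f y)"
proof (rule compactly_supported_integrable[where K = "cball c \<delta>"])
  show "continuous_on UNIV (\<lambda>y. mollifier \<delta> (c - y) * f y)"
    by (intro continuous_intros assms(1) continuous_on_compose2[OF continuous_mollifier]) auto
  show "mollifier \<delta> (c - y) * f y = 0" if "y \<notin> cball c \<delta>" for y
    using mollifier_outside[OF assms(2), of "c - y"] that by (simp add: dist_real_def)
qed simp

lemma conv_mollifier_continuous: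
  fixes f :: "real \<Rightarrow> real"
  assumes f: "continuous_on UNIV f" and "0 < e"
  obtains d where "0 < d" "\<And>\<delta>. 0 < \<delta> \<Longrightarrow> \<delta> < d \<Longrightarrow> \<bar>conv (mollifier \<delta>) f a - f a\<bar> \<le> e"
proof -
  have [measurable]: "f \<in> borel_measurable borel" using f by (rule borel_measurable_continuous_onI)
  obtain d where d: "0 < d" "\<And>x. \<bar>x - a\<bar> < d \<Longrightarrow> \<bar>f x - f a\<bar> < e"
    using f \<open>0 < e\<close> unfolding continuous_on_iff dist_real_def by (metis UNIV_I)
  show thesis
  proof (rule that[OF d(1)])
    fix \<delta> :: real assume \<delta>: "0 < \<delta>" "\<delta> < d"
    have m: "integrable lborel (\<lambda>y. mollifier \<delta> (a - y))" "(LINT y|lborel. mollifier \<delta> (a - y)) = 1"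
      using integrable_lborel_reflect[OF integrable_mollifier[OF \<delta>(1)], of a] integral_lborel_reflect[of "mollifier \<delta>" a]
        integral_mollifier[OF \<delta>(1), where 'a = real] by auto
    note i = mollifier_times_continuous_integrable[OF f \<delta>(1), of a]
    have "conv (mollifier \<delta>) f a - f a = (LINT y|lborel. mollifier \<delta> (a - y) * f y - mollifier \<delta> (a - y) * f a)"
      using i m by (simp add: conv_def)
    also have "\<bar>\<dots>\<bar> \<le> (LINT y|lborel. mollifier \<delta> (a - y) * e)"
      unfolding real_norm_def[symmetric]
    proof (rule order_trans[OF integral_norm_bound integral_mono])
      fix y :: real
      show "norm (mollifier \<delta> (a - y) * f y - mollifier \<delta> (a - y) * f a) \<le> mollifier \<delta> (a - y) * e"
      proof (cases "\<bar>y - a\<bar> < d")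
        case True
        have "mollifier \<delta> (a - y) * \<bar>f y - f a\<bar> \<le> mollifier \<delta> (a - y) * e"
          using d(2)[OF True] by (intro mult_left_mono mollifier_nonneg \<delta>(1)) simp
        then show ?thesis
          by (simp add: abs_mult mollifier_nonneg[OF \<delta>(1)] flip: right_diff_distrib)
      next
        case False
        then have "mollifier \<delta> (a - y) = 0" using \<delta> by (intro mollifier_outside) auto
        then show ?thesis by simp
      qed
    qed (use i m in auto)
    also have "\<dots> = e" using m by simp
    finally show "\<bar>conv (mollifier \<delta>) f a - f a\<bar> \<le> e" .
  qed
qed

text \<open>A smooth approximation of the indicator of \<open>[a, b]\<close>, built from two antiderivatives of the
  mollifier; its derivative averages at \<open>a\<close> and \<open>b\<close>.\<close>

lemma smooth_interval_cutoff:
  assumes \<delta>: "0 < \<delta>" "\<delta> < a" and ab: "a \<le> b"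
  obtains \<eta> where "\<eta> \<in> test_functions {0<..}" "\<And>t. \<bar>\<eta> t\<bar> \<le> 1" "\<And>t. t \<notin> {a - \<delta>..b + \<delta>} \<Longrightarrow> \<eta> t = 0"
    "\<And>t. deriv \<eta> t = mollifier \<delta> (a - t) - mollifier \<delta> (b - t)"
proof -
  obtain F where F: "\<And>t. (F has_real_derivative mollifier \<delta> t) (at t)" "\<And>t. t \<le> - \<delta> \<Longrightarrow> F t = 0"
    "\<And>t. \<delta> \<le> t \<Longrightarrow> F t = 1" "\<And>t. 0 \<le> F t \<and> F t \<le> 1"
    using mollifier_antiderivative[OF \<delta>(1)] by metis
  define \<eta> where "\<eta> t = F (t - a) - F (t - b)" for t
  have even: "mollifier \<delta> (t - c) = mollifier \<delta> (c - t)" for t c :: real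
    by (simp add: mollifier_def algebra_simps)
  have shift: "((\<lambda>t. F (t - c)) has_real_derivative mollifier \<delta> (c - t)) (at t)" for c t
    using F(1)[of "t + - c"] DERIV_shift[of F "mollifier \<delta> (c - t)" t "- c"] even[of t c] by simp
  have der: "(\<eta> has_real_derivative mollifier \<delta> (a - t) - mollifier \<delta> (b - t)) (at t)" for t
    unfolding \<eta>_def by (intro DERIV_diff shift)
  have out: "\<eta> t = 0" if "t \<notin> {a - \<delta>..b + \<delta>}" for t
  proof (cases "t < a - \<delta>")
    case True
    then show ?thesis using F(2)[of "t - a"] F(2)[of "t - b"] ab by (simp add: \<eta>_def)
  next
    case False
    with that have "b + \<delta> < t" by simp
    then show ?thesis using F(3)[of "t - a"] F(3)[of "t - b"] ab by (simp add: \<eta>_def)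
  qed
  have "closure {t. \<eta> t \<noteq> 0} \<subseteq> {a - \<delta>..b + \<delta>}"
  proof (rule closure_minimal)
    show "{t. \<eta> t \<noteq> 0} \<subseteq> {a - \<delta>..b + \<delta>}" using out by blast
  qed simp
  moreover from this have "compact (closure {t. \<eta> t \<noteq> 0})"
    by (meson bounded_closed_interval bounded_subset closed_closure compact_eq_bounded_closed)
  moreover have "Ck k \<eta>" for k
  proof -
    have "Ck (Suc k) \<eta>"
    proof (rule Ck_Suc_I)
      show "(\<eta> has_derivative (\<lambda>v. v * (mollifier \<delta> (a - t) + (-1) * mollifier \<delta> (b - t)))) (at t)" for t
        using der[of t] by (simp add: has_field_derivative_def mult_commute_abs)
      show "Ck k (\<lambda>t. v * (mollifier \<delta> (a - t) + (-1) * mollifier \<delta> (b - t)))" for v :: real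
        by (intro Ck_mult Ck_add Ck_const Ck_mollifier_shift)
    qed
    then show ?thesis by (rule Ck_Suc_D)
  qed
  ultimately have "\<eta> \<in> test_functions {0<..}"
    using \<delta> by (auto simp: test_functions_def)
  moreover have "\<bar>\<eta> t\<bar> \<le> 1" for t using F(4)[of "t - a"] F(4)[of "t - b"] by (auto simp: \<eta>_def)
  moreover have "deriv \<eta> t = mollifier \<delta> (a - t) - mollifier \<delta> (b - t)" for t by (rule DERIV_imp_deriv[OF der])
  ultimately show thesis using out that by blast
qed

text \<open>A continuous function whose weak derivative is square integrable up to infinity grows at most
  like the square root of time; the weak formulation is tested with the cutoffs of \<open>[a, b]\<close>.\<close>

lemma weak_derivative_increment_le:
  fixes F D :: "real \<Rightarrow> real"
  assumes F: "continuous_on {0..} F" and D: "D \<in> borel_measurable (lebesgue_on {0<..})"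
    and weak: "\<And>\<eta>. \<eta> \<in> test_functions {0<..} \<Longrightarrow>
      (LINT t|lebesgue_on {0<..}. deriv \<eta> t * F t) = - (LINT t|lebesgue_on {0<..}. \<eta> t * D t)"
    and bound: "AE t in lebesgue_on {0<..}. \<bar>D t\<bar> \<le> X t * K" and "0 \<le> K" "0 \<le> E"
    and X: "\<And>S. 0 < S \<Longrightarrow> (\<integral>\<^sup>+t. ennreal ((X t)\<^sup>2) \<partial>lebesgue_on {0..S}) \<le> ennreal E"
    and "0 \<le> T"
  shows "\<bar>F T - F 0\<bar> \<le> sqrt ((T + 1) * E) * K"
proof -
  define R where "R = sqrt ((T + 1) * E) * K"
  have pos: "{0<..} \<in> sets (borel :: real measure)" by simp
  define f where "f t = F (max 0 t)" for t
  have contf: "continuous_on UNIV f"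
    unfolding f_def by (rule continuous_on_compose2[OF F]) (auto intro!: continuous_intros)
  have [measurable]: "f \<in> borel_measurable borel" using contf by (rule borel_measurable_continuous_onI)
  obtain g where g[measurable]: "g \<in> borel_measurable borel" and eqg: "AE t in lborel. t \<in> {0<..} \<longrightarrow> g t = D t"
    and outg: "\<And>t. t \<notin> {0<..} \<Longrightarrow> g t = 0"
    using borel_representative_real[OF pos D] by metis
  \<comment> \<open>the cutoffs of \<open>[a, T]\<close> are supported in \<open>?J\<close> when they exceed that interval by less than 1\<close>
  let ?J = "{0..T + 1}"
  have gX: "AE t in lborel. \<bar>g t\<bar> \<le> X t * K \<or> t \<le> 0 \<and> g t = 0"
    using bound[unfolded AE_lebesgue_on_iff[OF pos]] eqg by eventually_elim (use outg in force)
  have g2: "(\<integral>\<^sup>+t. ennreal ((g t)\<^sup>2) * indicator ?J t \<partial>lborel) \<le> ennreal (K\<^sup>2 * E)"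
  proof (cases "K = 0")
    case True
    have "(\<integral>\<^sup>+t. ennreal ((g t)\<^sup>2) * indicator ?J t \<partial>lborel) = (\<integral>\<^sup>+t. 0 \<partial>(lborel::real measure))"
      by (rule nn_integral_cong_AE) (use gX True in \<open>auto elim!: eventually_mono\<close>)
    then show ?thesis by simp
  next
    case False
    with \<open>0 \<le> K\<close> have "0 < K" by simp
    \<comment> \<open>constants may be moved out of the integral of a measurable function, so the factor \<open>K\<close> is kept
      with \<open>g\<close> and not with \<open>X\<close>\<close>
    have "(\<integral>\<^sup>+t. ennreal ((g t / K)\<^sup>2) * indicator ?J t \<partial>lborel) \<le> (\<integral>\<^sup>+t. ennreal ((X t)\<^sup>2) * indicator ?J t \<partial>lborel)"
    proof (rule nn_integral_mono_AE)
      show "AE t in lborel. ennreal ((g t / K)\<^sup>2) * indicator ?J t \<le> ennreal ((X t)\<^sup>2) * indicator ?J t"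
        using gX
      proof eventually_elim
        case (elim t)
        have "(g t / K)\<^sup>2 \<le> (X t)\<^sup>2"
        proof (cases "g t = 0")
          case False
          with elim have "\<bar>g t / K\<bar> \<le> X t" using \<open>0 < K\<close> by (simp add: field_simps)
          from power_mono[OF this abs_ge_zero, of 2] show ?thesis by (simp only: power2_abs)
        qed simp
        then show ?case by (intro mult_right_mono ennreal_leI) auto
      qed
    qed
    also have "\<dots> = (\<integral>\<^sup>+t. ennreal ((X t)\<^sup>2) \<partial>lebesgue_on ?J)" by (simp add: nn_integral_lebesgue_on)
    also have "\<dots> \<le> ennreal E" using \<open>0 \<le> T\<close> by (intro X) simp
    finally have le: "(\<integral>\<^sup>+t. ennreal ((g t / K)\<^sup>2) * indicator ?J t \<partial>lborel) \<le> ennreal E" .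
    have "(\<integral>\<^sup>+t. ennreal ((g t)\<^sup>2) * indicator ?J t \<partial>lborel)
        = (\<integral>\<^sup>+t. ennreal (K\<^sup>2) * (ennreal ((g t / K)\<^sup>2) * indicator ?J t) \<partial>lborel)"
    proof (intro nn_integral_cong)
      fix t
      have "ennreal ((g t)\<^sup>2) = ennreal (K\<^sup>2) * ennreal ((g t / K)\<^sup>2)"
        using \<open>0 < K\<close> by (subst ennreal_mult[symmetric]) (auto simp: power_divide)
      then show "ennreal ((g t)\<^sup>2) * indicator ?J t = ennreal (K\<^sup>2) * (ennreal ((g t / K)\<^sup>2) * indicator ?J t)"
        by (simp add: mult.assoc)
    qed
    also have "\<dots> = ennreal (K\<^sup>2) * (\<integral>\<^sup>+t. ennreal ((g t / K)\<^sup>2) * indicator ?J t \<partial>lborel)"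
      by (rule nn_integral_cmult) measurable
    also have "\<dots> \<le> ennreal (K\<^sup>2) * ennreal E" by (intro mult_left_mono le) simp
    also have "\<dots> = ennreal (K\<^sup>2 * E)" using \<open>0 \<le> E\<close> by (simp add: ennreal_mult)
    finally show ?thesis .
  qed
  define h where "h t = indicator ?J t * g t" for t
  have [measurable]: "h \<in> borel_measurable borel" unfolding h_def by measurable
  have nnh: "(\<integral>\<^sup>+t. ennreal ((norm (h t))\<^sup>2) \<partial>lborel) \<le> ennreal (K\<^sup>2 * E)"
  proof -
    have "(\<integral>\<^sup>+t. ennreal ((norm (h t))\<^sup>2) \<partial>lborel) = (\<integral>\<^sup>+t. ennreal ((g t)\<^sup>2) * indicator ?J t \<partial>lborel)"
      by (intro nn_integral_cong) (auto simp: h_def indicator_def)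
    with g2 show ?thesis by simp
  qed
  have h2: "integrable lborel (\<lambda>t. (norm (h t))\<^sup>2)"
  proof (rule integrableI_bounded)
    show "(\<integral>\<^sup>+t. ennreal (norm ((norm (h t))\<^sup>2)) \<partial>lborel) < \<infinity>" using nnh by (simp add: le_less_trans)
  qed measurable
  have "ennreal (LINT t|lborel. (norm (h t))\<^sup>2) \<le> ennreal (K\<^sup>2 * E)"
    using nnh nn_integral_eq_integral[OF h2] by simp
  then have h2le: "(LINT t|lborel. (norm (h t))\<^sup>2) \<le> K\<^sup>2 * E" using \<open>0 \<le> E\<close> by simp
  have indJ: "integrable lborel (\<lambda>t. (norm (indicator ?J t :: real))\<^sup>2)" "(LINT t|lborel. (norm (indicator ?J t :: real))\<^sup>2) = T + 1"
  proof -
    have "(\<lambda>t. (norm (indicator ?J t :: real))\<^sup>2) = indicator ?J" by (auto simp: indicator_def)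
    then show "integrable lborel (\<lambda>t. (norm (indicator ?J t :: real))\<^sup>2)" "(LINT t|lborel. (norm (indicator ?J t :: real))\<^sup>2) = T + 1"
      using \<open>0 \<le> T\<close> by auto
  qed
  have absh: "(LINT t|lborel. \<bar>h t\<bar>) \<le> R" and inth: "integrable lborel (\<lambda>t. \<bar>h t\<bar>)"
  proof -
    have eq: "(\<lambda>t. \<bar>h t\<bar> \<bullet> (indicator ?J t :: real)) = (\<lambda>t. \<bar>h t\<bar>)" by (auto simp: h_def indicator_def)
    have "integrable lborel (\<lambda>t. \<bar>h t\<bar> \<bullet> (indicator ?J t :: real))"
      by (rule integrable_inner_L2) (use h2 indJ in auto)
    then show "integrable lborel (\<lambda>t. \<bar>h t\<bar>)" unfolding eq .
    have "\<bar>LINT t|lborel. \<bar>h t\<bar> \<bullet> (indicator ?J t :: real)\<bar>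
        \<le> sqrt (LINT t|lborel. (norm \<bar>h t\<bar>)\<^sup>2) * sqrt (LINT t|lborel. (norm (indicator ?J t :: real))\<^sup>2)"
      by (rule Cauchy_Schwarz_L2) (use h2 indJ in auto)
    also have "\<dots> \<le> sqrt (K\<^sup>2 * E) * sqrt (T + 1)"
      using h2le indJ(2) \<open>0 \<le> T\<close> \<open>0 \<le> E\<close> by (intro mult_mono) auto
    also have "\<dots> = R" using \<open>0 \<le> K\<close> by (simp add: R_def real_sqrt_mult mult_ac)
    finally show "(LINT t|lborel. \<bar>h t\<bar>) \<le> R" unfolding eq by simp
  qed
  have key: "\<bar>conv (mollifier \<delta>) f a - conv (mollifier \<delta>) f T\<bar> \<le> R" if \<delta>: "0 < \<delta>" "\<delta> < a" "\<delta> < 1" and a: "a \<le> T" for a \<delta>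
  proof -
    obtain \<eta> where \<eta>: "\<eta> \<in> test_functions {0<..}" "\<And>t. \<bar>\<eta> t\<bar> \<le> 1" "\<And>t. t \<notin> {a - \<delta>..T + \<delta>} \<Longrightarrow> \<eta> t = 0"
      "\<And>t. deriv \<eta> t = mollifier \<delta> (a - t) - mollifier \<delta> (T - t)"
      using smooth_interval_cutoff[OF \<delta>(1,2) a] by metis
    have [measurable]: "\<eta> \<in> borel_measurable borel"
      using test_functionsD(3)[OF \<eta>(1)] by (rule borel_measurable_continuous_onI)
    note i = mollifier_times_continuous_integrable[OF contf \<delta>(1)]
    have "(LINT t|lebesgue_on {0<..}. deriv \<eta> t * F t) = (LINT t|lborel. mollifier \<delta> (a - t) * f t - mollifier \<delta> (T - t) * f t)"
    proof (rule lebesgue_on_borel_representative(2)[OF pos])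
      have "(\<lambda>t. mollifier \<delta> (a - t) * f t - mollifier \<delta> (T - t) * f t) \<in> borel_measurable (lebesgue_on {0<..})"
        by (rule borel_measurable_lebesgue_onI) measurable
      moreover have "deriv \<eta> t * F t = mollifier \<delta> (a - t) * f t - mollifier \<delta> (T - t) * f t" if "t \<in> space (lebesgue_on {0<..})" for t
        using that by (simp add: \<eta>(4) f_def space_restrict_space algebra_simps)
      ultimately show "(\<lambda>t. deriv \<eta> t * F t) \<in> borel_measurable (lebesgue_on {0<..})"
        by (subst measurable_cong) auto
      show "AE t in lborel. t \<in> {0<..} \<longrightarrow> mollifier \<delta> (a - t) * f t - mollifier \<delta> (T - t) * f t = deriv \<eta> t * F t"
        by (auto simp: \<eta>(4) f_def algebra_simps)
      show "mollifier \<delta> (a - t) * f t - mollifier \<delta> (T - t) * f t = 0" if "t \<notin> {0<..}" for t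
        using mollifier_outside[OF \<delta>(1), of "a - t"] mollifier_outside[OF \<delta>(1), of "T - t"] that \<delta> a by simp
    qed measurable
    also have "\<dots> = conv (mollifier \<delta>) f a - conv (mollifier \<delta>) f T"
      using i[of a] i[of T] by (simp add: conv_def)
    finally have l: "conv (mollifier \<delta>) f a - conv (mollifier \<delta>) f T = - (LINT t|lebesgue_on {0<..}. \<eta> t * D t)"
      using weak[OF \<eta>(1)] by simp
    have "(LINT t|lebesgue_on {0<..}. \<eta> t * D t) = (LINT t|lborel. \<eta> t * h t)"
    proof (rule lebesgue_on_borel_representative(2)[OF pos])
      show "(\<lambda>t. \<eta> t * D t) \<in> borel_measurable (lebesgue_on {0<..})"
        by (rule borel_measurable_times[OF borel_measurable_lebesgue_onI D]) measurable
      show "AE t in lborel. t \<in> {0<..} \<longrightarrow> \<eta> t * h t = \<eta> t * D t"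
        using eqg
      proof eventually_elim
        case (elim t)
        show ?case using elim \<eta>(3)[of t] \<delta> a by (cases "t \<in> ?J") (auto simp: h_def)
      qed
      show "\<eta> t * h t = 0" if "t \<notin> {0<..}" for t using outg[OF that] by (simp add: h_def)
    qed measurable
    also have "\<bar>\<dots>\<bar> \<le> (LINT t|lborel. \<bar>h t\<bar>)"
      unfolding real_norm_def[symmetric]
    proof (rule order_trans[OF integral_norm_bound integral_mono])
      have le: "norm (\<eta> t * h t) \<le> norm (h t)" for t
        using mult_right_mono[OF \<eta>(2)[of t] abs_ge_zero[of "h t"]] by (simp add: abs_mult)
      then show "norm (\<eta> t * h t) \<le> norm (h t)" for t .
      show "integrable lborel (\<lambda>t. norm (\<eta> t * h t))"
        by (rule Bochner_Integration.integrable_bound[OF inth]) (use le in auto)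
    qed (use inth in simp)
    also have "\<dots> \<le> R" by (rule absh)
    finally show ?thesis using l by simp
  qed
  have interior: "\<bar>f a - f T\<bar> \<le> R" if a: "0 < a" "a \<le> T" for a
  proof (rule field_le_epsilon)
    fix e :: real assume "0 < e"
    then have "0 < e / 2" by simp
    obtain d1 where d1: "0 < d1" "\<And>\<delta>. 0 < \<delta> \<Longrightarrow> \<delta> < d1 \<Longrightarrow> \<bar>conv (mollifier \<delta>) f a - f a\<bar> \<le> e / 2"
      by (rule conv_mollifier_continuous[OF contf \<open>0 < e / 2\<close>]) blast
    obtain d2 where d2: "0 < d2" "\<And>\<delta>. 0 < \<delta> \<Longrightarrow> \<delta> < d2 \<Longrightarrow> \<bar>conv (mollifier \<delta>) f T - f T\<bar> \<le> e / 2"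
      by (rule conv_mollifier_continuous[OF contf \<open>0 < e / 2\<close>]) blast
    define \<delta> where "\<delta> = min (min d1 d2) (min a 1) / 2"
    have \<delta>: "0 < \<delta>" "\<delta> < d1" "\<delta> < d2" "\<delta> < a" "\<delta> < 1" using d1 d2 a by (auto simp: \<delta>_def min_def)
    have "\<bar>conv (mollifier \<delta>) f a - f a\<bar> \<le> e / 2" "\<bar>conv (mollifier \<delta>) f T - f T\<bar> \<le> e / 2"
      "\<bar>conv (mollifier \<delta>) f a - conv (mollifier \<delta>) f T\<bar> \<le> R"
      using d1 d2 \<delta> key[of \<delta> a] a by auto
    then show "\<bar>f a - f T\<bar> \<le> R + e" by linarith
  qed
  have "0 \<le> R" using \<open>0 \<le> K\<close> \<open>0 \<le> E\<close> \<open>0 \<le> T\<close> by (simp add: R_def)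
  \<comment> \<open>test functions vanish near time 0, which is therefore reached by continuity\<close>
  have "\<bar>f 0 - f T\<bar> \<le> R"
  proof (cases "T = 0")
    case False
    with \<open>0 \<le> T\<close> have "0 < T" by simp
    have "isCont f 0" using contf by (simp add: continuous_on_eq_continuous_at)
    then have "(f \<longlongrightarrow> f 0) (at_right 0)" unfolding isCont_def by (rule filterlim_mono) (auto simp: at_le)
    then have "((\<lambda>a. \<bar>f a - f T\<bar>) \<longlongrightarrow> \<bar>f 0 - f T\<bar>) (at_right 0)" by (intro tendsto_intros)
    then show ?thesis
    proof (rule tendsto_upperbound)
      show "\<forall>\<^sub>F a in at_right 0. \<bar>f a - f T\<bar> \<le> R"
        using eventually_at_right_less[of 0] eventually_at_right[of 0 T] \<open>0 < T\<close>
        by (auto simp: eventually_at_right[OF \<open>0 < T\<close>] intro!: exI[of _ T] interior)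
    qed simp
  qed (use \<open>0 \<le> R\<close> in simp)
  then show ?thesis using \<open>0 \<le> T\<close> by (simp add: R_def f_def abs_minus_commute)
qed

context regular_domain
begin

text \<open>The flow provides a potential of its velocity; subtracting the mean makes it the Neumann solution.\<close>

lemma neumann_solution_of_potential:
  assumes v: "v \<in> H1 \<Omega>" and f: "\<And>\<phi>. \<phi> \<in> H1 \<Omega> \<Longrightarrow> f \<phi> = (LINT x|M. grad \<Omega> v x \<bullet> grad \<Omega> \<phi> x)"
  shows "\<exists>g. neumann_solution \<Omega> f g"
proof -
  define g where "g x = v x - (LINT y|M. v y)" for x
  have g: "g \<in> H1 \<Omega>" "AE x in M. grad \<Omega> g x = grad \<Omega> v x"
    using grad_shift_const[OF v] by (simp_all add: g_def[abs_def])
  have "f \<phi> = (LINT x|M. grad \<Omega> g x \<bullet> grad \<Omega> \<phi> x)" if "\<phi> \<in> H1 \<Omega>" for \<phi>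
    using f[OF that] dirichlet_cong_AE[OF g(1) v that g(2)] by (simp add: dirichlet_def)
  moreover have "(LINT x|M. g x) = 0"
    unfolding g_def by (rule integral_sub_mean[OF L2D(3)[OF H1_L2[OF v]]])
  ultimately show ?thesis using g(1) unfolding neumann_solution_def by blast
qed

text \<open>For a fixed \<open>\<phi>\<close> the pairing of \<open>u t\<close> with \<open>\<phi>\<close> is a continuous real function whose weak derivative is
  bounded by the speed times the Dirichlet seminorm of \<open>\<phi>\<close>; the dual norm collects these bounds.\<close>

theorem X2_dist_le_of_dissipation:
  assumes sol: "solution_class \<Omega> u" and wd: "weak_time_derivative \<Omega> u d"
    and ns: "AE t in lebesgue_on {0<..}. \<exists>g. neumann_solution \<Omega> (d t) g"
    and mean: "\<And>t. 0 \<le> t \<Longrightarrow> (LINT x|M. u t x) = (LINT x|M. u 0 x)" and E: "0 \<le> E"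
    and diss: "\<And>S. 0 < S \<Longrightarrow> (\<integral>\<^sup>+s. ennreal ((X2_norm \<Omega> (d s))\<^sup>2) \<partial>lebesgue_on {0..S}) \<le> ennreal E"
    and T: "0 \<le> T"
  shows "X2_dist \<Omega> (u T) (u 0) \<le> sqrt ((T + 1) * E)"
proof -
  have uL2: "u t \<in> L2 \<Omega>" if "0 \<le> t" for t
    using sol that unfolding solution_class_def by (auto dest!: spec[of _ "t + 1"])
  have lim: "((\<lambda>s. L2_norm \<Omega> (\<lambda>x. u s x - u t x)) \<longlongrightarrow> 0) (at t within {0..})" if "0 \<le> t" for t
  proof -
    have "((\<lambda>s. L2_norm \<Omega> (\<lambda>x. u s x - u t x)) \<longlongrightarrow> 0) (at t within {0..t + 1})"
      using sol that unfolding solution_class_def by force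
    moreover have "at t within {0..} = at t within {0..t + 1}"
      by (rule at_within_nhd[of t "{..<t + 1}"]) auto
    ultimately show ?thesis by simp
  qed
  have ex: "\<exists>g. neumann_solution \<Omega> (L2_functional \<Omega> (\<lambda>x. u T x - u 0 x)) g"
    using mean[OF T] L2D(3)[OF uL2[OF T]] L2D(3)[OF uL2[of 0]]
    by (intro neumann_solution_exists L2_diff uL2 T) auto
  show ?thesis
    unfolding X2_dist_def
  proof (rule X2_norm_dual(3)[OF ex])
    show "0 \<le> sqrt ((T + 1) * E)" using T E by simp
    fix \<phi> assume \<phi>: "\<phi> \<in> H1 \<Omega>"
    note \<phi>2 = H1_L2[OF \<phi>]
    define F where "F t = L2_functional \<Omega> (u t) \<phi>" for t
    have Fdiff: "F s - F t = L2_functional \<Omega> (\<lambda>x. u s x - u t x) \<phi>" if "0 \<le> s" "0 \<le> t" for s t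
      using integrable_L2_mult[OF uL2[OF that(1)] \<phi>2] integrable_L2_mult[OF uL2[OF that(2)] \<phi>2]
      by (simp add: F_def L2_functional_def left_diff_distrib)
    have "\<bar>F T - F 0\<bar> \<le> sqrt ((T + 1) * E) * sqrt (dirichlet \<phi> \<phi>)"
    proof (rule weak_derivative_increment_le[where D = "\<lambda>t. d t \<phi>" and X = "\<lambda>t. X2_norm \<Omega> (d t)"])
      show "continuous_on {0..} F"
        unfolding continuous_on_def
      proof
        fix t :: real assume "t \<in> {0..}"
        then have t: "0 \<le> t" by simp
        have "((\<lambda>s. F s - F t) \<longlongrightarrow> 0) (at t within {0..})"
        proof (rule Lim_null_comparison)
          show "\<forall>\<^sub>F s in at t within {0..}. norm (F s - F t) \<le> L2_norm \<Omega> (\<lambda>x. u s x - u t x) * sqrt (LINT x|M. (\<phi> x)\<^sup>2)"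
            unfolding eventually_at_filter
          proof (intro always_eventually allI impI)
            fix s :: real assume "s \<in> {0..}"
            then have s: "0 \<le> s" by simp
            note D = L2_diff[OF uL2[OF s] uL2[OF t]]
            have "\<bar>LINT x|M. (u s x - u t x) \<bullet> \<phi> x\<bar> \<le> sqrt (LINT x|M. (norm (u s x - u t x))\<^sup>2) * sqrt (LINT x|M. (norm (\<phi> x))\<^sup>2)"
              by (rule Cauchy_Schwarz_L2) (use L2D[OF D] L2D[OF \<phi>2] in auto)
            then show "norm (F s - F t) \<le> L2_norm \<Omega> (\<lambda>x. u s x - u t x) * sqrt (LINT x|M. (\<phi> x)\<^sup>2)"
              unfolding Fdiff[OF s t] by (simp add: L2_functional_def L2_norm_def)
          qed
          show "((\<lambda>s. L2_norm \<Omega> (\<lambda>x. u s x - u t x) * sqrt (LINT x|M. (\<phi> x)\<^sup>2)) \<longlongrightarrow> 0) (at t within {0..})"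
            by (rule tendsto_mult_left_zero[OF lim[OF t]])
        qed
        then show "(F \<longlongrightarrow> F t) (at t within {0..})" by (rule LIM_zero_cancel)
      qed
      show "(\<lambda>t. d t \<phi>) \<in> borel_measurable (lebesgue_on {0<..})"
        using wd \<phi> by (auto simp: weak_time_derivative_def)
      show "(LINT t|lebesgue_on {0<..}. deriv \<eta> t * F t) = - (LINT t|lebesgue_on {0<..}. \<eta> t * d t \<phi>)"
        if "\<eta> \<in> test_functions {0<..}" for \<eta>
        using wd \<phi> that by (auto simp: weak_time_derivative_def F_def)
      show "AE t in lebesgue_on {0<..}. \<bar>d t \<phi>\<bar> \<le> X2_norm \<Omega> (d t) * sqrt (dirichlet \<phi> \<phi>)"
        using ns by eventually_elim (rule X2_norm_dual(2)[OF _ \<phi>])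
    qed (use dirichlet_nonneg E diss T in auto)
    then show "\<bar>L2_functional \<Omega> (\<lambda>x. u T x - u 0 x) \<phi>\<bar> \<le> sqrt ((T + 1) * E) * sqrt (dirichlet \<phi> \<phi>)"
      using Fdiff[OF T order_refl] by simp
  qed
qed

end


section \<open>Two-phase functions\<close>

lemma C1c_fields_uminus:
  assumes "\<phi> \<in> C1c_fields \<Omega>"
  shows "(\<lambda>x. - \<phi> x) \<in> C1c_fields \<Omega>" "divergence (\<lambda>x. - \<phi> x) x = - divergence \<phi> x"
proof -
  show c: "(\<lambda>x. - \<phi> x) \<in> C1c_fields \<Omega>"
    unfolding C1c_fields_def
  proof (intro CollectI conjI ballI)
    fix b :: 'a assume "b \<in> Basis"
    then have "Ck 1 (\<lambda>x. (-1) * (\<phi> x \<bullet> b))"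
      using assms by (intro Ck_mult Ck_const) (auto simp: C1c_fields_def)
    then show "Ck 1 (\<lambda>x. - \<phi> x \<bullet> b)" by simp
  qed (use assms in \<open>auto simp: C1c_fields_def\<close>)
  have "gradient_of (\<lambda>y. - \<phi> y \<bullet> b) x = - gradient_of (\<lambda>y. \<phi> y \<bullet> b) x" if "b \<in> Basis" for b
    using has_derivative_minus[OF C1c_fieldsD(5)[OF assms that, of x]] by (intro gradient_of_eq) simp
  then show "divergence (\<lambda>x. - \<phi> x) x = - divergence \<phi> x"
    unfolding C1c_fieldsD(7)[OF c] C1c_fieldsD(7)[OF assms] by (simp add: sum_negf)
qed

context regular_domain
begin

lemma two_phase_on: "x \<in> \<Omega> \<Longrightarrow> two_phase \<Omega> E x = 1 - 2 * indicator E x"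
  by (auto simp: two_phase_def indicator_def)

text \<open>The constant part of \<open>1 - 2 * indicator E\<close> does not contribute to the variation, because the divergence
  of a compactly supported field integrates to zero.\<close>

lemma two_phase_props:
  assumes E: "E \<in> sets borel" "E \<subseteq> \<Omega>"
  shows "two_phase \<Omega> E \<in> L2 \<Omega>" "(LINT x|M. two_phase \<Omega> E x) = 1 - 2 * measure lebesgue E"
    "{x \<in> \<Omega>. two_phase \<Omega> E x = -1} = E"
    "total_variation \<Omega> (two_phase \<Omega> E) \<le> 2 * perimeter E \<Omega>"
proof -
  have tm: "two_phase \<Omega> E \<in> borel_measurable borel" unfolding two_phase_def[abs_def] using E by measurable
  then have tM[measurable]: "two_phase \<Omega> E \<in> borel_measurable M" by (rule borel_measurable_lebesgue_onI)
  have bd: "\<bar>two_phase \<Omega> E x\<bar> \<le> 1" for x by (auto simp: two_phase_def indicator_def)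
  have "integrable M (\<lambda>x. (two_phase \<Omega> E x)\<^sup>2)"
  proof (rule M.integrable_const_bound[where B = 1])
    show "AE x in M. norm ((two_phase \<Omega> E x)\<^sup>2) \<le> 1"
      using power_mono[OF bd abs_ge_zero, of _ 2] by simp
  qed measurable
  then show "two_phase \<Omega> E \<in> L2 \<Omega>" using tM by (simp add: L2_def)
  have EM[measurable]: "(indicator E :: 'a \<Rightarrow> real) \<in> borel_measurable M" using E by (intro borel_measurable_lebesgue_onI) simp
  have iE: "integrable M (indicator E :: 'a \<Rightarrow> real)"
    by (rule M.integrable_const_bound[where B = 1]) (auto simp: indicator_def)
  have "(LINT x|M. two_phase \<Omega> E x) = (LINT x|M. 1 - 2 * indicator E x)"
    by (intro Bochner_Integration.integral_cong) (auto simp: two_phase_on space_restrict_space)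
  also have "\<dots> = 1 - 2 * (LINT x|M. indicator E x)" using iE by (simp add: measure_M)
  also have "(LINT x|M. indicator E x :: real) = (LINT x|lborel. indicator E x)"
    by (rule lebesgue_on_borel_representative(2)[OF \<Omega>_borel EM]) (use E in \<open>auto simp: indicator_def\<close>)
  also have "\<dots> = measure lebesgue E" using E by (simp add: measure_completion)
  finally show "(LINT x|M. two_phase \<Omega> E x) = 1 - 2 * measure lebesgue E" .
  show "{x \<in> \<Omega>. two_phase \<Omega> E x = -1} = E" using E by (auto simp: two_phase_def indicator_def)
  show "total_variation \<Omega> (two_phase \<Omega> E) \<le> 2 * perimeter E \<Omega>"
    unfolding total_variation_def[of _ "two_phase \<Omega> E"]
  proof (rule SUP_least)
    fix \<phi> assume "\<phi> \<in> {\<phi> \<in> C1c_fields \<Omega>. \<forall>x. norm (\<phi> x) \<le> 1}"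
    then have \<phi>: "\<phi> \<in> C1c_fields \<Omega>" "\<And>x. norm (\<phi> x) \<le> 1" by auto
    note div = divergence_props[OF \<phi>(1)]
    have dm[measurable]: "divergence \<phi> \<in> borel_measurable borel" using div(1) by (rule borel_measurable_continuous_onI)
    have iD: "integrable lborel (\<lambda>x. indicator A x * divergence \<phi> x)" if "A \<in> sets borel" for A
      by (rule Bochner_Integration.integrable_bound[OF div(3)]) (use that in \<open>auto simp: indicator_def\<close>)
    have "(LINT x|M. two_phase \<Omega> E x * divergence \<phi> x)
        = (LINT x|lborel. indicator \<Omega> x * divergence \<phi> x - 2 * (indicator E x * divergence \<phi> x))"
    proof (rule lebesgue_on_borel_representative(2)[OF \<Omega>_borel])
      show "(\<lambda>x. two_phase \<Omega> E x * divergence \<phi> x) \<in> borel_measurable M"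
        using tm by (intro borel_measurable_lebesgue_onI) simp
      show "AE x in lborel. x \<in> \<Omega> \<longrightarrow> indicator \<Omega> x * divergence \<phi> x - 2 * (indicator E x * divergence \<phi> x) = two_phase \<Omega> E x * divergence \<phi> x"
        by (auto simp: two_phase_on algebra_simps)
      show "indicator \<Omega> x * divergence \<phi> x - 2 * (indicator E x * divergence \<phi> x) = 0" if "x \<notin> \<Omega>" for x
        using that E by (auto simp: indicator_def)
    qed (use E in measurable)
    also have "\<dots> = (LINT x|lborel. indicator \<Omega> x * divergence \<phi> x) - 2 * (LINT x|lborel. indicator E x * divergence \<phi> x)"
      using iD[OF \<Omega>_borel] iD[OF E(1)] by simp
    also have "(\<lambda>x. indicator \<Omega> x * divergence \<phi> x) = divergence \<phi>"
    proof
      fix x show "indicator \<Omega> x * divergence \<phi> x = divergence \<phi> x"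
        using div(2)[of x] C1c_fieldsD(4)[OF \<phi>(1)] by (cases "x \<in> \<Omega>") auto
    qed
    also have "(LINT x|lborel. divergence \<phi> x) = 0" by (rule integral_divergence_eq_0[OF \<phi>(1)])
    finally have "(LINT x|M. two_phase \<Omega> E x * divergence \<phi> x) = 2 * (LINT x|lborel. indicator E x * divergence (\<lambda>x. - \<phi> x) x)"
      by (simp add: C1c_fields_uminus(2)[OF \<phi>(1)])
    also have "(LINT x|lborel. indicator E x * divergence (\<lambda>x. - \<phi> x) x) = (LINT x|M. indicator E x * divergence (\<lambda>x. - \<phi> x) x)"
      by (rule LINT_indicator_divergence[OF \<Omega>_borel E C1c_fields_uminus(1)[OF \<phi>(1)], symmetric])
    finally have "ennreal (LINT x|M. two_phase \<Omega> E x * divergence \<phi> x) = 2 * ennreal (LINT x|M. indicator E x * divergence (\<lambda>x. - \<phi> x) x)"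
      by (simp add: ennreal_mult')
    also have "\<dots> \<le> 2 * perimeter E \<Omega>"
      unfolding perimeter_def total_variation_def
      by (intro mult_left_mono SUP_upper) (use C1c_fields_uminus(1)[OF \<phi>(1)] \<phi>(2) in auto)
    finally show "ennreal (LINT x|M. two_phase \<Omega> E x * divergence \<phi> x) \<le> 2 * perimeter E \<Omega>" .
  qed
qed

lemma limit_energy_two_phase:
  assumes E: "E \<in> sets borel" "E \<subseteq> \<Omega>" and fin: "perimeter E \<Omega> < \<infinity>" and m: "measure lebesgue E = (1 - m) / 2"
    and W: "double_well W"
  shows "limit_energy \<Omega> W m (two_phase \<Omega> E) = ennreal (sqrt 2 * c_well W * enn2real (perimeter E \<Omega>))"
proof -
  note p = two_phase_props[OF E]
  have "total_variation \<Omega> (two_phase \<Omega> E) < \<infinity>"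
    using p(4) fin by (simp add: le_less_trans ennreal_mult_less_top)
  moreover have "AE x in M. two_phase \<Omega> E x \<in> {-1, 1}"
    by (rule AE_I2) (auto simp: two_phase_on space_restrict_space indicator_def)
  ultimately have "two_phase \<Omega> E \<in> BV_phase \<Omega>"
    using L2D(3)[OF p(1)] by (simp add: BV_phase_def)
  moreover have "(LINT x|M. two_phase \<Omega> E x) = m" using p(2) unfolding m by (simp add: diff_divide_distrib)
  ultimately have "limit_energy \<Omega> W m (two_phase \<Omega> E) = ennreal (sqrt 2 * c_well W) * perimeter E \<Omega>"
    by (simp add: limit_energy_def p(3))
  also have "perimeter E \<Omega> = ennreal (enn2real (perimeter E \<Omega>))" using fin by simp
  finally show ?thesis
    using c_well_nonneg[OF W] by (simp add: ennreal_mult)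
qed

lemma X2_dist_cong_AE:
  assumes L: "u \<in> L2 \<Omega>" "v \<in> L2 \<Omega>" "w \<in> L2 \<Omega>" and eq: "AE x in M. u x = v x"
  shows "X2_dist \<Omega> u w = X2_dist \<Omega> v w"
proof -
  have "L2_functional \<Omega> (\<lambda>x. u x - w x) \<phi> = L2_functional \<Omega> (\<lambda>x. v x - w x) \<phi>" if "\<phi> \<in> H1 \<Omega>" for \<phi>
  proof -
    note [measurable] = L2D(1)[OF L(1)] L2D(1)[OF L(2)] L2D(1)[OF L(3)] L2D(1)[OF H1_L2[OF that]]
    show ?thesis unfolding L2_functional_def by (rule integral_cong_AE) (use eq in auto)
  qed
  then have "neumann_solution \<Omega> (L2_functional \<Omega> (\<lambda>x. u x - w x)) = neumann_solution \<Omega> (L2_functional \<Omega> (\<lambda>x. v x - w x))"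
    by (auto simp: neumann_solution_def fun_eq_iff)
  then show ?thesis by (simp add: X2_dist_def X2_norm_def X2_inner_def inverse_laplacian_def)
qed

text \<open>The energy can fall below its limit value only by \<open>O(\<epsilon>)\<close>, and it starts at most \<open>O(\<epsilon>)\<close> above it;
  hence the total dissipation is \<open>O(\<epsilon>\<^sup>2)\<close> and the distance travelled up to time \<open>T\<close> is
  \<open>O(\<epsilon> sqrt T)\<close>.\<close>

lemma travelled_distance_le:
  assumes \<epsilon>: "0 < \<epsilon>" and "0 \<le> C" "0 \<le> K"
    and low: "\<And>w. ennreal L \<le> energy \<Omega> W m \<epsilon> w + ennreal (K * \<epsilon>)"
    and u0: "u0 \<in> L2 \<Omega>" "energy \<Omega> W m \<epsilon> u0 \<le> ennreal L + ennreal (C * \<epsilon>)"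
    and sol: "cahn_hilliard_solution \<Omega> W m \<epsilon> u0 u" and T: "0 \<le> T"
  shows "u T \<in> L2 \<Omega>" "(LINT x|M. u T x) = m"
    "X2_dist \<Omega> (u T) (u 0) \<le> sqrt ((T + 1) * ((C + K) * \<epsilon>\<^sup>2))"
proof -
  have sc: "solution_class \<Omega> u" and init: "AE x in M. u 0 x = u0 x"
    and mean: "\<And>t. 0 \<le> t \<Longrightarrow> (LINT x|M. u t x) = (LINT x|M. u 0 x)"
    using sol unfolding cahn_hilliard_solution_def by blast+
  obtain d v where wd: "weak_time_derivative \<Omega> u d"
    and eqs: "AE t in lebesgue_on {0<..}. v t \<in> H1 \<Omega> \<and> integrable M (\<lambda>x. deriv W (u t x)) \<and>
        (\<forall>\<phi>\<in>H1 \<Omega>. d t \<phi> = (LINT x|M. grad \<Omega> (v t) x \<bullet> grad \<Omega> \<phi> x)) \<and>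
        (\<forall>\<psi>\<in>H1 \<Omega>. (\<exists>B. AE x in M. \<bar>\<psi> x\<bar> \<le> B) \<longrightarrow>
           (LINT x|M. v t x * \<psi> x) = - \<epsilon>\<^sup>2 * (LINT x|M. grad \<Omega> (u t) x \<bullet> grad \<Omega> \<psi> x)
             - (LINT x|M. deriv W (u t x) * \<psi> x))"
    and en': "\<forall>S>0. energy \<Omega> W m \<epsilon> (u 0) = energy \<Omega> W m \<epsilon> (u S) +
        ennreal (1 / \<epsilon>) * (\<integral>\<^sup>+s. ennreal ((X2_norm \<Omega> (d s))\<^sup>2) \<partial>lebesgue_on {0..S})"
    using sol unfolding cahn_hilliard_solution_def by blast
  have en: "energy \<Omega> W m \<epsilon> (u 0) = energy \<Omega> W m \<epsilon> (u S) +
        ennreal (1 / \<epsilon>) * (\<integral>\<^sup>+s. ennreal ((X2_norm \<Omega> (d s))\<^sup>2) \<partial>lebesgue_on {0..S})" if "0 < S" for S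
    using en' that by blast
  have uL2: "u t \<in> L2 \<Omega>" if "0 \<le> t" for t
    using sc that unfolding solution_class_def by (auto dest!: spec[of _ "t + 1"])
  then show "u T \<in> L2 \<Omega>" using T by simp
  have e0: "energy \<Omega> W m \<epsilon> (u 0) \<le> ennreal L + ennreal (C * \<epsilon>)"
    using energy_cong_AE[OF open_\<Omega> uL2[OF order_refl] u0(1) init] u0(2) by simp
  then have "energy \<Omega> W m \<epsilon> (u 0) < \<infinity>" by (auto simp: less_top[symmetric] top_unique)
  then have "(LINT x|M. u 0 x) = m" by (auto simp: energy_def split: if_splits)
  with mean[OF T] show "(LINT x|M. u T x) = m" by simp
  have ns: "AE t in lebesgue_on {0<..}. \<exists>g. neumann_solution \<Omega> (d t) g"
    using eqs
  proof eventually_elim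
    case (elim t)
    then show ?case by (intro neumann_solution_of_potential[of "v t"]) blast+
  qed
  have diss: "(\<integral>\<^sup>+s. ennreal ((X2_norm \<Omega> (d s))\<^sup>2) \<partial>lebesgue_on {0..S}) \<le> ennreal ((C + K) * \<epsilon>\<^sup>2)" if "0 < S" for S
  proof -
    let ?I = "\<integral>\<^sup>+s. ennreal ((X2_norm \<Omega> (d s))\<^sup>2) \<partial>lebesgue_on {0..S}"
    have "ennreal L + ennreal (1 / \<epsilon>) * ?I \<le> (energy \<Omega> W m \<epsilon> (u S) + ennreal (K * \<epsilon>)) + ennreal (1 / \<epsilon>) * ?I"
      by (intro add_right_mono low)
    also have "\<dots> = energy \<Omega> W m \<epsilon> (u 0) + ennreal (K * \<epsilon>)"
      unfolding en[OF that] by (simp add: add_ac)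
    also have "\<dots> \<le> (ennreal L + ennreal (C * \<epsilon>)) + ennreal (K * \<epsilon>)" by (intro add_right_mono e0)
    also have "\<dots> = ennreal L + ennreal ((C + K) * \<epsilon>)"
      using \<epsilon> \<open>0 \<le> C\<close> \<open>0 \<le> K\<close> by (simp add: add.assoc distrib_right)
    finally have "ennreal (1 / \<epsilon>) * ?I \<le> ennreal ((C + K) * \<epsilon>)"
      by (simp add: ennreal_add_left_cancel_le)
    then have "ennreal \<epsilon> * (ennreal (1 / \<epsilon>) * ?I) \<le> ennreal \<epsilon> * ennreal ((C + K) * \<epsilon>)"
      by (rule mult_left_mono) simp
    also have "ennreal \<epsilon> * ennreal ((C + K) * \<epsilon>) = ennreal ((C + K) * \<epsilon>\<^sup>2)"
      using \<epsilon> \<open>0 \<le> C\<close> \<open>0 \<le> K\<close> by (subst ennreal_mult[symmetric]) (auto simp: power2_eq_square mult_ac)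
    also have "ennreal \<epsilon> * (ennreal (1 / \<epsilon>) * ?I) = ?I"
      using \<epsilon> by (simp add: mult.assoc[symmetric] flip: ennreal_mult)
    finally show ?thesis .
  qed
  show "X2_dist \<Omega> (u T) (u 0) \<le> sqrt ((T + 1) * ((C + K) * \<epsilon>\<^sup>2))"
    by (rule X2_dist_le_of_dissipation[OF sc wd ns mean _ diss T]) (use \<open>0 \<le> C\<close> \<open>0 \<le> K\<close> in auto)
qed

end


section \<open>Slow motion\<close>

theorem theorem1p4:
  fixes \<Omega> E0 :: "(real ^ 'n) set" and W :: "real \<Rightarrow> real" and m r0 \<sigma> C :: real
    and u0 :: "real \<Rightarrow> real ^ 'n \<Rightarrow> real"
    and u :: "real \<Rightarrow> real \<Rightarrow> real ^ 'n \<Rightarrow> real"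
  assumes dim: "CARD('n) \<in> {2, 3}"
    and domain: "open \<Omega>" "bounded \<Omega>" "connected \<Omega>" "measure lebesgue \<Omega> = 1"
    and boundary: "0 < \<sigma>" "\<sigma> \<le> 1" "Ck_hoelder_boundary 4 \<sigma> \<Omega>"
    and potential: "double_well W"
    and mass: "-1 < m" "m < 1" "r0 = (1 - m) / 2"
    and minimizer: "E0 \<in> sets borel" "E0 \<subseteq> \<Omega>" "measure lebesgue E0 = r0"
      "perimeter E0 \<Omega> = isoperimetric \<Omega> r0"
    and taylor: "taylor_order_two (\<lambda>r. enn2real (isoperimetric \<Omega> r)) r0"
    and initial_space: "\<forall>\<^sub>F \<epsilon> in at_right 0. u0 \<epsilon> \<in> L2 \<Omega> \<and> L2_functional \<Omega> (u0 \<epsilon>) \<in> X2 \<Omega>"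
    and initial_limit: "((\<lambda>\<epsilon>. X2_dist \<Omega> (u0 \<epsilon>) (two_phase \<Omega> E0)) \<longlongrightarrow> 0) (at_right 0)"
    and initial_energy: "0 < C"
      "\<forall>\<^sub>F \<epsilon> in at_right 0. energy \<Omega> W m \<epsilon> (u0 \<epsilon>)
         \<le> limit_energy \<Omega> W m (two_phase \<Omega> E0) + ennreal (C * \<epsilon>)"
    and solution: "\<forall>\<^sub>F \<epsilon> in at_right 0. cahn_hilliard_solution \<Omega> W m \<epsilon> (u0 \<epsilon>) (u \<epsilon>)"
  shows "\<forall>M>0. ((\<lambda>\<epsilon>. SUP t\<in>{0..M / \<epsilon>}. ennreal (X2_dist \<Omega> (u \<epsilon> t) (two_phase \<Omega> E0)))
           \<longlongrightarrow> 0) (at_right 0)"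
proof (intro allI impI)
  fix M :: real assume "0 < M"
  interpret D: regular_domain \<Omega> 3 \<sigma>
    using domain boundary(3) by unfold_locales simp_all
  note r0 = mass(3)
  let ?w = "two_phase \<Omega> E0"
  define L where "L = sqrt 2 * c_well W * enn2real (perimeter E0 \<Omega>)"
  have "perimeter E0 \<Omega> < \<infinity>"
    unfolding minimizer(4)
    using mass domain by (intro isoperimetric_finite) auto
  then have limE: "limit_energy \<Omega> W m ?w = ennreal L"
    unfolding L_def using minimizer(3) r0
    by (intro D.limit_energy_two_phase[OF minimizer(1,2) _ _ potential]) auto
  have w: "?w \<in> L2 \<Omega>" "(LINT x|lebesgue_on \<Omega>. ?w x) = m"
    using D.two_phase_props(1,2)[OF minimizer(1,2)] unfolding minimizer(3) r0
    by (simp_all add: diff_divide_distrib)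
  have "(\<lambda>r. enn2real (isoperimetric \<Omega> r)) differentiable (at ((1 - m) / 2))"
    using taylor r0 by (simp add: taylor_order_two_def)
  from energy_lower_bound[OF domain(1,4) potential this]
  obtain K \<epsilon>0 where K: "0 \<le> K" "0 < \<epsilon>0" "\<And>\<epsilon> u. 0 < \<epsilon> \<Longrightarrow> \<epsilon> \<le> \<epsilon>0 \<Longrightarrow>
      ennreal L \<le> energy \<Omega> W m \<epsilon> u + ennreal (K * \<epsilon>)"
    unfolding L_def minimizer(4) r0 by blast
  \<comment> \<open>\<open>M * \<epsilon> + \<epsilon>\<^sup>2\<close> is \<open>(T + 1) * \<epsilon>\<^sup>2\<close> at the final time \<open>T = M / \<epsilon>\<close>\<close>
  define R where "R \<epsilon> = sqrt ((C + K) * (M * \<epsilon> + \<epsilon>\<^sup>2)) + X2_dist \<Omega> (u0 \<epsilon>) ?w" for \<epsilon>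
  have "((\<lambda>\<epsilon>. sqrt ((C + K) * (M * \<epsilon> + \<epsilon>\<^sup>2)) + X2_dist \<Omega> (u0 \<epsilon>) ?w) \<longlongrightarrow> sqrt ((C + K) * (M * 0 + 0\<^sup>2)) + 0) (at_right 0)"
    by (intro tendsto_intros initial_limit)
  then have "(R \<longlongrightarrow> 0) (at_right 0)" by (simp add: R_def[abs_def])
  then have lim: "((\<lambda>\<epsilon>. ennreal (R \<epsilon>)) \<longlongrightarrow> 0) (at_right 0)"
    using tendsto_ennrealI by fastforce
  have small: "\<forall>\<^sub>F \<epsilon> in at_right 0. 0 < \<epsilon> \<and> \<epsilon> \<le> \<epsilon>0"
    using K(2) by (auto simp: eventually_at_right[OF K(2)])
  have "\<forall>\<^sub>F \<epsilon> in at_right 0. (SUP t\<in>{0..M / \<epsilon>}. ennreal (X2_dist \<Omega> (u \<epsilon> t) ?w)) \<le> ennreal (R \<epsilon>)"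
    using small initial_space initial_energy(2) solution
  proof eventually_elim
    case (elim \<epsilon>)
    then have \<epsilon>: "0 < \<epsilon>" "\<epsilon> \<le> \<epsilon>0" and u0: "u0 \<epsilon> \<in> L2 \<Omega>" by auto
    note TD = D.travelled_distance_le[OF \<epsilon>(1) _ K(1) K(3)[OF \<epsilon>] u0 elim(3)[unfolded limE] elim(4)]
    note TD = TD[OF less_imp_le[OF initial_energy(1)]]
    show ?case
    proof (rule SUP_least, rule ennreal_leI)
      fix t assume t: "t \<in> {0..M / \<epsilon>}"
      then have "0 \<le> t" by simp
      have init: "AE x in lebesgue_on \<Omega>. u \<epsilon> 0 x = u0 \<epsilon> x"
        using elim(4) by (simp add: cahn_hilliard_solution_def)
      have "X2_dist \<Omega> (u \<epsilon> t) ?w \<le> X2_dist \<Omega> (u \<epsilon> t) (u \<epsilon> 0) + X2_dist \<Omega> (u \<epsilon> 0) ?w"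
        by (rule D.X2_dist_triangle) (use TD(1,2)[of t] TD(1,2)[of 0] w \<open>0 \<le> t\<close> in simp_all)
      also have "X2_dist \<Omega> (u \<epsilon> 0) ?w = X2_dist \<Omega> (u0 \<epsilon>) ?w"
        by (rule D.X2_dist_cong_AE[OF TD(1)[OF order_refl] u0 w(1) init])
      also have "X2_dist \<Omega> (u \<epsilon> t) (u \<epsilon> 0) \<le> sqrt ((t + 1) * ((C + K) * \<epsilon>\<^sup>2))" by (rule TD(3)[OF \<open>0 \<le> t\<close>])
      also have "\<dots> \<le> sqrt ((M / \<epsilon> + 1) * ((C + K) * \<epsilon>\<^sup>2))"
        using t K(1) initial_energy(1) by (intro real_sqrt_le_mono mult_right_mono) auto
      also have "(M / \<epsilon> + 1) * ((C + K) * \<epsilon>\<^sup>2) = (C + K) * (M * \<epsilon> + \<epsilon>\<^sup>2)"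
        using \<epsilon>(1) by (simp add: field_simps power2_eq_square)
      finally show "X2_dist \<Omega> (u \<epsilon> t) ?w \<le> R \<epsilon>" by (simp add: R_def)
    qed
  qed
  then show "((\<lambda>\<epsilon>. SUP t\<in>{0..M / \<epsilon>}. ennreal (X2_dist \<Omega> (u \<epsilon> t) ?w)) \<longlongrightarrow> 0) (at_right 0)"
    by (rule tendsto_sandwich[OF _ _ tendsto_const lim, rotated]) auto
qed

end
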